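(* Let $\lambda,\mu$ be rational numbers. Exact evaluation of $R'_2$ at the rational point $(\lambda,\mu)$ is \begin{itemize} \item polynomial-time computable when $\lambda\in\{0,1\}$ or $\mu=0$ or $(\lambda,\mu)=(1/2,-1)$; \item \#P-hard when $\lambda\notin\{0,1,1/2\}$ and $\mu\neq 0$, assuming the generalized Riemann hypothesis; \item \#P-hard when $\lambda=1/2$ and $\mu\notin\{0,-1\}$. \end{itemize}
   Context: For a finite simple bipartite graph $G=(U\cup W,E)$, $$R'_2(G;\lambda,\mu)=\sum_{S\subseteq E}\lambda^{\mathrm{rk}_2(S)}\mu^{|S|},$$ where $\mathrm{rk}_2(S)$ is the rank over $\mathbb{F}_2$ of the bipartite adjacency matrix of $(U\cup W,S)$, i.e. the $|U|\times|W|$ zero-one matrix whose $(u,w)$ entry is $1$ iff $\{u,w\}\in S$ (convention $0^0=1$). Exact evaluation of $R'_2$ at a fixed point $(\lambda,\mu)$ is the computational problem: given a bipartite graph $G$, output the rational number $R'_2(G;\lambda,\mu)$. \#P-hardness is with respect to polynomial-time Turing reductions. *)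

theory Defs
  imports
    "HOL-Complex_Analysis.Complex_Analysis"
    "HOL-Algebra.Embedded_Algebras"
    "HOL-Algebra.QuotRing"
    "HOL-Library.Z2"
    "Jordan_Normal_Form.DL_Rank"
begin

section \<open>The polynomial\<close>

text \<open>
  A finite simple bipartite graph with a given bipartition, its two sides numbered
  \<open>0, ..., left_size - 1\<close> and \<open>0, ..., right_size - 1\<close>.  The pair \<open>(u, w)\<close> stands for the edge
  between the \<open>u\<close>-th left and the \<open>w\<close>-th right vertex.
\<close>

record bipgraph =
  left_size :: nat
  right_size :: nat
  edges :: "(nat \<times> nat) set"

definition bipgraphs :: "bipgraph set" where
  "bipgraphs = {G. edges G \<subseteq> {..<left_size G} \<times> {..<right_size G}}"

definition biadjacency :: "nat \<Rightarrow> nat \<Rightarrow> (nat \<times> nat) set \<Rightarrow> bit mat" where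
  "biadjacency m n S = mat m n (\<lambda>(u, w). if (u, w) \<in> S then 1 else 0)"

definition rk2 :: "nat \<Rightarrow> nat \<Rightarrow> (nat \<times> nat) set \<Rightarrow> nat" where
  "rk2 m n S = vec_space.rank m (biadjacency m n S)"

definition R2 :: "rat \<Rightarrow> rat \<Rightarrow> bipgraph \<Rightarrow> rat" where
  "R2 lam mu G =
     (\<Sum>S \<in> Pow (edges G). lam ^ rk2 (left_size G) (right_size G) S * mu ^ card S)"

section \<open>Oracle Turing machines\<close>

text \<open>
  Deterministic multi-tape machines with one-way infinite tapes.  Tape symbols are the numbers
  below \<open>num_syms\<close>, where 0 is the blank and 1, 2 are the bits; states are the numbers below
  \<open>num_states\<close>, where 0 to 3 play the roles named below.  Tape 0 is the input and output tape and
  tape 1 is the oracle tape.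
\<close>

datatype direction = Go_Left | Stay | Go_Right

record machine =
  num_tapes :: nat
  num_syms :: nat
  num_states :: nat
  delta :: "nat \<Rightarrow> nat list \<Rightarrow> nat \<times> (nat \<times> direction) list"

abbreviation (input) "start_state \<equiv> 0 :: nat"
abbreviation (input) "halt_state \<equiv> 1 :: nat"
abbreviation (input) "query_state \<equiv> 2 :: nat"
abbreviation (input) "resume_state \<equiv> 3 :: nat"

definition machine_wf :: "machine \<Rightarrow> bool" where
  "machine_wf M \<longleftrightarrow>
     num_tapes M \<ge> 2 \<and> num_syms M \<ge> 3 \<and> num_states M \<ge> 4 \<and>
     (\<forall>q rs. q < num_states M \<and> length rs = num_tapes M \<and> set rs \<subseteq> {..<num_syms M} \<longrightarrow>
        fst (delta M q rs) < num_states M \<and>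
        length (snd (delta M q rs)) = num_tapes M \<and>
        fst ` set (snd (delta M q rs)) \<subseteq> {..<num_syms M})"

definition oracle_free :: "machine \<Rightarrow> bool" where
  "oracle_free M \<longleftrightarrow>
     (\<forall>q rs. q < num_states M \<and> length rs = num_tapes M \<and> set rs \<subseteq> {..<num_syms M} \<longrightarrow>
        fst (delta M q rs) \<noteq> query_state)"

text \<open>Tape contents together with the head position.\<close>

type_synonym tape = "(nat \<Rightarrow> nat) \<times> nat"

definition word_tape :: "bool list \<Rightarrow> tape" where
  "word_tape w = ((\<lambda>i. if i < length w then (if w ! i then 2 else 1) else 0), 0)"

text \<open>
  The word on a tape extends from cell 0 to the first cell that does not hold a bit, wherever the
  head is.  Such a cell exists on every tape that occurs in a computation.
\<close>

definition tape_word :: "tape \<Rightarrow> bool list" where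
  "tape_word t = map (\<lambda>i. fst t i = 2) [0 ..< (LEAST n. fst t n \<notin> {1, 2})]"

definition scanned :: "tape \<Rightarrow> nat" where
  "scanned t = fst t (snd t)"

text \<open>A move to the left in cell 0 leaves the head where it is.\<close>

definition update_tape :: "nat \<times> direction \<Rightarrow> tape \<Rightarrow> tape" where
  "update_tape a t =
     ((fst t)(snd t := fst a),
      (case snd a of Go_Left \<Rightarrow> snd t - 1 | Stay \<Rightarrow> snd t | Go_Right \<Rightarrow> snd t + 1))"

type_synonym config = "nat \<times> tape list"

definition step :: "machine \<Rightarrow> (bool list \<Rightarrow> bool list) \<Rightarrow> config \<Rightarrow> config" where
  "step M orc c =
     (let q = fst c; ts = snd c in
      if q = halt_state then c
      else if q = query_state then
        (resume_state, ts[1 := word_tape (orc (tape_word (ts ! 1)))])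
      else (fst (delta M q (map scanned ts)),
            map2 update_tape (snd (delta M q (map scanned ts))) ts))"

definition initial :: "machine \<Rightarrow> bool list \<Rightarrow> config" where
  "initial M w = (start_state, word_tape w # replicate (num_tapes M - 1) (word_tape []))"

definition computes_within ::
  "machine \<Rightarrow> (bool list \<Rightarrow> bool list) \<Rightarrow> bool list \<Rightarrow> nat \<Rightarrow> bool list \<Rightarrow> bool" where
  "computes_within M orc x t y \<longleftrightarrow>
     (let c = (step M orc ^^ t) (initial M x) in
      fst c = halt_state \<and> tape_word (hd (snd c)) = y)"

section \<open>Complexity classes\<close>

text \<open>Without queries the choice of the oracle is irrelevant.\<close>

definition polytime_computable :: "(bool list \<Rightarrow> bool list) \<Rightarrow> bool" where
  "polytime_computable f \<longleftrightarrow>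
     (\<exists>M (p :: nat poly). machine_wf M \<and> oracle_free M \<and>
        (\<forall>x. computes_within M (\<lambda>_. []) x (poly p (length x)) (f x)))"

definition polytime_turing_reducible ::
  "(bool list \<Rightarrow> bool list) \<Rightarrow> (bool list \<Rightarrow> bool list) \<Rightarrow> bool" where
  "polytime_turing_reducible f g \<longleftrightarrow>
     (\<exists>M (p :: nat poly). machine_wf M \<and>
        (\<forall>x. computes_within M g x (poly p (length x)) (f x)))"

text \<open>Binary notation, least significant bit first, without leading zeros.\<close>

fun nat_code :: "nat \<Rightarrow> bool list" where
  "nat_code n = (if n = 0 then [] else odd n # nat_code (n div 2))"

declare nat_code.simps [simp del]

text \<open>Pairs of words: the bits of the first are doubled, and 01 marks its end.\<close>

definition pair_code :: "bool list \<Rightarrow> bool list \<Rightarrow> bool list" where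
  "pair_code x y = concat (map (\<lambda>b. [b, b]) x) @ [False, True] @ y"

text \<open>
  \<open>V\<close> is a polynomial-time verifier; the certificates for \<open>x\<close> are the words of length
  \<open>p(|x|)\<close> that it accepts.
\<close>

definition sharpP :: "(bool list \<Rightarrow> nat) set" where
  "sharpP = {f. \<exists>V (p :: nat poly). polytime_computable (\<lambda>z. [V z]) \<and>
     (\<forall>x. f x = card {y. length y = poly p (length x) \<and> V (pair_code x y)})}"

definition sharpP_hard :: "(bool list \<Rightarrow> bool list) \<Rightarrow> bool" where
  "sharpP_hard g \<longleftrightarrow> (\<forall>f \<in> sharpP. polytime_turing_reducible (\<lambda>x. nat_code (f x)) g)"

section \<open>Evaluation as a computational problem\<close>

text \<open>Sign, numerator and denominator of the reduced fraction.\<close>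

definition rat_code :: "rat \<Rightarrow> bool list" where
  "rat_code r = (case quotient_of r of (a, b) \<Rightarrow>
     (a < 0) # pair_code (nat_code (nat \<bar>a\<bar>)) (nat_code (nat b)))"

text \<open>The sizes of the two sides in unary, followed by the rows of the adjacency matrix.\<close>

definition bipgraph_code :: "bipgraph \<Rightarrow> bool list" where
  "bipgraph_code G =
     replicate (left_size G) True @ False # replicate (right_size G) True @ False #
     concat (map (\<lambda>u. map (\<lambda>w. (u, w) \<in> edges G) [0 ..< right_size G]) [0 ..< left_size G])"

text \<open>Words that encode no graph are answered by the empty word, which encodes no number.\<close>

definition eval_problem :: "(bipgraph \<Rightarrow> rat) \<Rightarrow> bool list \<Rightarrow> bool list" where
  "eval_problem F w =
     (if w \<in> bipgraph_code ` bipgraphs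
      then rat_code (F (the_inv_into bipgraphs bipgraph_code w)) else [])"

lemma replicate_True_False_eqD:
  assumes "replicate m True @ False # xs = replicate n True @ False # ys"
  shows "m = n \<and> xs = ys"
  using assms
proof (induction m arbitrary: n)
  case 0
  then show ?case by (cases n) auto
next
  case (Suc m)
  then show ?case by (cases n) auto
qed

lemma concat_rows_eqD:
  assumes "concat (map f us) = concat (map g us)"
    and "\<And>u. u \<in> set us \<Longrightarrow> length (f u) = length (g u)"
  shows "\<forall>u \<in> set us. f u = g u"
  using assms by (induction us) auto

lemma inj_on_bipgraph_code: "inj_on bipgraph_code bipgraphs"
proof (rule inj_onI)
  fix G H :: bipgraph
  assume G: "G \<in> bipgraphs" and H: "H \<in> bipgraphs" and eq: "bipgraph_code G = bipgraph_code H"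
  have m: "left_size G = left_size H"
    using eq unfolding bipgraph_code_def by (blast dest: replicate_True_False_eqD)
  have n: "right_size G = right_size H"
    using eq unfolding bipgraph_code_def by (blast dest: replicate_True_False_eqD)
  have "concat (map (\<lambda>u. map (\<lambda>w. (u, w) \<in> edges G) [0 ..< right_size G]) [0 ..< left_size G])
      = concat (map (\<lambda>u. map (\<lambda>w. (u, w) \<in> edges H) [0 ..< right_size G]) [0 ..< left_size G])"
    using eq m n unfolding bipgraph_code_def by simp
  from concat_rows_eqD[OF this]
  have "\<forall>u \<in> {..<left_size G}. \<forall>w \<in> {..<right_size G}. (u, w) \<in> edges G \<longleftrightarrow> (u, w) \<in> edges H"
    by (simp add: atLeast0LessThan)
  then have "edges G = edges H"
    using G H m n unfolding bipgraphs_def by (auto simp: subset_iff)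
  with m n show "G = H" by simp
qed

lemma eval_problem_code:
  "G \<in> bipgraphs \<Longrightarrow> eval_problem F (bipgraph_code G) = rat_code (F G)"
  by (simp add: eval_problem_def the_inv_into_f_f[OF inj_on_bipgraph_code])

section \<open>The generalized Riemann hypothesis\<close>

text \<open>Every number field is isomorphic to a subfield of the complex numbers.\<close>

definition number_field :: "complex set \<Rightarrow> bool" where
  "number_field K \<longleftrightarrow> subfield K class_ring \<and> ring.finite_dimension class_ring \<rat> K"

definition ring_of_integers :: "complex set \<Rightarrow> complex ring" where
  "ring_of_integers K = class_ring\<lparr>carrier := {x \<in> K. algebraic_int x}\<rparr>"

definition nonzero_ideals :: "complex set \<Rightarrow> complex set set" where
  "nonzero_ideals K = {I. ideal I (ring_of_integers K) \<and> I \<noteq> {0}}"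

definition ideal_norm :: "complex set \<Rightarrow> complex set \<Rightarrow> nat" where
  "ideal_norm K I = card (carrier (ring_of_integers K Quot I))"

text \<open>
  The Dedekind zeta function is the analytic continuation to \<open>s \<noteq> 1\<close> of the sum over the nonzero
  ideals, which converges absolutely for \<open>Re s > 1\<close>.  The continuation exists by a theorem of
  Hecke and is unique.
\<close>

definition is_dedekind_zeta :: "complex set \<Rightarrow> (complex \<Rightarrow> complex) \<Rightarrow> bool" where
  "is_dedekind_zeta K Z \<longleftrightarrow> Z holomorphic_on - {1} \<and>
     (\<forall>s. Re s > 1 \<longrightarrow>
        ((\<lambda>I. of_nat (ideal_norm K I) powr (- s)) has_sum Z s) (nonzero_ideals K))"

text \<open>
  The hypothesis in the form for Dedekind zeta functions of all number fields, which includes that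
  for Dirichlet L-functions (by way of cyclotomic fields) and is the form known from the
  conditional results on Artin's primitive root conjecture.
\<close>

definition generalized_Riemann_hypothesis :: bool where
  "generalized_Riemann_hypothesis \<longleftrightarrow>
     (\<forall>K. number_field K \<longrightarrow>
        (\<exists>Z. is_dedekind_zeta K Z \<and>
           (\<forall>s. Z s = 0 \<and> 0 < Re s \<and> Re s < 1 \<longrightarrow> Re s = 1 / 2)))"

end

theory Submission
  imports Defs
begin

text \<open>
  For \<open>\<lambda> \<noteq> 0\<close> put \<open>q = 1 / \<lambda>\<close>, and let \<open>n\<close> be the number of right vertices.  If \<open>q = 2 ^ r\<close>, then \<open>q ^ n\<close> times the
  polynomial is a partition function: the right vertices are coloured by vectors of length \<open>r\<close> over
  the field with two elements, and every left vertex contributes a factor that depends on the colours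
  of its neighbours (\<open>R2_partition_function\<close>).  For left vertices of degree one or two the factor only
  depends on which colours vanish and which agree.  Both sides then are polynomials in \<open>q\<close>, and for all
  \<open>q\<close> the value is the sum over \<open>b\<close> of the binomial coefficient \<open>q - 1\<close> over \<open>b\<close> times the sum over the
  colourings with exactly \<open>b\<close> nonzero colours (\<open>R2_colourings\<close>).

  Taking \<open>k\<close> copies of every left vertex raises the products to their \<open>k\<close>-th powers.  As a function of
  \<open>k\<close> the polynomial at the given point is therefore a power sum, and the coefficient of a known ratio is
  found from polynomially many values, by annihilating the other ratios one after the other in
  exact arithmetic (\<open>annihilate_power_sum\<close>, \<open>interpolation_reduction\<close>).  From a graph and a number \<open>w\<close>
  one can construct left vertices such that one of these coefficients is a nonzero multiple of the
  number of cliques of size \<open>w\<close>.  If \<open>\<mu>\<close> is none of \<open>0, -1, -2\<close>, then \<open>(1 + \<mu>)\<^sup>2\<close> is neither 0 nor 1, and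
  pendant vertices make the products tell the number of vertices of colour zero
  (\<open>power_sum_loops\<close>); the multiple is by \<open>q - 1\<close>, up to powers of \<open>q\<close>.  For \<open>\<mu> = -1\<close> and \<open>\<mu> = -2\<close> the colour of
  one additional right vertex takes the part of zero (\<open>power_sum_hub\<close>), and the multiple is by
  \<open>(q - 1) (q - 2)\<close>.  If \<open>q = 2\<close> and \<open>\<mu> = -2\<close>, another coefficient serves; the point with \<open>q = 2\<close> and
  \<open>\<mu> = -1\<close> is tractable.

  Counting cliques is as hard as every problem in the class: the computations of a
  verifier are the solutions of binary constraints, and the solutions of binary constraints are the
  cliques of the maximal size in a multipartite graph (\<open>sharpP_cliques\<close>).

  In the tractable cases the polynomial has a closed form.  If \<open>\<lambda> = 0\<close> or \<open>\<mu> = 0\<close>, only the empty set of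
  edges counts; for \<open>\<lambda> = 1\<close> it is a power of \<open>1 + \<mu>\<close>; and for \<open>\<lambda> = 1 / 2\<close> and \<open>\<mu> = -1\<close> the partition function
  with two colours forces the value one on every right vertex that is not isolated
  (\<open>R2_half_minus_one\<close>).

  Machines are not constructed by hand.  A small structured language is compiled to oracle machines
  (\<open>compile_program\<close>), its programs manipulate binary trees on stacks, and the functions computable in
  polynomial time on types with an encoding are closed under composition, case distinction, bounded
  folds and arithmetic (\<open>fpt_foldl\<close> and the rules \<open>fpt_intros\<close>), so that polynomial time is
  mostly a matter of applying rules.
\<close>

section \<open>Structured programs for Turing machines\<close>

text \<open>
  The commands of a structured language over the tapes of a machine: \<open>Act j w d\<close> writes on tape
  \<open>j\<close> (\<open>None\<close> keeps the scanned symbol) and moves the head, \<open>Ask\<close> consults the oracle, and the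
  tests of \<open>Branch\<close> and \<open>Loop\<close> ask whether the symbol scanned on a tape lies in a set.
\<close>

datatype com =
    Act nat "nat option" direction
  | Ask
  | Seq com com
  | Branch nat "nat set" com com
  | Loop nat "nat set" com

text \<open>
  One step of a program that is given by the stack of commands still to be executed.  A step of the
  language is a step of the machine, whose states are the stacks that can occur.
\<close>

fun sstep :: "(bool list \<Rightarrow> bool list) \<Rightarrow> com list \<times> tape list \<Rightarrow> com list \<times> tape list" where
  "sstep g ([], ts) = ([], ts)"
| "sstep g (Act j w d # cs, ts) =
     (cs, ts[j := update_tape (case w of None \<Rightarrow> scanned (ts ! j) | Some a \<Rightarrow> a, d) (ts ! j)])"
| "sstep g (Ask # cs, ts) = (cs, ts[1 := word_tape (g (tape_word (ts ! 1)))])"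
| "sstep g (Seq a b # cs, ts) = (a # b # cs, ts)"
| "sstep g (Branch j P a b # cs, ts) = ((if scanned (ts ! j) \<in> P then a else b) # cs, ts)"
| "sstep g (Loop j P a # cs, ts) =
     (if scanned (ts ! j) \<in> P then a # Loop j P a # cs else cs, ts)"

text \<open>The stacks that occur while \<open>c\<close> is executed on top of \<open>cs\<close>.\<close>

fun conts :: "com \<Rightarrow> com list \<Rightarrow> com list set" where
  "conts (Act j w d) cs = {Act j w d # cs}"
| "conts Ask cs = {Ask # cs}"
| "conts (Seq a b) cs = insert (Seq a b # cs) (conts a (b # cs) \<union> conts b cs)"
| "conts (Branch j P a b) cs = insert (Branch j P a b # cs) (conts a cs \<union> conts b cs)"
| "conts (Loop j P a) cs = insert (Loop j P a # cs) (conts a (Loop j P a # cs))"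

lemma finite_conts: "finite (conts c cs)"
  by (induction c arbitrary: cs) auto

lemma conts_self: "c # cs \<in> conts c cs"
  by (cases c) auto

text \<open>The stacks that may follow upon a given one, whatever the tests say.\<close>

fun succs :: "com list \<Rightarrow> com list set" where
  "succs [] = {}"
| "succs (Act j w d # cs) = {cs}"
| "succs (Ask # cs) = {cs}"
| "succs (Seq a b # cs) = {a # b # cs}"
| "succs (Branch j P a b # cs) = {a # cs, b # cs}"
| "succs (Loop j P a # cs) = {a # Loop j P a # cs, cs}"

lemma sstep_succs: "x \<noteq> [] \<Longrightarrow> fst (sstep g (x, ts)) \<in> succs x"
  by (induction g "(x, ts)" rule: sstep.induct) auto

lemma conts_succs: "x \<in> conts c cs \<Longrightarrow> succs x \<subseteq> insert cs (conts c cs)"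
proof (induction c arbitrary: cs)
  case (Seq a b)
  then show ?case using conts_self[of a] conts_self[of b] by fastforce
next
  case (Branch j P a b)
  then show ?case using conts_self[of a] conts_self[of b] by fastforce
next
  case (Loop j P a)
  then show ?case using conts_self[of a] by fastforce
qed auto

text \<open>Only the tapes below \<open>K\<close> and the symbols below \<open>N\<close> are used.\<close>

fun wf_com :: "nat \<Rightarrow> nat \<Rightarrow> com \<Rightarrow> bool" where
  "wf_com K N (Act j w d) \<longleftrightarrow> j < K \<and> (\<forall>a. w = Some a \<longrightarrow> a < N)"
| "wf_com K N Ask \<longleftrightarrow> True"
| "wf_com K N (Seq a b) \<longleftrightarrow> wf_com K N a \<and> wf_com K N b"
| "wf_com K N (Branch j P a b) \<longleftrightarrow> j < K \<and> wf_com K N a \<and> wf_com K N b"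
| "wf_com K N (Loop j P a) \<longleftrightarrow> j < K \<and> wf_com K N a"

lemma conts_wf:
  "x \<in> conts c cs \<Longrightarrow> wf_com K N c \<Longrightarrow> list_all (wf_com K N) cs \<Longrightarrow> list_all (wf_com K N) x"
  by (induction c arbitrary: cs) fastforce+

text \<open>
  The machine of a set \<open>St\<close> of stacks that are numbered by \<open>h\<close>.  In the query state the transition
  function is irrelevant.
\<close>

definition compile :: "nat \<Rightarrow> nat \<Rightarrow> (com list \<Rightarrow> nat) \<Rightarrow> com list set \<Rightarrow> machine" where
  "compile K N h St = \<lparr>num_tapes = K, num_syms = N, num_states = Max (insert 3 (h ` St)) + 1,
     delta = (\<lambda>q rs.
       let keep = map (\<lambda>s. (s, Stay)) rs in
       if q \<in> h ` St then
         (case the_inv_into St h q of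
            [] \<Rightarrow> (halt_state, keep)
          | c # cs \<Rightarrow>
             (case c of
                Act j w d \<Rightarrow> (h cs, keep[j := (case w of None \<Rightarrow> rs ! j | Some a \<Rightarrow> a, d)])
              | Ask \<Rightarrow> (halt_state, keep)
              | Seq a b \<Rightarrow> (h (a # b # cs), keep)
              | Branch j P a b \<Rightarrow> (h ((if rs ! j \<in> P then a else b) # cs), keep)
              | Loop j P a \<Rightarrow> (h (if rs ! j \<in> P then a # Loop j P a # cs else cs), keep)))
       else (halt_state, keep))\<rparr>"

lemma update_tape_keep: "update_tape (scanned t, Stay) t = t"
  by (simp add: update_tape_def scanned_def)

lemma map2_keep: "map2 update_tape (map (\<lambda>s. (s, Stay)) (map scanned ts)) ts = ts"
  by (rule nth_equalityI) (simp_all add: update_tape_keep)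

lemma map2_keep_update:
  "map2 update_tape ((map (\<lambda>s. (s, Stay)) (map scanned ts))[j := a]) ts
     = ts[j := update_tape a (ts ! j)]"
  by (rule nth_equalityI; cases "j < length ts")
    (auto simp: nth_list_update update_tape_keep list_update_beyond)

lemma length_sstep: "length (snd (sstep g (x, ts))) = length ts"
  by (induction g "(x, ts)" rule: sstep.induct) auto

text \<open>
  The numbering of the stacks respects the roles of the states 1 to 3: the machine halts, asks
  and resumes there.
\<close>

locale numbered =
  fixes K N :: nat and St :: "com list set" and h :: "com list \<Rightarrow> nat"
  assumes fin: "finite St" and inj: "inj_on h St" and two: "2 \<le> K" and three: "3 \<le> N"
    and wf: "x \<in> St \<Longrightarrow> list_all (wf_com K N) x"
    and closed: "x \<in> St \<Longrightarrow> succs x \<subseteq> St"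
    and h_halt: "x \<in> St \<Longrightarrow> h x = 1 \<longleftrightarrow> x = []"
    and h_query: "x \<in> St \<Longrightarrow> h x = 2 \<longleftrightarrow> (\<exists>cs. x = Ask # cs)"
    and h_resume: "Ask # cs \<in> St \<Longrightarrow> h cs = 3"
begin

abbreviation "M \<equiv> compile K N h St"

lemma M_simps: "num_tapes M = K" "num_syms M = N" "num_states M = Max (insert 3 (h ` St)) + 1"
  by (simp_all add: compile_def)

lemma h_bound: "x \<in> St \<Longrightarrow> h x < num_states M"
  using fin by (simp add: M_simps less_Suc_eq_le)

lemma four: "4 \<le> num_states M"
proof -
  have "3 \<le> Max (insert 3 (h ` St))" using fin by (intro Max_ge) auto
  then show ?thesis by (simp add: M_simps)
qed

lemma inv_h: "x \<in> St \<Longrightarrow> the_inv_into St h (h x) = x"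
  using inj by (simp add: the_inv_into_f_f)

lemma set_keep:
  assumes "set rs \<subseteq> {..<N}" "length rs = K" "j < K" "\<forall>a. w = Some a \<longrightarrow> a < N"
  shows "fst ` set ((map (\<lambda>s. (s, Stay)) rs)[j := (case w of None \<Rightarrow> rs ! j | Some a \<Rightarrow> a, d)])
    \<subseteq> {..<N}"
proof -
  have "rs ! j < N" using assms nth_mem[of j rs] by blast
  then have 1: "(case w of None \<Rightarrow> rs ! j | Some a \<Rightarrow> a) < N" (is "?a < N")
    using assms by (cases w) auto
  have "set ((map (\<lambda>s. (s, Stay)) rs)[j := (?a, d)])
      \<subseteq> insert (?a, d) (set (map (\<lambda>s. (s, Stay)) rs))"
    by (rule set_update_subset_insert)
  then show ?thesis using assms(1) 1 by (force simp: subset_iff)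
qed

lemma wf_M: "machine_wf M"
  unfolding machine_wf_def
proof (intro conjI allI impI)
  show "2 \<le> num_tapes M" "3 \<le> num_syms M" "4 \<le> num_states M"
    using two three four by (simp_all add: M_simps)
  fix q rs
  assume A: "q < num_states M \<and> length rs = num_tapes M \<and> set rs \<subseteq> {..<num_syms M}"
  then have rs: "length rs = K" "set rs \<subseteq> {..<N}" by (simp_all add: M_simps)
  have one: "halt_state < num_states M" using four by simp
  have "fst (delta M q rs) < num_states M \<and> length (snd (delta M q rs)) = K \<and>
      fst ` set (snd (delta M q rs)) \<subseteq> {..<N}"
  proof (cases "q \<in> h ` St")
    case False
    then show ?thesis using one rs by (auto simp: compile_def)
  next
    case True
    then obtain x where x: "x \<in> St" "q = h x" by auto
    show ?thesis
    proof (cases x)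
      case Nil
      then show ?thesis using one rs x inv_h[of x] by (auto simp: compile_def)
    next
      case (Cons c cs)
      note cl = closed[OF x(1)] wf[OF x(1)]
      show ?thesis
      proof (cases c)
        case (Act j w d)
        then show ?thesis
          using x rs inv_h[of x] Cons cl h_bound[of cs] set_keep[of rs j w d]
          by (simp add: compile_def)
      next
        case Ask
        then show ?thesis using x rs inv_h[of x] Cons one by (auto simp: compile_def)
      next
        case (Seq a b)
        then show ?thesis
          using x rs inv_h[of x] Cons cl h_bound[of "a # b # cs"] by (auto simp: compile_def)
      next
        case (Branch j P a b)
        then show ?thesis
          using x rs inv_h[of x] Cons cl h_bound[of "a # cs"] h_bound[of "b # cs"]
          by (auto simp: compile_def)
      next
        case (Loop j P a)
        then show ?thesis
          using x rs inv_h[of x] Cons cl h_bound[of "a # Loop j P a # cs"] h_bound[of "cs"]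
          by (auto simp: compile_def)
      qed
    qed
  qed
  then show "fst (delta M q rs) < num_states M" "length (snd (delta M q rs)) = num_tapes M"
    "fst ` set (snd (delta M q rs)) \<subseteq> {..<num_syms M}"
    by (simp_all add: M_simps)
qed

lemma step_M:
  assumes x: "x \<in> St" and ts: "length ts = K"
  shows "step M g (h x, ts) = (h (fst (sstep g (x, ts))), snd (sstep g (x, ts)))"
proof (cases x)
  case Nil
  then show ?thesis using h_halt[OF x] by (simp add: step_def)
next
  case (Cons c cs)
  have n1: "h x \<noteq> 1" using h_halt[OF x] Cons by simp
  note cl = closed[OF x] wf[OF x]
  have memh: "h x \<in> h ` St" using x by simp
  show ?thesis
  proof (cases "c = Ask")
    case True
    then have "h x = 2" "h cs = 3" using h_query[OF x] h_resume[of cs] Cons x by auto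
    then show ?thesis using Cons True by (simp add: step_def)
  next
    case False
    then have n2: "h x \<noteq> 2" using h_query[OF x] Cons by simp
    show ?thesis
    proof (cases c)
      case (Act j w d)
      have "j < K" using cl Act Cons by simp
      then have "map scanned ts ! j = scanned (ts ! j)" using ts by simp
      then show ?thesis
        using x n1 n2 memh inv_h[OF x] Cons Act map2_keep_update[of ts j]
        by (simp add: step_def compile_def cong: option.case_cong)
    next
      case Ask
      then show ?thesis using False by simp
    next
      case (Seq a b)
      then show ?thesis
        using x n1 n2 memh inv_h[OF x] Cons map2_keep[of ts] by (simp add: step_def compile_def)
    next
      case (Branch j P a b)
      have "j < K" using cl Branch Cons by simp
      then have "map scanned ts ! j = scanned (ts ! j)" using ts by simp
      then show ?thesis
        using x n1 n2 memh inv_h[OF x] Cons Branch map2_keep[of ts]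
        by (simp add: step_def compile_def)
    next
      case (Loop j P a)
      have "j < K" using cl Loop Cons by simp
      then have "map scanned ts ! j = scanned (ts ! j)" using ts by simp
      then show ?thesis
        using x n1 n2 memh inv_h[OF x] Cons Loop map2_keep[of ts]
        by (simp add: step_def compile_def)
    qed
  qed
qed

lemma sstep_St: "x \<in> St \<Longrightarrow> fst (sstep g (x, ts)) \<in> St"
  using closed[of x] sstep_succs[of x g ts] by (cases "x = []") auto

lemma steps_M:
  assumes "x \<in> St" "length ts = K"
  shows "(step M g ^^ n) (h x, ts) = (h (fst ((sstep g ^^ n) (x, ts))), snd ((sstep g ^^ n) (x, ts)))
    \<and> fst ((sstep g ^^ n) (x, ts)) \<in> St \<and> length (snd ((sstep g ^^ n) (x, ts))) = K"
proof (induction n)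
  case 0
  then show ?case using assms by simp
next
  case (Suc n)
  obtain y us where y: "(sstep g ^^ n) (x, ts) = (y, us)" by fastforce
  have "y \<in> St" "length us = K" using Suc y by auto
  then show ?case
    using Suc y step_M[of y us g] sstep_St[of y g us] length_sstep[of g y us] by simp
qed

lemma oracle_free_M:
  assumes "\<And>cs. Ask # cs \<notin> St"
  shows "oracle_free M"
  unfolding oracle_free_def
proof (intro allI impI)
  fix q rs
  have n2: "h x \<noteq> 2" if "x \<in> St" for x using h_query[OF that] assms that by auto
  show "fst (delta M q rs) \<noteq> query_state"
  proof (cases "q \<in> h ` St")
    case False
    then show ?thesis by (simp add: compile_def)
  next
    case True
    then obtain x where x: "x \<in> St" "q = h x" by auto
    show ?thesis
    proof (cases x)
      case Nil
      then show ?thesis using x inv_h[of x] by (simp add: compile_def)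
    next
      case (Cons c cs)
      have "\<And>y. y \<in> succs x \<Longrightarrow> h y \<noteq> 2" using closed[OF x(1)] n2 by auto
      then show ?thesis using x inv_h[of x] Cons
        by (cases c) (auto simp: compile_def)
    qed
  qed
qed

end

text \<open>
  A program in which every call of the oracle is followed by the same stack of commands, as happens
  when \<open>Ask\<close> occurs only once, is executed step by step by some machine.
\<close>

lemma compile_program:
  assumes wfc: "wf_com K N c" and K: "2 \<le> K" "3 \<le> N"
    and uniq: "\<And>cs. Ask # cs \<in> conts c [] \<Longrightarrow> cs = cs0"
    and cs0: "cs0 \<noteq> []" "cs0 \<noteq> [c]" and c: "c \<noteq> Ask"
  shows "\<exists>M. machine_wf M \<and> num_tapes M = K \<and>
    (\<forall>g ts n ts'. length ts = K \<longrightarrow> (sstep g ^^ n) ([c], ts) = ([], ts') \<longrightarrow>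
       (step M g ^^ n) (start_state, ts) = (halt_state, ts')) \<and>
    ((\<forall>cs. Ask # cs \<notin> conts c []) \<longrightarrow> oracle_free M)"
proof -
  define St where "St = insert [] (conts c [])"
  have fin: "finite St" by (simp add: St_def finite_conts)
  then obtain h0 :: "com list \<Rightarrow> nat" where h0: "inj_on h0 St"
    using finite_imp_inj_to_nat_seg by metis
  define h where "h x = (if x = [c] then 0 else if x = [] then 1 else if \<exists>cs. x = Ask # cs then 2
    else if x = cs0 \<and> Ask # cs0 \<in> St then 3 else 4 + h0 x)" for x
  have ask: "cs = cs0" if "Ask # cs \<in> St" for cs using that uniq by (auto simp: St_def)
  have cl: "succs x \<subseteq> St" if "x \<in> St" for x
    using that conts_succs[of x c "[]"] by (auto simp: St_def)
  have cs0_ask: "cs0 \<noteq> Ask # cs" if "Ask # cs0 \<in> St" for cs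
  proof
    assume eq: "cs0 = Ask # cs"
    have "cs0 \<in> St" using cl[OF that] by simp
    then have "cs = cs0" using ask eq by blast
    then show False using eq by simp
  qed
  interpret numbered K N St h
  proof
    show "inj_on h St"
    proof (rule inj_onI)
      fix x y assume "x \<in> St" "y \<in> St" "h x = h y"
      moreover have "h z = 0 \<Longrightarrow> z = [c]" "h z = 1 \<Longrightarrow> z = []" "h z = 2 \<Longrightarrow> \<exists>cs. z = Ask # cs"
        "h z = 3 \<Longrightarrow> z = cs0" "h z \<ge> 4 \<Longrightarrow> h z = 4 + h0 z" for z
        unfolding h_def by (auto split: if_split_asm)
      moreover have "n = 0 \<or> n = 1 \<or> n = 2 \<or> n = 3 \<or> n \<ge> 4" for n :: nat by arith
      ultimately show "x = y" using inj_onD[OF h0, of x y] ask by (metis add_left_cancel)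
    qed
    show "list_all (wf_com K N) x" if "x \<in> St" for x
      using that conts_wf[of x c "[]" K N] wfc by (auto simp: St_def)
    show "h x = 1 \<longleftrightarrow> x = []" if "x \<in> St" for x by (auto simp: h_def)
    show "h x = 2 \<longleftrightarrow> (\<exists>cs. x = Ask # cs)" if "x \<in> St" for x using c by (auto simp: h_def)
    show "h cs = 3" if "Ask # cs \<in> St" for cs
      using ask[OF that] that cs0 cs0_ask by (auto simp: h_def)
  qed (use fin cl K in auto)
  have start: "[c] \<in> St" "h [c] = 0" "h [] = 1" by (auto simp: St_def conts_self h_def)
  show ?thesis
  proof (intro exI conjI allI impI)
    show "machine_wf M" by (rule wf_M)
    show "num_tapes M = K" by (rule M_simps)
    show "oracle_free M" if "\<forall>cs. Ask # cs \<notin> conts c []"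
      using oracle_free_M that by (auto simp: St_def)
    fix g ts n ts'
    assume "length ts = K" "(sstep g ^^ n) ([c], ts) = ([], ts')"
    then show "(step M g ^^ n) (start_state, ts) = (halt_state, ts')"
      using steps_M[OF start(1), of ts n g] start by simp
  qed
qed

section \<open>Programs on stacks\<close>

definition runs ::
  "(bool list \<Rightarrow> bool list) \<Rightarrow> com \<Rightarrow> nat \<Rightarrow> tape list \<Rightarrow> tape list \<Rightarrow> bool" where
  "runs g c n ts ts' \<longleftrightarrow> (\<exists>m\<le>n. \<forall>cs. (sstep g ^^ m) (c # cs, ts) = (cs, ts'))"

lemma runs_mono: "runs g c m ts ts' \<Longrightarrow> m \<le> n \<Longrightarrow> runs g c n ts ts'"
  unfolding runs_def using order_trans by blast

lemma runs_Act:
  "ts' = ts[j := update_tape (case w of None \<Rightarrow> scanned (ts ! j) | Some a \<Rightarrow> a, d) (ts ! j)] \<Longrightarrow>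
     runs g (Act j w d) 1 ts ts'"
  unfolding runs_def by (rule exI[of _ 1]) simp

lemma runs_Ask: "ts' = ts[1 := word_tape (g (tape_word (ts ! 1)))] \<Longrightarrow> runs g Ask 1 ts ts'"
  unfolding runs_def by (rule exI[of _ 1]) simp

lemma runs_Seq:
  assumes "runs g a m ts ts1" "runs g b n ts1 ts2" "m + n + 1 \<le> k"
  shows "runs g (Seq a b) k ts ts2"
proof -
  obtain m' n' where "m' \<le> m" "\<forall>cs. (sstep g ^^ m') (a # cs, ts) = (cs, ts1)"
    "n' \<le> n" "\<forall>cs. (sstep g ^^ n') (b # cs, ts1) = (cs, ts2)"
    using assms unfolding runs_def by blast
  then show ?thesis
    unfolding runs_def using assms(3)
    by (intro exI[of _ "n' + m' + 1"]) (simp add: funpow_add funpow_swap1)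
qed

lemma runs_Branch:
  assumes "runs g (if scanned (ts ! j) \<in> P then a else b) n ts ts'" "n + 1 \<le> k"
  shows "runs g (Branch j P a b) k ts ts'"
proof -
  obtain n' where "n' \<le> n"
    "\<forall>cs. (sstep g ^^ n') ((if scanned (ts ! j) \<in> P then a else b) # cs, ts) = (cs, ts')"
    using assms unfolding runs_def by blast
  then show ?thesis
    unfolding runs_def using assms(2)
    by (intro exI[of _ "n' + 1"]) (auto simp: funpow_swap1)
qed

lemma runs_Loop_exit: "scanned (ts ! j) \<notin> P \<Longrightarrow> runs g (Loop j P a) 1 ts ts"
  unfolding runs_def by (rule exI[of _ 1]) simp

lemma runs_Loop_step:
  assumes "scanned (ts ! j) \<in> P" "runs g a m ts ts1" "runs g (Loop j P a) n ts1 ts2" "m + n + 1 \<le> k"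
  shows "runs g (Loop j P a) k ts ts2"
proof -
  obtain m' n' where "m' \<le> m" "\<forall>cs. (sstep g ^^ m') (a # cs, ts) = (cs, ts1)"
    "n' \<le> n" "\<forall>cs. (sstep g ^^ n') (Loop j P a # cs, ts1) = (cs, ts2)"
    using assms unfolding runs_def by blast
  then show ?thesis
    unfolding runs_def using assms(1,4)
    by (intro exI[of _ "n' + m' + 1"]) (simp add: funpow_add funpow_swap1)
qed

text \<open>
  A stack of bits on a tape: cell 0 holds the marker 3, the head is on the top of the stack.
\<close>

definition stk :: "bool list \<Rightarrow> tape" where
  "stk w = ((\<lambda>i. if i = 0 then 3 else if i \<le> length w then (if w ! (length w - i) then 2 else 1) else 0),
     length w)"

lemma scanned_stk: "scanned (stk []) = 3" "scanned (stk (b # w)) = (if b then 2 else 1)"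
  by (simp_all add: stk_def scanned_def)

lemma pop_stk: "update_tape (0, Go_Left) (stk (b # w)) = stk w"
  by (auto simp: stk_def update_tape_def fun_eq_iff nth_Cons' Suc_diff_le)

lemma push_stk:
  "update_tape (if b then 2 else 1, Stay) (update_tape (scanned (stk w), Go_Right) (stk w)) = stk (b # w)"
  by (auto simp: stk_def update_tape_def scanned_def fun_eq_iff nth_Cons' Suc_diff_le)

text \<open>
  The tapes of all our machines: the two distinguished ones, given by \<open>t\<close>, and five stacks, given
  by \<open>s\<close>.
\<close>

definition tps :: "(nat \<Rightarrow> tape) \<Rightarrow> (nat \<Rightarrow> bool list) \<Rightarrow> tape list" where
  "tps t s = t 0 # t 1 # map (\<lambda>i. stk (s i)) [0..<5]"

lemma length_tps: "length (tps t s) = 7"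
  by (simp add: tps_def)

lemma tps_stack: "v < 5 \<Longrightarrow> tps t s ! Suc (Suc v) = stk (s v)"
  by (simp add: tps_def del: upt_Suc)

lemma tps_tape: "j < 2 \<Longrightarrow> tps t s ! j = t j"
  by (auto simp: tps_def nth_Cons' less_2_cases_iff)

lemma tps_stack_update: "v < 5 \<Longrightarrow> (tps t s)[Suc (Suc v) := stk w] = tps t (s(v := w))"
proof -
  assume "v < 5"
  then have "(map (\<lambda>i. stk (s i)) [0..<5])[v := stk w] = map (\<lambda>i. stk ((s(v := w)) i)) [0..<5]"
    by (intro nth_equalityI) (simp_all add: nth_list_update del: upt_Suc)
  then show ?thesis by (simp add: tps_def del: upt_Suc)
qed

lemma tps_tape_update: "j < 2 \<Longrightarrow> (tps t s)[j := x] = tps (t(j := x)) s"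
  by (auto simp: tps_def less_2_cases_iff)

text \<open>
  A program that leaves the two distinguished tapes alone.
\<close>

definition srun :: "com \<Rightarrow> nat \<Rightarrow> (nat \<Rightarrow> bool list) \<Rightarrow> (nat \<Rightarrow> bool list) \<Rightarrow> bool" where
  "srun c n s s' \<longleftrightarrow> (\<forall>g t. runs g c n (tps t s) (tps t s'))"

lemma srun_mono: "srun c m s s' \<Longrightarrow> m \<le> n \<Longrightarrow> srun c n s s'"
  unfolding srun_def using runs_mono by blast

lemma srun_Seq: "srun a m s s1 \<Longrightarrow> srun b n s1 s2 \<Longrightarrow> m + n + 1 \<le> k \<Longrightarrow> srun (Seq a b) k s s2"
  unfolding srun_def by (metis runs_Seq)

lemma srun_Branch:
  assumes "v < 5" "srun (if scanned (stk (s v)) \<in> P then a else b) n s s'" "n + 1 \<le> k"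
  shows "srun (Branch (Suc (Suc v)) P a b) k s s'"
  using assms unfolding srun_def by (auto intro!: runs_Branch simp: tps_stack)

lemma srun_Loop_exit:
  "v < 5 \<Longrightarrow> scanned (stk (s v)) \<notin> P \<Longrightarrow> srun (Loop (Suc (Suc v)) P a) 1 s s"
  unfolding srun_def by (auto intro!: runs_Loop_exit[unfolded One_nat_def] simp: tps_stack)

lemma srun_Loop_step:
  assumes "v < 5" "scanned (stk (s v)) \<in> P" "srun a m s s1" "srun (Loop (Suc (Suc v)) P a) n s1 s2"
    "m + n + 1 \<le> k"
  shows "srun (Loop (Suc (Suc v)) P a) k s s2"
  unfolding srun_def
proof (intro allI)
  fix g t
  show "runs g (Loop (Suc (Suc v)) P a) k (tps t s) (tps t s2)"
    by (rule runs_Loop_step[of "tps t s" _ _ _ _ m "tps t s1" n])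
      (use assms in \<open>auto simp: tps_stack srun_def\<close>)
qed

text \<open>Programs over these tapes that do not consult the oracle.\<close>

fun okc :: "com \<Rightarrow> bool" where
  "okc (Act j w d) \<longleftrightarrow> j < 7 \<and> (\<forall>a. w = Some a \<longrightarrow> a < 4)"
| "okc Ask \<longleftrightarrow> False"
| "okc (Seq a b) \<longleftrightarrow> okc a \<and> okc b"
| "okc (Branch j P a b) \<longleftrightarrow> j < 7 \<and> okc a \<and> okc b"
| "okc (Loop j P a) \<longleftrightarrow> j < 7 \<and> okc a"

lemma okc_wf: "okc c \<Longrightarrow> wf_com 7 4 c"
  by (induction c) auto

lemma okc_no_Ask: "okc c \<Longrightarrow> Ask # ds \<notin> conts c cs"
  by (induction c arbitrary: cs) auto

definition skip :: com where
  "skip = Act 0 None Stay"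

definition pushc :: "nat \<Rightarrow> bool \<Rightarrow> com" where
  "pushc v b = Seq (Act (Suc (Suc v)) None Go_Right) (Act (Suc (Suc v)) (Some (if b then 2 else 1)) Stay)"

definition popc :: "nat \<Rightarrow> com" where
  "popc v = Act (Suc (Suc v)) (Some 0) Go_Left"

text \<open>Pop a bit and branch on it; the same in a loop until the stack is empty.\<close>

definition caseb :: "nat \<Rightarrow> com \<Rightarrow> com \<Rightarrow> com" where
  "caseb v cF cT = Branch (Suc (Suc v)) {2} (Seq (popc v) cT) (Seq (popc v) cF)"

definition loopb :: "nat \<Rightarrow> com \<Rightarrow> com \<Rightarrow> com" where
  "loopb v cF cT = Loop (Suc (Suc v)) (- {3}) (caseb v cF cT)"

lemma okc_basic [simp]:
  "okc skip" "v < 5 \<Longrightarrow> okc (pushc v b)" "v < 5 \<Longrightarrow> okc (popc v)"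
  "okc (caseb v cF cT) \<longleftrightarrow> v < 5 \<and> okc cF \<and> okc cT" "okc (loopb v cF cT) \<longleftrightarrow> v < 5 \<and> okc cF \<and> okc cT"
  by (auto simp: skip_def pushc_def popc_def caseb_def loopb_def)

lemma runs_skip: "runs g skip 1 (tps t s) (tps t s)"
  unfolding skip_def by (rule runs_Act) (simp add: update_tape_keep)

lemma srun_skip: "srun skip 1 s s"
  unfolding srun_def using runs_skip by blast

lemma srun_pushc: "v < 5 \<Longrightarrow> s' = s(v := b # s v) \<Longrightarrow> srun (pushc v b) 3 s s'"
  unfolding srun_def
proof (intro allI)
  fix g t
  assume A: "v < 5" "s' = s(v := b # s v)"
  let ?t = "stk (s v)"
  have "runs g (Act (Suc (Suc v)) None Go_Right) 1 (tps t s)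
      ((tps t s)[Suc (Suc v) := update_tape (scanned ?t, Go_Right) ?t])"
    by (rule runs_Act) (simp add: tps_stack A)
  moreover have "runs g (Act (Suc (Suc v)) (Some (if b then 2 else 1)) Stay) 1
      ((tps t s)[Suc (Suc v) := update_tape (scanned ?t, Go_Right) ?t]) (tps t s')"
    by (rule runs_Act) (use A push_stk[of b "s v"] in \<open>simp add: length_tps tps_stack_update\<close>)
  ultimately show "runs g (pushc v b) 3 (tps t s) (tps t s')"
    unfolding pushc_def by (rule runs_Seq) simp
qed

lemma srun_popc: "v < 5 \<Longrightarrow> s v = b # w \<Longrightarrow> s' = s(v := w) \<Longrightarrow> srun (popc v) 1 s s'"
  unfolding srun_def popc_def
  by (intro allI runs_Act) (auto simp: tps_stack pop_stk tps_stack_update)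

lemma srun_caseb:
  assumes "v < 5" "s v = b # w" "srun (if b then cT else cF) n (s(v := w)) s'" "n + 3 \<le> k"
  shows "srun (caseb v cF cT) k s s'"
  unfolding caseb_def
proof (rule srun_Branch)
  have "srun (Seq (popc v) (if b then cT else cF)) (n + 2) s s'"
    using assms by (intro srun_Seq[OF srun_popc[where v = v and s = s and b = b and w = w, OF assms(1,2) refl] assms(3)]) simp
  then show "srun (if scanned (stk (s v)) \<in> {2} then Seq (popc v) cT else Seq (popc v) cF) (n + 2) s s'"
    using assms by (auto simp: scanned_stk)
qed (use assms in auto)

lemma srun_loopb_Nil: "v < 5 \<Longrightarrow> s v = [] \<Longrightarrow> srun (loopb v cF cT) 1 s s"
  unfolding loopb_def by (rule srun_Loop_exit) (auto simp: scanned_stk)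

lemma srun_loopb_Cons:
  assumes "v < 5" "s v = b # w" "srun (if b then cT else cF) m (s(v := w)) s1"
    "srun (loopb v cF cT) n s1 s2" "m + n + 4 \<le> k"
  shows "srun (loopb v cF cT) k s s2"
  unfolding loopb_def
  by (rule srun_Loop_step[OF assms(1) _ srun_caseb[OF assms(1,2,3) order_refl] assms(4)[unfolded loopb_def]])
    (use assms in \<open>auto simp: scanned_stk\<close>)

section \<open>Trees as data\<close>

text \<open>
  All data are binary trees.  The code is prefix-free, so that a program may work on the tree on top
  of a stack without disturbing what lies below.
\<close>

datatype tree = Lf | Nd tree tree

text \<open>
  Polish notation, with \<open>True\<close> for nodes.
\<close>

primrec code :: "tree \<Rightarrow> bool list" where
  "code Lf = [False]"
| "code (Nd a b) = True # code a @ code b"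

abbreviation sz :: "tree \<Rightarrow> nat" where
  "sz t \<equiv> length (code t)"

lemma sz_pos: "0 < sz t"
  by (cases t) auto

text \<open>
  Popping a tree from stack \<open>a\<close>: it is collected in reverse order on stack 3, while stack 4 counts
  the subtrees that are still expected.
\<close>

definition pump :: "nat \<Rightarrow> com" where
  "pump a = caseb a (pushc 3 False) (Seq (pushc 3 True) (Seq (pushc 4 True) (pushc 4 True)))"

text \<open>
  Push a bit on several stacks.
\<close>

primrec pushes :: "nat list \<Rightarrow> bool \<Rightarrow> com" where
  "pushes [] b = skip"
| "pushes (v # vs) b = Seq (pushc v b) (pushes vs b)"

definition takec :: "nat \<Rightarrow> nat list \<Rightarrow> com" where
  "takec a B = Seq (pushc 4 True) (Seq (loopb 4 (pump a) (pump a))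
     (loopb 3 (pushes B False) (pushes B True)))"

text \<open>
  The stacks in \<open>B\<close> receive the word \<open>w\<close> on top.
\<close>

definition addp :: "nat list \<Rightarrow> bool list \<Rightarrow> (nat \<Rightarrow> bool list) \<Rightarrow> nat \<Rightarrow> bool list" where
  "addp B w s = (\<lambda>v. if v \<in> set B then w @ s v else s v)"

lemma okc_pushes: "set B \<subseteq> {..<5} \<Longrightarrow> okc (pushes B b)"
  by (induction B) auto

lemma okc_takec [simp]: "a < 3 \<Longrightarrow> set B \<subseteq> {..<3} \<Longrightarrow> okc (takec a B)"
proof -
  assume A: "a < 3" "set B \<subseteq> {..<3}"
  then have "okc (pushes B b)" for b by (intro okc_pushes) auto
  then show ?thesis using A by (simp add: takec_def pump_def)
qed

lemma srun_pump_loop: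
  assumes "a < 3"
  shows "srun (loopb 4 (pump a) (pump a)) n (s(a := r, 3 := rev (code t) @ u, 4 := cw)) s' \<Longrightarrow>
    srun (loopb 4 (pump a) (pump a)) (n + 20 * sz t) (s(a := code t @ r, 3 := u, 4 := True # cw)) s'"
proof (induction t arbitrary: r u cw n)
  case Lf
  let ?s = "s(a := code Lf @ r, 3 := u, 4 := True # cw)"
  have "srun (pushc 3 False) 3 (?s(4 := cw, a := r)) (s(a := r, 3 := rev (code Lf) @ u, 4 := cw))"
    by (rule srun_pushc) (use assms in \<open>auto simp: fun_eq_iff\<close>)
  then have 1: "srun (if True then pump a else pump a) 6 (?s(4 := cw)) (s(a := r, 3 := rev (code Lf) @ u, 4 := cw))"
    unfolding pump_def if_True using assms
    by (intro srun_caseb[where b = False and w = r and n = 3]) auto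
  show ?case
    by (rule srun_loopb_Cons[OF _ _ 1 Lf]) auto
next
  case (Nd x y)
  let ?L = "loopb 4 (pump a) (pump a)" and ?s = "s(a := code (Nd x y) @ r, 3 := u, 4 := True # cw)"
  let ?s' = "s(a := code x @ code y @ r, 3 := True # u, 4 := True # True # cw)"
  have 1: "srun ?L (n + 20 * sz y)
      (s(a := code y @ r, 3 := rev (code x) @ True # u, 4 := True # cw)) s'"
    by (rule Nd.IH(2))
      (use Nd.prems in \<open>simp only: code.simps rev.simps rev_append append_assoc append.simps\<close>)
  have 2: "srun ?L (n + 20 * sz y + 20 * sz x) ?s' s'"
    by (rule Nd.IH(1)[OF 1])
  have p1: "srun (pushc 3 True) 3 (?s(4 := cw, a := code x @ code y @ r)) (?s'(4 := cw))"
    and p2: "srun (pushc 4 True) 3 (?s'(4 := cw)) (?s'(4 := True # cw))"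
    and p3: "srun (pushc 4 True) 3 (?s'(4 := True # cw)) ?s'"
    by (rule srun_pushc; use assms in \<open>auto simp: fun_eq_iff\<close>)+
  have "srun (Seq (pushc 3 True) (Seq (pushc 4 True) (pushc 4 True))) 11
      (?s(4 := cw, a := code x @ code y @ r)) ?s'"
    by (rule srun_Seq[OF p1 srun_Seq[OF p2 p3 order_refl]]) simp
  then have 3: "srun (if True then pump a else pump a) 14 (?s(4 := cw)) ?s'"
    unfolding pump_def if_True using assms
    by (intro srun_caseb[where b = True and w = "code x @ code y @ r" and n = 11]) auto
  show ?case
    by (rule srun_loopb_Cons[OF _ _ 3 2]) auto
qed

lemma srun_pushes:
  "set B \<subseteq> {..<5} \<Longrightarrow> distinct B \<Longrightarrow> s' = addp B [b] s \<Longrightarrow> srun (pushes B b) (4 * length B + 1) s s'"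
proof (induction B arbitrary: s s')
  case Nil
  then show ?case using srun_skip[of s] by (simp add: addp_def)
next
  case (Cons v B)
  have "srun (pushes B b) (4 * length B + 1) (s(v := b # s v)) s'"
    using Cons by (intro Cons.IH) (auto simp: addp_def fun_eq_iff)
  then show ?case using Cons.prems by (auto intro!: srun_Seq[OF srun_pushc[OF _ refl]])
qed

lemma srun_unload:
  assumes "set B \<subseteq> {..<3}" "distinct B"
  shows "s 3 = w \<Longrightarrow> s' = addp B (rev w) (s(3 := [])) \<Longrightarrow>
    srun (loopb 3 (pushes B False) (pushes B True)) ((4 * length B + 5) * length w + 1) s s'"
proof (induction w arbitrary: s s')
  case Nil
  then have "s' = s" by (auto simp: addp_def)
  then show ?case using srun_loopb_Nil[of 3 s] Nil by simp
next
  case (Cons b w)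
  have B: "set B \<subseteq> {..<5}" "3 \<notin> set B" using assms by auto
  have 1: "srun (if b then pushes B True else pushes B False) (4 * length B + 1) (s(3 := w))
      (addp B [b] (s(3 := w)))"
    using srun_pushes[OF B(1) assms(2) refl] by simp
  have 2: "srun (loopb 3 (pushes B False) (pushes B True)) ((4 * length B + 5) * length w + 1)
      (addp B [b] (s(3 := w))) s'"
    by (rule Cons.IH) (use Cons.prems B in \<open>auto simp: addp_def fun_eq_iff\<close>)
  show ?case
    by (rule srun_loopb_Cons[OF _ Cons.prems(1) 1 2]) (simp_all add: algebra_simps)
qed

text \<open>\<open>takec a B\<close> pops a tree from stack \<open>a\<close> and pushes it on the stacks in \<open>B\<close>.\<close>

lemma srun_takec:
  assumes a: "a < 3" and B: "set B \<subseteq> {..<3}" "distinct B" and s: "s a = code t @ r" "s 3 = []" "s 4 = []"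
    and s': "s' = addp B (code t) (s(a := r))"
  shows "srun (takec a B) (44 * sz t) s s'"
proof -
  have "length B \<le> 3"
    using card_mono[OF _ B(1)] B(2) by (simp add: distinct_card)
  define s2 where "s2 = s(a := r, 3 := rev (code t), 4 := [])"
  have 1: "srun (pushc 4 True) 3 s (s(4 := [True]))"
    by (rule srun_pushc) (use s in auto)
  have "srun (loopb 4 (pump a) (pump a)) 1 s2 s2"
    by (rule srun_loopb_Nil) (simp_all add: s2_def)
  then have "srun (loopb 4 (pump a) (pump a)) (1 + 20 * sz t) (s(a := code t @ r, 3 := [], 4 := [True])) s2"
    by (intro srun_pump_loop[OF a]) (simp add: s2_def)
  moreover have "s(a := code t @ r, 3 := [], 4 := [True]) = s(4 := [True])" using s a by auto
  ultimately have 2: "srun (loopb 4 (pump a) (pump a)) (1 + 20 * sz t) (s(4 := [True])) s2" by simp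
  have 3: "srun (loopb 3 (pushes B False) (pushes B True)) ((4 * length B + 5) * sz t + 1) s2 s'"
  proof -
    have "s2 3 = rev (code t)" by (simp add: s2_def)
    moreover have "s' = addp B (rev (rev (code t))) (s2(3 := []))"
      unfolding s' by (rule ext) (use s a B in \<open>auto simp: s2_def addp_def\<close>)
    ultimately show ?thesis using srun_unload[OF B, of s2 "rev (code t)" s'] by simp
  qed
  have "(4 * length B + 5) * sz t \<le> 17 * sz t" using \<open>length B \<le> 3\<close> by (intro mult_right_mono) auto
  then show ?thesis
    unfolding takec_def using sz_pos[of t] by (intro srun_Seq[OF 1 srun_Seq[OF 2 3 order_refl]]) linarith
qed

section \<open>Polynomially bounded functions\<close>

text \<open>Functions with a polynomial bound; the bound is a power of \<open>n + 2\<close> so that constants are covered at \<open>n = 0\<close>.\<close>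

definition pb :: "(nat \<Rightarrow> nat) \<Rightarrow> bool" where
  "pb h \<longleftrightarrow> (\<exists>k. \<forall>n. h n \<le> (n + 2) ^ k)"

lemma pbI: "(\<And>n. h n \<le> (n + 2) ^ k) \<Longrightarrow> pb h"
  unfolding pb_def by blast

lemma pb_const [intro!]: "pb (\<lambda>n. c)"
proof (rule pbI)
  fix n :: nat
  have "c \<le> 2 ^ c" using less_exp[of c] by simp
  also have "\<dots> \<le> (n + 2) ^ c" by (rule power_mono) auto
  finally show "c \<le> (n + 2) ^ c" .
qed

lemma pb_id [intro!]: "pb (\<lambda>n. n)"
  by (rule pbI[of _ 1]) auto

lemma pb_add [intro!]:
  assumes "pb f" "pb g"
  shows "pb (\<lambda>n. f n + g n)"
proof -
  obtain k m where km: "\<And>n. f n \<le> (n + 2) ^ k" "\<And>n. g n \<le> (n + 2) ^ m"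
    using assms unfolding pb_def by blast
  show ?thesis
  proof (rule pbI)
    fix n :: nat
    have "f n \<le> (n + 2) ^ (k + m)" "g n \<le> (n + 2) ^ (k + m)"
      using km[of n] power_increasing[of k "k + m" "n + 2"] power_increasing[of m "k + m" "n + 2"]
      by linarith+
    then have "f n + g n \<le> (n + 2) * (n + 2) ^ (k + m)"
      using mult_right_mono[of 2 "n + 2" "(n + 2) ^ (k + m)"] by linarith
    then show "f n + g n \<le> (n + 2) ^ Suc (k + m)" by simp
  qed
qed

lemma pb_mult [intro!]:
  assumes "pb f" "pb g"
  shows "pb (\<lambda>n. f n * g n)"
proof -
  obtain k m where km: "\<And>n. f n \<le> (n + 2) ^ k" "\<And>n. g n \<le> (n + 2) ^ m"
    using assms unfolding pb_def by blast
  show ?thesis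
  proof (rule pbI)
    fix n :: nat
    show "f n * g n \<le> (n + 2) ^ (k + m)"
      unfolding power_add by (rule mult_mono) (use km in auto)
  qed
qed

lemma pb_Suc [intro!]: "pb f \<Longrightarrow> pb (\<lambda>n. Suc (f n))"
  using pb_add[of f "\<lambda>_. 1"] by auto

lemma pb_power [intro!]: "pb f \<Longrightarrow> pb (\<lambda>n. f n ^ k)"
  by (induction k) auto

lemma pb_poly: "pb h \<Longrightarrow> \<exists>p :: nat poly. \<forall>n. h n \<le> poly p n"
proof -
  assume "pb h"
  then obtain k where "\<And>n. h n \<le> (n + 2) ^ k" unfolding pb_def by blast
  then have "\<forall>n. h n \<le> poly ([:2, 1:] ^ k) n" by (simp add: poly_power add.commute)
  then show ?thesis by blast
qed

section \<open>Polynomial-time functions on trees\<close>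

text \<open>
  The program replaces the code of a tree \<open>t\<close> in \<open>D\<close> on top of the first stack by the code of \<open>F t\<close>,
  within \<open>h (sz t)\<close> steps, which bounds the size of \<open>F t\<close> too.  Two stacks serve as scratch space and
  are empty before and after.
\<close>

definition implements :: "com \<Rightarrow> (nat \<Rightarrow> nat) \<Rightarrow> tree set \<Rightarrow> (tree \<Rightarrow> tree) \<Rightarrow> bool" where
  "implements c h D F \<longleftrightarrow> okc c \<and> pb h \<and> (\<forall>t\<in>D. sz (F t) \<le> h (sz t) \<and>
     (\<forall>s r. s 0 = code t @ r \<longrightarrow> s 3 = [] \<longrightarrow> s 4 = [] \<longrightarrow>
        srun c (h (sz t)) s (s(0 := code (F t) @ r))))"

lemma implementsD:
  assumes "implements c h D F"
  shows "okc c" "pb h" "t \<in> D \<Longrightarrow> sz (F t) \<le> h (sz t)"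
    "t \<in> D \<Longrightarrow> s 0 = code t @ r \<Longrightarrow> s 3 = [] \<Longrightarrow> s 4 = [] \<Longrightarrow> srun c (h (sz t)) s (s(0 := code (F t) @ r))"
  using assms unfolding implements_def by blast+

text \<open>
  Computable in polynomial time on the arguments in \<open>D\<close>.
\<close>

definition fp :: "tree set \<Rightarrow> (tree \<Rightarrow> tree) \<Rightarrow> bool" where
  "fp D F \<longleftrightarrow> (\<exists>c h. implements c h D F)"

lemma fpI:
  assumes "okc c" "pb h1" "pb h2" "\<And>t. t \<in> D \<Longrightarrow> sz (F t) \<le> h1 (sz t)"
    "\<And>t s r. t \<in> D \<Longrightarrow> s 0 = code t @ r \<Longrightarrow> s 3 = [] \<Longrightarrow> s 4 = [] \<Longrightarrow>
       srun c (h2 (sz t)) s (s(0 := code (F t) @ r))"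
  shows "fp D F"
  unfolding fp_def implements_def
proof (intro exI conjI allI impI ballI)
  show "okc c" by fact
  show "pb (\<lambda>n. h1 n + h2 n)" using assms by blast
  show "sz (F t) \<le> h1 (sz t) + h2 (sz t)" if "t \<in> D" for t using assms(4)[of t] that by simp
  show "srun c (h1 (sz t) + h2 (sz t)) s (s(0 := code (F t) @ r))"
    if "t \<in> D" "s 0 = code t @ r" "s 3 = []" "s 4 = []" for t s r
    using assms(5)[OF that] srun_mono by fastforce
qed

lemma fp_size: "fp D F \<Longrightarrow> \<exists>h. pb h \<and> (\<forall>t\<in>D. sz (F t) \<le> h (sz t))"
  unfolding fp_def by (elim exE) (intro exI conjI ballI, erule implementsD(2), erule (1) implementsD(3))

lemma fp_subset: "fp D F \<Longrightarrow> E \<subseteq> D \<Longrightarrow> fp E F"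
  unfolding fp_def implements_def by (metis (no_types, lifting) subsetD)

lemma srun_dup:
  assumes "s 0 = code t @ r" "s 3 = []" "s 4 = []" "s' = s(Suc 0 := code t @ s (Suc 0))"
  shows "srun (takec 0 [0, 1]) (44 * sz t) s s'"
  by (rule srun_takec[where r = r]) (use assms in \<open>auto simp: addp_def fun_eq_iff\<close>)

lemma srun_mv:
  assumes "a < 3" "b < 3" "a \<noteq> b" "s a = code t @ r" "s 3 = []" "s 4 = []"
    "s' = s(a := r, b := code t @ s b)"
  shows "srun (takec a [b]) (44 * sz t) s s'"
  by (rule srun_takec[where r = r]) (use assms in \<open>auto simp: addp_def fun_eq_iff\<close>)

lemma srun_drop:
  assumes "a < 3" "s a = code t @ r" "s 3 = []" "s 4 = []" "s' = s(a := r)"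
  shows "srun (takec a []) (44 * sz t) s s'"
  by (rule srun_takec[where r = r]) (use assms in \<open>auto simp: addp_def fun_eq_iff\<close>)

lemma fp_id: "fp D (\<lambda>t. t)"
proof (rule fpI[of skip "\<lambda>n. n" "\<lambda>n. 1"])
  show "srun skip 1 s (s(0 := code t @ r))" if "s 0 = code t @ r" for s :: "nat \<Rightarrow> bool list" and t r
  proof -
    have "s(0 := code t @ r) = s" using that by auto
    then show ?thesis using srun_skip[of s] by simp
  qed
qed auto

lemma fp_comp:
  assumes "fp E F" "fp D G" "\<And>t. t \<in> D \<Longrightarrow> G t \<in> E"
  shows "fp D (\<lambda>t. F (G t))"
proof -
  obtain cF hF where "implements cF hF E F" using assms(1) unfolding fp_def by blast
  note F = implementsD[OF this]
  obtain cG hG where "implements cG hG D G" using assms(2) unfolding fp_def by blast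
  note G = implementsD[OF this]
  obtain k where k: "\<And>n. hF n \<le> (n + 2) ^ k" using F(2) unfolding pb_def by blast
  have b: "hF (sz (G t)) \<le> (hG (sz t) + 2) ^ k" if "t \<in> D" for t
    by (rule order_trans[OF k power_mono]) (use G(3)[of t] that in auto)
  show ?thesis
  proof (rule fpI[of "Seq cG cF" "\<lambda>n. (hG n + 2) ^ k" "\<lambda>n. hG n + (hG n + 2) ^ k + 1"])
    show "sz (F (G t)) \<le> (hG (sz t) + 2) ^ k" if "t \<in> D" for t
      using F(3)[of "G t"] b[of t] assms(3)[of t] that by linarith
    show "srun (Seq cG cF) (hG (sz t) + (hG (sz t) + 2) ^ k + 1) s (s(0 := code (F (G t)) @ r))"
      if "t \<in> D" "s 0 = code t @ r" "s 3 = []" "s 4 = []" for t s r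
    proof (rule srun_Seq[OF G(4)[OF that]])
      show "srun cF (hF (sz (G t))) (s(0 := code (G t) @ r)) (s(0 := code (F (G t)) @ r))"
        using F(4)[of "G t" "s(0 := code (G t) @ r)" r] assms(3)[of t] that by simp
    qed (use b[of t] that in simp)
  qed (use F G in auto)
qed

lemma fp_Nd:
  assumes "fp D F" "fp D G"
  shows "fp D (\<lambda>t. Nd (F t) (G t))"
proof -
  obtain cF hF where "implements cF hF D F" using assms(1) unfolding fp_def by blast
  note F = implementsD[OF this]
  obtain cG hG where "implements cG hG D G" using assms(2) unfolding fp_def by blast
  note G = implementsD[OF this]
  let ?c = "Seq (takec 0 [0, 1]) (Seq cG (Seq (takec 1 [0]) (Seq cF (pushc 0 True))))"
  show ?thesis
  proof (rule fpI[of ?c "\<lambda>n. hF n + hG n + 1" "\<lambda>n. 88 * n + hF n + hG n + 7"])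
    show "sz (Nd (F t) (G t)) \<le> hF (sz t) + hG (sz t) + 1" if "t \<in> D" for t
      using F(3)[of t] G(3)[of t] that by simp
    fix t s r
    assume t: "t \<in> D" and s: "s 0 = code t @ r" "s 3 = []" "s (4 :: nat) = []"
    define s1 where "s1 = s(Suc 0 := code t @ s (Suc 0))"
    define s2 where "s2 = s(Suc 0 := code t @ s (Suc 0), 0 := code (G t) @ r)"
    define s3 where "s3 = s(0 := code t @ code (G t) @ r)"
    define s4 where "s4 = s(0 := code (F t) @ code (G t) @ r)"
    have 1: "srun (takec 0 [0, 1]) (44 * sz t) s s1"
      by (rule srun_dup) (use s in \<open>simp_all add: s1_def\<close>)
    have 2: "srun cG (hG (sz t)) s1 s2"
      using G(4)[of t s1 r] s t by (simp add: s1_def s2_def)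
    have 3: "srun (takec 1 [0]) (44 * sz t) s2 s3"
      by (rule srun_mv[where r = "s (Suc 0)"]) (use s in \<open>auto simp: s2_def s3_def fun_eq_iff\<close>)
    have 4: "srun cF (hF (sz t)) s3 s4"
      using F(4)[of t s3 "code (G t) @ r"] s t by (simp add: s3_def s4_def)
    have 5: "srun (pushc 0 True) 3 s4 (s(0 := code (Nd (F t) (G t)) @ r))"
      by (rule srun_pushc) (simp_all add: s4_def)
    show "srun ?c (88 * sz t + hF (sz t) + hG (sz t) + 7) s (s(0 := code (Nd (F t) (G t)) @ r))"
      by (rule srun_Seq[OF 1 srun_Seq[OF 2 srun_Seq[OF 3 srun_Seq[OF 4 5 order_refl] order_refl]
            order_refl]]) simp
  qed (use F G in auto)
qed

text \<open>Projections; their value at a leaf is a leaf.\<close>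

primrec tfst :: "tree \<Rightarrow> tree" where
  "tfst Lf = Lf"
| "tfst (Nd a b) = a"

primrec tsnd :: "tree \<Rightarrow> tree" where
  "tsnd Lf = Lf"
| "tsnd (Nd a b) = b"

lemma srun_test_Nd:
  assumes "s 0 = code t @ r" "srun (if t = Lf then cF else cT) n s s'" "n + 1 \<le> k"
  shows "srun (Branch 2 {2} cT cF) k s s'"
proof -
  have "scanned (stk (s 0)) \<in> {2} \<longleftrightarrow> t \<noteq> Lf" using assms(1) by (cases t) (auto simp: scanned_stk)
  then have "srun (Branch (Suc (Suc 0)) {2} cT cF) k s s'"
    using assms by (intro srun_Branch[OF _ _ assms(3)]) auto
  then show ?thesis by (simp add: numeral_2_eq_2)
qed

lemma fp_tfst: "fp D tfst"
proof (rule fpI[of "Branch 2 {2} (Seq (popc 0) (Seq (takec 0 [1]) (Seq (takec 0 []) (takec 1 [0])))) skip"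
      "\<lambda>n. n + 1" "\<lambda>n. 132 * n + 10"])
  show "sz (tfst t) \<le> sz t + 1" for t by (cases t) auto
  fix t s r
  assume s: "s 0 = code t @ r" "s 3 = []" "s (4 :: nat) = []"
  let ?c = "Seq (popc 0) (Seq (takec 0 [1]) (Seq (takec 0 []) (takec 1 [0])))"
  show "srun (Branch 2 {2} ?c skip) (132 * sz t + 10) s (s(0 := code (tfst t) @ r))"
  proof (cases t)
    case Lf
    then have "s(0 := code (tfst t) @ r) = s" using s by (simp add: fun_eq_iff)
    then show ?thesis using Lf srun_skip[of s] s by (intro srun_test_Nd[of s t r _ _ 1]) auto
  next
    case (Nd a b)
    define s1 where "s1 = s(0 := code a @ code b @ r)"
    define s2 where "s2 = s(0 := code b @ r, Suc 0 := code a @ s (Suc 0))"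
    define s3 where "s3 = s(0 := r, Suc 0 := code a @ s (Suc 0))"
    have 1: "srun (popc 0) 1 s s1"
      by (rule srun_popc) (use s Nd in \<open>auto simp: s1_def\<close>)
    have 2: "srun (takec 0 [1]) (44 * sz a) s1 s2"
      by (rule srun_mv[where r = "code b @ r"]) (use s in \<open>auto simp: s1_def s2_def fun_eq_iff\<close>)
    have 3: "srun (takec 0 []) (44 * sz b) s2 s3"
      by (rule srun_drop[where r = r]) (use s in \<open>auto simp: s3_def s2_def fun_eq_iff\<close>)
    have 4: "srun (takec 1 [0]) (44 * sz a) s3 (s(0 := code (tfst t) @ r))"
      by (rule srun_mv[where r = "s (Suc 0)"]) (use s Nd in \<open>auto simp: s3_def fun_eq_iff\<close>)
    have "srun ?c (44 * sz a + 44 * sz b + 44 * sz a + 4) s (s(0 := code (tfst t) @ r))"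
      by (rule srun_Seq[OF 1 srun_Seq[OF 2 srun_Seq[OF 3 4 order_refl] order_refl]]) simp
    then show ?thesis using Nd s by (intro srun_test_Nd[of s t r, where n = "44 * sz a + 44 * sz b + 44 * sz a + 4"]) auto
  qed
qed auto

lemma fp_tsnd: "fp D tsnd"
proof (rule fpI[of "Branch 2 {2} (Seq (popc 0) (takec 0 [])) skip" "\<lambda>n. n + 1" "\<lambda>n. 132 * n + 10"])
  show "sz (tsnd t) \<le> sz t + 1" for t by (cases t) auto
  fix t s r
  assume s: "s 0 = code t @ r" "s 3 = []" "s (4 :: nat) = []"
  let ?c = "Seq (popc 0) (takec 0 [])"
  show "srun (Branch 2 {2} ?c skip) (132 * sz t + 10) s (s(0 := code (tsnd t) @ r))"
  proof (cases t)
    case Lf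
    then have "s(0 := code (tsnd t) @ r) = s" using s by (simp add: fun_eq_iff)
    then show ?thesis using Lf srun_skip[of s] s by (intro srun_test_Nd[of s t r _ _ 1]) auto
  next
    case (Nd a b)
    define s1 where "s1 = s(0 := code a @ code b @ r)"
    have 1: "srun (popc 0) 1 s s1"
      by (rule srun_popc) (use s Nd in \<open>auto simp: s1_def\<close>)
    have 2: "srun (takec 0 []) (44 * sz a) s1 (s(0 := code (tsnd t) @ r))"
      by (rule srun_drop[where r = "code b @ r"]) (use s Nd in \<open>auto simp: s1_def fun_eq_iff\<close>)
    have "srun ?c (44 * sz a + 2) s (s(0 := code (tsnd t) @ r))"
      by (rule srun_Seq[OF 1 2]) simp
    then show ?thesis using Nd s by (intro srun_test_Nd[of s t r, where n = "44 * sz a + 2"]) auto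
  qed
qed auto

primrec pushall :: "bool list \<Rightarrow> com" where
  "pushall [] = skip"
| "pushall (b # bs) = Seq (pushall bs) (pushc 0 b)"

lemma okc_pushall: "okc (pushall w)"
  by (induction w) auto

lemma srun_pushall: "s' = s(0 := w @ s 0) \<Longrightarrow> srun (pushall w) (4 * length w + 1) s s'"
proof (induction w arbitrary: s')
  case Nil
  then show ?case using srun_skip[of s] by simp
next
  case (Cons b w)
  have 1: "srun (pushc 0 b) 3 (s(0 := w @ s 0)) s'" by (rule srun_pushc) (use Cons in auto)
  show ?case by (simp, rule srun_Seq[OF Cons.IH[OF refl] 1]) simp
qed

lemma fp_const: "fp D (\<lambda>t. u)"
proof (rule fpI[of "Seq (takec 0 []) (pushall (code u))" "\<lambda>n. sz u" "\<lambda>n. 44 * n + 4 * sz u + 2"])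
  fix t s r
  assume s: "s 0 = code t @ r" "s 3 = []" "s (4 :: nat) = []"
  have 1: "srun (takec 0 []) (44 * sz t) s (s(0 := r))"
    by (rule srun_drop) (use s in auto)
  have 2: "srun (pushall (code u)) (4 * sz u + 1) (s(0 := r)) (s(0 := code u @ r))"
    by (rule srun_pushall) simp
  show "srun (Seq (takec 0 []) (pushall (code u))) (44 * sz t + 4 * sz u + 2) s (s(0 := code u @ r))"
    by (rule srun_Seq[OF 1 2]) simp
qed (auto simp: okc_pushall)

lemma fp_if:
  assumes "fp D P" "fp D F" "fp D G"
  shows "fp D (\<lambda>t. if P t = Lf then G t else F t)"
proof -
  obtain cP hP where "implements cP hP D P" using assms(1) unfolding fp_def by blast
  note P = implementsD[OF this]
  obtain cF hF where "implements cF hF D F" using assms(2) unfolding fp_def by blast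
  note F = implementsD[OF this]
  obtain cG hG where "implements cG hG D G" using assms(3) unfolding fp_def by blast
  note G = implementsD[OF this]
  let ?b = "\<lambda>c. Seq (takec 0 []) (Seq (takec 1 [0]) c)"
  let ?c = "Seq (takec 0 [0, 1]) (Seq cP (Branch 2 {2} (?b cF) (?b cG)))"
  show ?thesis
  proof (rule fpI[of ?c "\<lambda>n. hF n + hG n" "\<lambda>n. 88 * n + 45 * hP n + hF n + hG n + 10"])
    show "sz (if P t = Lf then G t else F t) \<le> hF (sz t) + hG (sz t)" if "t \<in> D" for t
      using F(3)[of t] G(3)[of t] that by simp
    fix t s r
    assume t: "t \<in> D" and s: "s 0 = code t @ r" "s 3 = []" "s (4 :: nat) = []"
    define s1 where "s1 = s(Suc 0 := code t @ s (Suc 0))"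
    define s2 where "s2 = s(Suc 0 := code t @ s (Suc 0), 0 := code (P t) @ r)"
    define s3 where "s3 = s(Suc 0 := code t @ s (Suc 0), 0 := r)"
    define s4 where "s4 = s(0 := code (if P t = Lf then G t else F t) @ r)"
    have 1: "srun (takec 0 [0, 1]) (44 * sz t) s s1"
      by (rule srun_dup) (use s in \<open>simp_all add: s1_def\<close>)
    have 2: "srun cP (hP (sz t)) s1 s2"
      using P(4)[of t s1 r] s t by (simp add: s1_def s2_def)
    have 3: "srun (takec 0 []) (44 * sz (P t)) s2 s3"
      by (rule srun_drop[where r = r]) (use s in \<open>auto simp: s2_def s3_def fun_eq_iff\<close>)
    have "s(0 := code t @ r) = s" using s by auto
    then have 4: "srun (takec 1 [0]) (44 * sz t) s3 s"
      by (intro srun_mv[where r = "s (Suc 0)"]) (use s in \<open>auto simp: s3_def fun_eq_iff\<close>)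
    have 5: "srun (if P t = Lf then cG else cF) (hF (sz t) + hG (sz t)) s s4"
      using srun_mono[OF F(4)[OF t s], of "hF (sz t) + hG (sz t)"]
        srun_mono[OF G(4)[OF t s], of "hF (sz t) + hG (sz t)"] by (simp add: s4_def)
    have "srun (?b (if P t = Lf then cG else cF))
        (44 * sz (P t) + 44 * sz t + hF (sz t) + hG (sz t) + 2) s2 s4"
      by (rule srun_Seq[OF 3 srun_Seq[OF 4 5 order_refl]]) simp
    then have "srun (if P t = Lf then ?b cG else ?b cF)
        (44 * sz (P t) + 44 * sz t + hF (sz t) + hG (sz t) + 2) s2 s4"
      by (cases "P t = Lf") simp_all
    then have "srun (Branch 2 {2} (?b cF) (?b cG))
        (44 * sz (P t) + 44 * sz t + hF (sz t) + hG (sz t) + 3) s2 s4"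
      by (rule srun_test_Nd[rotated]) (auto simp: s2_def)
    then have 6: "srun (Branch 2 {2} (?b cF) (?b cG))
        (44 * hP (sz t) + 44 * sz t + hF (sz t) + hG (sz t) + 3) s2 s4"
      by (rule srun_mono) (use P(3)[of t] t in simp)
    show "srun ?c (88 * sz t + 45 * hP (sz t) + hF (sz t) + hG (sz t) + 10) s s4"
      by (rule srun_Seq[OF 1 srun_Seq[OF 2 6 order_refl]]) simp
  qed (use P F G in auto)
qed

text \<open>Folding over a list, with a parameter \<open>u\<close> that is passed on.\<close>

fun tfold :: "(tree \<Rightarrow> tree) \<Rightarrow> tree \<Rightarrow> tree \<Rightarrow> tree \<Rightarrow> tree" where
  "tfold F u acc Lf = acc"
| "tfold F u acc (Nd x l) = tfold F u (F (Nd (Nd u acc) x)) l"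

text \<open>The intermediate values of a fold.\<close>

fun taccs :: "(tree \<Rightarrow> tree) \<Rightarrow> tree \<Rightarrow> tree \<Rightarrow> tree \<Rightarrow> tree set" where
  "taccs F u acc Lf = {acc}"
| "taccs F u acc (Nd x l) = insert acc (taccs F u (F (Nd (Nd u acc) x)) l)"

text \<open>The arguments to which the function is applied in a fold.\<close>

fun targs :: "(tree \<Rightarrow> tree) \<Rightarrow> tree \<Rightarrow> tree \<Rightarrow> tree \<Rightarrow> tree set" where
  "targs F u acc Lf = {}"
| "targs F u acc (Nd x l) = insert (Nd (Nd u acc) x) (targs F u (F (Nd (Nd u acc) x)) l)"

lemma taccs_self: "acc \<in> taccs F u acc l"
  by (cases l) auto

lemma tfold_taccs: "tfold F u acc l \<in> taccs F u acc l"
  by (induction F u acc l rule: tfold.induct) auto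

text \<open>
  The parameter and the accumulator are copied for every call of the program \<open>c\<close> of the function
  that is folded.
\<close>

definition foldc :: "com \<Rightarrow> com" where
  "foldc c = Loop 2 {2} (Seq (popc 0) (Seq (takec 1 [0]) (Seq (takec 1 [0, 1])
     (Seq (pushc 0 True) (Seq (pushc 0 True) (Seq c (takec 0 [1])))))))"

lemma srun_foldc:
  assumes c: "\<And>t s r. t \<in> E \<Longrightarrow> s 0 = code t @ r \<Longrightarrow> s 3 = [] \<Longrightarrow> s 4 = [] \<Longrightarrow>
       srun c (h (sz t)) s (s(0 := code (F t) @ r))"
    and h: "\<And>n. h n \<le> (n + 2) ^ k" and N: "sz u \<le> N"
    and s34: "s 3 = []" "s 4 = []"
  shows "sz l \<le> N \<Longrightarrow> targs F u acc l \<subseteq> E \<Longrightarrow> \<forall>a\<in>taccs F u acc l. sz a \<le> N \<Longrightarrow>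
    srun (foldc c) (sz l * (150 * N + (3 * N + 4) ^ k + 20))
      (s(0 := code l @ r, 1 := code acc @ code u @ w))
      (s(0 := False # r, 1 := code (tfold F u acc l) @ code u @ w))"
proof (induction l arbitrary: acc)
  case Lf
  have "srun (foldc c) 1 (s(0 := code Lf @ r, 1 := code acc @ code u @ w))
      (s(0 := code Lf @ r, 1 := code acc @ code u @ w))"
    unfolding foldc_def numeral_2_eq_2 by (rule srun_Loop_exit) (auto simp: scanned_stk)
  then have "srun (foldc c) 1 (s(0 := code Lf @ r, 1 := code acc @ code u @ w))
      (s(0 := False # r, 1 := code (tfold F u acc Lf) @ code u @ w))" by simp
  then show ?case by (rule srun_mono) simp
next
  case (Nd x l)
  let ?acc = "F (Nd (Nd u acc) x)" and ?T = "150 * N + (3 * N + 4) ^ k + 20"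
  define s0 where "s0 = s(0 := code (Nd x l) @ r, 1 := code acc @ code u @ w)"
  define s1 where "s1 = s(0 := code x @ code l @ r, 1 := code acc @ code u @ w)"
  define s2 where "s2 = s(0 := code acc @ code x @ code l @ r, 1 := code u @ w)"
  define s3 where "s3 = s(0 := code u @ code acc @ code x @ code l @ r, 1 := code u @ w)"
  define s4 where "s4 = s(0 := True # code u @ code acc @ code x @ code l @ r, 1 := code u @ w)"
  define s5 where "s5 = s(0 := code (Nd (Nd u acc) x) @ code l @ r, 1 := code u @ w)"
  define s6 where "s6 = s(0 := code ?acc @ code l @ r, 1 := code u @ w)"
  define s7 where "s7 = s(0 := code l @ r, 1 := code ?acc @ code u @ w)"
  have 1: "srun (popc 0) 1 s0 s1"
    by (rule srun_popc) (auto simp: s0_def s1_def fun_eq_iff)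
  have 2: "srun (takec 1 [0]) (44 * sz acc) s1 s2"
    by (rule srun_mv[where r = "code u @ w"]) (use s34 in \<open>auto simp: s1_def s2_def fun_eq_iff\<close>)
  have 3: "srun (takec 1 [0, 1]) (44 * sz u) s2 s3"
    by (rule srun_takec[where r = w]) (use s34 in \<open>auto simp: s2_def s3_def addp_def fun_eq_iff\<close>)
  have 4: "srun (pushc 0 True) 3 s3 s4"
    by (rule srun_pushc) (auto simp: s3_def s4_def fun_eq_iff)
  have 5: "srun (pushc 0 True) 3 s4 s5"
    by (rule srun_pushc) (auto simp: s4_def s5_def fun_eq_iff)
  have "srun c (h (sz (Nd (Nd u acc) x))) s5 (s5(0 := code ?acc @ code l @ r))"
    by (rule c) (use s34 Nd.prems(2) in \<open>auto simp: s5_def\<close>)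
  moreover have "s5(0 := code ?acc @ code l @ r) = s6"
    by (auto simp: s5_def s6_def fun_eq_iff)
  ultimately have 6: "srun c (h (sz (Nd (Nd u acc) x))) s5 s6" by simp
  have 7: "srun (takec 0 [1]) (44 * sz ?acc) s6 s7"
    by (rule srun_mv[where r = "code l @ r"]) (use s34 in \<open>auto simp: s6_def s7_def fun_eq_iff\<close>)
  have ih: "srun (foldc c) (sz l * ?T) s7
      (s(0 := False # r, 1 := code (tfold F u ?acc l) @ code u @ w))"
    unfolding s7_def by (rule Nd.IH(2)) (use Nd.prems in auto)
  have a: "sz acc \<le> N" "sz ?acc \<le> N" "sz x \<le> N"
    using Nd.prems taccs_self[of ?acc F u l] by auto
  have "h (sz (Nd (Nd u acc) x)) \<le> (sz (Nd (Nd u acc) x) + 2) ^ k" by (rule h)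
  also have "\<dots> \<le> (3 * N + 4) ^ k" using a N by (intro power_mono) auto
  finally have b: "h (sz (Nd (Nd u acc) x)) \<le> (3 * N + 4) ^ k" .
  have "srun (foldc c) (sz (Nd x l) * ?T) s0
      (s(0 := False # r, 1 := code (tfold F u ?acc l) @ code u @ w))"
    unfolding foldc_def numeral_2_eq_2
  proof (rule srun_Loop_step)
    show "srun (Loop (Suc (Suc 0)) {Suc (Suc 0)} (Seq (popc 0) (Seq (takec 1 [0]) (Seq (takec 1 [0, 1])
        (Seq (pushc 0 True) (Seq (pushc 0 True) (Seq c (takec 0 [1])))))))) (sz l * ?T) s7
      (s(0 := False # r, 1 := code (tfold F u ?acc l) @ code u @ w))"
      using ih unfolding foldc_def numeral_2_eq_2 .
    show "srun (Seq (popc 0) (Seq (takec 1 [0]) (Seq (takec 1 [0, 1])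
        (Seq (pushc 0 True) (Seq (pushc 0 True) (Seq c (takec 0 [1]))))))) (?T - 1) s0 s7"
      by (rule srun_Seq[OF 1 srun_Seq[OF 2 srun_Seq[OF 3 srun_Seq[OF 4 srun_Seq[OF 5 srun_Seq[OF 6 7
        order_refl] order_refl] order_refl] order_refl] order_refl]]) (use a N b in simp)
    show "scanned (stk (s0 0)) \<in> {Suc (Suc 0)}" by (simp add: s0_def scanned_stk)
    have "?T + sz l * ?T \<le> (sz x + (sz l + 1)) * ?T" by (simp add: algebra_simps)
    then show "?T - 1 + sz l * ?T + 1 \<le> sz (Nd x l) * ?T" by simp
  qed simp
  then show ?case unfolding s0_def tfold.simps .
qed

lemma fp_tfold:
  assumes F: "fp E F" and U: "fp D U" and A: "fp D A" and L: "fp D L"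
    and E: "\<And>t. t \<in> D \<Longrightarrow> targs F (U t) (A t) (L t) \<subseteq> E"
    and b: "pb b" "\<And>t a. t \<in> D \<Longrightarrow> a \<in> taccs F (U t) (A t) (L t) \<Longrightarrow> sz a \<le> b (sz t)"
  shows "fp D (\<lambda>t. tfold F (U t) (A t) (L t))"
proof -
  obtain c h where "implements c h E F" using F unfolding fp_def by blast
  note c = implementsD[OF this]
  obtain k where k: "\<And>n. h n \<le> (n + 2) ^ k" using c(2) unfolding pb_def by blast
  have "fp D (\<lambda>t. Nd (U t) (Nd (A t) (L t)))" by (intro fp_Nd U A L)
  then obtain cW hW where "implements cW hW D (\<lambda>t. Nd (U t) (Nd (A t) (L t)))" unfolding fp_def by blast
  note W = implementsD[OF this]
  let ?c = "Seq cW (Seq (popc 0) (Seq (takec 0 [1]) (Seq (popc 0) (Seq (takec 0 [1])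
     (Seq (foldc c) (Seq (popc 0) (Seq (takec 1 [0]) (takec 1 []))))))))"
  let ?N = "\<lambda>n. hW n + b n"
  let ?T = "\<lambda>n. hW n * (150 * ?N n + (3 * ?N n + 4) ^ k + 20)"
  show ?thesis
  proof (rule fpI[of ?c b "\<lambda>n. hW n + 200 * ?N n + ?T n + 20"])
    show "okc ?c" using c W by (simp add: foldc_def)
    show "pb b" by fact
    show "pb (\<lambda>n. hW n + 200 * ?N n + ?T n + 20)" using W b by (intro pb_add pb_mult pb_power) auto
    show "sz (tfold F (U t) (A t) (L t)) \<le> b (sz t)" if "t \<in> D" for t
      using b(2)[OF that tfold_taccs] .
    fix t s r
    assume t: "t \<in> D" and s: "s 0 = code t @ r" "s 3 = []" "s (4 :: nat) = []"
    let ?w = "s 1" and ?n = "sz t"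
    define s1 where "s1 = s(0 := code (Nd (U t) (Nd (A t) (L t))) @ r)"
    define s2 where "s2 = s(0 := code (U t) @ code (Nd (A t) (L t)) @ r)"
    define s3 where "s3 = s(0 := code (Nd (A t) (L t)) @ r, 1 := code (U t) @ ?w)"
    define s4 where "s4 = s(0 := code (A t) @ code (L t) @ r, 1 := code (U t) @ ?w)"
    define s5 where "s5 = s(0 := code (L t) @ r, 1 := code (A t) @ code (U t) @ ?w)"
    define s6 where "s6 = s(0 := False # r, 1 := code (tfold F (U t) (A t) (L t)) @ code (U t) @ ?w)"
    define s7 where "s7 = s(0 := r, 1 := code (tfold F (U t) (A t) (L t)) @ code (U t) @ ?w)"
    define s8 where "s8 = s(0 := code (tfold F (U t) (A t) (L t)) @ r, 1 := code (U t) @ ?w)"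
    have sizes: "sz (U t) \<le> hW ?n" "sz (A t) \<le> hW ?n" "sz (L t) \<le> hW ?n"
      "sz (tfold F (U t) (A t) (L t)) \<le> b ?n"
      using W(3)[OF t] b(2)[OF t tfold_taccs] by auto
    have 1: "srun cW (hW ?n) s s1" unfolding s1_def by (rule W(4)) (use s t in auto)
    have 2: "srun (popc 0) 1 s1 s2" by (rule srun_popc) (auto simp: s1_def s2_def)
    have 3: "srun (takec 0 [1]) (44 * sz (U t)) s2 s3"
      by (rule srun_mv[where r = "code (Nd (A t) (L t)) @ r"])
        (use s in \<open>auto simp: s3_def s2_def fun_eq_iff\<close>)
    have 4: "srun (popc 0) 1 s3 s4" by (rule srun_popc) (auto simp: s3_def s4_def fun_eq_iff)
    have 5: "srun (takec 0 [1]) (44 * sz (A t)) s4 s5"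
      by (rule srun_mv[where r = "code (L t) @ r"])
        (use s in \<open>auto simp: s4_def s5_def fun_eq_iff\<close>)
    have "srun (foldc c) (sz (L t) * (150 * ?N ?n + (3 * ?N ?n + 4) ^ k + 20)) s5 s6"
      unfolding s5_def s6_def
    proof (rule srun_foldc[OF c(4) k])
      show "\<forall>a\<in>taccs F (U t) (A t) (L t). sz a \<le> ?N ?n" using b(2)[OF t] by fastforce
      show "targs F (U t) (A t) (L t) \<subseteq> E" by (rule E[OF t])
    qed (use s sizes in auto)
    then have "srun (foldc c) (?T ?n) s5 s6"
      by (rule srun_mono) (use sizes in \<open>intro mult_right_mono; simp\<close>)
    moreover define X where "X = ?T ?n"
    ultimately have 6: "srun (foldc c) X s5 s6" by simp
    have 7: "srun (popc 0) 1 s6 s7" by (rule srun_popc) (auto simp: s6_def s7_def fun_eq_iff)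
    have 8: "srun (takec 1 [0]) (44 * sz (tfold F (U t) (A t) (L t))) s7 s8"
      by (rule srun_mv[where r = "code (U t) @ ?w"])
        (use s in \<open>auto simp: s7_def s8_def fun_eq_iff\<close>)
    have 9: "srun (takec 1 []) (44 * sz (U t)) s8 (s(0 := code (tfold F (U t) (A t) (L t)) @ r))"
      by (rule srun_drop[where r = "?w"]) (use s in \<open>auto simp: s8_def fun_eq_iff\<close>)
    show "srun ?c (hW ?n + 200 * ?N ?n + ?T ?n + 20) s (s(0 := code (tfold F (U t) (A t) (L t)) @ r))"
      unfolding X_def[symmetric]
      by (rule srun_Seq[OF 1 srun_Seq[OF 2 srun_Seq[OF 3 srun_Seq[OF 4 srun_Seq[OF 5 srun_Seq[OF 6
        srun_Seq[OF 7 srun_Seq[OF 8 9 order_refl] order_refl] order_refl] order_refl] order_refl]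
        order_refl] order_refl]]) (use sizes in simp)
  qed
qed

section \<open>Words and trees\<close>

definition tlist :: "tree list \<Rightarrow> tree" where
  "tlist xs = foldr Nd xs Lf"

definition btree :: "bool \<Rightarrow> tree" where
  "btree b = (if b then Nd Lf Lf else Lf)"

definition blist :: "bool list \<Rightarrow> tree" where
  "blist bs = tlist (map btree bs)"

lemma tlist_simps [simp]: "tlist [] = Lf" "tlist (x # xs) = Nd x (tlist xs)"
  by (simp_all add: tlist_def)

lemma blist_simps [simp]: "blist [] = Lf" "blist (b # bs) = Nd (btree b) (blist bs)"
  by (simp_all add: blist_def)

lemma sz_blist: "length bs < sz (blist bs)" "sz (blist bs) \<le> 4 * length bs + 1"
  by (induction bs) (auto simp: btree_def)

text \<open>Turn the bits on stack 3 into a list on top of stack 0.\<close>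

definition loadc :: com where
  "loadc = loopb 3 (Seq (pushc 0 False) (pushc 0 True))
     (Seq (pushc 0 False) (Seq (pushc 0 False) (Seq (pushc 0 True) (pushc 0 True))))"

lemma okc_loadc [simp]: "okc loadc"
  by (simp add: loadc_def)

lemma srun_loadc:
  "s 3 = w \<Longrightarrow> s 0 = code (blist bs) @ r \<Longrightarrow> s' = s(3 := [], 0 := code (blist (rev w @ bs)) @ r) \<Longrightarrow>
     srun loadc (20 * length w + 1) s s'"
proof (induction w arbitrary: s bs)
  case Nil
  then have "s' = s" by (simp add: fun_eq_iff)
  then show ?case using srun_loopb_Nil[of 3 s] Nil by (simp add: loadc_def)
next
  case (Cons b w)
  define s1 where "s1 = s(3 := w, 0 := code (blist (b # bs)) @ r)"
  let ?F = "Seq (pushc 0 False) (pushc 0 True)"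
  let ?T = "Seq (pushc 0 False) (Seq (pushc 0 False) (Seq (pushc 0 True) (pushc 0 True)))"
  have p: "srun (pushc 0 c) 3 u (u(0 := c # u 0))" for c u by (rule srun_pushc) simp_all
  have 1: "srun (if b then ?T else ?F) 15 (s(3 := w)) s1"
  proof (cases b)
    case True
    have "srun ?T 15 (s(3 := w)) ((((s(3 := w))(0 := False # (s(3 := w)) 0))(0 := False # False # (s(3 := w)) 0))
        (0 := True # False # False # (s(3 := w)) 0, 0 := True # True # False # False # (s(3 := w)) 0))"
      by (intro srun_Seq[OF p srun_Seq[OF srun_pushc srun_Seq[OF srun_pushc srun_pushc order_refl] order_refl]])
        auto
    then show ?thesis using True Cons.prems by (simp add: s1_def btree_def)
  next
    case False
    have "srun ?F 7 (s(3 := w)) (((s(3 := w))(0 := False # (s(3 := w)) 0))(0 := True # False # (s(3 := w)) 0))"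
      by (intro srun_Seq[OF p srun_pushc]) auto
    then have "srun ?F 15 (s(3 := w)) (((s(3 := w))(0 := False # (s(3 := w)) 0))(0 := True # False # (s(3 := w)) 0))"
      by (rule srun_mono) simp
    then show ?thesis using False Cons.prems by (simp add: s1_def btree_def)
  qed
  have "srun loadc (20 * length w + 1) s1 s'"
    by (rule Cons.IH[of _ "b # bs"]) (use Cons.prems in \<open>auto simp: s1_def fun_eq_iff\<close>)
  then have 2: "srun (loopb 3 ?F ?T) (20 * length w + 1) s1 s'" unfolding loadc_def .
  show ?case unfolding loadc_def
    by (rule srun_loopb_Cons[OF _ Cons.prems(1) 1 2]) simp_all
qed

text \<open>The code of a tree, as a list.\<close>

lemma fp_flatten: "fp D (\<lambda>t. blist (code t))"
proof (rule fpI[of "Seq (Seq (pushc 4 True) (loopb 4 (pump 0) (pump 0))) (Seq (pushc 0 False) loadc)"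
      "\<lambda>n. 4 * n + 1" "\<lambda>n. 40 * n + 20"])
  show "sz (blist (code t)) \<le> 4 * sz t + 1" for t by (rule sz_blist)
  fix t s r
  assume s: "s 0 = code t @ r" "s 3 = []" "s (4 :: nat) = []"
  define s2 where "s2 = s(0 := r, 3 := rev (code t), 4 := [])"
  define s3 where "s3 = s(0 := code (blist []) @ r, 3 := rev (code t))"
  have 1: "srun (pushc 4 True) 3 s (s(4 := [True]))"
    by (rule srun_pushc) (use s in auto)
  have "srun (loopb 4 (pump 0) (pump 0)) 1 s2 s2"
    by (rule srun_loopb_Nil) (simp_all add: s2_def)
  then have "srun (loopb 4 (pump 0) (pump 0)) (1 + 20 * sz t) (s(0 := code t @ r, 3 := [], 4 := [True])) s2"
    by (intro srun_pump_loop) (simp_all add: s2_def)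
  moreover have "s(0 := code t @ r, 3 := [], 4 := [True]) = s(4 := [True])" using s by auto
  ultimately have "srun (loopb 4 (pump 0) (pump 0)) (1 + 20 * sz t) (s(4 := [True])) s2" by simp
  then have 2: "srun (Seq (pushc 4 True) (loopb 4 (pump 0) (pump 0))) (5 + 20 * sz t) s s2"
    by (rule srun_Seq[OF 1]) simp
  have 3: "srun (pushc 0 False) 3 s2 s3"
    by (rule srun_pushc) (use s in \<open>auto simp: s2_def s3_def fun_eq_iff\<close>)
  have 4: "srun loadc (20 * sz t + 1) s3 (s(0 := code (blist (code t)) @ r))"
    using srun_loadc[of s3 "rev (code t)" "[]" r] s by (simp add: s3_def fun_upd_twist)
      (metis fun_upd_triv fun_upd_twist)
  show "srun (Seq (Seq (pushc 4 True) (loopb 4 (pump 0) (pump 0))) (Seq (pushc 0 False) loadc))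
      (40 * sz t + 20) s (s(0 := code (blist (code t)) @ r))"
    by (rule srun_Seq[OF 2 srun_Seq[OF 3 4 order_refl]]) simp
qed (auto simp: pump_def intro!: pb_add pb_mult)

section \<open>Input, output and the oracle\<close>

text \<open>
  Between transfers, a distinguished tape carries the marker 3 exactly in cell 0, which allows the
  head to find back.
\<close>

definition marked :: "tape \<Rightarrow> bool" where
  "marked t \<longleftrightarrow> fst t 0 = 3 \<and> (\<forall>i>0. fst t i \<noteq> 3)"

abbreviation bsym :: "bool \<Rightarrow> nat" where
  "bsym b \<equiv> (if b then 2 else 1)"

abbreviation absorb_loop :: "nat \<Rightarrow> com" where
  "absorb_loop j \<equiv> Loop j (- {0}) (Seq (Branch j {2} (pushc 3 True) (pushc 3 False)) (Act j None Go_Right))"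

abbreviation emit_loop :: "nat \<Rightarrow> com" where
  "emit_loop j \<equiv> Loop 2 {2} (Seq (popc 0) (caseb 0 (Act j (Some 1) Go_Right)
     (Seq (popc 0) (Seq (popc 0) (Act j (Some 2) Go_Right)))))"

text \<open>
  Read the word on tape \<open>j\<close>, leave the marker there, and push the word on stack 0 as a list; the
  converse writes the list on stack 0 to tape \<open>j\<close>.
\<close>

definition absorb :: "nat \<Rightarrow> com" where
  "absorb j = Seq (Branch j {2} (pushc 3 True) (Branch j {1} (pushc 3 False) skip))
     (Seq (Act j (Some 3) Go_Right)
     (Seq (absorb_loop j)
     (Seq (pushc 0 False) loadc)))"

definition emit :: "nat \<Rightarrow> com" where
  "emit j = Seq (Loop j (- {3}) (Act j None Go_Left))
     (Seq (emit_loop j)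
     (Seq (popc 0) (Act j (Some 0) Stay)))"

lemma okc_absorb_emit [simp]: "j < 7 \<Longrightarrow> okc (absorb j)" "j < 7 \<Longrightarrow> okc (emit j)"
  by (auto simp: absorb_def emit_def)

lemma srunD: "srun c n s s' \<Longrightarrow> runs g c n (tps t s) (tps t s')"
  by (simp add: srun_def)

lemma runs_Act_tape:
  assumes "j < 2" "t' = t(j := update_tape (case w of None \<Rightarrow> scanned (t j) | Some a \<Rightarrow> a, d) (t j))"
  shows "runs g (Act j w d) 1 (tps t s) (tps t' s)"
  by (rule runs_Act) (use assms in \<open>simp add: tps_tape tps_tape_update cong: option.case_cong\<close>)

lemma runs_Branch_tape:
  assumes "j < 2" "runs g (if scanned (t j) \<in> P then a else b) n (tps t s) ts'" "n + 1 \<le> k"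
  shows "runs g (Branch j P a b) k (tps t s) ts'"
  by (rule runs_Branch[OF _ assms(3)]) (use assms in \<open>simp add: tps_tape\<close>)

lemma runs_absorb_loop:
  assumes j: "j < 2"
  shows "\<lbrakk>t j = (c, i); \<And>m. m < length ys \<Longrightarrow> c (i + m) = bsym (ys ! m); c (i + length ys) = 0;
     t' = t(j := (c, i + length ys)); s' = s(3 := rev ys @ s 3)\<rbrakk> \<Longrightarrow>
   runs g (absorb_loop j)
     (7 * length ys + 1) (tps t s) (tps t' s')"
proof (induction ys arbitrary: t i s)
  case Nil
  then have "t' = t" "s' = s" by (auto simp: fun_eq_iff)
  then show ?case using Nil j
    by (auto intro!: runs_Loop_exit[unfolded One_nat_def] simp: tps_tape scanned_def)
next
  case (Cons b ys)
  have sc: "scanned (t j) = bsym b" using Cons.prems(1) Cons.prems(2)[of 0] by (simp add: scanned_def)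
  define t1 where "t1 = t(j := (c, Suc i))"
  define s1 where "s1 = s(3 := b # s 3)"
  have "srun (pushc 3 b) 3 s s1" by (rule srun_pushc) (simp_all add: s1_def)
  then have 1: "runs g (Branch j {2} (pushc 3 True) (pushc 3 False)) 4 (tps t s) (tps t s1)"
    by (intro runs_Branch_tape[OF j, of g t _ _ _ 3]) (auto simp: sc dest: srunD)
  have 2: "runs g (Act j None Go_Right) 1 (tps t s1) (tps t1 s1)"
    by (rule runs_Act_tape[OF j]) (use Cons.prems(1) in \<open>simp add: t1_def update_tape_def scanned_def\<close>)
  have c: "c (Suc i + m) = bsym (ys ! m)" if "m < length ys" for m
    using Cons.prems(2)[of "Suc m"] that by simp
  have 3: "runs g (absorb_loop j)
     (7 * length ys + 1) (tps t1 s1) (tps t' s')"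
    by (rule Cons.IH[of t1 "Suc i"]) (use Cons.prems c in \<open>auto simp: t1_def s1_def\<close>)
  show ?case
    by (rule runs_Loop_step[OF _ runs_Seq[OF 1 2 order_refl] 3])
      (use sc j in \<open>auto simp: tps_tape\<close>)
qed

lemma runs_absorb:
  assumes j: "j < 2" and t: "t j = word_tape x" and s: "s 3 = []"
  shows "\<exists>u. marked u \<and> snd u = length x + (if x = [] then 1 else 0) \<and>
    runs g (absorb j) (30 * length x + 20) (tps t s)
      (tps (t(j := u)) (s(0 := code (blist x) @ s 0)))"
proof -
  define c where "c = (fst (word_tape x))(0 := 3)"
  define t1 where "t1 = t(j := (c, 1))"
  define s1 where "s1 = s(3 := rev (take 1 x))"
  define u where "u = (c, length x + (if x = [] then 1 else 0))"
  define t2 where "t2 = t(j := u)"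
  define s2 where "s2 = s(3 := rev x)"
  define s3 where "s3 = s(3 := rev x, 0 := code (blist []) @ s 0)"
  define s4 where "s4 = s(0 := code (blist x) @ s 0)"
  have 1: "runs g (Branch j {2} (pushc 3 True) (Branch j {1} (pushc 3 False) skip)) 6 (tps t s) (tps t s1)"
  proof (cases x)
    case Nil
    then have "scanned (t j) = 0" "s1 = s" using t s by (auto simp: word_tape_def scanned_def s1_def)
    then have "runs g (Branch j {2} (pushc 3 True) (Branch j {1} (pushc 3 False) skip)) 3 (tps t s) (tps t s1)"
      using runs_skip[of g t s]
      by (intro runs_Branch_tape[OF j, of g t _ _ _ 2]) (auto intro!: runs_Branch_tape[OF j, of g t _ _ _ 1])
    then show ?thesis by (rule runs_mono) simp
  next
    case (Cons b ys)
    have sc: "scanned (t j) = bsym b" using Cons t by (simp add: word_tape_def scanned_def)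
    have p: "runs g (pushc 3 b) 3 (tps t s) (tps t s1)"
      by (rule srunD, rule srun_pushc) (use Cons s in \<open>auto simp: s1_def\<close>)
    show ?thesis
    proof (cases b)
      case True
      then have "runs g (Branch j {2} (pushc 3 True) (Branch j {1} (pushc 3 False) skip)) 4 (tps t s) (tps t s1)"
        using p sc by (intro runs_Branch_tape[OF j, of g t _ _ _ 3]) auto
      then show ?thesis by (rule runs_mono) simp
    next
      case False
      then have "runs g (Branch j {1} (pushc 3 False) skip) 4 (tps t s) (tps t s1)"
        using p sc by (intro runs_Branch_tape[OF j, of g t _ _ _ 3]) auto
      then have "runs g (Branch j {2} (pushc 3 True) (Branch j {1} (pushc 3 False) skip)) 5 (tps t s) (tps t s1)"
        using False sc by (intro runs_Branch_tape[OF j, of g t _ _ _ 4]) auto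
      then show ?thesis by (rule runs_mono) simp
    qed
  qed
  have 2: "runs g (Act j (Some 3) Go_Right) 1 (tps t s1) (tps t1 s1)"
    by (rule runs_Act_tape[OF j]) (use t in \<open>simp add: t1_def c_def update_tape_def word_tape_def\<close>)
  have 3: "runs g (absorb_loop j)
      (7 * length (drop 1 x) + 1) (tps t1 s1) (tps t2 s2)"
  proof (rule runs_absorb_loop[OF j])
    show "t1 j = (c, 1)" by (simp add: t1_def)
    show "c (1 + m) = bsym (drop 1 x ! m)" if "m < length (drop 1 x)" for m
      using that by (auto simp: c_def word_tape_def)
    show "c (1 + length (drop 1 x)) = 0" by (auto simp: c_def word_tape_def)
    show "t2 = t1(j := (c, 1 + length (drop 1 x)))"
      by (cases x) (auto simp: t2_def t1_def u_def)
    show "s2 = s1(3 := rev (drop 1 x) @ s1 3)" by (cases x) (auto simp: s2_def s1_def)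
  qed
  have 4: "runs g (pushc 0 False) 3 (tps t2 s2) (tps t2 s3)"
    by (rule srunD, rule srun_pushc) (auto simp: s2_def s3_def)
  have 5: "runs g loadc (20 * length x + 1) (tps t2 s3) (tps t2 s4)"
  proof (rule srunD)
    have "s4 = s3(3 := [], 0 := code (blist (rev (rev x) @ [])) @ s 0)"
      using s by (auto simp: s4_def s3_def fun_eq_iff)
    then show "srun loadc (20 * length x + 1) s3 s4"
      using srun_loadc[of s3 "rev x" "[]" "s 0" s4] by (simp add: s3_def)
  qed
  have "runs g (absorb j) (30 * length x + 20) (tps t s) (tps t2 s4)"
    unfolding absorb_def
    by (rule runs_Seq[OF 1 runs_Seq[OF 2 runs_Seq[OF 3 runs_Seq[OF 4 5 order_refl] order_refl]
          order_refl]]) simp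
  moreover have "marked u" by (auto simp: marked_def u_def c_def word_tape_def)
  ultimately show ?thesis unfolding t2_def s4_def by (intro exI[of _ u]) (auto simp: u_def)
qed

lemma runs_emit_back:
  assumes j: "j < 2"
  shows "marked (t j) \<Longrightarrow> snd (t j) = h \<Longrightarrow>
    runs g (Loop j (- {3}) (Act j None Go_Left)) (2 * h + 1) (tps t s) (tps (t(j := (fst (t j), 0))) s)"
proof (induction h arbitrary: t)
  case 0
  then have "t(j := (fst (t j), 0)) = t" by (metis fun_upd_triv prod.collapse)
  then show ?case using 0 j
    by (auto intro!: runs_Loop_exit[unfolded One_nat_def] simp: tps_tape scanned_def marked_def)
next
  case (Suc h)
  define t1 where "t1 = t(j := (fst (t j), h))"
  have 1: "runs g (Act j None Go_Left) 1 (tps t s) (tps t1 s)"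
    by (rule runs_Act_tape[OF j]) (use Suc.prems in \<open>simp add: t1_def update_tape_def scanned_def\<close>)
  have 2: "runs g (Loop j (- {3}) (Act j None Go_Left)) (2 * h + 1) (tps t1 s)
      (tps (t1(j := (fst (t1 j), 0))) s)"
    by (rule Suc.IH) (use Suc.prems in \<open>auto simp: t1_def marked_def\<close>)
  have e: "t1(j := (fst (t1 j), 0)) = t(j := (fst (t j), 0))" by (simp add: t1_def)
  show ?case
    by (rule runs_Loop_step[OF _ 1 2[unfolded e]])
      (use Suc.prems j in \<open>auto simp: tps_tape scanned_def marked_def\<close>)
qed

text \<open>The effect of writing a word from cell \<open>i\<close> on.\<close>

definition put :: "bool list \<Rightarrow> nat \<Rightarrow> (nat \<Rightarrow> nat) \<Rightarrow> nat \<Rightarrow> nat" where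
  "put ys i c = (\<lambda>m. if i \<le> m \<and> m < i + length ys then bsym (ys ! (m - i)) else c m)"

lemma put_Cons: "put ys (Suc i) (c(i := bsym b)) = put (b # ys) i c"
  by (auto simp: put_def fun_eq_iff nth_Cons' Suc_diff_le not_less_eq_eq)

lemma runs_emit_loop:
  assumes j: "j < 2"
  shows "t j = (c, i) \<Longrightarrow> s 0 = code (blist ys) @ r \<Longrightarrow>
    runs g (emit_loop j)
      (15 * length ys + 1) (tps t s) (tps (t(j := (put ys i c, i + length ys))) (s(0 := False # r)))"
proof (induction ys arbitrary: t c i s)
  case Nil
  have "t(j := (put [] i c, i + length [])) = t" "s(0 := False # r) = s"
    using Nil by (auto simp: put_def fun_eq_iff)
  moreover have "runs g (Loop (Suc (Suc 0)) {2} d) 1 (tps t s) (tps t s)" for d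
    by (rule runs_Loop_exit) (use Nil in \<open>simp add: tps_stack scanned_stk\<close>)
  ultimately show ?case by (simp add: numeral_2_eq_2)
next
  case (Cons b ys)
  define t1 where "t1 = t(j := (c(i := bsym b), Suc i))"
  define s1 where "s1 = s(0 := code (btree b) @ code (blist ys) @ r)"
  define s2 where "s2 = s(0 := code (blist ys) @ r)"
  have 1: "runs g (popc 0) 1 (tps t s) (tps t s1)"
    by (rule srunD, rule srun_popc) (use Cons.prems in \<open>auto simp: s1_def\<close>)
  have act: "runs g (Act j (Some (bsym b)) Go_Right) 1 (tps t s') (tps t1 s')" for s'
    by (rule runs_Act_tape[OF j]) (use Cons.prems in \<open>auto simp: t1_def update_tape_def fun_eq_iff\<close>)
  have 2: "runs g (caseb 0 (Act j (Some 1) Go_Right) (Seq (popc 0) (Seq (popc 0) (Act j (Some 2) Go_Right)))) 8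
      (tps t s1) (tps t1 s2)"
    unfolding caseb_def
  proof (rule runs_Branch)
    show "runs g (if scanned (tps t s1 ! Suc (Suc 0)) \<in> {2}
       then Seq (popc 0) (Seq (popc 0) (Seq (popc 0) (Act j (Some 2) Go_Right)))
       else Seq (popc 0) (Act j (Some 1) Go_Right)) 7 (tps t s1) (tps t1 s2)"
    proof (cases b)
      case True
      define s3 where "s3 = s(0 := False # False # code (blist ys) @ r)"
      define s4 where "s4 = s(0 := False # code (blist ys) @ r)"
      have a: "runs g (popc 0) 1 (tps t s1) (tps t s3)"
        by (rule srunD, rule srun_popc) (use True in \<open>auto simp: s1_def s3_def btree_def\<close>)
      have b: "runs g (popc 0) 1 (tps t s3) (tps t s4)"
        by (rule srunD, rule srun_popc) (use True in \<open>auto simp: s4_def s3_def\<close>)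
      have c: "runs g (popc 0) 1 (tps t s4) (tps t s2)"
        by (rule srunD, rule srun_popc) (use True in \<open>auto simp: s4_def s2_def\<close>)
      have "runs g (Seq (popc 0) (Seq (popc 0) (Seq (popc 0) (Act j (Some (bsym b)) Go_Right)))) 7 (tps t s1) (tps t1 s2)"
        by (rule runs_Seq[OF a runs_Seq[OF b runs_Seq[OF c act order_refl] order_refl]]) simp
      then show ?thesis using True by (simp add: tps_stack s1_def btree_def scanned_stk)
    next
      case False
      have c: "runs g (popc 0) 1 (tps t s1) (tps t s2)"
        by (rule srunD, rule srun_popc) (use False in \<open>auto simp: s1_def s2_def btree_def\<close>)
      have "runs g (Seq (popc 0) (Act j (Some (bsym b)) Go_Right)) 7 (tps t s1) (tps t1 s2)"
        by (rule runs_Seq[OF c act]) simp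
      then show ?thesis using False by (simp add: tps_stack s1_def btree_def scanned_stk)
    qed
  qed simp
  have 3: "runs g (emit_loop j)
      (15 * length ys + 1) (tps t1 s2)
      (tps (t1(j := (put ys (Suc i) (c(i := bsym b)), Suc i + length ys))) (s2(0 := False # r)))"
    by (rule Cons.IH) (auto simp: t1_def s2_def fun_eq_iff)
  have e: "t1(j := (put ys (Suc i) (c(i := bsym b)), Suc i + length ys))
      = t(j := (put (b # ys) i c, i + length (b # ys)))" "s2(0 := False # r) = s(0 := False # r)"
    unfolding put_Cons by (simp_all add: t1_def s2_def)
  have "scanned (tps t s ! Suc (Suc 0)) = 2"
    using Cons.prems by (simp add: tps_stack scanned_stk)
  then show ?case
    by (intro runs_Loop_step[OF _ runs_Seq[OF 1 2 order_refl] 3[unfolded e]])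
      (auto simp: numeral_2_eq_2)
qed

lemma tape_word_put: "tape_word ((put y 0 c)(length y := 0), h) = y"
proof -
  have "(LEAST n. ((put y 0 c)(length y := 0)) n \<notin> {1, 2}) = length y"
  proof (rule Least_equality)
    show "length y \<le> n" if "((put y 0 c)(length y := 0)) n \<notin> {1, 2}" for n
      using that by (rule_tac ccontr) (auto simp: put_def split: if_splits)
  qed simp
  then show ?thesis by (intro nth_equalityI) (auto simp: tape_word_def put_def)
qed

lemma runs_emit:
  assumes j: "j < 2" and t: "marked (t j)" "snd (t j) \<le> h" and s: "s 0 = code (blist y) @ r"
  shows "\<exists>u. tape_word u = y \<and>
    runs g (emit j) (2 * h + 15 * length y + 10) (tps t s) (tps (t(j := u)) (s(0 := r)))"
proof -
  define t1 where "t1 = t(j := (fst (t j), 0))"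
  define c where "c = put y 0 (fst (t j))"
  define t2 where "t2 = t(j := (c, length y))"
  define u where "u = (c(length y := 0), length y)"
  have 1: "runs g (Loop j (- {3}) (Act j None Go_Left)) (2 * h + 1) (tps t s) (tps t1 s)"
    using runs_mono[OF runs_emit_back[where t = t and s = s and g = g, OF j t(1) refl], of "2 * h + 1"] t(2)
    by (simp add: t1_def)
  have 2: "runs g (emit_loop j)
      (15 * length y + 1) (tps t1 s) (tps t2 (s(0 := False # r)))"
    using runs_emit_loop[OF j, of t1 "fst (t j)" 0 s y r g] s by (simp add: t1_def t2_def c_def)
  have 3: "runs g (popc 0) 1 (tps t2 (s(0 := False # r))) (tps t2 (s(0 := r)))"
    by (rule srunD, rule srun_popc) auto
  have 4: "runs g (Act j (Some 0) Stay) 1 (tps t2 (s(0 := r))) (tps (t(j := u)) (s(0 := r)))"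
    by (rule runs_Act_tape[OF j]) (simp add: t2_def u_def update_tape_def)
  have "runs g (emit j) (2 * h + 15 * length y + 10) (tps t s) (tps (t(j := u)) (s(0 := r)))"
    unfolding emit_def
    by (rule runs_Seq[OF 1 runs_Seq[OF 2 runs_Seq[OF 3 4 order_refl] order_refl]]) simp
  moreover have "tape_word u = y" unfolding u_def c_def by (rule tape_word_put)
  ultimately show ?thesis by blast
qed

text \<open>
  The oracle tape and the stacks start out blank and receive their markers.
\<close>

definition initc :: com where
  "initc = Seq (Act 1 (Some 3) Stay) (Seq (Act 2 (Some 3) Stay) (Seq (Act 3 (Some 3) Stay)
     (Seq (Act 4 (Some 3) Stay) (Seq (Act 5 (Some 3) Stay) (Act 6 (Some 3) Stay)))))"

lemma mark_empty: "update_tape (3, Stay) (word_tape []) = stk []"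
  by (auto simp: update_tape_def word_tape_def stk_def fun_eq_iff)

lemma marked_stk_Nil: "marked (stk [])"
  by (simp add: marked_def stk_def)

lemma runs_initc:
  "runs g initc 11 (word_tape x # replicate 6 (word_tape []))
     (tps ((\<lambda>_. stk [])(0 := word_tape x)) (\<lambda>_. []))"
proof -
  let ?e = "word_tape []" and ?m = "stk []"
  have r: "word_tape x # replicate 6 ?e = [word_tape x, ?e, ?e, ?e, ?e, ?e, ?e]"
    by (simp add: numeral_eq_Suc)
  have e: "tps ((\<lambda>_. stk [])(0 := word_tape x)) (\<lambda>_. []) = [word_tape x, ?m, ?m, ?m, ?m, ?m, ?m]"
    by (simp add: tps_def upt_rec)
  have a: "ts ! j = ?e \<Longrightarrow> ts' = ts[j := ?m] \<Longrightarrow> runs g (Act j (Some 3) Stay) 1 ts ts'" for j ts ts'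
    by (rule runs_Act) (simp add: mark_empty)
  have 1: "runs g (Act 1 (Some 3) Stay) 1 [word_tape x, ?e, ?e, ?e, ?e, ?e, ?e] [word_tape x, ?m, ?e, ?e, ?e, ?e, ?e]"
    and 2: "runs g (Act 2 (Some 3) Stay) 1 [word_tape x, ?m, ?e, ?e, ?e, ?e, ?e] [word_tape x, ?m, ?m, ?e, ?e, ?e, ?e]"
    and 3: "runs g (Act 3 (Some 3) Stay) 1 [word_tape x, ?m, ?m, ?e, ?e, ?e, ?e] [word_tape x, ?m, ?m, ?m, ?e, ?e, ?e]"
    and 4: "runs g (Act 4 (Some 3) Stay) 1 [word_tape x, ?m, ?m, ?m, ?e, ?e, ?e] [word_tape x, ?m, ?m, ?m, ?m, ?e, ?e]"
    and 5: "runs g (Act 5 (Some 3) Stay) 1 [word_tape x, ?m, ?m, ?m, ?m, ?e, ?e] [word_tape x, ?m, ?m, ?m, ?m, ?m, ?e]"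
    and 6: "runs g (Act 6 (Some 3) Stay) 1 [word_tape x, ?m, ?m, ?m, ?m, ?m, ?e] [word_tape x, ?m, ?m, ?m, ?m, ?m, ?m]"
    by (rule a; simp)+
  show ?thesis
    unfolding initc_def r e
    by (rule runs_Seq[OF 1 runs_Seq[OF 2 runs_Seq[OF 3 runs_Seq[OF 4 runs_Seq[OF 5 6 order_refl]
      order_refl] order_refl] order_refl]]) simp
qed

lemma okc_initc [simp]: "okc initc"
  by (simp add: initc_def)

lemma halted_stays: "fst c = halt_state \<Longrightarrow> (step M g ^^ n) c = c"
  by (induction n) (auto simp: step_def)

lemma runs_computes:
  assumes M: "num_tapes M = 7"
    "\<forall>g ts n ts'. length ts = 7 \<longrightarrow> (sstep g ^^ n) ([c], ts) = ([], ts') \<longrightarrow>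
       (step M g ^^ n) (start_state, ts) = (halt_state, ts')"
    and r: "runs g c T (word_tape x # replicate 6 (word_tape [])) (tps t s)"
    and y: "tape_word (t 0) = y" and T: "T \<le> k"
  shows "computes_within M g x k y"
proof -
  obtain m where m: "m \<le> T" "(sstep g ^^ m) ([c], word_tape x # replicate 6 (word_tape [])) = ([], tps t s)"
    using r unfolding runs_def by blast
  have i: "initial M x = (start_state, word_tape x # replicate 6 (word_tape []))"
    by (simp add: initial_def M)
  have "(step M g ^^ m) (initial M x) = (halt_state, tps t s)"
    unfolding i using M(2) m by simp
  moreover have "(step M g ^^ k) (initial M x) = (step M g ^^ (k - m)) ((step M g ^^ m) (initial M x))"
    using m T by (metis add_diff_inverse_nat funpow_add o_apply le_trans not_less add.commute)
  ultimately have "(step M g ^^ k) (initial M x) = (halt_state, tps t s)"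
    using halted_stays[of "(halt_state, tps t s)"] by simp
  moreover have "hd (tps t s) = t 0" by (simp add: tps_def)
  ultimately show ?thesis using y by (simp add: computes_within_def)
qed

theorem fp_polytime_computable:
  assumes "fp (range blist) F" and F: "\<And>x. F (blist x) = blist (f x)"
  shows "polytime_computable f"
proof -
  obtain c h where "implements c h (range blist) F" using assms(1) unfolding fp_def by blast
  note c = implementsD[OF this]
  obtain k where k: "\<And>n. h n \<le> (n + 2) ^ k" using c(2) unfolding pb_def by blast
  let ?P = "Seq initc (Seq (absorb 0) (Seq c (emit 0)))"
  let ?h = "\<lambda>n. (4 * n + 3) ^ k"
  let ?T = "\<lambda>n. 40 * n + 20 * ?h n + 60"
  have ok: "okc ?P" using c by simp
  obtain p :: "nat poly" where p: "\<And>n. ?T n \<le> poly p n"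
  proof -
    have "pb ?T" by (intro pb_add pb_mult pb_power pb_const pb_id)
    then show thesis using pb_poly that by blast
  qed
  have side: "(2 :: nat) \<le> 7" "(3 :: nat) \<le> 4" "[skip] \<noteq> []" "[skip] \<noteq> [?P]" "?P \<noteq> Ask"
    by (simp_all add: skip_def)
  have uniq: "cs = [skip]" if "Ask # cs \<in> conts ?P []" for cs using that okc_no_Ask[OF ok] by blast
  obtain M where M: "machine_wf M" "num_tapes M = 7"
    "\<forall>g ts n ts'. length ts = 7 \<longrightarrow> (sstep g ^^ n) ([?P], ts) = ([], ts') \<longrightarrow>
       (step M g ^^ n) (start_state, ts) = (halt_state, ts')" "oracle_free M"
    using compile_program[OF okc_wf[OF ok] side(1,2) uniq side(3-5)] okc_no_Ask[OF ok] by blast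
  have "computes_within M (\<lambda>_. []) x (poly p (length x)) (f x)" for x
  proof -
    let ?g = "\<lambda>_ :: bool list. [] :: bool list"
    let ?t0 = "(\<lambda>_ :: nat. stk [])(0 := word_tape x)" and ?s0 = "\<lambda>_ :: nat. [] :: bool list"
    have hx: "h (sz (blist x)) \<le> ?h (length x)"
      by (rule order_trans[OF k power_mono]) (use sz_blist(2)[of x] in auto)
    have fx: "length (f x) \<le> ?h (length x)"
      using sz_blist(1)[of "f x"] c(3)[of "blist x"] hx by (simp add: F)
    obtain u where u: "marked u" "snd u \<le> length x + 1" and
      2: "runs ?g (absorb 0) (30 * length x + 20) (tps ?t0 ?s0)
        (tps (?t0(0 := u)) (?s0(0 := code (blist x) @ [])))"
      using runs_absorb[of 0 ?t0 x ?s0 ?g] by fastforce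
    have "srun c (h (sz (blist x))) (?s0(0 := code (blist x) @ []))
        ((?s0(0 := code (blist x) @ []))(0 := code (F (blist x)) @ []))"
      by (rule c(4)) auto
    then have "srun c (?h (length x)) (?s0(0 := code (blist x) @ []))
        (?s0(0 := code (blist (f x)) @ []))"
      using srun_mono hx by (fastforce simp: F)
    then have 3: "runs ?g c (?h (length x)) (tps (?t0(0 := u)) (?s0(0 := code (blist x) @ [])))
        (tps (?t0(0 := u)) (?s0(0 := code (blist (f x)) @ [])))" by (rule srunD)
    obtain v where v: "tape_word v = f x" and
      4: "runs ?g (emit 0) (2 * (length x + 1) + 15 * length (f x) + 10)
        (tps (?t0(0 := u)) (?s0(0 := code (blist (f x)) @ [])))
        (tps (?t0(0 := u, 0 := v)) (?s0(0 := code (blist (f x)) @ [], 0 := [])))"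
      using runs_emit[of 0 "?t0(0 := u)" "length x + 1" "?s0(0 := code (blist (f x)) @ [])" "f x" "[]" ?g] u
      by auto
    have r: "runs ?g ?P (?T (length x)) (word_tape x # replicate 6 (word_tape []))
        (tps (?t0(0 := u, 0 := v)) (?s0(0 := code (blist (f x)) @ [], 0 := [])))"
      by (rule runs_Seq[OF runs_initc runs_Seq[OF 2 runs_Seq[OF 3 4 order_refl] order_refl]])
        (use fx in simp)
    show ?thesis
      by (rule runs_computes[OF M(2,3) r _ p]) (simp_all add: v)
  qed
  then show ?thesis unfolding polytime_computable_def using M by blast
qed

lemma tlist_sizes: "length xs < sz (tlist xs)" "x \<in> set xs \<Longrightarrow> sz x < sz (tlist xs)"
  by (induction xs) (use sz_pos in \<open>auto simp: Suc_le_eq\<close>)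

lemma sz_tlist_le: "(\<And>x. x \<in> set xs \<Longrightarrow> sz x \<le> B) \<Longrightarrow> sz (tlist xs) \<le> length xs * (B + 1) + 1"
proof (induction xs)
  case (Cons x xs)
  then have "sz x \<le> B" "sz (tlist xs) \<le> length xs * (B + 1) + 1" by simp_all
  then show ?case by simp
qed simp

text \<open>
  Ask the queries in the list on stack 0, and collect the answers on stack 1.
\<close>

definition queryc :: com where
  "queryc = Loop 2 {2} (Seq (popc 0) (Seq (emit 1) (Seq Ask (Seq (absorb 1)
     (Seq (takec 0 [1]) (pushc 1 True))))))"

lemma runs_queryc:
  shows "\<lbrakk>\<And>q. q \<in> set qs \<Longrightarrow> length q \<le> N \<and> length (g q) \<le> N; marked (t 1); snd (t 1) \<le> N + 1;
     s 0 = code (tlist (map blist qs)) @ u; s 1 = code (tlist as) @ v; s 3 = []; s 4 = []\<rbrakk> \<Longrightarrow>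
   \<exists>t'. t' 0 = t 0 \<and> runs g queryc (length qs * (300 * (N + 1)) + 1) (tps t s)
      (tps t' (s(0 := False # u, 1 := code (tlist (rev (map (\<lambda>q. blist (g q)) qs) @ as)) @ v)))"
proof (induction qs arbitrary: t s as)
  case Nil
  have e: "s(0 := False # u, 1 := code (tlist (rev (map (\<lambda>q. blist (g q)) []) @ as)) @ v) = s"
    using Nil by (auto simp: fun_eq_iff)
  have "runs g (Loop (Suc (Suc 0)) {2} d) 1 (tps t s) (tps t s)" for d
    by (rule runs_Loop_exit) (use Nil in \<open>simp add: tps_stack scanned_stk\<close>)
  then have "runs g queryc (length [] * (300 * (N + 1)) + 1) (tps t s) (tps t s)"
    unfolding queryc_def by (simp add: numeral_2_eq_2)
  then show ?case unfolding e by blast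
next
  case (Cons q qs)
  let ?r = "code (tlist (map blist qs)) @ u"
  have q: "length q \<le> N" "length (g q) \<le> N" using Cons.prems(1)[of q] by auto
  define s1 where "s1 = s(0 := code (blist q) @ ?r)"
  define s2 where "s2 = s(0 := ?r)"
  define s3 where "s3 = s(0 := code (blist (g q)) @ ?r)"
  define s4 where "s4 = s(0 := ?r, 1 := code (blist (g q)) @ code (tlist as) @ v)"
  define s5 where "s5 = s(0 := ?r, 1 := code (tlist (blist (g q) # as)) @ v)"
  have 1: "runs g (popc 0) 1 (tps t s) (tps t s1)"
    by (rule srunD, rule srun_popc) (use Cons.prems in \<open>auto simp: s1_def\<close>)
  have "s1 0 = code (blist q) @ ?r" "s1(0 := ?r) = s2" by (simp_all add: s1_def s2_def)
  then obtain w where w: "tape_word w = q" and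
    2: "runs g (emit 1) (2 * (N + 1) + 15 * length q + 10) (tps t s1) (tps (t(1 := w)) s2)"
    using runs_emit[of 1 t "N + 1" s1 q ?r g] Cons.prems(2,3) by auto
  define t2 where "t2 = t(1 := word_tape (g q))"
  have 3: "runs g Ask 1 (tps (t(1 := w)) s2) (tps t2 s2)"
    by (rule runs_Ask) (simp add: tps_def w t2_def)
  have "s2(0 := code (blist (g q)) @ s2 0) = s3" by (simp add: s2_def s3_def)
  then obtain x where x: "marked x" "snd x \<le> length (g q) + 1" and
    4: "runs g (absorb 1) (30 * length (g q) + 20) (tps t2 s2) (tps (t2(1 := x)) s3)"
    using runs_absorb[of 1 t2 "g q" s2 g] Cons.prems by (fastforce simp: t2_def s2_def)
  have 5: "runs g (takec 0 [1]) (44 * sz (blist (g q))) (tps (t2(1 := x)) s3) (tps (t2(1 := x)) s4)"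
    by (rule srunD, rule srun_mv[where r = ?r]) (use Cons.prems in \<open>auto simp: s3_def s4_def fun_eq_iff\<close>)
  have 6: "runs g (pushc 1 True) 3 (tps (t2(1 := x)) s4) (tps (t2(1 := x)) s5)"
    by (rule srunD, rule srun_pushc) (auto simp: s4_def s5_def fun_eq_iff)
  have "\<exists>t'. t' 0 = (t2(1 := x)) 0 \<and> runs g queryc (length qs * (300 * (N + 1)) + 1) (tps (t2(1 := x)) s5)
      (tps t' (s5(0 := False # u,
        1 := code (tlist (rev (map (\<lambda>q. blist (g q)) qs) @ blist (g q) # as)) @ v)))"
  proof (rule Cons.IH)
    show "snd ((t2(1 := x)) 1) \<le> N + 1" using x(2) q(2) by simp
  qed (use x(1) Cons.prems in \<open>auto simp: s5_def\<close>)
  then obtain t' where t': "t' 0 = (t2(1 := x)) 0" and 7: "runs g queryc (length qs * (300 * (N + 1)) + 1)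
      (tps (t2(1 := x)) s5) (tps t' (s5(0 := False # u,
        1 := code (tlist (rev (map (\<lambda>q. blist (g q)) qs) @ blist (g q) # as)) @ v)))" by blast
  have e: "s5(0 := False # u, 1 := code (tlist (rev (map (\<lambda>q. blist (g q)) qs) @ blist (g q) # as)) @ v)
      = s(0 := False # u, 1 := code (tlist (rev (map (\<lambda>q. blist (g q)) (q # qs)) @ as)) @ v)"
    by (simp add: s5_def fun_eq_iff)
  have b: "sz (blist (g q)) \<le> 4 * N + 1" using sz_blist(2)[of "g q"] q by simp
  have "runs g queryc (length (q # qs) * (300 * (N + 1)) + 1) (tps t s) (tps t'
      (s(0 := False # u, 1 := code (tlist (rev (map (\<lambda>q. blist (g q)) (q # qs)) @ as)) @ v)))"
    unfolding queryc_def
    by (rule runs_Loop_step[OF _ runs_Seq[OF 1 runs_Seq[OF 2 runs_Seq[OF 3 runs_Seq[OF 4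
          runs_Seq[OF 5 6 order_refl] order_refl] order_refl] order_refl] order_refl]
          7[unfolded e queryc_def]])
      (use q b Cons.prems(4) in \<open>simp_all add: tps_def upt_rec scanned_stk\<close>)
  moreover have "t' 0 = t 0" using t' by (simp add: t2_def)
  ultimately show ?case by blast
qed

text \<open>
  A reduction that computes a list of queries together with further data, puts the queries to the
  oracle one after the other, and computes the result from the answers, which come in reverse order.
\<close>

theorem fp_polytime_turing_reducible:
  assumes "fp (range blist) Pre" and Pre: "\<And>x. Pre (blist x) = Nd (tlist (map blist (qs x))) (rest x)"
    and "fp (range (\<lambda>x. Nd (tlist (rev (map (\<lambda>w. blist (g w)) (qs x)))) (rest x))) Post"
    and Post: "\<And>x. Post (Nd (tlist (rev (map (\<lambda>w. blist (g w)) (qs x)))) (rest x)) = blist (f x)"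
    and b: "pb b" "\<And>w. length (g w) \<le> b (length w)"
  shows "polytime_turing_reducible f g"
proof -
  obtain c h where "implements c h (range blist) Pre" using assms(1) unfolding fp_def by blast
  note c = implementsD[OF this]
  let ?S = "range (\<lambda>x. Nd (tlist (rev (map (\<lambda>w. blist (g w)) (qs x)))) (rest x))"
  obtain d e where "implements d e ?S Post" using assms(3) unfolding fp_def by blast
  note d = implementsD[OF this]
  obtain k where k: "\<And>n. h n \<le> (n + 2) ^ k" using c(2) unfolding pb_def by blast
  obtain l where l: "\<And>n. e n \<le> (n + 2) ^ l" using d(2) unfolding pb_def by blast
  obtain m where m: "\<And>n. b n \<le> (n + 2) ^ m" using b(1) unfolding pb_def by blast
  let ?E = "Seq (popc 0) (Seq (takec 1 [0]) (Seq (pushc 0 True) (Seq d (emit 0))))"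
  let ?P = "Seq initc (Seq (absorb 0) (Seq c (Seq (popc 0) (Seq (pushc 1 False) (Seq queryc ?E)))))"
  let ?cs0 = "[Seq (absorb 1) (Seq (takec 0 [1]) (pushc 1 True)), queryc, ?E]"
  have wf: "wf_com 7 4 ?P" using c d by (auto intro!: okc_wf simp: queryc_def)
  have no: "Ask # ds \<notin> conts a cs" if "okc a" for a ds cs using okc_no_Ask[OF that] .
  have uniq: "cs = ?cs0" if "Ask # cs \<in> conts ?P []" for cs
    using that c d by (simp add: no queryc_def)
  have side: "(2 :: nat) \<le> 7" "(3 :: nat) \<le> 4" "?cs0 \<noteq> []" "?cs0 \<noteq> [?P]" "?P \<noteq> Ask" by simp_all
  obtain M where M: "machine_wf M" "num_tapes M = 7"
    "\<forall>g ts n ts'. length ts = 7 \<longrightarrow> (sstep g ^^ n) ([?P], ts) = ([], ts') \<longrightarrow>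
       (step M g ^^ n) (start_state, ts) = (halt_state, ts')"
    using compile_program[OF wf side(1,2) uniq side(3-5)] by blast
  \<comment> \<open>\<open>N\<close> bounds the sizes of the queries and answers, \<open>A\<close> that of the list of answers\<close>
  define H where "H n = (4 * n + 3) ^ k" for n :: nat
  define N where "N n = H n + (H n + 2) ^ m + 1" for n
  define A where "A n = H n * (4 * N n + 2) + 1" for n
  define D where "D n = (A n + H n + 4) ^ l" for n
  define T where "T n = 40 * n + 60 * H n + H n * (300 * (N n + 1)) + 50 * A n + 20 * D n + 200" for n
  obtain p :: "nat poly" where p: "\<And>n. T n \<le> poly p n"
  proof -
    have "pb T" unfolding T_def D_def A_def N_def H_def
      by (intro pb_add pb_mult pb_power pb_const pb_id)
    then show thesis using pb_poly that by blast
  qed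
  have "computes_within M g x (poly p (length x)) (f x)" for x
  proof -
    let ?n = "length x"
    let ?t0 = "(\<lambda>_ :: nat. stk [])(0 := word_tape x)" and ?s0 = "\<lambda>_ :: nat. [] :: bool list"
    let ?Q = "tlist (map blist (qs x))" and ?R = "tlist (rev (map (\<lambda>q. blist (g q)) (qs x)))"
    have hx: "h (sz (blist x)) \<le> H ?n"
      unfolding H_def by (rule order_trans[OF k power_mono]) (use sz_blist(2)[of x] in auto)
    have qsz: "sz ?Q + sz (rest x) + 1 \<le> H ?n"
      using c(3)[of "blist x"] hx by (simp add: Pre)
    have qlen: "length (qs x) \<le> H ?n" using tlist_sizes(1)[of "map blist (qs x)"] qsz by simp
    have qN: "length q \<le> N ?n \<and> length (g q) \<le> N ?n" if "q \<in> set (qs x)" for q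
    proof -
      have 1: "length q \<le> H ?n"
        using tlist_sizes(2)[of "blist q" "map blist (qs x)"] sz_blist(1)[of q] qsz that by auto
      have "length (g q) \<le> (length q + 2) ^ m" using b(2)[of q] m[of "length q"] by linarith
      also have "\<dots> \<le> (H ?n + 2) ^ m" using 1 by (intro power_mono) auto
      finally show ?thesis using 1 by (simp add: N_def)
    qed
    have RA: "sz ?R \<le> A ?n"
    proof -
      have "sz ?R \<le> length (rev (map (\<lambda>q. blist (g q)) (qs x))) * (4 * N ?n + 1 + 1) + 1"
      proof (rule sz_tlist_le)
        fix y assume "y \<in> set (rev (map (\<lambda>q. blist (g q)) (qs x)))"
        then obtain q where q: "q \<in> set (qs x)" "y = blist (g q)" by auto
        then show "sz y \<le> 4 * N ?n + 1" using sz_blist(2)[of "g q"] qN[of q] by simp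
      qed
      also have "\<dots> \<le> A ?n" unfolding A_def using mult_right_mono[OF qlen, of "4 * N ?n + 1 + 1"] by simp
      finally show ?thesis .
    qed
    have ex: "e (sz (Nd ?R (rest x))) \<le> D ?n"
    proof -
      have "e (sz (Nd ?R (rest x))) \<le> (sz (Nd ?R (rest x)) + 2) ^ l" by (rule l)
      also have "\<dots> \<le> D ?n" unfolding D_def using RA qsz by (intro power_mono) auto
      finally show ?thesis .
    qed
    have fx: "length (f x) \<le> D ?n"
      using sz_blist(1)[of "f x"] d(3)[of "Nd ?R (rest x)"] ex Post[of x] by simp
    obtain u where u: "marked u" "snd u \<le> length x + 1" and
      2: "runs g (absorb 0) (30 * length x + 20) (tps ?t0 ?s0)
        (tps (?t0(0 := u)) (?s0(0 := code (blist x) @ [])))"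
      using runs_absorb[of 0 ?t0 x ?s0 g] by fastforce
    let ?t1 = "?t0(0 := u)"
    define s1 where "s1 = ?s0(0 := code (Nd ?Q (rest x)))"
    define s2 where "s2 = ?s0(0 := code ?Q @ code (rest x))"
    define s3 where "s3 = ?s0(0 := code ?Q @ code (rest x), 1 := code (tlist []) @ [])"
    define s4 where "s4 = ?s0(0 := False # code (rest x), 1 := code ?R @ [])"
    define s5 where "s5 = ?s0(0 := code (rest x), 1 := code ?R @ [])"
    define s6 where "s6 = ?s0(0 := code ?R @ code (rest x))"
    define s7 where "s7 = ?s0(0 := code (Nd ?R (rest x)))"
    define s8 where "s8 = ?s0(0 := code (blist (f x)) @ [])"
    have "srun c (h (sz (blist x))) (?s0(0 := code (blist x) @ []))
        ((?s0(0 := code (blist x) @ []))(0 := code (Pre (blist x)) @ []))"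
      by (rule c(4)) auto
    then have "srun c (H ?n) (?s0(0 := code (blist x) @ [])) s1"
      using srun_mono hx by (fastforce simp: Pre s1_def)
    then have 3: "runs g c (H ?n) (tps ?t1 (?s0(0 := code (blist x) @ []))) (tps ?t1 s1)" by (rule srunD)
    have 4: "runs g (popc 0) 1 (tps ?t1 s1) (tps ?t1 s2)"
      by (rule srunD, rule srun_popc) (auto simp: s1_def s2_def)
    have 5: "runs g (pushc 1 False) 3 (tps ?t1 s2) (tps ?t1 s3)"
      by (rule srunD, rule srun_pushc) (auto simp: s2_def s3_def fun_eq_iff)
    have e4: "s3(0 := False # code (rest x), 1 := code (tlist (rev (map (\<lambda>q. blist (g q)) (qs x)) @ [])) @ []) = s4"
      by (simp add: s3_def s4_def fun_eq_iff)
    have "\<exists>t'. t' 0 = ?t1 0 \<and> runs g queryc (length (qs x) * (300 * (N ?n + 1)) + 1) (tps ?t1 s3)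
      (tps t' (s3(0 := False # code (rest x),
        1 := code (tlist (rev (map (\<lambda>q. blist (g q)) (qs x)) @ [])) @ [])))"
    proof -
      have 1: "marked (?t1 1)" "snd (?t1 1) \<le> N ?n + 1" using marked_stk_Nil by (simp_all add: stk_def)
      have 2: "s3 0 = code ?Q @ code (rest x)" "s3 1 = code (tlist []) @ []" "s3 3 = []" "s3 4 = []"
        by (simp_all add: s3_def)
      show ?thesis
        using runs_queryc[where qs = "qs x" and t = "?t1" and s = s3 and u = "code (rest x)"
            and as = "[]" and v = "[]" and N = "N ?n" and g = g, OF qN 1 2] by simp
    qed
    then obtain t' where t': "t' 0 = u" and
      "runs g queryc (length (qs x) * (300 * (N ?n + 1)) + 1) (tps ?t1 s3) (tps t' s4)"
      unfolding e4 by auto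
    then have 6: "runs g queryc (H ?n * (300 * (N ?n + 1)) + 1) (tps ?t1 s3) (tps t' s4)"
      using qlen by (elim runs_mono) (simp add: mult_right_mono)
    have 7: "runs g (popc 0) 1 (tps t' s4) (tps t' s5)"
      by (rule srunD, rule srun_popc) (auto simp: s4_def s5_def fun_eq_iff)
    have 8: "runs g (takec 1 [0]) (44 * sz ?R) (tps t' s5) (tps t' s6)"
      by (rule srunD, rule srun_mv[where r = "[]"]) (auto simp: s5_def s6_def fun_eq_iff)
    have 9: "runs g (pushc 0 True) 3 (tps t' s6) (tps t' s7)"
      by (rule srunD, rule srun_pushc) (auto simp: s6_def s7_def fun_eq_iff)
    have "srun d (e (sz (Nd ?R (rest x)))) s7 (s7(0 := code (Post (Nd ?R (rest x))) @ []))"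
      by (rule d(4)) (auto simp: s7_def)
    moreover have "s7(0 := code (Post (Nd ?R (rest x))) @ []) = s8"
      by (simp add: Post s7_def s8_def)
    ultimately have 10: "runs g d (D ?n) (tps t' s7) (tps t' s8)"
      using srunD srun_mono ex by metis
    obtain w where w: "tape_word w = f x" and
      11: "runs g (emit 0) (2 * (length x + 1) + 15 * length (f x) + 10) (tps t' s8) (tps (t'(0 := w)) (s8(0 := [])))"
      using runs_emit[of 0 t' "length x + 1" s8 "f x" "[]" g] u t' by (auto simp: s8_def)
    have r: "runs g ?P (T ?n) (word_tape x # replicate 6 (word_tape [])) (tps (t'(0 := w)) (s8(0 := [])))"
      by (rule runs_Seq[OF runs_initc runs_Seq[OF 2 runs_Seq[OF 3 runs_Seq[OF 4 runs_Seq[OF 5 runs_Seq[OF 6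
        runs_Seq[OF 7 runs_Seq[OF 8 runs_Seq[OF 9 runs_Seq[OF 10 11 order_refl] order_refl] order_refl]
        order_refl] order_refl] order_refl] order_refl] order_refl] order_refl]])
        (use fx RA in \<open>simp add: T_def\<close>)
    show ?thesis
      by (rule runs_computes[OF M(2,3) r _ p]) (simp_all add: w)
  qed
  then show ?thesis unfolding polytime_turing_reducible_def using M by blast
qed

section \<open>Polynomial-time functions on types with an encoding\<close>

text \<open>
  Words are encoded as lists, and numbers as the words of their binary notation.
\<close>

class enc =
  fixes enc :: "'a \<Rightarrow> tree"
  assumes enc_inj: "enc x = enc y \<Longrightarrow> x = y"

abbreviation esz :: "'a::enc \<Rightarrow> nat" where
  "esz x \<equiv> sz (enc x)"

instantiation unit :: enc
begin
definition enc_unit :: "unit \<Rightarrow> tree" where "enc_unit x = Lf"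
instance by standard simp
end

instantiation bool :: enc
begin
definition enc_bool :: "bool \<Rightarrow> tree" where "enc_bool = btree"
instance by standard (auto simp: enc_bool_def btree_def split: if_splits)
end

instantiation prod :: (enc, enc) enc
begin
definition enc_prod :: "'a \<times> 'b \<Rightarrow> tree" where "enc_prod p = Nd (enc (fst p)) (enc (snd p))"
instance by standard (auto simp: enc_prod_def prod_eq_iff dest: enc_inj)
end

instantiation sum :: (enc, enc) enc
begin
definition enc_sum :: "'a + 'b \<Rightarrow> tree" where
  "enc_sum s = (case s of Inl a \<Rightarrow> Nd (enc False) (enc a) | Inr b \<Rightarrow> Nd (enc True) (enc b))"
instance by standard (auto simp: enc_sum_def enc_bool_def btree_def split: sum.splits dest: enc_inj)
end

instantiation list :: (enc) enc
begin
definition enc_list :: "'a list \<Rightarrow> tree" where "enc_list xs = tlist (map enc xs)"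
instance
proof
  show "xs = ys" if "enc xs = enc ys" for xs ys :: "'a list"
    using that unfolding enc_list_def
  proof (induction xs arbitrary: ys)
    case Nil
    then show ?case by (cases ys) auto
  next
    case (Cons x xs)
    then show ?case by (cases ys) (auto dest: enc_inj)
  qed
qed
end

text \<open>The number with given binary digits, least significant digit first.\<close>

primrec val :: "bool list \<Rightarrow> nat" where
  "val [] = 0"
| "val (b # bs) = of_bool b + 2 * val bs"

lemma val_nat_code: "val (nat_code n) = n"
proof (induction n rule: nat_code.induct)
  case (1 n)
  then show ?case by (subst nat_code.simps) (auto simp: odd_two_times_div_two_succ)
qed

instantiation nat :: enc
begin
definition enc_nat :: "nat \<Rightarrow> tree" where "enc_nat n = enc (nat_code n)"
instance by standard (metis enc_nat_def enc_inj val_nat_code)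
end

lemma enc_simps:
  "enc () = Lf" "enc False = Lf" "enc True = Nd Lf Lf" "enc (a, b) = Nd (enc a) (enc b)"
  "enc [] = Lf" "enc (x # xs) = Nd (enc x) (enc xs)"
  by (simp_all add: enc_unit_def enc_bool_def btree_def enc_prod_def enc_list_def)

lemma blist_enc: "blist = enc"
  by (auto simp: fun_eq_iff blist_def enc_list_def enc_bool_def)

text \<open>The encodings of the arguments of \<open>f\<close>.\<close>

abbreviation (input) Enc :: "('a::enc \<Rightarrow> 'b) \<Rightarrow> tree set" where
  "Enc f \<equiv> range (enc :: 'a \<Rightarrow> tree)"

text \<open>
  Computable in polynomial time, with respect to the encodings.
\<close>

definition fpt :: "('a::enc \<Rightarrow> 'b::enc) \<Rightarrow> bool" where
  "fpt f \<longleftrightarrow> (\<exists>F. fp (Enc f) F \<and> (\<forall>x. F (enc x) = enc (f x)))"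

lemma fptI: "fp (Enc f) F \<Longrightarrow> (\<And>x. F (enc x) = enc (f x)) \<Longrightarrow> fpt f"
  unfolding fpt_def by blast

lemma fptE:
  assumes "fpt f"
  obtains F where "fp (Enc f) F" "\<And>x. F (enc x) = enc (f x)"
  using assms unfolding fpt_def by blast

named_theorems fpt_intros

lemma fpt_id [fpt_intros]: "fpt (\<lambda>x. x)"
  by (rule fptI[OF fp_id]) simp

lemma fpt_const [fpt_intros]: "fpt (\<lambda>x. c)"
  by (rule fptI[OF fp_const]) simp

lemma fpt_comp:
  assumes "fpt f" "fpt g"
  shows "fpt (\<lambda>x. f (g x))"
proof -
  obtain F G where F: "fp (Enc f) F" "\<And>x. F (enc x) = enc (f x)"
    and G: "fp (Enc g) G" "\<And>x. G (enc x) = enc (g x)"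
    using assms by (auto elim!: fptE)
  show ?thesis
    by (rule fptI[of "\<lambda>t. F (G t)"], rule fp_comp[OF F(1) G(1)]) (auto simp: F G)
qed

lemma fpt_Pair [fpt_intros]:
  assumes "fpt f" "fpt g"
  shows "fpt (\<lambda>x. (f x, g x))"
proof -
  obtain F G where F: "fp (Enc f) F" "\<And>x. F (enc x) = enc (f x)"
    and G: "fp (Enc g) G" "\<And>x. G (enc x) = enc (g x)"
    using assms by (auto elim!: fptE)
  show ?thesis
    by (rule fptI[OF fp_Nd[OF F(1) G(1)]]) (simp add: F G enc_simps)
qed

lemma fpt_fst' : "fpt fst"
  by (rule fptI[OF fp_tfst]) (simp add: enc_prod_def)

lemma fpt_snd' : "fpt snd"
  by (rule fptI[OF fp_tsnd]) (simp add: enc_prod_def)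

lemmas fpt_fst [fpt_intros] = fpt_comp[OF fpt_fst']
lemmas fpt_snd [fpt_intros] = fpt_comp[OF fpt_snd']

lemma fpt_comp2:
  assumes "fpt (\<lambda>p. f (fst p) (snd p))" "fpt g" "fpt h"
  shows "fpt (\<lambda>x. f (g x) (h x))"
  using fpt_comp[OF assms(1) fpt_Pair[OF assms(2,3)]] by simp

lemma fpt_if [fpt_intros]:
  assumes "fpt P" "fpt f" "fpt g"
  shows "fpt (\<lambda>x. if P x then f x else g x)"
proof -
  obtain Q F G where Q: "fp (Enc P) Q" "\<And>x. Q (enc x) = enc (P x)"
    and F: "fp (Enc f) F" "\<And>x. F (enc x) = enc (f x)"
    and G: "fp (Enc g) G" "\<And>x. G (enc x) = enc (g x)"
    using assms by (auto elim!: fptE)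
  show ?thesis
    by (rule fptI[OF fp_if[OF Q(1) F(1) G(1)]]) (simp add: F G Q enc_bool_def btree_def)
qed

lemma fpt_not [fpt_intros]: "fpt P \<Longrightarrow> fpt (\<lambda>x. \<not> P x)"
  using fpt_if[OF _ fpt_const[of False] fpt_const[of True], of P] by (rule back_subst[of fpt]) auto

lemma fpt_conj [fpt_intros]: "fpt P \<Longrightarrow> fpt Q \<Longrightarrow> fpt (\<lambda>x. P x \<and> Q x)"
  using fpt_if[OF _ _ fpt_const[of False], of P Q] by (rule back_subst[of fpt]) auto

lemma fpt_disj [fpt_intros]: "fpt P \<Longrightarrow> fpt Q \<Longrightarrow> fpt (\<lambda>x. P x \<or> Q x)"
  using fpt_if[OF _ fpt_const[of True], of P Q] by (rule back_subst[of fpt]) auto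

lemma fpt_imp [fpt_intros]: "fpt P \<Longrightarrow> fpt Q \<Longrightarrow> fpt (\<lambda>x. P x \<longrightarrow> Q x)"
  using fpt_if[OF _ _ fpt_const[of True], of P Q] by (rule back_subst[of fpt]) auto

lemma fpt_iff: "fpt P \<Longrightarrow> fpt Q \<Longrightarrow> fpt (\<lambda>x. P x \<longleftrightarrow> Q x)"
  using fpt_if[OF _ _ fpt_not, of P Q Q] by (rule back_subst[of fpt]) auto

lemma fpt_Cons [fpt_intros]:
  assumes "fpt f" "fpt g"
  shows "fpt (\<lambda>x. f x # g x)"
proof -
  obtain F G where F: "fp (Enc f) F" "\<And>x. F (enc x) = enc (f x)"
    and G: "fp (Enc g) G" "\<And>x. G (enc x) = enc (g x)"
    using assms by (auto elim!: fptE)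
  show ?thesis
    by (rule fptI[OF fp_Nd[OF F(1) G(1)]]) (simp add: F G enc_simps)
qed

lemma fpt_tl' : "fpt tl"
proof (rule fptI[OF fp_tsnd])
  show "tsnd (enc x) = enc (tl x)" for x :: "'a list" by (cases x) (auto simp: enc_simps)
qed

lemma fpt_hd' : "fpt hd"
proof (rule fptI[OF fp_if[OF fp_id fp_tfst fp_const]])
  show "(if enc x = Lf then enc (hd [] :: 'a) else tfst (enc x)) = enc (hd x)" for x :: "'a list"
    by (cases x) (auto simp: enc_simps)
qed

lemma fpt_null' : "fpt (\<lambda>x :: 'a::enc list. x = [])"
proof (rule fptI[OF fp_if[OF fp_id fp_const fp_const]])
  show "(if enc x = Lf then enc True else enc False) = enc (x = [])" for x :: "'a list"
    by (cases x) (auto simp: enc_simps)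
qed

lemmas fpt_tl [fpt_intros] = fpt_comp[OF fpt_tl']
lemmas fpt_hd [fpt_intros] = fpt_comp[OF fpt_hd']
lemmas fpt_null [fpt_intros] = fpt_comp[OF fpt_null']

lemma fpt_Inl' : "fpt Inl"
  by (rule fptI[OF fp_Nd[OF fp_const fp_id]]) (simp add: enc_sum_def)

lemma fpt_Inr' : "fpt Inr"
  by (rule fptI[OF fp_Nd[OF fp_const fp_id]]) (simp add: enc_sum_def)

lemmas fpt_Inl [fpt_intros] = fpt_comp[OF fpt_Inl']
lemmas fpt_Inr [fpt_intros] = fpt_comp[OF fpt_Inr']

lemma fpt_case_sum [fpt_intros]:
  fixes s :: "'a::enc \<Rightarrow> 'b::enc + 'c::enc"
  assumes s: "fpt s" and f: "fpt (\<lambda>p. f (fst p) (snd p))" and g: "fpt (\<lambda>p. g (fst p) (snd p))"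
  shows "fpt (\<lambda>x. case s x of Inl b \<Rightarrow> f x b | Inr c \<Rightarrow> g x c)"
proof -
  obtain S where S: "fp (Enc s) S" "\<And>x. S (enc x) = enc (s x)" using s by (auto elim: fptE)
  obtain F where F: "fp (range (enc :: 'a \<times> 'b \<Rightarrow> tree)) F" "\<And>p. F (enc p) = enc (f (fst p) (snd p))"
    using f by (auto elim: fptE)
  obtain G where G: "fp (range (enc :: 'a \<times> 'c \<Rightarrow> tree)) G" "\<And>p. G (enc p) = enc (g (fst p) (snd p))"
    using g by (auto elim: fptE)
  let ?A = "\<lambda>t. Nd t (tsnd (S t))"
  let ?P = "\<lambda>t. tfst (S t)"
  have A: "fp (Enc s) ?A" "fp (Enc s) ?P"
    by (intro fp_Nd fp_id fp_comp[OF fp_tsnd[of UNIV] S(1)] fp_comp[OF fp_tfst[of UNIV] S(1)]; simp)+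
  \<comment> \<open>the branch that is not taken is applied to a default argument\<close>
  let ?d1 = "Nd (enc (undefined :: 'a)) (enc (undefined :: 'b))"
  let ?d2 = "Nd (enc (undefined :: 'a)) (enc (undefined :: 'c))"
  let ?B1 = "\<lambda>t. if ?P t = Lf then ?A t else ?d1"
  let ?B2 = "\<lambda>t. if ?P t = Lf then ?d2 else ?A t"
  have B: "fp (Enc s) ?B1" "fp (Enc s) ?B2" by (intro fp_if A fp_const)+
  have r1: "?B1 (enc x) = enc (case s x of Inl b \<Rightarrow> (x, b) | Inr c \<Rightarrow> (undefined, undefined))" for x
    by (auto simp: S enc_sum_def enc_bool_def btree_def enc_prod_def split: sum.split)
  have r2: "?B2 (enc x) = enc (case s x of Inl b \<Rightarrow> (undefined, undefined) | Inr c \<Rightarrow> (x, c))" for x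
    by (auto simp: S enc_sum_def enc_bool_def btree_def enc_prod_def split: sum.split)
  have C: "fp (Enc s) (\<lambda>t. F (?B1 t))" "fp (Enc s) (\<lambda>t. G (?B2 t))"
    using r1 r2 by (auto intro!: fp_comp[OF F(1) B(1)] fp_comp[OF G(1) B(2)])
  show ?thesis
    by (rule fptI[OF fp_if[OF A(2) C(2) C(1)]])
      (auto simp: S F(2)[of "(_, _)", unfolded enc_prod_def, simplified]
         G(2)[of "(_, _)", unfolded enc_prod_def, simplified]
         enc_sum_def enc_bool_def btree_def split: sum.split)
qed

section \<open>Size bounds\<close>

text \<open>
  Numbers bounded by a polynomial in the size of the encoding of the argument.
\<close>

definition pbt :: "('a::enc \<Rightarrow> nat) \<Rightarrow> bool" where
  "pbt h \<longleftrightarrow> (\<exists>p. pb p \<and> (\<forall>x. h x \<le> p (esz x)))"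

named_theorems pbt_intros

lemma pbt_mono: "pbt g \<Longrightarrow> (\<And>x. f x \<le> g x) \<Longrightarrow> pbt f"
  unfolding pbt_def using order_trans by blast

lemma pbt_const [pbt_intros]: "pbt (\<lambda>x. c)"
  unfolding pbt_def by (rule exI[of _ "\<lambda>_. c"]) auto

lemma pbt_fpt [pbt_intros]: "fpt f \<Longrightarrow> pbt (\<lambda>x. esz (f x))"
proof -
  assume "fpt f"
  then obtain F where F: "fp (Enc f) F" "\<And>x. F (enc x) = enc (f x)" by (rule fptE) blast
  obtain p where "pb p" "\<forall>t\<in>Enc f. sz (F t) \<le> p (sz t)" using fp_size[OF F(1)] by blast
  then show ?thesis unfolding pbt_def by (intro exI[of _ p]) (simp add: F(2)[symmetric])
qed

lemma pbt_add [pbt_intros]: "pbt f \<Longrightarrow> pbt g \<Longrightarrow> pbt (\<lambda>x. f x + g x)"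
  unfolding pbt_def by (metis (no_types, lifting) pb_add add_mono)

lemma pbt_mult [pbt_intros]: "pbt f \<Longrightarrow> pbt g \<Longrightarrow> pbt (\<lambda>x. f x * g x)"
  unfolding pbt_def by (metis (no_types, lifting) pb_mult mult_le_mono)

lemma pbt_power [pbt_intros]: "pbt f \<Longrightarrow> pbt (\<lambda>x. f x ^ k)"
  by (induction k) (auto intro: pbt_intros)

lemma length_le_esz: "length xs < esz xs"
  using tlist_sizes(1)[of "map enc xs"] by (simp add: enc_list_def)

lemma pbt_length [pbt_intros]: "fpt l \<Longrightarrow> pbt (\<lambda>x. length (l x))"
  by (rule pbt_mono[OF pbt_fpt[of l]]) (simp_all add: length_le_esz less_imp_le)

lemma esz_Pair: "esz (a, b) = esz a + esz b + 1"
  by (simp add: enc_simps)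

lemma esz_Cons: "esz (x # xs) = esz x + esz xs + 1"
  by (simp add: enc_simps)

lemma esz_append: "esz (xs @ ys) + 1 = esz xs + esz ys"
  by (induction xs) (auto simp: enc_simps)

lemma esz_mem: "x \<in> set xs \<Longrightarrow> esz x < esz xs"
  using tlist_sizes(2)[of "enc x" "map enc xs"] by (auto simp: enc_list_def)

lemma esz_list_le: "(\<And>x. x \<in> set xs \<Longrightarrow> esz x \<le> B) \<Longrightarrow> esz xs \<le> length xs * (B + 1) + 1"
  unfolding enc_list_def using sz_tlist_le[of "map enc xs" B] by auto

section \<open>Folds and list functions\<close>

lemma enc_foldl:
  assumes "\<And>a y. F (Nd (Nd u (enc a)) (enc y)) = enc (f a y)"
  shows "tfold F u (enc a) (enc ys) = enc (foldl f a ys)"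
  using assms by (induction ys arbitrary: a) (auto simp: enc_simps assms)

lemma taccs_foldl:
  assumes "\<And>a y. F (Nd (Nd u (enc a)) (enc y)) = enc (f a y)"
  shows "t \<in> taccs F u (enc a) (enc ys) \<Longrightarrow> \<exists>n\<le>length ys. t = enc (foldl f a (take n ys))"
proof (induction ys arbitrary: a)
  case Nil
  then show ?case by (auto simp: enc_simps)
next
  case (Cons y ys)
  then consider "t = enc a" | "t \<in> taccs F u (enc (f a y)) (enc ys)"
    by (auto simp: enc_simps assms)
  then show ?case
  proof cases
    case 1
    then show ?thesis by (intro exI[of _ 0]) simp
  next
    case 2
    then obtain n where "n \<le> length ys" "t = enc (foldl f (f a y) (take n ys))"
      using Cons.IH by blast
    then show ?thesis by (intro exI[of _ "Suc n"]) simp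
  qed
qed

lemma targs_foldl:
  fixes f :: "'a::enc \<Rightarrow> 'y::enc \<Rightarrow> 'a" and x :: "'x::enc" and a :: 'a and ys :: "'y list"
  assumes "\<And>a y. F (Nd (Nd (enc x) (enc a)) (enc y)) = enc (f a y)"
  shows "targs F (enc x) (enc a) (enc ys) \<subseteq> range (enc :: ('x \<times> 'a) \<times> 'y \<Rightarrow> tree)"
proof (induction ys arbitrary: a)
  case (Cons y ys)
  have "Nd (Nd (enc x) (enc a)) (enc y) = enc ((x, a), y)" by (simp add: enc_simps)
  then have "Nd (Nd (enc x) (enc a)) (enc y) \<in> range (enc :: ('x \<times> 'a) \<times> 'y \<Rightarrow> tree)" by (rule range_eqI)
  then show ?case using Cons.IH[of "f a y"] by (simp add: enc_simps(6) assms)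
qed (simp add: enc_simps)

text \<open>
  A fold takes polynomial time if its intermediate values are of polynomial size.
\<close>

lemma fpt_foldl:
  fixes f :: "'x::enc \<Rightarrow> 'a::enc \<Rightarrow> 'y::enc \<Rightarrow> 'a"
  assumes "fpt (\<lambda>p. f (fst (fst p)) (snd (fst p)) (snd p))" "fpt i" "fpt l" "pbt h"
    and bound: "\<And>x n. n \<le> length (l x) \<Longrightarrow> esz (foldl (f x) (i x) (take n (l x))) \<le> h x"
  shows "fpt (\<lambda>x. foldl (f x) (i x) (l x))"
proof -
  obtain F where F: "fp (range (enc :: ('x \<times> 'a) \<times> 'y \<Rightarrow> tree)) F"
    "\<And>p. F (enc p) = enc (f (fst (fst p)) (snd (fst p)) (snd p))"
    using assms(1) by (auto elim: fptE)
  obtain I L where I: "fp (Enc i) I" "\<And>x. I (enc x) = enc (i x)"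
    and L: "fp (Enc l) L" "\<And>x. L (enc x) = enc (l x)"
    using assms(2,3) by (auto elim!: fptE)
  obtain b where b: "pb b" "\<And>x. h x \<le> b (esz x)" using assms(4) unfolding pbt_def by blast
  have st: "F (Nd (Nd (enc x) (enc a)) (enc y)) = enc (f x a y)" for x a y
    using F(2)[of "((x, a), y)"] by (simp add: enc_simps)
  show ?thesis
  proof (rule fptI[OF fp_tfold[OF F(1) fp_id I(1) L(1) _ b(1)]])
    show "targs F t (I t) (L t) \<subseteq> range (enc :: ('x \<times> 'a) \<times> 'y \<Rightarrow> tree)" if t: "t \<in> Enc l" for t
    proof -
      obtain x :: 'x where x: "t = enc x" using t by blast
      show ?thesis unfolding x I L by (rule targs_foldl[where f = "f x"]) (rule st)
    qed
    show "sz a \<le> b (sz t)" if t: "t \<in> Enc l" and a: "a \<in> taccs F t (I t) (L t)" for t a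
    proof -
      obtain x :: 'x where x: "t = enc x" using t by blast
      obtain n where "n \<le> length (l x)" "a = enc (foldl (f x) (i x) (take n (l x)))"
        using taccs_foldl[of F "enc x" "f x" a "i x" "l x", OF st] a by (auto simp: x I L)
      then show ?thesis using bound[of n x] b(2)[of x] by (simp add: x)
    qed
    show "tfold F (enc x) (I (enc x)) (L (enc x)) = enc (foldl (f x) (i x) (l x))" for x
      using enc_foldl[of F "enc x" "f x", OF st] by (simp add: I L)
  qed
qed

lemma foldl_Cons: "foldl (\<lambda>a y. g y # a) zs ys = rev (map g ys) @ zs"
  by (induction ys arbitrary: zs) auto

lemma fpt_rev_append:
  assumes "fpt (l :: 'a::enc \<Rightarrow> 'b::enc list)" "fpt m"
  shows "fpt (\<lambda>x. rev (l x) @ m x)"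
proof -
  have "fpt (\<lambda>x. foldl (\<lambda>a y. y # a) (m x) (l x))"
  proof (rule fpt_foldl[OF _ assms(2,1), where h = "\<lambda>x. esz (l x) + esz (m x)"])
    fix x n
    have "esz (l x) + 1 = esz (take n (l x)) + esz (drop n (l x))"
      using esz_append[of "take n (l x)" "drop n (l x)"] by simp
    moreover have "esz (rev zs) = esz zs" for zs :: "'b list"
    proof (induction zs)
      case (Cons z zs)
      then show ?case using esz_append[of "rev zs" "[z]"] by (simp add: enc_simps)
    qed simp
    ultimately show "esz (foldl (\<lambda>a y. y # a) (m x) (take n (l x))) \<le> esz (l x) + esz (m x)"
      using esz_append[of "rev (take n (l x))" "m x"] foldl_Cons[of "\<lambda>y. y" "m x" "take n (l x)"]
        sz_pos[of "enc (drop n (l x))"] by simp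
  qed (intro fpt_intros pbt_intros assms)+
  moreover have "foldl (\<lambda>a y. y # a) zs ys = rev ys @ zs" for zs ys :: "'b list"
    using foldl_Cons[of "\<lambda>y. y"] by simp
  ultimately show ?thesis by simp
qed

lemma fpt_rev [fpt_intros]: "fpt l \<Longrightarrow> fpt (\<lambda>x. rev (l x))"
  using fpt_rev_append[OF _ fpt_const[of "[]"], of l] by simp

lemma fpt_append [fpt_intros]: "fpt l \<Longrightarrow> fpt m \<Longrightarrow> fpt (\<lambda>x. l x @ m x)"
  using fpt_rev_append[OF fpt_rev, of l m] by simp

lemma fpt_concat_map:
  fixes f :: "'x::enc \<Rightarrow> 'y::enc \<Rightarrow> 'z::enc list"
  assumes f: "fpt (\<lambda>p. f (fst p) (snd p))" and l: "fpt l"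
  shows "fpt (\<lambda>x. concat (map (f x) (l x)))"
proof -
  obtain b where b: "pb b" "\<And>p. esz (f (fst p) (snd p)) \<le> b (esz p)"
    using pbt_fpt[OF f] unfolding pbt_def by blast
  obtain k where k: "\<And>n. b n \<le> (n + 2) ^ k" using b(1) unfolding pb_def by blast
  have fb: "esz (f x y) \<le> (esz x + esz (l x) + 3) ^ k" if "y \<in> set (l x)" for x y
  proof -
    have "esz (f x y) \<le> (esz (x, y) + 2) ^ k"
      using b(2)[of "(x, y)"] k order_trans by (metis fst_conv snd_conv)
    also have "\<dots> \<le> (esz x + esz (l x) + 3) ^ k"
      using esz_mem[OF that] by (intro power_mono) (auto simp: esz_Pair)
    finally show ?thesis .
  qed
  have fold: "foldl (\<lambda>a y. a @ g y) zs ys = zs @ concat (map g ys)"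
    for g :: "'y \<Rightarrow> 'z list" and zs ys by (induction ys arbitrary: zs) auto
  have sz: "esz (concat (map g ys)) \<le> length ys * B + 1" if "\<And>y. y \<in> set ys \<Longrightarrow> esz (g y) \<le> B"
    for g :: "'y \<Rightarrow> 'z list" and ys B using that
  proof (induction ys)
    case (Cons y ys)
    then have "esz (g y) \<le> B" "esz (concat (map g ys)) \<le> length ys * B + 1" by simp_all
    then show ?case using esz_append[of "g y" "concat (map g ys)"] by simp
  qed (simp add: enc_simps)
  have "fpt (\<lambda>x. foldl (\<lambda>a y. a @ f x y) [] (l x))"
  proof (rule fpt_foldl[OF _ _ l, where h = "\<lambda>x. length (l x) * (esz x + esz (l x) + 3) ^ k + 1"])
    fix x n assume n: "n \<le> length (l x)"
    have "esz (concat (map (f x) (take n (l x)))) \<le> length (take n (l x)) * (esz x + esz (l x) + 3) ^ k + 1"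
      by (rule sz) (use fb in_set_takeD in fastforce)
    also have "\<dots> \<le> length (l x) * (esz x + esz (l x) + 3) ^ k + 1" by (intro add_right_mono mult_right_mono) auto
    finally show "esz (foldl (\<lambda>a y. a @ f x y) [] (take n (l x))) \<le> \<dots>" by (simp add: fold)
  next
    have "fpt (\<lambda>p :: ('x \<times> 'z list) \<times> 'y. f (fst (fst p)) (snd p))"
      by (rule fpt_comp2[OF f]) (intro fpt_intros)+
    then show "fpt (\<lambda>p :: ('x \<times> 'z list) \<times> 'y. snd (fst p) @ f (fst (fst p)) (snd p))"
      by (intro fpt_intros)
  qed (intro fpt_intros pbt_intros l)+
  then show ?thesis by (simp add: fold)
qed

lemma fpt_map [fpt_intros]:
  assumes "fpt (\<lambda>p. f (fst p) (snd p))" "fpt l"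
  shows "fpt (\<lambda>x. map (f x) (l x))"
proof -
  have "fpt (\<lambda>x. concat (map (\<lambda>y. [f x y]) (l x)))"
    by (rule fpt_concat_map) (intro fpt_intros assms)+
  moreover have "concat (map (\<lambda>y. [f x y]) ys) = map (f x) ys" for x ys by (induction ys) auto
  ultimately show ?thesis by simp
qed

lemma fpt_concat [fpt_intros]: "fpt l \<Longrightarrow> fpt (\<lambda>x. concat (l x))"
proof -
  assume "fpt l"
  then have "fpt (\<lambda>x. concat (map (\<lambda>y. y) (l x)))" by (rule fpt_concat_map[OF fpt_snd[OF fpt_id]])
  then show ?thesis by simp
qed

lemma fpt_filter [fpt_intros]:
  assumes "fpt (\<lambda>p. P (fst p) (snd p))" "fpt l"
  shows "fpt (\<lambda>x. filter (P x) (l x))"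
proof -
  have "fpt (\<lambda>x. concat (map (\<lambda>y. if P x y then [y] else []) (l x)))"
  proof (rule fpt_concat_map[OF _ assms(2)])
    show "fpt (\<lambda>p. if P (fst p) (snd p) then [snd p] else [])"
      by (rule fpt_if[OF assms(1)]) (intro fpt_intros)+
  qed
  moreover have "concat (map (\<lambda>y. if P x y then [y] else []) ys) = filter (P x) ys" for x ys
    by (induction ys) auto
  ultimately show ?thesis by simp
qed

lemma fpt_list_all [fpt_intros]:
  assumes "fpt (\<lambda>p. P (fst p) (snd p))" "fpt l"
  shows "fpt (\<lambda>x. list_all (P x) (l x))"
proof -
  have "fpt (\<lambda>x. filter (\<lambda>y. \<not> P x y) (l x) = [])" by (intro fpt_intros assms)
  then show ?thesis by (simp add: filter_empty_conv list_all_iff)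
qed

lemma fpt_ball [fpt_intros]:
  "fpt (\<lambda>p. P (fst p) (snd p)) \<Longrightarrow> fpt l \<Longrightarrow> fpt (\<lambda>x. \<forall>y\<in>set (l x). P x y)"
  using fpt_list_all[of P l] by (simp add: list_all_iff)

lemma fpt_bex [fpt_intros]:
  "fpt (\<lambda>p. P (fst p) (snd p)) \<Longrightarrow> fpt l \<Longrightarrow> fpt (\<lambda>x. \<exists>y\<in>set (l x). P x y)"
  using fpt_not[OF fpt_ball[of "\<lambda>x y. \<not> P x y" l, OF fpt_not]] by simp

text \<open>Equality of words, and from this equality in general.\<close>

lemma fpt_eq_word:
  fixes l m :: "'a::enc \<Rightarrow> bool list"
  assumes "fpt l" "fpt m"
  shows "fpt (\<lambda>x. l x = m x)"
proof -
  let ?f = "\<lambda>(s :: bool \<times> bool list) b. (fst s \<and> snd s \<noteq> [] \<and> (b \<longleftrightarrow> hd (snd s)), tl (snd s))"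
  have run: "foldl ?f (c, zs) ys = (c \<and> (\<exists>r. zs = ys @ r), drop (length ys) zs)" for c ys zs
  proof (induction ys arbitrary: c zs)
    case (Cons y ys)
    show ?case
    proof (cases zs)
      case Nil
      then show ?thesis using Cons.IH[of False "[]"] by simp
    next
      case (Cons z zs')
      then show ?thesis using Cons.IH[of "c \<and> (y \<longleftrightarrow> z)" zs'] by auto
    qed
  qed simp
  have esz_drop: "esz (drop n zs) \<le> esz zs" for n and zs :: "bool list"
    using esz_append[of "take n zs" "drop n zs"] sz_pos[of "enc (take n zs)"]
    unfolding append_take_drop_id by linarith
  have eszb: "esz b \<le> 3" for b :: bool by (cases b) (auto simp: enc_simps)
  have "fpt (\<lambda>x. foldl ?f (True, m x) (l x))"
  proof (rule fpt_foldl[OF _ _ assms(1), where h = "\<lambda>x. 4 + esz (m x)"])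
    show "esz (foldl ?f (True, m x) (take n (l x))) \<le> 4 + esz (m x)" for x n
      unfolding run esz_Pair using esz_drop[of "length (take n (l x))" "m x"]
        eszb[of "True \<and> (\<exists>r. m x = take n (l x) @ r)"] by linarith
  qed (intro fpt_intros fpt_iff pbt_intros assms)+
  then have "fpt (\<lambda>x. fst (foldl ?f (True, m x) (l x)) \<and> snd (foldl ?f (True, m x) (l x)) = [])"
    by (intro fpt_intros)
  moreover have "(True \<and> (\<exists>r. zs = ys @ r)) \<and> drop (length ys) zs = [] \<longleftrightarrow> ys = zs" for ys zs :: "bool list"
    by auto
  ultimately show ?thesis by (simp add: run)
qed

lemma code_inj: "code a @ r = code b @ r' \<Longrightarrow> a = b \<and> r = r'"
proof (induction a arbitrary: b r r')
  case Lf
  then show ?case by (cases b) auto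
next
  case (Nd a1 a2)
  obtain b1 b2 where b: "b = Nd b1 b2" using Nd.prems by (cases b) auto
  have "code a1 @ code a2 @ r = code b1 @ code b2 @ r'" using Nd.prems unfolding b by simp
  from Nd.IH(1)[OF this] have 1: "a1 = b1" "code a2 @ r = code b2 @ r'" by blast+
  from Nd.IH(2)[OF 1(2)] 1(1) b show ?case by blast
qed

lemma fpt_code: "fpt (\<lambda>x. code (enc x))"
  by (rule fptI[OF fp_flatten]) (simp add: blist_enc)

lemma fpt_eq [fpt_intros]:
  assumes "fpt f" "fpt g"
  shows "fpt (\<lambda>x. f x = g x)"
proof -
  have "fpt (\<lambda>x. code (enc (f x)) = code (enc (g x)))"
    by (intro fpt_eq_word fpt_comp[OF fpt_code] assms)
  moreover have "code (enc a) = code (enc b) \<longleftrightarrow> a = b" for a b :: 'b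
    using code_inj[of "enc a" "[]" "enc b" "[]"] enc_inj by auto
  ultimately show ?thesis by simp
qed

lemma fpt_mem [fpt_intros]: "fpt f \<Longrightarrow> fpt l \<Longrightarrow> fpt (\<lambda>x. f x \<in> set (l x))"
proof -
  assume f: "fpt f" and "fpt l"
  then have "fpt (\<lambda>x. \<exists>y\<in>set (l x). y = f x)" by (intro fpt_intros fpt_comp[OF f])
  then show ?thesis by simp
qed

text \<open>A function is immaterial outside of a finite set on which it may be tabulated.\<close>

lemma fpt_table:
  fixes f :: "'a::enc \<Rightarrow> 'b::enc"
  assumes "finite D"
  shows "\<exists>g. fpt g \<and> (\<forall>x\<in>D. g x = f x)"
  using assms
proof (induction rule: finite_induct)
  case empty
  then show ?case using fpt_const by blast
next
  case (insert d D)
  then obtain g where g: "fpt g" "\<forall>x\<in>D. g x = f x" by blast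
  have "fpt (\<lambda>x. if x = d then f d else g x)" by (intro fpt_intros g)
  then show ?case using g by (intro exI[of _ "\<lambda>x. if x = d then f d else g x"]) auto
qed

text \<open>Numbers in unary notation are lists over the unit type.\<close>

lemma fpt_replicate_length [fpt_intros]:
  "fpt f \<Longrightarrow> fpt l \<Longrightarrow> fpt (\<lambda>x. replicate (length (l x)) (f x))"
proof -
  assume f: "fpt f" and "fpt l"
  then have "fpt (\<lambda>x. map (\<lambda>_. f x) (l x))" by (intro fpt_intros fpt_comp[OF f])
  then show ?thesis by (simp add: map_replicate_const)
qed

lemma fpt_poly:
  assumes "fpt l"
  shows "fpt (\<lambda>x. replicate (poly p (length (l x))) ())"
proof (induction p)
  case 0
  then show ?case by (simp add: fpt_const)
next
  case (pCons a p)
  have "fpt (\<lambda>x. replicate a () @ concat (map (\<lambda>_. replicate (poly p (length (l x))) ()) (l x)))"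
    by (intro fpt_intros assms fpt_comp[OF pCons.IH])
  moreover have "concat (map (\<lambda>_. replicate c ()) (l x)) = replicate (length (l x) * c) ()" for c x
  proof -
    have "concat (replicate n (replicate c ())) = replicate (n * c) ()" for n
      by (induction n) (auto simp: replicate_add)
    then show ?thesis by (simp add: map_replicate_const)
  qed
  ultimately show ?case by (simp add: replicate_add)
qed

section \<open>Arithmetic in binary notation\<close>

text \<open>
  Omission of leading zeros, that is, of those at the end of the list.
\<close>

definition strip :: "bool list \<Rightarrow> bool list" where
  "strip bs = foldl (\<lambda>r b. if b \<or> r \<noteq> [] then b # r else []) [] (rev bs)"

lemma strip_simps: "strip [] = []" "strip (b # bs) = (if b \<or> strip bs \<noteq> [] then b # strip bs else [])"
  by (simp_all add: strip_def)

lemma nat_code_0 [simp]: "nat_code 0 = []"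
  by (subst nat_code.simps) simp

lemma nat_code_step: "of_bool b + 2 * n \<noteq> 0 \<Longrightarrow> nat_code (of_bool b + 2 * n) = b # nat_code n"
  by (subst nat_code.simps) auto

lemma nat_code_val: "nat_code (val bs) = strip bs"
proof (induction bs)
  case Nil
  then show ?case by (simp add: strip_simps)
next
  case (Cons b bs)
  have "strip bs = [] \<longleftrightarrow> val bs = 0"
    using Cons val_nat_code[of "val bs"] by (metis nat_code_0 val.simps(1))
  then show ?case
    using Cons nat_code_step[of b "val bs"] by (cases b) (auto simp: strip_simps)
qed

lemma esz_word: "esz bs \<le> 4 * length bs + 1" for bs :: "bool list"
  using sz_blist(2)[of bs] by (simp add: blist_enc)

lemma foldl_strip_length: "length (foldl (\<lambda>r b. if b \<or> r \<noteq> [] then b # r else []) r bs) \<le> length r + length bs"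
proof (induction bs arbitrary: r)
  case (Cons b bs)
  show ?case using Cons.IH[of "if b \<or> r \<noteq> [] then b # r else []"] by (auto split: if_splits)
qed simp

lemma fpt_strip: "fpt strip"
  unfolding strip_def
proof (rule fpt_foldl[where h = "\<lambda>bs. 4 * length bs + 1"])
  fix bs :: "bool list" and n
  have "length (foldl (\<lambda>r b. if b \<or> r \<noteq> [] then b # r else []) [] (take n (rev bs))) \<le> length bs"
    using foldl_strip_length[of "[]" "take n (rev bs)"] by simp
  then show "esz (foldl (\<lambda>r b. if b \<or> r \<noteq> [] then b # r else []) [] (take n (rev bs))) \<le> 4 * length bs + 1"
    using esz_word[of "foldl (\<lambda>r b. if b \<or> r \<noteq> [] then b # r else []) [] (take n (rev bs))"] by linarith
qed (intro fpt_intros pbt_intros)+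

lemma fpt_val' : "fpt val"
proof -
  obtain F where F: "fp (Enc strip) F" "\<And>x. F (enc x) = enc (strip x)" using fpt_strip by (rule fptE) blast
  show ?thesis by (rule fptI[OF F(1)]) (simp add: F(2) enc_nat_def nat_code_val)
qed

lemma fpt_nat_code' : "fpt nat_code"
  by (rule fptI[OF fp_id]) (simp add: enc_nat_def)

lemmas fpt_val [fpt_intros] = fpt_comp[OF fpt_val']
lemmas fpt_nat_code [fpt_intros] = fpt_comp[OF fpt_nat_code']

subsection \<open>The number of binary digits\<close>

abbreviation blen :: "nat \<Rightarrow> nat" where
  "blen n \<equiv> length (nat_code n)"

lemma val_less: "val bs < 2 ^ length bs"
  by (induction bs) (auto split: if_splits simp: of_bool_def)

lemma blen_le_iff: "blen n \<le> k \<longleftrightarrow> n < 2 ^ k"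
proof (induction k arbitrary: n)
  case 0
  show ?case using nat_code_0 val_nat_code[of n] by auto
next
  case (Suc k)
  show ?case
  proof (cases "n = 0")
    case False
    then have "blen n = Suc (blen (n div 2))" by (subst nat_code.simps) simp
    then show ?thesis using Suc[of "n div 2"] by (simp add: less_mult_imp_div_less) linarith
  qed simp
qed

lemma less_blen: "n < 2 ^ blen n"
  using blen_le_iff[of n "blen n"] by simp

lemma blen_mono: "m \<le> n \<Longrightarrow> blen m \<le> blen n"
  using less_blen[of n] by (simp add: blen_le_iff)

lemma blen_mult: "blen (m * n) \<le> blen m + blen n"
  unfolding blen_le_iff power_add
  using less_blen[of m] less_blen[of n] by (intro mult_strict_mono) auto

lemma blen_le: "blen n \<le> n"
  by (simp add: blen_le_iff less_exp)

lemma esz_nat: "blen n < esz n" "esz n \<le> 4 * blen n + 1"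
  using esz_word[of "nat_code n"] length_le_esz[of "nat_code n"] by (simp_all add: enc_nat_def)

subsection \<open>Addition and subtraction\<close>

text \<open>
  One step of the school methods: the state consists of the carry, what is left of the two summands
  and the digits of the result in reverse order.  The new carry is given by \<open>k\<close>.
\<close>

type_synonym bst = "bool \<times> bool list \<times> bool list \<times> bool list"

definition bit0 :: "bool list \<Rightarrow> bool" where
  "bit0 xs \<longleftrightarrow> xs \<noteq> [] \<and> hd xs"

definition bstep :: "(bool \<Rightarrow> bool \<Rightarrow> bool \<Rightarrow> bool) \<Rightarrow> bst \<Rightarrow> bst" where
  "bstep k s = (let c = fst s; xs = fst (snd s); ys = fst (snd (snd s)); out = snd (snd (snd s)) in
     (k (bit0 xs) (bit0 ys) c, tl xs, tl ys, (bit0 xs \<noteq> (bit0 ys \<noteq> c)) # out))"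

lemma val_bit0: "val xs = of_bool (bit0 xs) + 2 * val (tl xs)"
  by (cases xs) (auto simp: bit0_def)

lemma val_snoc: "val (xs @ [b]) = val xs + 2 ^ length xs * of_bool b"
  by (induction xs) (auto simp: algebra_simps)

text \<open>
  The state after all digits have been processed.
\<close>

definition bop :: "(bool \<Rightarrow> bool \<Rightarrow> bool \<Rightarrow> bool) \<Rightarrow> nat \<Rightarrow> nat \<Rightarrow> bst" where
  "bop k m n = foldl (\<lambda>s _. bstep k s) (False, nat_code m, nat_code n, []) (nat_code m @ nat_code n)"

lemma bop_shape:
  fixes us :: "bool list"
  shows "fst (snd (foldl (\<lambda>s _. bstep k s) s us)) = drop (length us) (fst (snd s)) \<and>
    fst (snd (snd (foldl (\<lambda>s _. bstep k s) s us))) = drop (length us) (fst (snd (snd s))) \<and>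
    length (snd (snd (snd (foldl (\<lambda>s _. bstep k s) s us)))) = length us + length (snd (snd (snd s)))"
  by (induction us arbitrary: s) (auto simp: bstep_def Let_def drop_Suc)

lemma bop_inv:
  assumes "\<And>s. I (bstep k s) = I s"
  shows "I (foldl (\<lambda>s _. bstep k s) s us) = I s"
  by (induction us arbitrary: s) (auto simp: assms)

lemma fpt_bop:
  assumes "fpt (\<lambda>p. k (fst p) (fst (snd p)) (snd (snd p)))"
  shows "fpt (\<lambda>p. bop k (fst p) (snd p))"
  unfolding bop_def
proof (rule fpt_foldl[where h = "\<lambda>p. 4 * (3 + 4 * (4 * (blen (fst p) + blen (snd p)) + 10))"])
  fix p :: "nat \<times> nat" and n
  let ?us = "take n (nat_code (fst p) @ nat_code (snd p))"
  let ?s = "foldl (\<lambda>s _. bstep k s) (False, nat_code (fst p), nat_code (snd p), []) ?us"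
  obtain c xs ys out where s: "?s = (c, xs, ys, out)" by (metis surj_pair)
  have l: "length xs \<le> blen (fst p)" "length ys \<le> blen (snd p)" "length out \<le> blen (fst p) + blen (snd p)"
    using bop_shape[of k "(False, nat_code (fst p), nat_code (snd p), [])" ?us] unfolding s by auto
  have "esz c \<le> 3" by (cases c) (auto simp: enc_simps)
  then show "esz ?s \<le> 4 * (3 + 4 * (4 * (blen (fst p) + blen (snd p)) + 10))"
    unfolding s esz_Pair using l esz_word[of xs] esz_word[of ys] esz_word[of out] by simp
next
  have b: "fpt (\<lambda>x. bit0 (l x))" if "fpt l" for l :: "'z::enc \<Rightarrow> bool list"
    unfolding bit0_def by (intro fpt_intros that)
  have k: "fpt (\<lambda>x. k (a x) (b x) (c x))" if "fpt a" "fpt b" "fpt c" for a b c :: "'z::enc \<Rightarrow> bool"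
    using fpt_comp[OF assms fpt_Pair[OF that(1) fpt_Pair[OF that(2,3)]]] by simp
  show "fpt (\<lambda>p :: ((nat \<times> nat) \<times> bst) \<times> bool. bstep k (snd (fst p)))"
    unfolding bstep_def Let_def by (intro fpt_intros k b)
qed (intro fpt_intros pbt_intros)+

definition maj :: "bool \<Rightarrow> bool \<Rightarrow> bool \<Rightarrow> bool" where
  "maj a b c \<longleftrightarrow> (a \<and> b) \<or> (c \<and> (a \<or> b))"

lemma bop_add: "m + n = val (rev (snd (snd (snd (bop maj m n)))) @ [fst (bop maj m n)])"
proof -
  define I :: "bst \<Rightarrow> nat" where "I s = val (rev (snd (snd (snd s)))) + 2 ^ length (snd (snd (snd s))) *
      (of_bool (fst s) + val (fst (snd s)) + val (fst (snd (snd s))))" for s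
  have I: "I (bstep maj s) = I s" for s
  proof -
    obtain c xs ys out where s: "s = (c, xs, ys, out)" by (metis surj_pair)
    have "2 ^ length out * (of_bool (bit0 xs \<noteq> (bit0 ys \<noteq> c)) + 2 * of_bool (maj (bit0 xs) (bit0 ys) c))
        = (2 ^ length out * (of_bool c + of_bool (bit0 xs) + of_bool (bit0 ys)) :: nat)"
      by (auto simp: maj_def)
    then show ?thesis
      unfolding s I_def bstep_def Let_def using val_bit0[of xs] val_bit0[of ys]
      by (simp add: val_snoc algebra_simps)
  qed
  have "I (bop maj m n) = m + n"
    unfolding bop_def bop_inv[of I, OF I] by (simp add: I_def val_nat_code)
  moreover have "fst (snd (bop maj m n)) = []" "fst (snd (snd (bop maj m n))) = []"
    unfolding bop_def using bop_shape[of maj "(False, nat_code m, nat_code n, [])" "nat_code m @ nat_code n"]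
    by auto
  ultimately show ?thesis by (simp add: I_def val_snoc)
qed

lemma fpt_add [fpt_intros]:
  fixes f g :: "'a::enc \<Rightarrow> nat"
  assumes "fpt f" "fpt g"
  shows "fpt (\<lambda>x. f x + g x)"
proof -
  have "fpt (\<lambda>p. bop maj (fst p) (snd p))" by (rule fpt_bop) (unfold maj_def, intro fpt_intros)
  from fpt_comp[OF this fpt_Pair[OF assms]] have "fpt (\<lambda>x. bop maj (f x) (g x))" by simp
  then have "fpt (\<lambda>x. val (rev (snd (snd (snd (bop maj (f x) (g x))))) @ [fst (bop maj (f x) (g x))]))"
    by (intro fpt_intros)
  then show ?thesis by (simp only: bop_add[symmetric])
qed

lemma fpt_Suc [fpt_intros]: "fpt f \<Longrightarrow> fpt (\<lambda>x. Suc (f x))"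
  using fpt_add[OF _ fpt_const[of 1], of f] by simp

definition borrow :: "bool \<Rightarrow> bool \<Rightarrow> bool \<Rightarrow> bool" where
  "borrow a b c \<longleftrightarrow> (b \<and> c) \<or> (\<not> a \<and> (b \<or> c))"

lemma bop_sub: "m - n = (if fst (bop borrow m n) then 0 else val (rev (snd (snd (snd (bop borrow m n))))))"
proof -
  define I :: "bst \<Rightarrow> int" where "I s = int (val (rev (snd (snd (snd s))))) + 2 ^ length (snd (snd (snd s))) *
      (int (val (fst (snd s))) - int (val (fst (snd (snd s)))) - of_bool (fst s))" for s
  have I: "I (bstep borrow s) = I s" for s
  proof -
    obtain c xs ys out where s: "s = (c, xs, ys, out)" by (metis surj_pair)
    have "2 ^ length out * (of_bool (bit0 xs \<noteq> (bit0 ys \<noteq> c)) - 2 * of_bool (borrow (bit0 xs) (bit0 ys) c))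
        = (2 ^ length out * (of_bool (bit0 xs) - of_bool (bit0 ys) - of_bool c) :: int)"
      by (auto simp: borrow_def)
    then show ?thesis
      unfolding s I_def bstep_def Let_def using val_bit0[of xs] val_bit0[of ys]
      by (simp add: val_snoc algebra_simps)
  qed
  let ?b = "bop borrow m n"
  have 1: "I ?b = int m - int n"
    unfolding bop_def bop_inv[of I, OF I] by (simp add: I_def val_nat_code)
  have 2: "fst (snd ?b) = []" "fst (snd (snd ?b)) = []"
    unfolding bop_def using bop_shape[of borrow "(False, nat_code m, nat_code n, [])" "nat_code m @ nat_code n"]
    by auto
  have "val (rev (snd (snd (snd ?b)))) < 2 ^ length (snd (snd (snd ?b)))"
    using val_less[of "rev (snd (snd (snd ?b)))"] by simp
  then have 3: "int (val (rev (snd (snd (snd ?b))))) < 2 ^ length (snd (snd (snd ?b)))"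
    by (metis of_nat_less_iff of_nat_numeral of_nat_power)
  show ?thesis
  proof (cases "fst ?b")
    case True
    then have "int (val (rev (snd (snd (snd ?b))))) - 2 ^ length (snd (snd (snd ?b))) = int m - int n"
      using 1 2 by (simp add: I_def)
    then have "int m < int n" using 3 by linarith
    then show ?thesis using True by simp
  next
    case False
    then have "int (val (rev (snd (snd (snd ?b))))) = int m - int n" using 1 2 by (simp add: I_def)
    then show ?thesis using False by simp
  qed
qed

lemma fpt_diff [fpt_intros]:
  fixes f g :: "'a::enc \<Rightarrow> nat"
  assumes "fpt f" "fpt g"
  shows "fpt (\<lambda>x. f x - g x)"
proof -
  have "fpt (\<lambda>p. bop borrow (fst p) (snd p))" by (rule fpt_bop) (unfold borrow_def, intro fpt_intros)
  from fpt_comp[OF this fpt_Pair[OF assms]] have "fpt (\<lambda>x. bop borrow (f x) (g x))" by simp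
  then have "fpt (\<lambda>x. if fst (bop borrow (f x) (g x)) then 0
      else val (rev (snd (snd (snd (bop borrow (f x) (g x)))))))"
    by (intro fpt_intros)
  then show ?thesis by (simp only: bop_sub[symmetric])
qed

lemma fpt_le [fpt_intros]: "fpt f \<Longrightarrow> fpt g \<Longrightarrow> fpt (\<lambda>x. f x \<le> g x)" for f g :: "'a::enc \<Rightarrow> nat"
  using fpt_eq[OF fpt_diff fpt_const[of 0], of f g] by simp

lemma fpt_less [fpt_intros]: "fpt f \<Longrightarrow> fpt g \<Longrightarrow> fpt (\<lambda>x. f x < g x)" for f g :: "'a::enc \<Rightarrow> nat"
  using fpt_not[OF fpt_le, of g f] by (simp add: not_le)

subsection \<open>Multiplication and division\<close>

lemma foldl_mult: "foldl (\<lambda>a b. a + a + (if b then n else 0)) 0 (rev bs) = val bs * n"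
  by (induction bs) (auto simp: algebra_simps)

lemma rev_take: "take k (rev bs) = rev (drop (length bs - k) bs)"
  by (cases "k \<le> length bs") (auto simp: rev_drop)

lemma val_drop_le: "val (drop k bs) \<le> val bs"
proof (induction bs arbitrary: k)
  case (Cons b bs)
  show ?case
  proof (cases k)
    case (Suc j)
    then show ?thesis using Cons[of j] by simp
  qed simp
qed simp

lemma fpt_mult [fpt_intros]:
  fixes f g :: "'a::enc \<Rightarrow> nat"
  assumes "fpt f" "fpt g"
  shows "fpt (\<lambda>x. f x * g x)"
proof -
  have "fpt (\<lambda>x. foldl (\<lambda>a b. a + a + (if b then g x else 0)) 0 (rev (nat_code (f x))))"
  proof (rule fpt_foldl[where h = "\<lambda>x. 4 * (blen (f x) + blen (g x)) + 1"])
    fix x n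
    let ?a = "foldl (\<lambda>a b. a + a + (if b then g x else 0)) 0 (take n (rev (nat_code (f x))))"
    have a: "?a \<le> f x * g x"
      unfolding rev_take foldl_mult using val_drop_le[of _ "nat_code (f x)"] by (simp add: val_nat_code)
    show "esz ?a \<le> 4 * (blen (f x) + blen (g x)) + 1"
      using esz_nat(2)[of ?a] blen_mono[OF a] blen_mult[of "f x" "g x"] by simp
  qed (intro fpt_intros pbt_intros assms fpt_comp[OF assms(2)])+
  then show ?thesis by (simp add: foldl_mult val_nat_code)
qed

text \<open>
  One step of long division by \<open>n\<close>: quotient and remainder after one more digit.
\<close>

definition divstep :: "nat \<Rightarrow> nat \<times> nat \<Rightarrow> bool \<Rightarrow> nat \<times> nat" where
  "divstep n s b = (let r = 2 * snd s + (if b then 1 else 0) in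
     if n \<le> r then (2 * fst s + 1, r - n) else (2 * fst s, r))"

lemma foldl_div:
  assumes "n > 0"
  shows "foldl (divstep n) (0, 0) (rev bs) = (val bs div n, val bs mod n)"
proof (induction bs)
  case (Cons b bs)
  have r: "val bs mod n < n" "val bs = n * (val bs div n) + val bs mod n" using assms by auto
  let ?q = "val bs div n" and ?r = "2 * (val bs mod n) + (if b then 1 else 0)"
  have e: "val (b # bs) = n * (2 * ?q) + ?r" proof -
    have "2 * val bs = n * (2 * ?q) + 2 * (val bs mod n)"
      using mult_div_mod_eq[of n "val bs"] by (metis distrib_left mult.left_commute)
    then show ?thesis by simp
  qed
  have "foldl (divstep n) (0, 0) (rev (b # bs)) = divstep n (?q, val bs mod n) b" by (simp add: Cons)
  moreover have "(val (b # bs) div n, val (b # bs) mod n) = (if n \<le> ?r then (2 * ?q + 1, ?r - n) else (2 * ?q, ?r))"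
  proof (cases "n \<le> ?r")
    case True
    define R where "R = ?r - n"
    have 1: "val (b # bs) = n * (2 * ?q + 1) + R" using True e by (simp add: algebra_simps R_def)
    have 2: "R < n" using r(1) True by (auto simp: R_def split: if_splits)
    have "val (b # bs) div n = 2 * ?q + 1" "val (b # bs) mod n = R"
    proof -
      have "(n * k + R) div n = k" "(n * k + R) mod n = R" for k using 2 by simp_all
      then show "val (b # bs) div n = 2 * ?q + 1" "val (b # bs) mod n = R" unfolding 1 by blast+
    qed
    then show ?thesis using True by (simp only: R_def if_True)
  next
    case False
    then show ?thesis unfolding e using assms by (simp add: mult.commute[of n])
  qed
  moreover have "divstep n (?q, val bs mod n) b = (if n \<le> ?r then (2 * ?q + 1, ?r - n) else (2 * ?q, ?r))"
    by (simp only: divstep_def Let_def fst_conv snd_conv)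
  ultimately show ?case by (simp only:)
qed simp

lemma fpt_divmod:
  fixes f g :: "'a::enc \<Rightarrow> nat"
  assumes "fpt f" "fpt g" "\<And>x. g x > 0"
  shows "fpt (\<lambda>x. (f x div g x, f x mod g x))"
proof -
  have "fpt (\<lambda>x. foldl (divstep (g x)) (0, 0) (rev (nat_code (f x))))"
  proof (rule fpt_foldl[where h = "\<lambda>x. 8 * blen (f x) + 3"])
    fix x n
    let ?v = "val (drop (blen (f x) - n) (nat_code (f x)))"
    have "?v \<le> f x" using val_drop_le[of _ "nat_code (f x)"] by (simp add: val_nat_code)
    then have "?v div g x \<le> f x" "?v mod g x \<le> f x"
      using div_le_dividend[of ?v "g x"] mod_less_eq_dividend[of ?v "g x"] by linarith+
    then have "blen (?v div g x) \<le> blen (f x)" "blen (?v mod g x) \<le> blen (f x)" by (auto intro: blen_mono)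
    then show "esz (foldl (divstep (g x)) (0, 0) (take n (rev (nat_code (f x))))) \<le> 8 * blen (f x) + 3"
      unfolding rev_take foldl_div[OF assms(3)] esz_Pair
      using esz_nat(2)[of "?v div g x"] esz_nat(2)[of "?v mod g x"] by linarith
  next
    show "fpt (\<lambda>p :: ('a \<times> nat \<times> nat) \<times> bool. divstep (g (fst (fst p))) (snd (fst p)) (snd p))"
      unfolding divstep_def Let_def by (intro fpt_intros fpt_comp[OF assms(2)])
  qed (intro fpt_intros pbt_intros assms)+
  then show ?thesis by (simp add: foldl_div[OF assms(3)] val_nat_code)
qed

lemma fpt_div [fpt_intros]:
  fixes f g :: "'a::enc \<Rightarrow> nat"
  assumes "fpt f" "fpt g"
  shows "fpt (\<lambda>x. f x div g x)"
proof -
  have "fpt (\<lambda>x. (f x div (if g x = 0 then 1 else g x), f x mod (if g x = 0 then 1 else g x)))"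
    by (rule fpt_divmod) ((intro fpt_intros assms)+, simp)
  then have "fpt (\<lambda>x. if g x = 0 then 0 else fst (f x div (if g x = 0 then 1 else g x), f x mod (if g x = 0 then 1 else g x)))"
    by (intro fpt_if fpt_fst fpt_eq fpt_const assms)
  moreover have "(\<lambda>x. if g x = 0 then 0 else fst (f x div (if g x = 0 then 1 else g x), f x mod (if g x = 0 then 1 else g x)))
      = (\<lambda>x. f x div g x)" by auto
  ultimately show ?thesis by simp
qed

subsection \<open>Numbers and lists\<close>

lemma fpt_length [fpt_intros]: "fpt l \<Longrightarrow> fpt (\<lambda>x. length (l x))"
proof -
  assume l: "fpt l"
  have f: "foldl (\<lambda>a _. a + 1) a ys = a + length ys" for a :: nat and ys :: "'b list"
    by (induction ys arbitrary: a) auto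
  have "fpt (\<lambda>x. foldl (\<lambda>a _. a + 1) (0 :: nat) (l x))"
  proof (rule fpt_foldl[OF _ _ l, where h = "\<lambda>x. 4 * length (l x) + 1"])
    show "esz (foldl (\<lambda>a _. a + 1) (0 :: nat) (take n (l x))) \<le> 4 * length (l x) + 1" for x n
      unfolding f using esz_nat(2)[of "0 + length (take n (l x))"] blen_le[of "0 + length (take n (l x))"] by auto
  qed (intro fpt_intros pbt_intros l)+
  from this[unfolded f] show ?thesis by simp
qed

lemma fpt_upt [fpt_intros]: "fpt l \<Longrightarrow> fpt (\<lambda>x. [0..<length (l x)])"
proof -
  assume l: "fpt l"
  have f: "foldl (\<lambda>a _. a @ [length a]) [0..<k] ys = [0..<k + length ys]" for k :: nat and ys :: "'b list"
  proof (induction ys arbitrary: k)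
    case (Cons y ys)
    have "[0..<k] @ [length [0..<k]] = [0..<Suc k]" by simp
    then show ?case using Cons[of "Suc k"] by simp
  qed simp
  have f0: "foldl (\<lambda>a _. a @ [length a]) [] ys = [0..<length ys]" for ys :: "'b list"
    using f[of 0 ys] by simp
  have "fpt (\<lambda>x. foldl (\<lambda>a _. a @ [length a]) [] (l x))"
  proof (rule fpt_foldl[OF _ _ l, where h = "\<lambda>x. length (l x) * (4 * length (l x) + 1 + 1) + 1"])
    fix x n
    let ?k = "length (take n (l x))"
    have "esz i \<le> 4 * length (l x) + 1" if "i \<in> set [0..<?k]" for i
      using esz_nat(2)[of i] blen_le[of i] that by auto
    then have "esz [0..<?k] \<le> length [0..<?k] * (4 * length (l x) + 1 + 1) + 1" by (rule esz_list_le)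
    also have "\<dots> \<le> length (l x) * (4 * length (l x) + 1 + 1) + 1" by (intro add_right_mono mult_right_mono) auto
    finally show "esz (foldl (\<lambda>a _. a @ [length a]) [] (take n (l x))) \<le> \<dots>" by (simp add: f0)
  qed (intro fpt_intros pbt_intros l)+
  then show ?thesis by (simp add: f0)
qed

lemma fpt_power [fpt_intros]:
  fixes f :: "'a::enc \<Rightarrow> nat"
  assumes "fpt f" "fpt l"
  shows "fpt (\<lambda>x. f x ^ length (l x))"
proof -
  have f: "foldl (\<lambda>a _. a * b) 1 ys = b ^ length ys" for b :: nat and ys :: "'b list"
    by (induction ys rule: rev_induct) auto
  have bl: "blen (b ^ k) \<le> k * blen b + 1" for b k
  proof (induction k)
    case 0
    then show ?case by (simp add: blen_le_iff)
  next
    case (Suc k)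
    then show ?case using blen_mult[of b "b ^ k"] by simp
  qed
  have "fpt (\<lambda>x. foldl (\<lambda>a _. a * f x) 1 (l x))"
  proof (rule fpt_foldl[OF _ _ assms(2), where h = "\<lambda>x. 4 * (length (l x) * blen (f x) + 1) + 1"])
    fix x n
    let ?k = "length (take n (l x))"
    have "?k * blen (f x) \<le> length (l x) * blen (f x)" by (intro mult_right_mono) auto
    then show "esz (foldl (\<lambda>a _. a * f x) 1 (take n (l x))) \<le> 4 * (length (l x) * blen (f x) + 1) + 1"
      unfolding f using order_trans[OF bl[of "f x" ?k], of "length (l x) * blen (f x) + 1"]
        esz_nat(2)[of "f x ^ ?k"] by simp
  qed (intro fpt_intros pbt_intros assms fpt_comp[OF assms(1)])+
  from this[unfolded f] show ?thesis by simp
qed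

lemma fpt_prod_list [fpt_intros]:
  fixes l :: "'a::enc \<Rightarrow> nat list"
  assumes "fpt l"
  shows "fpt (\<lambda>x. prod_list (l x))"
proof -
  have f: "foldl (\<lambda>a y. a * y) b ys = b * prod_list ys" for b :: nat and ys
    by (induction ys arbitrary: b) auto
  have bl: "blen (prod_list ys) \<le> length ys * B + 1" if "\<And>y. y \<in> set ys \<Longrightarrow> blen y \<le> B" for ys B
    using that
  proof (induction ys)
    case Nil
    then show ?case by (simp add: blen_le_iff)
  next
    case (Cons y ys)
    then show ?case using blen_mult[of y "prod_list ys"] by fastforce
  qed
  have "fpt (\<lambda>x. foldl (\<lambda>a y. a * y) 1 (l x))"
  proof (rule fpt_foldl[OF _ _ assms, where h = "\<lambda>x. 4 * (length (l x) * esz (l x) + 1) + 1"])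
    fix x n
    let ?ys = "take n (l x)"
    have "blen (prod_list ?ys) \<le> length ?ys * esz (l x) + 1"
    proof (rule bl)
      show "blen y \<le> esz (l x)" if "y \<in> set ?ys" for y
        using esz_nat(1)[of y] esz_mem[OF in_set_takeD[OF that]] by linarith
    qed
    also have "\<dots> \<le> length (l x) * esz (l x) + 1" by (intro add_right_mono mult_right_mono) auto
    finally show "esz (foldl (\<lambda>a y. a * y) 1 ?ys) \<le> 4 * (length (l x) * esz (l x) + 1) + 1"
      unfolding f using esz_nat(2)[of "1 * prod_list ?ys"] by simp
  qed (intro fpt_intros pbt_intros assms)+
  then show ?thesis by (simp add: f)
qed

lemma fpt_zip [fpt_intros]:
  fixes l :: "'a::enc \<Rightarrow> 'b::enc list" and m :: "'a \<Rightarrow> 'c::enc list"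
  assumes "fpt l" "fpt m"
  shows "fpt (\<lambda>x. zip (l x) (m x))"
proof -
  let ?f = "\<lambda>(s :: ('b \<times> 'c) list \<times> 'c list) y.
    if snd s = [] then s else (fst s @ [(y, hd (snd s))], tl (snd s))"
  have f: "foldl ?f (a, zs) ys = (a @ zip ys zs, drop (length ys) zs)" for a zs ys
  proof (induction ys arbitrary: a zs)
    case (Cons y ys)
    show ?case using Cons[of a "[]"] Cons[of "a @ [(y, hd zs)]" "tl zs"] by (cases zs) auto
  qed simp
  have sub: "esz (drop n zs) \<le> esz zs" for n and zs :: "'c list"
    using esz_append[of "take n zs" "drop n zs"] sz_pos[of "enc (take n zs)"]
    unfolding append_take_drop_id by linarith
  have "fpt (\<lambda>x. foldl ?f ([], m x) (l x))"
  proof (rule fpt_foldl[OF _ _ assms(1), where h = "\<lambda>x. length (l x) * (esz (l x) + esz (m x) + 1 + 1) + 1 + esz (m x) + 1"])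
    fix x n
    let ?ys = "take n (l x)"
    have "esz p \<le> esz (l x) + esz (m x) + 1" if "p \<in> set (zip ?ys (m x))" for p
    proof -
      obtain u v where p: "p = (u, v)" by (cases p)
      then have "u \<in> set (l x)" "v \<in> set (m x)"
        using that set_zip_leftD[of u v ?ys "m x"] set_zip_rightD[of u v ?ys "m x"] in_set_takeD by fastforce+
      then show ?thesis using esz_mem[of u "l x"] esz_mem[of v "m x"] by (simp add: p esz_Pair)
    qed
    then have "esz (zip ?ys (m x)) \<le> length (zip ?ys (m x)) * (esz (l x) + esz (m x) + 1 + 1) + 1"
      by (rule esz_list_le)
    also have "\<dots> \<le> length (l x) * (esz (l x) + esz (m x) + 1 + 1) + 1"
      by (intro add_right_mono mult_right_mono) auto
    finally show "esz (foldl ?f ([], m x) ?ys)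
        \<le> length (l x) * (esz (l x) + esz (m x) + 1 + 1) + 1 + esz (m x) + 1"
      unfolding f esz_Pair using sub[of "length ?ys" "m x"] by simp
  qed (intro fpt_intros pbt_intros assms)+
  then have "fpt (\<lambda>x. fst (foldl ?f ([], m x) (l x)))" by (intro fpt_intros)
  then show ?thesis by (simp add: f)
qed

text \<open>The element of a list with a given index, or a default value.\<close>

definition nthd :: "'a \<Rightarrow> 'a list \<Rightarrow> nat \<Rightarrow> 'a" where
  "nthd d xs n = (if n < length xs then xs ! n else d)"

lemma nthd_nth [simp]: "n < length xs \<Longrightarrow> nthd d xs n = xs ! n"
  by (simp add: nthd_def)

lemma fpt_nthd [fpt_intros]:
  fixes l :: "'a::enc \<Rightarrow> 'b::enc list"
  assumes "fpt d" "fpt l" "fpt f"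
  shows "fpt (\<lambda>x. nthd (d x) (l x) (f x))"
proof -
  have *: "filter (\<lambda>p. fst p = n) (zip [k..<k + length xs] xs) = (if k \<le> n \<and> n < k + length xs then [(n, xs ! (n - k))] else [])"
    for n k and xs :: "'b list"
  proof (induction xs arbitrary: k)
    case (Cons y ys)
    show ?case using Cons[of "Suc k"] by (auto simp: upt_rec[of k] nth_Cons' Suc_le_eq)
  qed simp
  have e: "nthd d xs n = snd (hd (filter (\<lambda>p. fst p = n) (zip [0..<length xs] xs) @ [(0, d)]))"
    for d n and xs :: "'b list"
    using *[of n 0 xs] by (simp add: nthd_def)
  show ?thesis unfolding e by (intro fpt_intros assms fpt_comp[OF assms(3)])
qed

section \<open>Counting solutions of linear systems over the field with two elements\<close>

lemma finite_UNIV_bit: "finite (UNIV :: bit set)" and card_UNIV_bit: "card (UNIV :: bit set) = 2"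
proof -
  have "x = 0 \<or> x = 1" for x :: bit by (cases x) auto
  then have U: "(UNIV :: bit set) = {0, 1}" by auto
  show "finite (UNIV :: bit set)" unfolding U by simp
  show "card (UNIV :: bit set) = 2" unfolding U by simp
qed

lemma card_subspace_bit:
  assumes "vectorspace class_ring W" "vectorspace.fin_dim class_ring W"
  shows "finite (carrier W) \<and> card (carrier W) = 2 ^ vectorspace.dim (class_ring :: bit ring) W"
proof -
  interpret W: vectorspace "class_ring :: bit ring" W by fact
  obtain B where B: "finite B" "W.basis B" using W.finite_basis_exists[OF assms(2)] by blast
  have BW: "B \<subseteq> carrier W" using B(2) unfolding W.basis_def by blast
  let ?F = "B \<rightarrow>\<^sub>E (UNIV :: bit set)"
  have CU: "carrier (class_ring :: bit ring) = UNIV" by (simp add: class_ring_simps)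
  have crit: "\<forall>v. v \<in> carrier W \<longrightarrow> (\<exists>!a. a \<in> ?F \<and> W.lincomb a B = v)"
    by (insert W.basis_criterion[OF B(1) BW] B(2)) (simp only: CU)
  have "bij_betw (\<lambda>a. W.lincomb a B) ?F (carrier W)"
    unfolding bij_betw_def
  proof (intro conjI)
    have cl: "W.lincomb a B \<in> carrier W" for a
      by (rule W.lincomb_closed[OF BW]) (simp add: CU)
    show "inj_on (\<lambda>a. W.lincomb a B) ?F" using crit cl by (intro inj_onI) metis
    show "(\<lambda>a. W.lincomb a B) ` ?F = carrier W" using crit cl by (auto simp: image_iff)
  qed
  moreover have "finite ?F" "card ?F = 2 ^ card B"
    using B(1) by (auto intro!: finite_PiE simp: card_PiE card_UNIV_bit finite_UNIV_bit)
  moreover have "W.dim = card B" using W.dim_basis[OF B] .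
  ultimately show ?thesis using bij_betw_same_card[of _ ?F "carrier W"] bij_betw_finite[of _ ?F "carrier W"] by fastforce
qed

text \<open>
  The theorem on rank and nullity, in terms of cardinalities.
\<close>

lemma card_kernel_bit:
  fixes A :: "bit mat"
  assumes A: "A \<in> carrier_mat m n"
  shows "card {v \<in> carrier_vec n. A *\<^sub>v v = 0\<^sub>v m} * 2 ^ vec_space.rank m A = (2 :: nat) ^ n"
proof -
  interpret V: vec_space "TYPE(bit)" m .
  let ?C = "carrier_vec n :: bit vec set" and ?K = "{v \<in> carrier_vec n. A *\<^sub>v v = 0\<^sub>v m}"
  have bij: "bij_betw (\<lambda>f. vec n f) ({..<n} \<rightarrow>\<^sub>E (UNIV :: bit set)) ?C"
  proof (rule bij_betwI')
    show "(vec n f = vec n g) = (f = g)" if "f \<in> {..<n} \<rightarrow>\<^sub>E UNIV" "g \<in> {..<n} \<rightarrow>\<^sub>E UNIV" for f g :: "nat \<Rightarrow> bit"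
      using PiE_ext[OF that] by (auto simp: vec_eq_iff)
    show "\<exists>f\<in>{..<n} \<rightarrow>\<^sub>E UNIV. v = vec n f" if "v \<in> ?C" for v
      by (rule bexI[of _ "\<lambda>i\<in>{..<n}. v $ i"]) (use that in \<open>auto intro!: eq_vecI\<close>)
  qed auto
  have finC: "finite ?C" using bij_betw_finite[OF bij] by (auto intro: finite_PiE simp: finite_UNIV_bit)
  have cardC: "card ?C = 2 ^ n"
    using bij_betw_same_card[OF bij] by (simp add: card_PiE card_UNIV_bit)
  let ?I = "(\<lambda>v. A *\<^sub>v v) ` ?C"
  have sub: "set (cols A) \<subseteq> carrier_vec m" using A cols_dim by blast
  have I: "?I = V.span (set (cols A))"
  proof -
    have "V.span (set (cols A)) = {y \<in> carrier_vec m. \<exists>x\<in>?C. A *\<^sub>v x = y}"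
      by (insert V.col_space_eq[OF A] carrier_matD[OF A]) (simp only: V.col_space_def)
    moreover have "A *\<^sub>v x \<in> carrier_vec m" if "x \<in> ?C" for x using mult_mat_vec_carrier[OF A that] .
    ultimately show ?thesis by (auto simp: image_def)
  qed
  have "vectorspace class_ring (V.span_vs (set (cols A)))"
    by (rule V.subspace_is_vs[OF V.span_is_subspace]) (use sub in simp)
  moreover have "vectorspace.fin_dim class_ring (V.span_vs (set (cols A)))"
    using V.fin_dim_span_cols[OF A] .
  ultimately have "card (carrier (V.span_vs (set (cols A)))) = 2 ^ V.rank A"
    unfolding V.rank_def by (rule card_subspace_bit[THEN conjunct2])
  then have cardI: "card ?I = 2 ^ V.rank A" unfolding I by simp
  have "card ?C = (\<Sum>v\<in>?C. 1)" by simp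
  also have "\<dots> = (\<Sum>y\<in>?I. \<Sum>v\<in>{v \<in> ?C. A *\<^sub>v v = y}. 1)"
    by (rule sum.image_gen[OF finC])
  also have "\<dots> = (\<Sum>y\<in>?I. card ?K)"
  proof (rule sum.cong[OF refl])
    fix y assume "y \<in> ?I"
    then obtain v0 where v0: "v0 \<in> ?C" "y = A *\<^sub>v v0" by blast
    have "bij_betw (\<lambda>k. v0 + k) ?K {v \<in> ?C. A *\<^sub>v v = y}"
    proof (rule bij_betwI')
      show "(v0 + k = v0 + l) = (k = l)" if "k \<in> ?K" "l \<in> ?K" for k l
      proof
        assume e: "v0 + k = v0 + l"
        have c: "dim_vec k = n" "dim_vec l = n" using that by (auto simp: carrier_vecD)
        show "k = l"
        proof (rule eq_vecI)
          fix i assume "i < dim_vec l"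
          then have "v0 $ i + k $ i = v0 $ i + l $ i" using arg_cong[OF e, of "\<lambda>v :: bit Matrix.vec. v $ i"] c by simp
          then show "k $ i = l $ i" by (rule add_left_imp_eq)
        qed (use c in simp)
      qed simp
      show "v0 + k \<in> {v \<in> ?C. A *\<^sub>v v = y}" if "k \<in> ?K" for k
        using that v0 A mult_mat_vec_carrier[OF A v0(1)] by (simp add: mult_add_distrib_mat_vec[OF A])
      show "\<exists>k\<in>?K. v = v0 + k" if v: "v \<in> {v \<in> ?C. A *\<^sub>v v = y}" for v
      proof (rule bexI[of _ "v - v0"])
        show "v = v0 + (v - v0)" using v v0 by (auto intro!: eq_vecI)
        show "v - v0 \<in> ?K"
          using v v0 A mult_mat_vec_carrier[OF A v0(1)]
          by (auto simp: mult_minus_distrib_mat_vec[OF A])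
      qed
    qed
    then show "(\<Sum>v\<in>{v \<in> ?C. A *\<^sub>v v = y}. 1) = card ?K" by (simp add: bij_betw_same_card)
  qed
  finally show ?thesis using cardC cardI by (simp add: mult.commute)
qed

lemma bit_sum_of_bool: "(\<Sum>w\<in>B. of_bool (P w) :: bit) = of_bool (odd (card {w \<in> B. P w}))"
  if "finite B"
  using that
proof (induction B rule: finite_induct)
  case (insert b B)
  have "{w \<in> insert b B. P w} = (if P b then insert b {w \<in> B. P w} else {w \<in> B. P w})" by auto
  then show ?case using insert by (auto simp: of_bool_def)
qed simp

lemma bit_of_bool: "(x :: bit) = of_bool (x = 1)"
  by (cases x) auto

text \<open>The kernel, as a set of Boolean functions on the columns.\<close>

definition ker2 :: "nat \<Rightarrow> nat \<Rightarrow> (nat \<Rightarrow> nat set) \<Rightarrow> (nat \<Rightarrow> bool) set" where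
  "ker2 m n B = {x \<in> {..<n} \<rightarrow>\<^sub>E UNIV. \<forall>u<m. even (card {w \<in> B u. x w})}"

text \<open>
  The edges when \<open>B u\<close> is the set of neighbours of the left vertex \<open>u\<close>.
\<close>

definition rowset :: "nat \<Rightarrow> (nat \<Rightarrow> nat set) \<Rightarrow> (nat \<times> nat) set" where
  "rowset m B = {(u, w). u < m \<and> w \<in> B u}"

lemma card_ker2:
  assumes B: "\<And>u. u < m \<Longrightarrow> B u \<subseteq> {..<n}"
  shows "card (ker2 m n B) * 2 ^ rk2 m n (rowset m B) = 2 ^ n"
proof -
  let ?A = "biadjacency m n (rowset m B)"
  have A: "?A \<in> carrier_mat m n" by (simp add: biadjacency_def)
  have mult: "?A *\<^sub>v vec n (\<lambda>w. of_bool (x w)) = 0\<^sub>v m \<longleftrightarrow> (\<forall>u<m. even (card {w \<in> B u. x w}))" for x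
  proof -
    have "(?A *\<^sub>v vec n (\<lambda>w. of_bool (x w))) $ u = of_bool (odd (card {w \<in> B u. x w}))" if u: "u < m" for u
    proof -
      have "(?A *\<^sub>v vec n (\<lambda>w. of_bool (x w))) $ u
          = (\<Sum>w = 0..<n. (if (u, w) \<in> rowset m B then 1 else 0) * of_bool (x w))"
        using u by (simp add: biadjacency_def scalar_prod_def)
      also have "\<dots> = (\<Sum>w = 0..<n. if w \<in> B u then of_bool (x w) else 0)"
        using u by (intro sum.cong) (auto simp: rowset_def)
      also have "\<dots> = (\<Sum>w \<in> B u. of_bool (x w))"
        using B[OF u] by (subst sum.mono_neutral_cong_right[of "{0..<n}" "B u"]) auto
      also have "\<dots> = of_bool (odd (card {w \<in> B u. x w}))"
        using B[OF u] finite_subset by (intro bit_sum_of_bool) blast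
      finally show ?thesis .
    qed
    note p = this
    show ?thesis
    proof
      assume e: "?A *\<^sub>v vec n (\<lambda>w. of_bool (x w)) = 0\<^sub>v m"
      show "\<forall>u<m. even (card {w \<in> B u. x w})"
      proof (intro allI impI)
        fix u assume u: "u < m"
        have "(of_bool (odd (card {w \<in> B u. x w})) :: bit) = 0"
          using p[OF u] unfolding e using u by simp
        then show "even (card {w \<in> B u. x w})" by (simp split: split_of_bool_asm)
      qed
    next
      assume e: "\<forall>u<m. even (card {w \<in> B u. x w})"
      show "?A *\<^sub>v vec n (\<lambda>w. of_bool (x w)) = 0\<^sub>v m"
      proof (rule eq_vecI)
        fix u assume "u < dim_vec (0\<^sub>v m :: bit Matrix.vec)"
        then have u: "u < m" by simp
        show "(?A *\<^sub>v vec n (\<lambda>w. of_bool (x w))) $ u = 0\<^sub>v m $ u" unfolding p[OF u] using e u by simp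
      qed (use A in simp)
    qed
  qed
  have "bij_betw (\<lambda>x. vec n (\<lambda>w. of_bool (x w))) (ker2 m n B) {v \<in> carrier_vec n. ?A *\<^sub>v v = 0\<^sub>v m}"
  proof (rule bij_betwI')
    show "(vec n (\<lambda>w. of_bool (x w) :: bit) = vec n (\<lambda>w. of_bool (y w))) = (x = y)"
      if "x \<in> ker2 m n B" "y \<in> ker2 m n B" for x y
    proof -
      have "x \<in> {..<n} \<rightarrow>\<^sub>E UNIV" "y \<in> {..<n} \<rightarrow>\<^sub>E UNIV" using that by (auto simp: ker2_def)
      from PiE_ext[OF this] show ?thesis by (auto simp: vec_eq_iff of_bool_eq_iff)
    qed
    show "vec n (\<lambda>w. of_bool (x w)) \<in> {v \<in> carrier_vec n. ?A *\<^sub>v v = 0\<^sub>v m}" if "x \<in> ker2 m n B" for x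
      using that mult by (simp add: ker2_def)
    show "\<exists>x\<in>ker2 m n B. v = vec n (\<lambda>w. of_bool (x w))" if v: "v \<in> {v \<in> carrier_vec n. ?A *\<^sub>v v = 0\<^sub>v m}" for v
    proof -
      let ?x = "\<lambda>w\<in>{..<n}. v $ w = 1"
      have e: "v = vec n (\<lambda>w. of_bool (?x w))"
        using v by (auto intro!: eq_vecI simp: bit_of_bool[symmetric])
      then have "?A *\<^sub>v vec n (\<lambda>w. of_bool (?x w)) = 0\<^sub>v m" using v by simp
      then have "?x \<in> ker2 m n B" unfolding mult by (auto simp: ker2_def)
      then show ?thesis using e by blast
    qed
  qed
  from bij_betw_same_card[OF this] show ?thesis
    using card_kernel_bit[OF A] unfolding rk2_def by simp
qed

lemma rk2_le: "rk2 m n S \<le> n"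
proof -
  interpret V: vec_space "TYPE(bit)" m .
  show ?thesis unfolding rk2_def by (rule V.rank_le_nc) (simp add: biadjacency_def)
qed

section \<open>The polynomial as a partition function\<close>

text \<open>
  Assignments of colours below \<open>2 ^ r\<close> to the columns.  Colours stand for vectors over the field
  with two elements, by their binary digits; a row imposes that its colours sum to zero.
\<close>

definition balanced :: "nat \<Rightarrow> (nat \<Rightarrow> nat) \<Rightarrow> nat set \<Rightarrow> bool" where
  "balanced r hue B \<longleftrightarrow> (\<forall>i<r. even (card {w \<in> B. bit (hue w) i}))"

lemma card_balanced:
  assumes B: "\<And>u. u < m \<Longrightarrow> B u \<subseteq> {..<n}"
  shows "card {hue \<in> {..<n} \<rightarrow>\<^sub>E {..<2 ^ r}. \<forall>u<m. balanced r hue (B u)} = (2 ^ r) ^ (n - rk2 m n (rowset m B))"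
proof -
  let ?S = "{hue \<in> {..<n} \<rightarrow>\<^sub>E {..<2 ^ r}. \<forall>u<m. balanced r hue (B u)}"
  let ?T = "{..<r} \<rightarrow>\<^sub>E ker2 m n B"
  let ?f = "\<lambda>hue. \<lambda>i\<in>{..<r}. \<lambda>w\<in>{..<n}. bit (hue w) i"
  let ?g = "\<lambda>\<tau>. \<lambda>w\<in>{..<n}. horner_sum of_bool (2 :: nat) (map (\<lambda>i. \<tau> i w) [0..<r])"
  have sub: "{w \<in> B u. (\<lambda>w\<in>{..<n}. p w) w} = {w \<in> B u. p w}" if "u < m" for u and p :: "nat \<Rightarrow> bool"
    using B[OF that] by auto
  have bitg: "bit (?g \<tau> w) i \<longleftrightarrow> i < r \<and> \<tau> i w" if "w < n" for \<tau> w i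
    using that by (auto simp: bit_horner_sum_bit_iff)
  have lt: "?g \<tau> w < 2 ^ r" if "w < n" for \<tau> w
    using that horner_sum_of_bool_2_less[of "map (\<lambda>i. \<tau> i w) [0..<r]"] by simp
  have "bij_betw ?f ?S ?T"
  proof (rule bij_betwI[where g = ?g])
    show "?f \<in> ?S \<rightarrow> ?T"
      using sub by (auto simp: ker2_def balanced_def)
    show "?g \<in> ?T \<rightarrow> ?S"
    proof
      fix \<tau> assume t: "\<tau> \<in> ?T"
      have "balanced r (?g \<tau>) (B u)" if u: "u < m" for u
        unfolding balanced_def
      proof (intro allI impI)
        fix i assume i: "i < r"
        have "{w \<in> B u. bit (?g \<tau> w) i} = {w \<in> B u. \<tau> i w}" using B[OF u] bitg i by auto
        moreover have "\<tau> i \<in> ker2 m n B" using t i by auto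
        ultimately show "even (card {w \<in> B u. bit (?g \<tau> w) i})" using u by (simp add: ker2_def)
      qed
      then show "?g \<tau> \<in> ?S" using lt by auto
    qed
    show "?g (?f hue) = hue" if "hue \<in> ?S" for hue
    proof (rule ext)
      fix w
      have s: "hue \<in> {..<n} \<rightarrow>\<^sub>E {..<2 ^ r}" using that by simp
      show "?g (?f hue) w = hue w"
      proof (cases "w < n")
        case True
        have "hue w < 2 ^ r" using s True by (auto simp: PiE_iff)
        then have "take_bit r (hue w) = hue w" by (simp add: take_bit_nat_eq_self_iff)
        moreover have "map (\<lambda>i. ?f hue i w) [0..<r] = map (bit (hue w)) [0..<r]" using True by auto
        moreover have "?g (?f hue) w = horner_sum of_bool 2 (map (\<lambda>i. ?f hue i w) [0..<r])"
          using True by (simp only: restrict_apply lessThan_iff if_True)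
        ultimately show ?thesis using horner_sum_bit_eq_take_bit[of "hue w" r] by (simp only:)
      next
        case False
        then show ?thesis using s by (auto simp: PiE_iff extensional_def)
      qed
    qed
    show "?f (?g \<tau>) = \<tau>" if t: "\<tau> \<in> ?T" for \<tau>
    proof (rule PiE_ext[of _ "{..<r}" "\<lambda>_. ker2 m n B"])
      show "?f (?g \<tau>) \<in> ?T" 
        by (rule funcset_mem[OF \<open>?f \<in> ?S \<rightarrow> ?T\<close> funcset_mem[OF \<open>?g \<in> ?T \<rightarrow> ?S\<close> t]])
      fix i assume i: "i \<in> {..<r}"
      have ti: "\<tau> i \<in> {..<n} \<rightarrow>\<^sub>E UNIV" using t i by (auto simp: ker2_def)
      show "?f (?g \<tau>) i = \<tau> i"
      proof (rule ext)
        show "?f (?g \<tau>) i w = \<tau> i w" for w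
          using i ti bitg[of w \<tau> i] by (cases "w < n") (auto simp: PiE_iff extensional_def)
      qed
    qed (use t in auto)
  qed
  then have "card ?S = card (ker2 m n B) ^ r" by (simp add: bij_betw_same_card card_PiE)
  moreover have "card (ker2 m n B) = 2 ^ (n - rk2 m n (rowset m B))"
  proof -
    have "card (ker2 m n B) * 2 ^ rk2 m n (rowset m B)
        = 2 ^ (n - rk2 m n (rowset m B)) * 2 ^ rk2 m n (rowset m B)"
      using card_ker2[OF B] rk2_le by (simp flip: power_add)
    then show ?thesis by simp
  qed
  ultimately show ?thesis by (simp flip: power_mult add: mult.commute)
qed

text \<open>A bipartite graph given by the list of the neighbourhoods of its left vertices.\<close>

definition rgraph :: "nat \<Rightarrow> nat set list \<Rightarrow> bipgraph" where
  "rgraph n rs = \<lparr>left_size = length rs, right_size = n, edges = rowset (length rs) (\<lambda>u. rs ! u)\<rparr>"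

lemma rgraph_bipgraphs: "(\<And>A. A \<in> set rs \<Longrightarrow> A \<subseteq> {..<n}) \<Longrightarrow> rgraph n rs \<in> bipgraphs"
  by (auto simp: rgraph_def bipgraphs_def rowset_def) (meson nth_mem lessThan_iff subsetD)

text \<open>
  The factor of a left vertex with neighbours \<open>A\<close>, summed over the edges at it that are chosen.
\<close>

definition rweight :: "nat \<Rightarrow> rat \<Rightarrow> (nat \<Rightarrow> nat) \<Rightarrow> nat set \<Rightarrow> rat" where
  "rweight r mu hue A = (\<Sum>B\<in>Pow A. mu ^ card B * of_bool (balanced r hue B))"

lemma bij_rowset:
  "bij_betw (rowset m) (PiE {..<m} (\<lambda>u. Pow (C u))) (Pow (rowset m C))"
proof (rule bij_betwI[where g = "\<lambda>S. \<lambda>u\<in>{..<m}. {w. (u, w) \<in> S}"])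
  show "(\<lambda>u\<in>{..<m}. {w. (u, w) \<in> rowset m B}) = B" if "B \<in> PiE {..<m} (\<lambda>u. Pow (C u))" for B
    using that by (auto simp: rowset_def PiE_iff extensional_def fun_eq_iff)
  show "rowset m \<in> PiE {..<m} (\<lambda>u. Pow (C u)) \<rightarrow> Pow (rowset m C)"
    by (fastforce simp: rowset_def PiE_iff)
  show "(\<lambda>S. \<lambda>u\<in>{..<m}. {w. (u, w) \<in> S}) \<in> Pow (rowset m C) \<rightarrow> PiE {..<m} (\<lambda>u. Pow (C u))"
    by (auto simp: rowset_def)
  show "rowset m (\<lambda>u\<in>{..<m}. {w. (u, w) \<in> S}) = S" if "S \<in> Pow (rowset m C)" for S
    using that by (auto simp: rowset_def)
qed

lemma card_rowset:
  assumes "\<And>u. u < m \<Longrightarrow> finite (B u)"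
  shows "card (rowset m B) = (\<Sum>u<m. card (B u))"
proof -
  have "rowset m B = Sigma {..<m} B" by (auto simp: rowset_def)
  then show ?thesis using assms by simp
qed

text \<open>
  The number of colourings that balance all rows of a matrix is the number of colours to the power
  of its nullity.  Summing over the sets of edges first makes the weight a product over the rows.
\<close>

theorem R2_partition_function:
  assumes rs: "\<And>A. A \<in> set rs \<Longrightarrow> A \<subseteq> {..<n}"
  shows "(2 ^ r) ^ n * R2 (1 / 2 ^ r) mu (rgraph n rs)
    = (\<Sum>hue \<in> {..<n} \<rightarrow>\<^sub>E {..<2 ^ r}. \<Prod>u<length rs. rweight r mu hue (rs ! u))"
proof -
  let ?m = "length rs" and ?C = "\<lambda>u. rs ! u" and ?Q = "{..<n} \<rightarrow>\<^sub>E {..<(2 :: nat) ^ r}"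
  let ?P = "PiE {..<length rs} (\<lambda>u. Pow (rs ! u))"
  have C: "?C u \<subseteq> {..<n}" if "u < ?m" for u using rs that by simp
  have finC: "finite (?C u)" if "u < ?m" for u using C[OF that] finite_subset by blast
  have q: "(2 ^ r) ^ n * (1 / 2 ^ r) ^ k = ((2 ^ r) ^ (n - k) :: rat)" if "k \<le> n" for k
    using that by (simp add: power_one_over power_diff field_simps)
  have "(2 ^ r) ^ n * R2 (1 / 2 ^ r) mu (rgraph n rs)
      = (\<Sum>S\<in>Pow (rowset ?m ?C). (2 ^ r) ^ (n - rk2 ?m n S) * mu ^ card S)"
    unfolding R2_def rgraph_def by (simp add: sum_distrib_left mult.assoc[symmetric] q rk2_le)
  also have "\<dots> = (\<Sum>B\<in>?P. (2 ^ r) ^ (n - rk2 ?m n (rowset ?m B)) * mu ^ card (rowset ?m B))"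
    by (rule sum.reindex_bij_betw[OF bij_rowset, symmetric])
  also have "\<dots> = (\<Sum>B\<in>?P. \<Sum>hue\<in>?Q. \<Prod>u<?m. mu ^ card (B u) * of_bool (balanced r hue (B u)))"
  proof (rule sum.cong[OF refl])
    fix B assume B: "B \<in> ?P"
    have Bu: "B u \<subseteq> {..<n}" "finite (B u)" if "u < ?m" for u
      using B C[OF that] finC[OF that] that by (auto simp: PiE_iff dest: finite_subset)
    have "(\<Sum>hue\<in>?Q. \<Prod>u<?m. mu ^ card (B u) * of_bool (balanced r hue (B u)))
        = (\<Sum>hue\<in>?Q. mu ^ card (rowset ?m B) * of_bool (\<forall>u<?m. balanced r hue (B u)))"
    proof (rule sum.cong[OF refl])
      fix hue
      have "(\<Prod>u<?m. of_bool (balanced r hue (B u))) = (of_bool (\<forall>u<?m. balanced r hue (B u)) :: rat)"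
        by (auto simp: prod_zero_iff of_bool_def intro: prod.neutral)
      then show "(\<Prod>u<?m. mu ^ card (B u) * of_bool (balanced r hue (B u)))
          = mu ^ card (rowset ?m B) * of_bool (\<forall>u<?m. balanced r hue (B u))"
        by (simp add: prod.distrib card_rowset[OF Bu(2)] power_sum)
    qed
    also have "\<dots> = mu ^ card (rowset ?m B) * of_nat (card {hue \<in> ?Q. \<forall>u<?m. balanced r hue (B u)})"
      by (simp add: sum_distrib_left[symmetric] of_bool_def sum.If_cases finite_PiE Int_def)
    finally show "(2 ^ r) ^ (n - rk2 ?m n (rowset ?m B)) * mu ^ card (rowset ?m B)
        = (\<Sum>hue\<in>?Q. \<Prod>u<?m. mu ^ card (B u) * of_bool (balanced r hue (B u)))"
      using card_balanced[of ?m B n r, OF Bu(1)] by (simp add: mult.commute)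
  qed
  also have "\<dots> = (\<Sum>hue\<in>?Q. \<Sum>B\<in>?P. \<Prod>u<?m. mu ^ card (B u) * of_bool (balanced r hue (B u)))"
    by (rule sum.swap)
  also have "\<dots> = (\<Sum>hue\<in>?Q. \<Prod>u<?m. rweight r mu hue (rs ! u))"
    unfolding rweight_def using finC by (intro sum.cong refl prod_sum_PiE[symmetric]) auto
  finally show ?thesis .
qed

section \<open>Rows with at most two entries\<close>

text \<open>
  A row with one or two entries is given by a pair of columns, which may coincide.  Its weight only
  depends on which of the colours vanish and whether they coincide.
\<close>

definition pset :: "nat \<times> nat \<Rightarrow> nat set" where
  "pset p = {fst p, snd p}"

definition pw :: "rat \<Rightarrow> (nat \<Rightarrow> nat) \<Rightarrow> nat \<times> nat \<Rightarrow> rat" where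
  "pw mu hue p = (let a = hue (fst p); b = hue (snd p) in
     if fst p = snd p then (if a = 0 then 1 + mu else 1)
     else if a = 0 \<and> b = 0 then (1 + mu)\<^sup>2
     else if a = 0 \<or> b = 0 then 1 + mu
     else if a = b then 1 + mu\<^sup>2 else 1)"

lemma bits_eq_iff: "a < 2 ^ r \<Longrightarrow> b < 2 ^ r \<Longrightarrow> (\<forall>i<r. bit a i = bit b i) \<longleftrightarrow> a = b" for a b :: nat
proof
  assume A: "a < 2 ^ r" "b < 2 ^ r" "\<forall>i<r. bit a i = bit b i"
  have "take_bit r a = take_bit r b" by (rule bit_eqI) (use A in \<open>auto simp: bit_take_bit_iff\<close>)
  then show "a = b" using A by (simp add: take_bit_nat_eq_self)
qed simp

lemma balanced_single: "hue x < 2 ^ r \<Longrightarrow> balanced r hue {x} \<longleftrightarrow> hue x = 0"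
proof -
  assume x: "hue x < 2 ^ r"
  have "{w \<in> {x}. bit (hue w) i} = (if bit (hue x) i then {x} else {})" for i by auto
  then have "even (card {w \<in> {x}. bit (hue w) i}) \<longleftrightarrow> bit (hue x) i = bit 0 i" for i by simp
  then show ?thesis unfolding balanced_def using bits_eq_iff[OF x, of 0] by simp
qed

lemma balanced_pair:
  "hue x < 2 ^ r \<Longrightarrow> hue y < 2 ^ r \<Longrightarrow> x \<noteq> y \<Longrightarrow> balanced r hue {x, y} \<longleftrightarrow> hue x = hue y"
proof -
  assume x: "hue x < 2 ^ r" "hue y < 2 ^ r" "x \<noteq> y"
  have "{w \<in> {x, y}. bit (hue w) i}
      = (if bit (hue x) i then {x} else {}) \<union> (if bit (hue y) i then {y} else {})" for i by auto
  then have "even (card {w \<in> {x, y}. bit (hue w) i}) \<longleftrightarrow> bit (hue x) i = bit (hue y) i" for i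
    using x(3) by simp
  then show ?thesis unfolding balanced_def using bits_eq_iff[OF x(1,2)] by simp
qed

lemma rweight_pw:
  assumes "hue (fst p) < 2 ^ r" "hue (snd p) < 2 ^ r"
  shows "rweight r mu hue (pset p) = pw mu hue p"
proof (cases p)
  case (Pair x y)
  have 0: "balanced r hue {}" by (simp add: balanced_def)
  show ?thesis
  proof (cases "x = y")
    case True
    have "Pow {x} = {{}, {x}}" by auto
    then show ?thesis
      using assms True 0 by (simp add: Pair rweight_def pset_def pw_def balanced_single)
  next
    case False
    have e: "Pow {x, y} = {{}, {x}, {y}, {x, y}}" by auto
    have "{x} \<noteq> {x, y}" "{y} \<noteq> {x, y}" "{x} \<noteq> {y}" using False by auto
    then have s: "(\<Sum>B\<in>Pow {x, y}. f B) = f {} + f {x} + f {y} + f {x, y}" for f :: "nat set \<Rightarrow> rat"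
      unfolding e by (simp add: add.assoc)
    show ?thesis
      using assms False 0 unfolding rweight_def pset_def Pair fst_conv snd_conv s
      by (simp add: pw_def balanced_single balanced_pair power2_eq_square algebra_simps)
  qed
qed

lemma pw_cong:
  assumes "hue (fst p) = 0 \<longleftrightarrow> \<tau> (fst p) = 0" "hue (snd p) = 0 \<longleftrightarrow> \<tau> (snd p) = 0"
    "hue (fst p) = hue (snd p) \<longleftrightarrow> \<tau> (fst p) = \<tau> (snd p)"
  shows "pw mu hue p = pw mu \<tau> p"
  using assms by (simp add: pw_def Let_def)

section \<open>Colourings up to renaming of the nonzero colours\<close>

text \<open>
  Colourings of \<open>n\<close> columns in which the nonzero colours are exactly those from 1 to \<open>b\<close>.  The colour
  zero may or may not occur.
\<close>

definition onto :: "nat \<Rightarrow> nat \<Rightarrow> (nat \<Rightarrow> nat) set" where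
  "onto n b = {hue \<in> {..<n} \<rightarrow>\<^sub>E {..b}. hue ` {..<n} - {0} = {1..b}}"

lemma finite_onto: "finite (onto n b)"
  unfolding onto_def by (rule finite_subset[OF _ finite_PiE[of "{..<n}" "\<lambda>_. {..b}"]]) auto

text \<open>
  A sum over colourings that only depends on the zeros and on the classes of equal colours.
\<close>

lemma sum_onto:
  fixes W :: "(nat \<Rightarrow> nat) \<Rightarrow> rat"
  assumes inv: "\<And>hue \<tau>. (\<And>x. x < n \<Longrightarrow> hue x = 0 \<longleftrightarrow> \<tau> x = 0) \<Longrightarrow>
    (\<And>x y. x < n \<Longrightarrow> y < n \<Longrightarrow> hue x = hue y \<longleftrightarrow> \<tau> x = \<tau> y) \<Longrightarrow> W hue = W \<tau>"
  shows "(\<Sum>hue \<in> {..<n} \<rightarrow>\<^sub>E {..Q}. W hue) = (\<Sum>b\<le>n. of_nat (Q choose b) * (\<Sum>hue\<in>onto n b. W hue))"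
proof -
  let ?P = "{..<n} \<rightarrow>\<^sub>E {..Q}" and ?im = "\<lambda>hue :: nat \<Rightarrow> nat. hue ` {..<n} - {0}"
  let ?T = "{I. I \<subseteq> {1..Q} \<and> card I \<le> n}" and ?S = "\<lambda>b. \<Sum>hue\<in>onto n b. W hue"
  have finP: "finite ?P" by (intro finite_PiE) auto
  have finT: "finite ?T" by (rule finite_subset[of _ "Pow {1..Q}"]) auto
  have part: "(\<Sum>hue | hue \<in> ?P \<and> ?im hue = I. W hue) = ?S (card I)" if I: "I \<in> ?T" for I
  proof -
    have finI: "finite I" using I finite_subset by auto
    then obtain h where h: "bij_betw h {1..card I} I" using ex_bij_betw_nat_finite_1 by blast
    \<comment> \<open>colourings with nonzero colours in \<open>I\<close> arise from those in \<open>onto n (card I)\<close> by renaming\<close>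
    define h' where "h' = h(0 := 0)"
    have I0: "0 \<notin> I" using I by auto
    have h'b: "bij_betw h' {..card I} (insert 0 I)"
    proof -
      have "bij_betw h' {1..card I} I"
        using h by (rule bij_betw_cong[THEN iffD1, rotated]) (auto simp: h'_def)
      moreover have "bij_betw h' (insert 0 {1..card I}) (insert 0 I)" if "bij_betw h' {1..card I} I"
      proof -
        note that
        moreover have "h' 0 = 0" by (simp add: h'_def)
        ultimately show "bij_betw h' (insert 0 {1..card I}) (insert 0 I)"
          using I0 by (auto simp: bij_betw_def)
      qed
      moreover have "insert 0 {1..card I} = {..card I}" by auto
      ultimately show ?thesis by metis
    qed
    let ?g = "inv_into {..card I} h'"
    have h0: "h' 0 = 0" by (simp add: h'_def)
    have inj: "inj_on h' {..card I}" and img: "h' ` {..card I} = insert 0 I" using h'b by (auto simp: bij_betw_def)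
    have gh: "?g (h' i) = i" if "i \<le> card I" for i using inv_into_f_f[OF inj] that by simp
    have hg: "h' (?g j) = j" "?g j \<le> card I" if "j \<in> insert 0 I" for j
      using that img f_inv_into_f[of j h' "{..card I}"] inv_into_into[of j h' "{..card I}"] by auto
    have g0: "?g 0 = 0" using gh[of 0] h0 by simp
    have hnz: "h' i = 0 \<longleftrightarrow> i = 0" if "i \<le> card I" for i using inj_onD[OF inj, of i 0] that h0 by auto
    have img1: "h' ` {1..card I} = I"
      using h by (auto simp: h'_def bij_betw_def)
    have gimg: "?g ` I = {1..card I}"
    proof -
      have "?g ` I = ?g ` (h' ` {1..card I})" by (simp only: img1)
      also have "\<dots> = (\<lambda>i. ?g (h' i)) ` {1..card I}" by (rule image_image)
      also have "\<dots> = (\<lambda>i. i) ` {1..card I}" by (rule image_cong) (use gh in auto)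
      finally show ?thesis by simp
    qed
    have bij: "bij_betw (\<lambda>hue. \<lambda>x\<in>{..<n}. h' (hue x)) (onto n (card I)) {hue \<in> ?P. ?im hue = I}"
    proof (rule bij_betwI[where g = "\<lambda>hue. \<lambda>x\<in>{..<n}. ?g (hue x)"])
      show "(\<lambda>hue. \<lambda>x\<in>{..<n}. h' (hue x)) \<in> onto n (card I) \<rightarrow> {hue \<in> ?P. ?im hue = I}"
      proof
        fix hue assume "hue \<in> onto n (card I)"
        then have s: "\<And>x. x < n \<Longrightarrow> hue x \<le> card I" "?im hue = {1..card I}" by (auto simp: onto_def)
        have "(\<lambda>x\<in>{..<n}. h' (hue x)) x \<le> Q" if "x < n" for x
        proof -
          have "h' (hue x) \<in> insert 0 I" using s(1)[OF that] img by blast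
          then show ?thesis using I that by auto
        qed
        moreover have "?im (\<lambda>x\<in>{..<n}. h' (hue x)) = I"
        proof -
          have "?im (\<lambda>x\<in>{..<n}. h' (hue x)) = h' ` (hue ` {..<n}) - {0}" by auto
          also have "\<dots> = h' ` (?im hue)" using hnz s(1) h0 by auto
          finally show ?thesis using s(2) img1 by simp
        qed
        ultimately show "(\<lambda>x\<in>{..<n}. h' (hue x)) \<in> {hue \<in> ?P. ?im hue = I}" by auto
      qed
      show "(\<lambda>hue. \<lambda>x\<in>{..<n}. ?g (hue x)) \<in> {hue \<in> ?P. ?im hue = I} \<rightarrow> onto n (card I)"
      proof
        fix hue assume s: "hue \<in> {hue \<in> ?P. ?im hue = I}"
        then have s1: "?im hue = I" "hue \<in> ?P" by simp_all
        have v: "hue x \<in> insert 0 I" if "x < n" for x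
          using s1(1)[THEN equalityD1] that by blast
        have nz: "?g j = 0 \<longleftrightarrow> j = 0" if "j \<in> insert 0 I" for j
          using hg(1)[OF that] h0 g0 by metis
        have "?im (\<lambda>x\<in>{..<n}. ?g (hue x)) = ?g ` (hue ` {..<n}) - {0}" by auto
        also have "\<dots> = ?g ` (?im hue)" proof -
          have "?g (hue x) = 0 \<longleftrightarrow> hue x = 0" if "x < n" for x by (rule nz[OF v[OF that]])
          then show ?thesis by auto
        qed
        finally have "?im (\<lambda>x\<in>{..<n}. ?g (hue x)) = {1..card I}" unfolding s1(1) gimg .
        then show "(\<lambda>x\<in>{..<n}. ?g (hue x)) \<in> onto n (card I)" using hg(2) v by (auto simp: onto_def)
      qed
      show "(\<lambda>x\<in>{..<n}. ?g ((\<lambda>x\<in>{..<n}. h' (hue x)) x)) = hue" if s: "hue \<in> onto n (card I)" for hue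
      proof
        fix x
        show "(\<lambda>x\<in>{..<n}. ?g ((\<lambda>x\<in>{..<n}. h' (hue x)) x)) x = hue x"
          using s gh[of "hue x"] by (cases "x < n") (auto simp: onto_def PiE_iff extensional_def)
      qed
      show "(\<lambda>x\<in>{..<n}. h' ((\<lambda>x\<in>{..<n}. ?g (hue x)) x)) = hue" if s: "hue \<in> {hue \<in> ?P. ?im hue = I}" for hue
      proof
        fix x
        have s1: "?im hue \<subseteq> I" using s by simp
        have "x < n \<Longrightarrow> hue x \<in> insert 0 I" using s1 by blast
        then show "(\<lambda>x\<in>{..<n}. h' ((\<lambda>x\<in>{..<n}. ?g (hue x)) x)) x = hue x"
          using s hg(1)[of "hue x"] by (cases "x < n") (auto simp: PiE_iff extensional_def)
      qed
    qed
    have "(\<Sum>hue | hue \<in> ?P \<and> ?im hue = I. W hue) = (\<Sum>hue\<in>onto n (card I). W (\<lambda>x\<in>{..<n}. h' (hue x)))"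
      using sum.reindex_bij_betw[OF bij, of W] by simp
    also have "\<dots> = ?S (card I)"
    proof (rule sum.cong[OF refl])
      fix hue assume "hue \<in> onto n (card I)"
      then have s: "\<And>x. x < n \<Longrightarrow> hue x \<le> card I" by (auto simp: onto_def)
      show "W (\<lambda>x\<in>{..<n}. h' (hue x)) = W hue"
        by (rule inv) (use hnz s inj_on_eq_iff[OF inj] in auto)
    qed
    finally show ?thesis .
  qed
  have "?im ` ?P \<subseteq> ?T"
  proof
    fix I assume "I \<in> ?im ` ?P"
    then obtain hue where s: "hue \<in> ?P" "I = ?im hue" by blast
    have "card I \<le> card (hue ` {..<n})" unfolding s(2) by (intro card_mono) auto
    also have "\<dots> \<le> n" using card_image_le[of "{..<n}" hue] by simp
    finally have c: "card I \<le> n" .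
    have "I \<subseteq> {1..Q}"
    proof
      fix i assume "i \<in> I"
      then obtain x where "x < n" "i = hue x" "i \<noteq> 0" unfolding s(2) by auto
      moreover have "hue x \<le> Q" using s(1) \<open>x < n\<close> by auto
      ultimately show "i \<in> {1..Q}" by simp
    qed
    then show "I \<in> ?T" using c by simp
  qed
  then have "(\<Sum>hue\<in>?P. W hue) = (\<Sum>I\<in>?T. \<Sum>hue | hue \<in> ?P \<and> ?im hue = I. W hue)"
    by (rule sum.group[OF finP finT, symmetric])
  also have "\<dots> = (\<Sum>I\<in>?T. ?S (card I))" by (rule sum.cong[OF refl part])
  also have "\<dots> = (\<Sum>b\<le>n. \<Sum>I | I \<in> ?T \<and> card I = b. ?S (card I))"
    by (rule sum.group[OF finT, symmetric]) auto
  also have "\<dots> = (\<Sum>b\<le>n. of_nat (Q choose b) * ?S b)"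
  proof (rule sum.cong[OF refl])
    fix b assume b: "b \<in> {..n}"
    have "card {I. I \<in> ?T \<and> card I = b} = Q choose b"
    proof -
      have "{I. I \<in> ?T \<and> card I = b} = {I. I \<subseteq> {1..Q} \<and> card I = b}" using b by auto
      then show ?thesis using n_subsets[of "{1..Q}" b] by simp
    qed
    then show "(\<Sum>I | I \<in> ?T \<and> card I = b. ?S (card I)) = of_nat (Q choose b) * ?S b" by simp
  qed
  finally show ?thesis .
qed

section \<open>The partition function for an arbitrary number of colours\<close>

lemma poly_eq_powers:
  fixes P Q :: "rat poly"
  assumes "\<And>r. poly P (2 ^ r) = poly Q (2 ^ r)"
  shows "P = Q"
proof (rule ccontr)
  assume "P \<noteq> Q"
  then have "finite {x. poly (P - Q) x = 0}" by (intro poly_roots_finite) simp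
  moreover have "range (\<lambda>r. (2 :: rat) ^ r) \<subseteq> {x. poly (P - Q) x = 0}" using assms by auto
  ultimately have "finite (range (\<lambda>r. (2 :: rat) ^ r))" by (rule finite_subset[rotated])
  moreover have "inj (\<lambda>r. (2 :: rat) ^ r)" by (intro injI) (simp add: power_inject_exp)
  ultimately show False using finite_imageD by blast
qed

text \<open>
  The left side of the following theorem as a polynomial in \<open>q\<close>; its right side is built from the
  binomial coefficients of \<open>q - 1\<close>, which are polynomials as well.
\<close>

definition Rpoly :: "nat \<Rightarrow> rat \<Rightarrow> nat set list \<Rightarrow> rat poly" where
  "Rpoly n mu rs = (\<Sum>S\<in>Pow (rowset (length rs) (\<lambda>u. rs ! u)). Polynomial.monom (mu ^ card S) (n - rk2 (length rs) n S))"

lemma poly_Rpoly: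
  assumes "q \<noteq> 0"
  shows "poly (Rpoly n mu rs) q = q ^ n * R2 (1 / q) mu (rgraph n rs)"
proof -
  have "q ^ n * (1 / q) ^ k = q ^ (n - k)" if "k \<le> n" for k
    using that assms by (simp add: power_one_over power_diff field_simps)
  then show ?thesis
    unfolding Rpoly_def R2_def rgraph_def
    by (simp add: poly_sum poly_monom sum_distrib_left mult.assoc[symmetric] rk2_le mult.commute[of "mu ^ _"])
qed

definition Gpoly :: "nat \<Rightarrow> rat poly" where
  "Gpoly b = Polynomial.smult (1 / fact b) (\<Prod>i = 0..<b. [:- 1 - of_nat i, 1:])"

lemma poly_Gpoly: "poly (Gpoly b) q = (q - 1) gchoose b"
  by (simp add: Gpoly_def poly_prod gbinomial_prod_rev algebra_simps)

text \<open>
  Both sides are polynomials in \<open>q\<close>, and for powers of two they agree by counting colourings, the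
  images of which, zero left out, can be chosen in \<open>q - 1\<close> over \<open>b\<close> ways.
\<close>

theorem R2_colourings:
  assumes q: "q \<noteq> 0" and ps: "\<And>p. p \<in> set ps \<Longrightarrow> fst p < n \<and> snd p < n"
  shows "q ^ n * R2 (1 / q) mu (rgraph n (map pset ps))
    = (\<Sum>b\<le>n. ((q - 1) gchoose b) * (\<Sum>hue\<in>onto n b. prod_list (map (pw mu hue) ps)))"
proof -
  let ?S = "\<lambda>b. \<Sum>hue\<in>onto n b. prod_list (map (pw mu hue) ps)"
  define Q where "Q = (\<Sum>b\<le>n. Polynomial.smult (?S b) (Gpoly b))"
  have polyQ: "poly Q x = (\<Sum>b\<le>n. ((x - 1) gchoose b) * ?S b)" for x
    by (simp add: Q_def poly_sum poly_Gpoly mult.commute)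
  have sub: "A \<subseteq> {..<n}" if "A \<in> set (map pset ps)" for A using that ps by (auto simp: pset_def)
  have "poly (Rpoly n mu (map pset ps)) (2 ^ r) = poly Q (2 ^ r)" for r
  proof -
    have e: "{..<(2 :: nat) ^ r} = {..2 ^ r - 1}" by (auto simp: less_eq_iff_succ_less)
    have "poly (Rpoly n mu (map pset ps)) (2 ^ r)
        = (\<Sum>hue \<in> {..<n} \<rightarrow>\<^sub>E {..<2 ^ r}. \<Prod>u<length (map pset ps). rweight r mu hue (map pset ps ! u))"
      using R2_partition_function[of "map pset ps" n r mu, OF sub] by (simp add: poly_Rpoly)
    also have "\<dots> = (\<Sum>hue \<in> {..<n} \<rightarrow>\<^sub>E {..<2 ^ r}. prod_list (map (pw mu hue) ps))"
    proof (rule sum.cong[OF refl])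
      fix hue assume s: "hue \<in> {..<n} \<rightarrow>\<^sub>E {..<(2 :: nat) ^ r}"
      have "rweight r mu hue (pset p) = pw mu hue p" if "p \<in> set ps" for p
        by (rule rweight_pw) (use s ps[OF that] in auto)
      then show "(\<Prod>u<length (map pset ps). rweight r mu hue (map pset ps ! u)) = prod_list (map (pw mu hue) ps)"
        by (simp add: prod.list_conv_set_nth lessThan_atLeast0)
    qed
    also have "\<dots> = (\<Sum>b\<le>n. of_nat ((2 ^ r - 1) choose b) * ?S b)"
      unfolding e
    proof (rule sum_onto)
      fix hue \<tau> :: "nat \<Rightarrow> nat"
      assume "\<And>x. x < n \<Longrightarrow> hue x = 0 \<longleftrightarrow> \<tau> x = 0"
        "\<And>x y. x < n \<Longrightarrow> y < n \<Longrightarrow> hue x = hue y \<longleftrightarrow> \<tau> x = \<tau> y"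
      then have "map (pw mu hue) ps = map (pw mu \<tau>) ps"
        using ps by (intro map_cong refl pw_cong) auto
      then show "prod_list (map (pw mu hue) ps) = prod_list (map (pw mu \<tau>) ps)" by (rule arg_cong)
    qed
    also have "\<dots> = poly Q (2 ^ r)"
      unfolding polyQ by (simp add: binomial_gbinomial of_nat_diff)
    finally show ?thesis .
  qed
  then have "Rpoly n mu (map pset ps) = Q" by (rule poly_eq_powers)
  then show ?thesis using poly_Rpoly[OF q, of n mu "map pset ps"] polyQ[of q] by simp
qed

section \<open>Encoding a graph by rows with two entries\<close>

text \<open>
  The cliques of size \<open>w\<close> in a graph on the numbers below \<open>n\<close>.
\<close>

definition cliques :: "nat \<Rightarrow> (nat \<Rightarrow> nat \<Rightarrow> bool) \<Rightarrow> nat \<Rightarrow> nat set set" where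
  "cliques n adj w = {C. C \<subseteq> {..<n} \<and> card C = w \<and> (\<forall>x\<in>C. \<forall>y\<in>C. x \<noteq> y \<longrightarrow> adj x y)}"

text \<open>The ordered pairs of adjacent vertices.\<close>

definition arcs :: "nat \<Rightarrow> (nat \<Rightarrow> nat \<Rightarrow> bool) \<Rightarrow> (nat \<times> nat) set" where
  "arcs n adj = {(x, y). x < n \<and> y < n \<and> x \<noteq> y \<and> adj x y}"

text \<open>
  Every arc becomes a row.  The remaining rows make up for the missing arcs, so that every vertex
  occurs equally often; the function \<open>hub\<close> gives their second entry.
\<close>

definition gadget :: "(nat \<Rightarrow> nat) \<Rightarrow> nat \<Rightarrow> nat \<Rightarrow> (nat \<Rightarrow> nat \<Rightarrow> bool) \<Rightarrow> (nat \<times> nat) list" where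
  "gadget hub L n adj = concat (map (\<lambda>x. concat (map (\<lambda>y.
      if x = y then replicate L (x, hub x)
      else if adj x y then [(x, y)] else replicate 2 (x, hub x)) [0..<n])) [0..<n])"

lemma prod_list_concat_map:
  fixes f :: "'a \<Rightarrow> 'b :: comm_monoid_mult"
  shows "prod_list (map f (concat (map g xs))) = prod_list (map (\<lambda>x. prod_list (map f (g x))) xs)"
  by (induction xs) auto

lemma prod_list_upt: "prod_list (map f [0..<n]) = (\<Prod>x<n. f x)"
  by (simp add: prod.distinct_set_conv_list[symmetric] lessThan_atLeast0)

lemma finite_arcs: "finite (arcs n adj)" and card_arcs_le: "card (arcs n adj) \<le> n * n"
proof -
  have s: "arcs n adj \<subseteq> {..<n} \<times> {..<n}" by (auto simp: arcs_def)
  then show "finite (arcs n adj)" by (rule finite_subset) simp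
  show "card (arcs n adj) \<le> n * n" using card_mono[OF _ s] by (simp add: card_cartesian_product)
qed

lemma prod_arcs: "(\<Prod>p\<in>arcs n adj. f p)
    = (\<Prod>x<n. \<Prod>y<n. if x \<noteq> y \<and> adj x y then f (x, y) else 1 :: rat)"
proof -
  have e: "arcs n adj = {p \<in> {..<n} \<times> {..<n}. fst p \<noteq> snd p \<and> adj (fst p) (snd p)}"
    by (auto simp: arcs_def)
  have "(\<Prod>p\<in>arcs n adj. f p)
      = (\<Prod>p\<in>{..<n} \<times> {..<n}. if fst p \<noteq> snd p \<and> adj (fst p) (snd p) then f p else 1)"
    unfolding e by (rule prod.inter_filter) simp
  also have "\<dots> = (\<Prod>x<n. \<Prod>y<n. if x \<noteq> y \<and> adj x y then f (x, y) else 1)"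
    unfolding prod.cartesian_product by (rule prod.cong) auto
  finally show ?thesis .
qed

text \<open>
  By symmetry, the factors at the two ends of the arcs can be gathered at the first end.  Together with
  those of the other rows they give the same power for every vertex, whatever its degree.
\<close>

lemma gadget_prod:
  fixes f :: "nat \<times> nat \<Rightarrow> rat"
  assumes sym: "\<And>x y. adj x y \<Longrightarrow> adj y x"
    and hub: "\<And>x. x < n \<Longrightarrow> (f (x, hub x))\<^sup>2 = (g x)\<^sup>2"
    and arc: "\<And>x y. (x, y) \<in> arcs n adj \<Longrightarrow> d * f (x, y) = g x * g y * h (x, y)"
  shows "d ^ card (arcs n adj) * prod_list (map f (gadget hub (2 * L) n adj))
    = ((\<Prod>x<n. g x) ^ 2) ^ (n - 1 + L) * (\<Prod>p\<in>arcs n adj. h p)"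
proof -
  let ?A = "arcs n adj"
  define a where "a x y = (if x \<noteq> y \<and> adj x y then f (x, y) else 1)" for x y
  define b where "b x y = (if x = y then (g x)\<^sup>2 ^ L else if adj x y then 1 else (g x)\<^sup>2)" for x y
  have "prod_list (map f (gadget hub (2 * L) n adj)) = (\<Prod>x<n. \<Prod>y<n. a x y * b x y)"
    unfolding gadget_def prod_list_concat_map prod_list_upt
    by (intro prod.cong refl) (auto simp: a_def b_def power_mult hub numeral_2_eq_2[symmetric])
  also have "\<dots> = (\<Prod>p\<in>?A. f p) * (\<Prod>x<n. \<Prod>y<n. b x y)"
    unfolding prod_arcs by (simp add: prod.distrib a_def)
  finally have 1: "prod_list (map f (gadget hub (2 * L) n adj)) = (\<Prod>p\<in>?A. f p) * (\<Prod>x<n. \<Prod>y<n. b x y)" .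
  have bij: "bij_betw prod.swap ?A ?A"
    by (rule bij_betwI[where g = prod.swap]) (auto simp: arcs_def sym)
  have sw: "(\<Prod>p\<in>?A. g (snd p)) = (\<Prod>p\<in>?A. g (fst p))"
    using prod.reindex_bij_betw[OF bij, of "\<lambda>p. g (fst p)"] by simp
  have "d ^ card ?A * (\<Prod>p\<in>?A. f p) = (\<Prod>p\<in>?A. d * f p)" by (simp add: prod.distrib)
  also have "\<dots> = (\<Prod>p\<in>?A. g (fst p) * g (snd p) * h p)"
    by (rule prod.cong) (use arc in auto)
  also have "\<dots> = (\<Prod>p\<in>?A. (g (fst p))\<^sup>2) * (\<Prod>p\<in>?A. h p)"
    by (simp add: prod.distrib sw power2_eq_square)
  also have "(\<Prod>p\<in>?A. (g (fst p))\<^sup>2) = (\<Prod>x<n. \<Prod>y<n. if x \<noteq> y \<and> adj x y then (g x)\<^sup>2 else 1)"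
    unfolding prod_arcs fst_conv by (rule refl)
  finally have 2: "d ^ card ?A * (\<Prod>p\<in>?A. f p)
    = (\<Prod>x<n. \<Prod>y<n. if x \<noteq> y \<and> adj x y then (g x)\<^sup>2 else 1) * (\<Prod>p\<in>?A. h p)" .
  have "(\<Prod>x<n. \<Prod>y<n. if x \<noteq> y \<and> adj x y then (g x)\<^sup>2 else 1) * (\<Prod>x<n. \<Prod>y<n. b x y)
      = (\<Prod>x<n. \<Prod>y<n. if x = y then (g x)\<^sup>2 ^ L else (g x)\<^sup>2)"
    unfolding prod.distrib[symmetric] by (intro prod.cong refl) (auto simp: b_def)
  also have "\<dots> = (\<Prod>x<n. (g x)\<^sup>2 ^ (n - 1 + L))"
  proof (rule prod.cong[OF refl])
    fix x assume x: "x \<in> {..<n}"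
    have "(\<Prod>y<n. if x = y then (g x)\<^sup>2 ^ L else (g x)\<^sup>2) = (g x)\<^sup>2 ^ L * (\<Prod>y\<in>{..<n} - {x}. (g x)\<^sup>2)"
      using x by (subst prod.remove[of _ x]) (auto intro: prod.cong)
    then show "(\<Prod>y<n. if x = y then (g x)\<^sup>2 ^ L else (g x)\<^sup>2) = (g x)\<^sup>2 ^ (n - 1 + L)"
      using x by (simp only: prod_constant card_Diff_singleton card_lessThan power_add mult.commute)
  qed
  also have "\<dots> = ((\<Prod>x<n. g x) ^ 2) ^ (n - 1 + L)" by (simp add: prod_power_distrib)
  finally have 3: "(\<Prod>x<n. \<Prod>y<n. if x \<noteq> y \<and> adj x y then (g x)\<^sup>2 else 1) * (\<Prod>x<n. \<Prod>y<n. b x y)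
    = ((\<Prod>x<n. g x) ^ 2) ^ (n - 1 + L)" .
  show ?thesis unfolding 1 mult.assoc[symmetric] 2 using 3 by (simp only: mult_ac)
qed

text \<open>Grouping the colourings by the value of the product.\<close>

lemma power_sum_grouped:
  fixes g :: "nat \<Rightarrow> rat" and node :: "(nat \<Rightarrow> nat) \<Rightarrow> rat"
  assumes F: "finite F" "r0 \<notin> F"
    and node: "\<And>b hue. b \<le> nv \<Longrightarrow> g b \<noteq> 0 \<Longrightarrow> hue \<in> onto nv b \<Longrightarrow> node hue \<noteq> r0 \<Longrightarrow> node hue \<in> F"
  shows "\<exists>c. \<forall>k. (\<Sum>b\<le>nv. g b * (\<Sum>hue\<in>onto nv b. node hue ^ k))
    = (\<Sum>r\<in>F. c r * r ^ k) + (\<Sum>b\<le>nv. g b * of_nat (card {hue \<in> onto nv b. node hue = r0})) * r0 ^ k"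
proof -
  define c where "c r = (\<Sum>b\<le>nv. g b * of_nat (card {hue \<in> onto nv b. node hue = r}))" for r
  have "(\<Sum>b\<le>nv. g b * (\<Sum>hue\<in>onto nv b. node hue ^ k)) = (\<Sum>r\<in>F. c r * r ^ k) + c r0 * r0 ^ k" for k
  proof -
    have b: "g b * (\<Sum>hue\<in>onto nv b. node hue ^ k)
      = (\<Sum>r\<in>insert r0 F. g b * of_nat (card {hue \<in> onto nv b. node hue = r}) * r ^ k)" if "b \<le> nv" for b
    proof (cases "g b = 0")
      case False
      have sub: "node ` onto nv b \<subseteq> insert r0 F" using node[OF that False] by auto
      have "(\<Sum>hue\<in>onto nv b. node hue ^ k) = (\<Sum>r\<in>insert r0 F. \<Sum>hue | hue \<in> onto nv b \<and> node hue = r. node hue ^ k)"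
        by (rule sum.group[OF finite_onto _ sub, symmetric]) (use F in simp)
      also have "\<dots> = (\<Sum>r\<in>insert r0 F. of_nat (card {hue \<in> onto nv b. node hue = r}) * r ^ k)"
        by (rule sum.cong) auto
      finally show ?thesis by (simp add: sum_distrib_left mult.assoc)
    qed simp
    have "(\<Sum>b\<le>nv. g b * (\<Sum>hue\<in>onto nv b. node hue ^ k)) = (\<Sum>r\<in>insert r0 F. c r * r ^ k)"
      unfolding c_def sum_distrib_right by (subst sum.swap) (simp add: b)
    then show ?thesis using F by simp
  qed
  then show ?thesis unfolding c_def by (intro exI allI)
qed

lemma prod_list_rows_replicate:
  "prod_list (map f (concat (replicate k ps))) = (prod_list (map f ps) :: rat) ^ k"
  by (induction k) auto

lemma card_offdiag:
  assumes "finite (W :: nat set)"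
  shows "finite {(x, y). x \<in> W \<and> y \<in> W \<and> x \<noteq> y}"
    "card {(x, y). x \<in> W \<and> y \<in> W \<and> x \<noteq> y} = card W * (card W - 1)"
proof -
  have e: "{(x, y). x \<in> W \<and> y \<in> W \<and> x \<noteq> y} = (SIGMA x:W. W - {x})" by auto
  show "finite {(x, y). x \<in> W \<and> y \<in> W \<and> x \<noteq> y}" unfolding e using assms by auto
  show "card {(x, y). x \<in> W \<and> y \<in> W \<and> x \<noteq> y} = card W * (card W - 1)"
    unfolding e using assms by simp
qed

lemma card_offdiag_filter:
  assumes "finite (W :: nat set)"
  shows "card {(x, y). x \<in> W \<and> y \<in> W \<and> x \<noteq> y \<and> P x y} \<le> card W * (card W - 1)"
    "card {(x, y). x \<in> W \<and> y \<in> W \<and> x \<noteq> y \<and> P x y} = card W * (card W - 1)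
      \<longleftrightarrow> (\<forall>x\<in>W. \<forall>y\<in>W. x \<noteq> y \<longrightarrow> P x y)"
proof -
  let ?S = "{(x, y). x \<in> W \<and> y \<in> W \<and> x \<noteq> y}" and ?T = "{(x, y). x \<in> W \<and> y \<in> W \<and> x \<noteq> y \<and> P x y}"
  have sub: "?T \<subseteq> ?S" by auto
  show "card ?T \<le> card W * (card W - 1)"
    using card_mono[OF card_offdiag(1)[OF assms] sub] card_offdiag(2)[OF assms] by simp
  have "card ?T = card W * (card W - 1) \<longleftrightarrow> ?T = ?S"
    using card_subset_eq[OF card_offdiag(1)[OF assms] sub] card_offdiag(2)[OF assms] by auto
  also have "\<dots> \<longleftrightarrow> (\<forall>x\<in>W. \<forall>y\<in>W. x \<noteq> y \<longrightarrow> P x y)" by auto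
  finally show "card ?T = card W * (card W - 1) \<longleftrightarrow> (\<forall>x\<in>W. \<forall>y\<in>W. x \<noteq> y \<longrightarrow> P x y)" .
qed

lemma mixed_radix_unique:
  fixes M :: nat
  assumes "M * a + e = M * a' + e'" "e < M" "e' < M"
  shows "a = a' \<and> e = e'"
proof -
  have "(M * a + e) div M = a" "(M * a' + e') div M = a'" using assms(2,3) by simp_all
  then have "a = a'" using assms(1) by simp
  then show ?thesis using assms(1) by simp
qed

section \<open>Colourings of cliques\<close>

locale clique_graph =
  fixes n :: nat and adj :: "nat \<Rightarrow> nat \<Rightarrow> bool"
  assumes sym: "adj x y \<Longrightarrow> adj y x"
begin

abbreviation zeros :: "(nat \<Rightarrow> nat) \<Rightarrow> nat" where
  "zeros hue \<equiv> card {x. x < n \<and> hue x = 0}"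

text \<open>The products for the two choices of the second entry: the vertex itself, or a common hub.\<close>

abbreviation loop_node :: "rat \<Rightarrow> (nat \<Rightarrow> nat) \<Rightarrow> nat \<Rightarrow> rat" where
  "loop_node mu hue L \<equiv> prod_list (map (pw mu hue) (gadget (\<lambda>x. x) (2 * L) n adj))"

abbreviation hub_node :: "rat \<Rightarrow> (nat \<Rightarrow> nat) \<Rightarrow> nat \<Rightarrow> rat" where
  "hub_node mu hue L \<equiv> prod_list (map (pw mu hue) (gadget (\<lambda>_. n) (2 * L) n adj))"

text \<open>The number of arcs the ends of which have the same nonzero colour.\<close>

definition mono_arcs :: "(nat \<Rightarrow> nat) \<Rightarrow> nat" where
  "mono_arcs hue = card {(x, y). (x, y) \<in> arcs n adj \<and> hue x = hue y \<and> hue x \<noteq> 0}"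

lemma mono_arcs_le: "mono_arcs hue \<le> n * n"
  unfolding mono_arcs_def
  by (rule order_trans[OF card_mono[OF finite_arcs] card_arcs_le]) auto

lemma prod_if_power: "finite A \<Longrightarrow> (\<Prod>p\<in>A. if P p then b else 1 :: rat) = b ^ card {p \<in> A. P p}"
  by (simp add: prod.If_cases Int_def)

lemma node_loops:
  "loop_node mu hue L
    = ((1 + mu)\<^sup>2) ^ ((n - 1 + L) * zeros hue) * (1 + mu\<^sup>2) ^ mono_arcs hue"
proof -
  let ?g = "\<lambda>x. if hue x = 0 then 1 + mu else 1"
  let ?h = "\<lambda>p. if hue (fst p) = hue (snd p) \<and> hue (fst p) \<noteq> 0 then 1 + mu\<^sup>2 else 1"
  have "1 ^ card (arcs n adj) * loop_node mu hue L
      = ((\<Prod>x<n. ?g x) ^ 2) ^ (n - 1 + L) * (\<Prod>p\<in>arcs n adj. ?h p)"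
    by (rule gadget_prod[OF sym]) (auto simp: pw_def arcs_def power2_eq_square Let_def)
  moreover have "(\<Prod>x<n. ?g x) = (1 + mu) ^ zeros hue"
    by (simp add: prod_if_power)
  moreover have "(\<Prod>p\<in>arcs n adj. ?h p) = (1 + mu\<^sup>2) ^ mono_arcs hue"
    unfolding prod_if_power[OF finite_arcs] mono_arcs_def
    by (intro arg_cong[where f = "\<lambda>A. _ ^ card A"]) auto
  ultimately show ?thesis by (simp add: power_mult[symmetric] mult_ac)
qed

text \<open>The number of zeros and of monochromatic arcs identifies the colourings of cliques.\<close>

lemma clique_colouring_zero:
  assumes w0: "1 \<le> w0" "w0 \<le> n"
  shows "{hue \<in> onto n b. zeros hue = n - w0 \<and> mono_arcs hue = w0 * (w0 - 1)}
    = (if b = 1 then (\<lambda>C. \<lambda>x\<in>{..<n}. if x \<in> C then 1 else 0) ` cliques n adj w0 else {})" (is "?L = ?R")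
proof (rule set_eq_iff[THEN iffD2, rule_format])
  fix hue :: "nat \<Rightarrow> nat"
  let ?W = "{x. x < n \<and> hue x \<noteq> 0}"
  have fin: "finite ?W" by simp
  have part: "zeros hue + card ?W = n"
  proof -
    have "card ({x. x < n \<and> hue x = 0} \<union> ?W) = zeros hue + card ?W"
      by (rule card_Un_disjoint) auto
    moreover have "{x. x < n \<and> hue x = 0} \<union> ?W = {..<n}" by auto
    ultimately show ?thesis by simp
  qed
  have e: "{(x, y). (x, y) \<in> arcs n adj \<and> hue x = hue y \<and> hue x \<noteq> 0}
    = {(x, y). x \<in> ?W \<and> y \<in> ?W \<and> x \<noteq> y \<and> (adj x y \<and> hue x = hue y)}" by (auto simp: arcs_def)
  show "hue \<in> ?L \<longleftrightarrow>
    hue \<in> ?R"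
  proof
    assume "hue \<in> ?L"
    then have s: "hue \<in> onto n b" and cW: "card ?W = w0" and m: "mono_arcs hue = w0 * (w0 - 1)"
      using part w0 by auto
    have all: "\<forall>x\<in>?W. \<forall>y\<in>?W. x \<noteq> y \<longrightarrow> adj x y \<and> hue x = hue y"
      using m unfolding mono_arcs_def e cW[symmetric] card_offdiag_filter(2)[OF fin] .
    have "?W \<noteq> {}" using cW w0 by (metis card.empty not_one_le_zero)
    then obtain z where z: "z \<in> ?W" by blast
    have "hue ` {..<n} - {0} = {hue z}"
    proof
      show "hue ` {..<n} - {0} \<subseteq> {hue z}" using all z by force
    qed (use z in auto)
    then have im: "{1..b} = {hue z}" using s by (simp add: onto_def)
    then have "card {1..b} = 1" by simp
    then have b: "b = 1" by simp
    then have z1: "hue z = 1" using im by simp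
    have v: "hue x = 1" if "x \<in> ?W" for x
      using all z z1 that by (cases "x = z") metis+
    have "hue = (\<lambda>x\<in>{..<n}. if x \<in> ?W then 1 else 0)"
    proof
      fix x
      show "hue x = (\<lambda>x\<in>{..<n}. if x \<in> ?W then 1 else 0) x"
        using s v[of x] by (cases "x < n") (auto simp: onto_def PiE_iff extensional_def)
    qed
    moreover have "?W \<in> cliques n adj w0" using all cW by (auto simp: cliques_def)
    ultimately have "hue \<in> (\<lambda>C. \<lambda>x\<in>{..<n}. if x \<in> C then 1 else 0) ` cliques n adj w0"
      by (rule image_eqI)
    then show "hue \<in> ?R"
      by (simp only: b if_P[OF refl])
  next
    assume "hue \<in> ?R"
    then obtain C where b: "b = 1" and C: "C \<in> cliques n adj w0"
      and s: "hue = (\<lambda>x\<in>{..<n}. if x \<in> C then 1 else 0)" by (auto split: if_splits)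
    have C': "C \<subseteq> {..<n}" "card C = w0" "\<forall>x\<in>C. \<forall>y\<in>C. x \<noteq> y \<longrightarrow> adj x y"
      using C by (auto simp: cliques_def)
    have W: "?W = C" using C'(1) by (auto simp: s)
    have "C \<noteq> {}" using C'(2) w0 by (metis card.empty not_one_le_zero)
    then obtain z where z: "z \<in> C" by blast
    have im: "hue ` {..<n} - {0} = {1..b}"
    proof -
      have "hue z = 1" "z < n" using z C'(1) by (auto simp: s)
      then have "1 \<in> hue ` {..<n}" by (metis imageI lessThan_iff)
      moreover have "hue ` {..<n} \<subseteq> {0, 1}" by (auto simp: s)
      ultimately show ?thesis unfolding b by auto
    qed
    have "hue \<in> onto n b"
      unfolding onto_def using im by (auto simp: s b)
    moreover have "mono_arcs hue = w0 * (w0 - 1)"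
    proof -
      have "\<forall>x\<in>?W. \<forall>y\<in>?W. x \<noteq> y \<longrightarrow> adj x y \<and> hue x = hue y"
        unfolding W using C'(1,3) by (auto simp: s)
      note card_offdiag_filter(2)[OF fin, THEN iffD2, OF this]
      then show ?thesis unfolding mono_arcs_def e W C'(2) .
    qed
    moreover have "zeros hue = n - w0" using part C'(2) W by simp
    ultimately show "hue \<in> ?L"
      by simp
  qed
qed

lemma inj_on_indicator:
  assumes "a \<noteq> (b :: nat)"
  shows "inj_on (\<lambda>C. \<lambda>x\<in>{..<m}. if x \<in> C then a else b) (Pow {..<m})"
proof (rule inj_onI)
  fix C D assume C: "C \<in> Pow {..<m}" "D \<in> Pow {..<m}"
    and e: "(\<lambda>x\<in>{..<m}. if x \<in> C then a else b) = (\<lambda>x\<in>{..<m}. if x \<in> D then a else b)"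
  have "x \<in> C \<longleftrightarrow> x \<in> D" if "x < m" for x
    using fun_cong[OF e, of x] that assms by (simp split: if_splits)
  then show "C = D" using C by blast
qed

lemma card_clique_colouring_zero:
  assumes w0: "1 \<le> w0" "w0 \<le> n"
  shows "card {hue \<in> onto n b. zeros hue = n - w0 \<and> mono_arcs hue = w0 * (w0 - 1)}
    = (if b = 1 then card (cliques n adj w0) else 0)"
proof -
  have "inj_on (\<lambda>C. \<lambda>x\<in>{..<n}. if x \<in> C then 1 else 0 :: nat) (cliques n adj w0)"
    by (rule inj_on_subset[OF inj_on_indicator]) (auto simp: cliques_def)
  then show ?thesis unfolding clique_colouring_zero[OF w0] by (simp add: card_image)
qed

text \<open>
  With an additional column \<open>n\<close> for a hub, the vertices of the colour of the hub play the part of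
  those of colour zero.
\<close>

definition far :: "(nat \<Rightarrow> nat) \<Rightarrow> nat set" where
  "far hue = {x. x < n \<and> hue x \<noteq> hue n}"

text \<open>
  The arcs between such vertices, and those among them with ends of the same nonzero colour.
\<close>

definition far_arcs :: "(nat \<Rightarrow> nat) \<Rightarrow> nat" where
  "far_arcs hue = card {(x, y). x \<in> far hue \<and> y \<in> far hue \<and> x \<noteq> y \<and> adj x y}"

definition far_mono :: "(nat \<Rightarrow> nat) \<Rightarrow> nat" where
  "far_mono hue = card {(x, y). x \<in> far hue \<and> y \<in> far hue \<and> x \<noteq> y \<and> (adj x y \<and> hue x = hue y \<and> hue x \<noteq> 0)}"

lemma card_far_complement: "card {x. x < n \<and> hue x = hue n} = n - card (far hue)"
proof -
  have "card ({x. x < n \<and> hue x = hue n} \<union> far hue) = card {x. x < n \<and> hue x = hue n} + card (far hue)"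
    by (rule card_Un_disjoint) (auto simp: far_def)
  moreover have "{x. x < n \<and> hue x = hue n} \<union> far hue = {..<n}" by (auto simp: far_def)
  ultimately show ?thesis by simp
qed

text \<open>
  The power of \<open>1 + \<mu>\<^sup>2\<close> on the left makes up for the arcs, which replace two rows through the hub
  by one only.
\<close>

lemma node_hub:
  assumes s: "hue n \<noteq> 0" and mu: "(1 + mu)\<^sup>2 = 1 \<or> (\<forall>x<n. hue x \<noteq> 0)"
  shows "(1 + mu\<^sup>2) ^ card (arcs n adj) * hub_node mu hue L
    = (1 + mu\<^sup>2) ^ (2 * (n - 1 + L) * (n - card (far hue)) + (far_arcs hue + far_mono hue))"
proof -
  let ?b = "1 + mu\<^sup>2"
  define g where "g x = (if hue x = 0 then 1 + mu else if hue x = hue n then ?b else 1)" for x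
  define h where "h p = (if fst p \<in> far hue \<and> snd p \<in> far hue then ?b else 1)
     * (if fst p \<in> far hue \<and> snd p \<in> far hue \<and> hue (fst p) = hue (snd p) \<and> hue (fst p) \<noteq> 0 then ?b else 1)" for p
  have "?b ^ card (arcs n adj) * hub_node mu hue L
      = ((\<Prod>x<n. g x) ^ 2) ^ (n - 1 + L) * (\<Prod>p\<in>arcs n adj. h p)"
  proof (rule gadget_prod[OF sym])
    show "(pw mu hue (x, n))\<^sup>2 = (g x)\<^sup>2" if "x < n" for x
      using that s by (auto simp: pw_def g_def)
    show "?b * pw mu hue (x, y) = g x * g y * h (x, y)" if "(x, y) \<in> arcs n adj" for x y
    proof -
      have "x < n" "y < n" "x \<noteq> y" using that by (auto simp: arcs_def)
      then show ?thesis using s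
        by (cases "hue x = 0"; cases "hue y = 0"; cases "hue x = hue n"; cases "hue y = hue n"; cases "hue x = hue y")
           (simp_all add: pw_def g_def h_def far_def power2_eq_square)
    qed
  qed
  moreover have "(\<Prod>x<n. g x) ^ 2 = ?b ^ (2 * (n - card (far hue)))"
  proof -
    have "(\<Prod>x<n. g x) ^ 2 = (\<Prod>x<n. (g x)\<^sup>2)" by (simp add: prod_power_distrib)
    also have "\<dots> = (\<Prod>x<n. if hue x = hue n then ?b\<^sup>2 else 1)"
      by (rule prod.cong) (use mu s in \<open>auto simp: g_def\<close>)
    also have "\<dots> = (?b\<^sup>2) ^ (n - card (far hue))"
      by (simp add: prod_if_power card_far_complement)
    finally show ?thesis by (simp only: power_mult)
  qed
  moreover have "(\<Prod>p\<in>arcs n adj. h p) = ?b ^ (far_arcs hue + far_mono hue)"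
  proof -
    have "(\<Prod>p\<in>arcs n adj. h p)
        = ?b ^ card {p \<in> arcs n adj. fst p \<in> far hue \<and> snd p \<in> far hue}
        * ?b ^ card {p \<in> arcs n adj. fst p \<in> far hue \<and> snd p \<in> far hue \<and> hue (fst p) = hue (snd p) \<and> hue (fst p) \<noteq> 0}"
      unfolding h_def prod.distrib prod_if_power[OF finite_arcs] ..
    moreover have "{p \<in> arcs n adj. fst p \<in> far hue \<and> snd p \<in> far hue}
        = {(x, y). x \<in> far hue \<and> y \<in> far hue \<and> x \<noteq> y \<and> adj x y}"
      by (auto simp: arcs_def far_def)
    moreover have "{p \<in> arcs n adj. fst p \<in> far hue \<and> snd p \<in> far hue \<and> hue (fst p) = hue (snd p) \<and> hue (fst p) \<noteq> 0}
        = {(x, y). x \<in> far hue \<and> y \<in> far hue \<and> x \<noteq> y \<and> (adj x y \<and> hue x = hue y \<and> hue x \<noteq> 0)}"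
      by (auto simp: arcs_def far_def)
    ultimately show ?thesis unfolding far_arcs_def far_mono_def by (simp only: power_add)
  qed
  ultimately have "?b ^ card (arcs n adj) * hub_node mu hue L
      = ?b ^ (2 * (n - card (far hue)) * (n - 1 + L) + (far_arcs hue + far_mono hue))"
    by (simp only: power_add[of _ "_ * _"] power_mult[of ?b "2 * (n - card (far hue))"])
  moreover have "2 * (n - card (far hue)) * (n - 1 + L) = 2 * (n - 1 + L) * (n - card (far hue))" by (simp only: mult_ac)
  ultimately show ?thesis by (simp only:)
qed

lemma node_hub_zero:
  assumes s: "hue n = 0" and mu: "(1 + mu)\<^sup>2 = 1"
  shows "hub_node mu hue L = (1 + mu\<^sup>2) ^ mono_arcs hue"
proof -
  let ?g = "\<lambda>x. if hue x = 0 then 1 + mu else 1"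
  let ?h = "\<lambda>p. if hue (fst p) = hue (snd p) \<and> hue (fst p) \<noteq> 0 then 1 + mu\<^sup>2 else 1"
  have "1 ^ card (arcs n adj) * hub_node mu hue L
      = ((\<Prod>x<n. ?g x) ^ 2) ^ (n - 1 + L) * (\<Prod>p\<in>arcs n adj. ?h p)"
    by (rule gadget_prod[OF sym]) (use s mu in \<open>auto simp: pw_def arcs_def power2_eq_square Let_def\<close>)
  moreover have "(\<Prod>x<n. ?g x) ^ 2 = 1"
  proof -
    have "(\<Prod>x<n. ?g x) ^ 2 = (\<Prod>x<n. (?g x)\<^sup>2)" by (simp add: prod_power_distrib)
    also have "\<dots> = 1" by (rule prod.neutral) (use mu in auto)
    finally show ?thesis .
  qed
  moreover have "(\<Prod>p\<in>arcs n adj. ?h p) = (1 + mu\<^sup>2) ^ mono_arcs hue"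
    unfolding prod_if_power[OF finite_arcs] mono_arcs_def
    by (intro arg_cong[where f = "\<lambda>A. _ ^ card A"]) auto
  ultimately show ?thesis by simp
qed

lemma prod_list_eq_zero: "0 \<in> set xs \<Longrightarrow> prod_list xs = (0 :: rat)"
  by (induction xs) auto

lemma node_hub_annihilated:
  assumes "hue x = 0" "x \<le> n" "1 + mu = 0" "1 \<le> n" "1 \<le> L"
  shows "hub_node mu hue L = 0"
proof (rule prod_list_eq_zero)
  define y where "y = (if x = n then 0 else x)"
  have y: "y < n" "hue y = 0 \<or> hue n = 0" using assms by (auto simp: y_def)
  have "(y, n) \<in> set (gadget (\<lambda>_. n) (2 * L) n adj)"
    unfolding gadget_def using y(1) assms(5) by (auto intro!: bexI[of _ y])
  moreover have "pw mu hue (y, n) = 0" using y assms(3) by (auto simp: pw_def Let_def)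
  ultimately show "0 \<in> set (map (pw mu hue) (gadget (\<lambda>_. n) (2 * L) n adj))" by force
qed

lemma finite_far: "finite (far hue)" by (simp add: far_def)

lemma far_le: "far_arcs hue \<le> card (far hue) * (card (far hue) - 1)" "far_mono hue \<le> card (far hue) * (card (far hue) - 1)"
  unfolding far_arcs_def far_mono_def by (rule card_offdiag_filter(1)[OF finite_far])+

lemma card_far_le: "card (far hue) \<le> n"
  using card_mono[of "{..<n}" "far hue"] by (auto simp: far_def)

text \<open>Colourings of cliques by two colours, one for the clique and the other for everything else.\<close>

lemma card_clique_colouring_hub:
  assumes w0: "2 \<le> w0" "w0 \<le> n"
  shows "card {hue \<in> onto (Suc n) b. (\<forall>x\<le>n. hue x \<noteq> 0) \<and> card (far hue) = w0
      \<and> far_arcs hue = w0 * (w0 - 1) \<and> far_mono hue = w0 * (w0 - 1)}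
    = (if b = 2 then 2 * card (cliques n adj w0) else 0)" (is "card ?A = _")
proof -
  let ?c = "\<lambda>s C. \<lambda>x\<in>{..<Suc n}. if x \<in> C then 3 - s else s :: nat"
  let ?R = "if b = 2 then ?c 1 ` cliques n adj w0 \<union> ?c 2 ` cliques n adj w0 else {}"
  have A: "?A = ?R"
  proof (rule set_eq_iff[THEN iffD2, rule_format])
    fix hue :: "nat \<Rightarrow> nat"
    show "hue \<in> ?A \<longleftrightarrow> hue \<in> ?R"
    proof
      assume "hue \<in> ?A"
      then have s: "hue \<in> onto (Suc n) b" and nz: "\<And>x. x \<le> n \<Longrightarrow> hue x \<noteq> 0" and c: "card (far hue) = w0"
        and fm: "far_mono hue = w0 * (w0 - 1)" by auto
      have all: "\<forall>x\<in>far hue. \<forall>y\<in>far hue. x \<noteq> y \<longrightarrow> adj x y \<and> hue x = hue y \<and> hue x \<noteq> 0"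
        using fm unfolding far_mono_def c[symmetric] card_offdiag_filter(2)[OF finite_far] .
      have "far hue \<noteq> {}" using c w0 by (metis card.empty not_numeral_le_zero)
      then obtain z where z: "z \<in> far hue" by blast
      have same: "hue x = hue z" if "x \<in> far hue" for x using all z that by metis
      have zn: "hue z \<noteq> hue n" "z < n" using z by (auto simp: far_def)
      have "hue ` {..<Suc n} = {hue z, hue n}"
      proof
        have "hue x \<in> {hue z, hue n}" if "x < Suc n" for x
          using same[of x] that by (cases "x \<in> far hue") (auto simp: far_def less_Suc_eq)
        then show "hue ` {..<Suc n} \<subseteq> {hue z, hue n}" by blast
        show "{hue z, hue n} \<subseteq> hue ` {..<Suc n}" using zn by auto
      qed
      moreover have "0 \<notin> hue ` {..<Suc n}" using nz by (metis imageE lessThan_iff less_Suc_eq_le)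
      ultimately have im: "{1..b} = {hue z, hue n}" using s by (auto simp: onto_def)
      then have "card {1..b} = 2" using zn by simp
      then have b: "b = 2" by simp
      have "{1..b} = {1, 2 :: nat}" unfolding b by auto
      then have e: "{hue z, hue n} = {1, 2 :: nat}" using im by simp
      then have sn: "hue n \<in> {1, 2}" "hue z = 3 - hue n" using zn(1) by (auto simp: doubleton_eq_iff)
      have "hue = ?c (hue n) (far hue)"
      proof
        fix x
        show "hue x = ?c (hue n) (far hue) x"
        proof (cases "x < Suc n")
          case True
          then show ?thesis using same[of x] sn(2) by (auto simp: far_def less_Suc_eq)
        next
          case False
          then show ?thesis using s by (auto simp: onto_def PiE_iff extensional_def)
        qed
      qed
      moreover have "far hue \<in> cliques n adj w0" using all c by (auto simp: cliques_def far_def)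
      ultimately have m: "hue \<in> ?c (hue n) ` cliques n adj w0" by (rule image_eqI)
      have "hue \<in> ?c 1 ` cliques n adj w0 \<or> hue \<in> ?c 2 ` cliques n adj w0"
        using sn(1)
      proof (elim insertE emptyE)
        assume e: "hue n = 1"
        show ?thesis using m unfolding e by (rule disjI1)
      next
        assume e: "hue n = 2"
        show ?thesis using m unfolding e by (rule disjI2)
      qed
      then show "hue \<in> ?R"
        by (simp only: b if_P[OF refl] Un_iff)
    next
      assume "hue \<in> ?R"
      moreover from this have b: "b = 2" by (simp split: if_splits)
      ultimately have "hue \<in> ?c 1 ` cliques n adj w0 \<union> ?c 2 ` cliques n adj w0" by (simp only: b if_P[OF refl])
      then have "\<exists>s C. C \<in> cliques n adj w0 \<and> (s = 1 \<or> s = 2) \<and> hue = ?c s C"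
      proof (elim UnE imageE)
        fix C assume "hue = ?c 1 C" "C \<in> cliques n adj w0"
        then show ?thesis by (intro exI[of _ 1] exI[of _ C] conjI disjI1 refl)
      next
        fix C assume "hue = ?c 2 C" "C \<in> cliques n adj w0"
        then show ?thesis by (intro exI[of _ 2] exI[of _ C] conjI disjI2 refl)
      qed
      then obtain C s where C: "C \<in> cliques n adj w0" and s12: "s = 1 \<or> s = 2" and s: "hue = ?c s C" by metis
      have C': "C \<subseteq> {..<n}" "card C = w0" "\<forall>x\<in>C. \<forall>y\<in>C. x \<noteq> y \<longrightarrow> adj x y"
        using C by (auto simp: cliques_def)
      have nC: "n \<notin> C" using C'(1) by auto
      have sn: "hue n = s" using nC by (simp add: s)
      have sC: "hue x = 3 - s" if "x \<in> C" for x using that C'(1) by (auto simp: s)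
      have sD: "hue x = s" if "x \<notin> C" "x < Suc n" for x using that by (auto simp: s)
      have ne: "3 - s \<noteq> s" using s12 by auto
      have W: "far hue = C" using C'(1) sn sC sD ne by (force simp: far_def)
      have "C \<noteq> {}" using C'(2) w0 by (metis card.empty not_numeral_le_zero)
      then obtain z where z: "z \<in> C" by blast
      have im: "hue ` {..<Suc n} = {1, 2}"
      proof
        show "hue ` {..<Suc n} \<subseteq> {1, 2}" using s12 by (auto simp: s)
        have "hue ` {z, n} \<subseteq> hue ` {..<Suc n}" using z C'(1) by (intro image_mono) auto
        moreover have "hue ` {z, n} = {1, 2}" using sC[OF z] sn s12 by auto
        ultimately show "{1, 2} \<subseteq> hue ` {..<Suc n}" by (simp only:)
      qed
      have "hue \<in> {..<Suc n} \<rightarrow>\<^sub>E {..b}" using s12 by (auto simp: s b)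
      moreover have "hue ` {..<Suc n} - {0} = {1..b}" unfolding im b by auto
      ultimately have "hue \<in> onto (Suc n) b" unfolding onto_def by simp
      moreover have "\<forall>x\<le>n. hue x \<noteq> 0" using s12 by (auto simp: s)
      moreover have "far_arcs hue = w0 * (w0 - 1)"
        unfolding far_arcs_def W C'(2)[symmetric]
        using card_offdiag_filter(2)[of C adj] C'(3) finite_far[of hue] W by auto
      moreover have "far_mono hue = w0 * (w0 - 1)"
        unfolding far_mono_def W C'(2)[symmetric]
        using card_offdiag_filter(2)[of C "\<lambda>x y. adj x y \<and> hue x = hue y \<and> hue x \<noteq> 0"] C'(3) sC s12 finite_far[of hue] W
        by auto
      ultimately show "hue \<in> ?A" using C'(2) W by simp
    qed
  qed
  have inj: "inj_on (?c s) (cliques n adj w0)" if "3 - s \<noteq> s" for s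
    by (rule inj_on_subset[OF inj_on_indicator[OF that]]) (auto simp: cliques_def)
  have "?c 1 ` cliques n adj w0 \<inter> ?c 2 ` cliques n adj w0 = {}"
  proof -
    have "?c 1 C \<noteq> ?c 2 D" if "C \<in> cliques n adj w0" "D \<in> cliques n adj w0" for C D
    proof -
      have "n \<notin> C" "n \<notin> D" using that by (auto simp: cliques_def)
      then have "?c 1 C n \<noteq> ?c 2 D n" by simp
      then show ?thesis by metis
    qed
    then show ?thesis by blast
  qed
  moreover have "finite (cliques n adj w0)"
    by (rule finite_subset[of _ "Pow {..<n}"]) (auto simp: cliques_def)
  ultimately show ?thesis unfolding A using inj[of 1] inj[of 2] by (simp add: card_Un_disjoint card_image)
qed

text \<open>With zero and one for the only colours, the hub has colour one and the clique colour zero.\<close>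

lemma card_clique_colouring_hub_one:
  assumes w0: "2 \<le> w0" "w0 \<le> n"
  shows "card {hue \<in> onto (Suc n) 1. hue n \<noteq> 0 \<and> card (far hue) = w0 \<and> far_arcs hue + far_mono hue = w0 * (w0 - 1)}
    = card (cliques n adj w0)" (is "card ?A = _")
proof -
  let ?c = "\<lambda>C. \<lambda>x\<in>{..<Suc n}. if x \<in> C then 0 else 1 :: nat"
  have A: "?A = ?c ` cliques n adj w0"
  proof (rule set_eq_iff[THEN iffD2, rule_format])
    fix hue :: "nat \<Rightarrow> nat"
    show "hue \<in> ?A \<longleftrightarrow> hue \<in> ?c ` cliques n adj w0"
    proof
      assume "hue \<in> ?A"
      then have s: "hue \<in> onto (Suc n) 1" and nz: "hue n \<noteq> 0" and c: "card (far hue) = w0"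
        and f: "far_arcs hue + far_mono hue = w0 * (w0 - 1)" by auto
      have v: "hue x \<le> 1" if "x \<le> n" for x using s that by (auto simp: onto_def PiE_iff less_Suc_eq_le)
      have n1: "hue n = 1" using v[of n] nz by simp
      have f0: "hue x = 0" if "x \<in> far hue" for x using that v[of x] n1 by (auto simp: far_def)
      have "{(x, y). x \<in> far hue \<and> y \<in> far hue \<and> x \<noteq> y \<and> (adj x y \<and> hue x = hue y \<and> hue x \<noteq> 0)} = {}"
        using f0 by auto
      then have "far_mono hue = 0" unfolding far_mono_def by (simp only: card.empty)
      then have fa: "far_arcs hue = w0 * (w0 - 1)" using f by simp
      have all: "\<forall>x\<in>far hue. \<forall>y\<in>far hue. x \<noteq> y \<longrightarrow> adj x y"
        using fa unfolding far_arcs_def c[symmetric] card_offdiag_filter(2)[OF finite_far] .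
      have "hue = ?c (far hue)"
      proof
        fix x
        show "hue x = ?c (far hue) x"
        proof (cases "x < Suc n")
          case True
          then show ?thesis using f0[of x] n1 by (auto simp: far_def less_Suc_eq)
        next
          case False
          then show ?thesis using s by (auto simp: onto_def PiE_iff extensional_def)
        qed
      qed
      moreover have "far hue \<in> cliques n adj w0" using all c by (auto simp: cliques_def far_def)
      ultimately show "hue \<in> ?c ` cliques n adj w0" by auto
    next
      assume "hue \<in> ?c ` cliques n adj w0"
      then obtain C where C: "C \<in> cliques n adj w0" and s: "hue = ?c C" by auto
      have C': "C \<subseteq> {..<n}" "card C = w0" "\<forall>x\<in>C. \<forall>y\<in>C. x \<noteq> y \<longrightarrow> adj x y"
        using C by (auto simp: cliques_def)
      have nC: "n \<notin> C" using C'(1) by auto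
      have sn: "hue n = 1" using nC by (simp add: s)
      have sC: "hue x = 0" if "x \<in> C" for x using that C'(1) by (auto simp: s)
      have W: "far hue = C" using C'(1) nC by (auto simp: far_def s)
      have "hue ` {..<Suc n} - {0} = {1}"
      proof
        show "hue ` {..<Suc n} - {0} \<subseteq> {1}" by (auto simp: s)
        have "hue n \<in> hue ` {..<Suc n}" by blast
        then show "{1} \<subseteq> hue ` {..<Suc n} - {0}" using sn by simp
      qed
      then have "hue \<in> onto (Suc n) 1"
        unfolding onto_def by (auto simp: s)
      moreover have "far_arcs hue = w0 * (w0 - 1)"
        unfolding far_arcs_def W C'(2)[symmetric]
        using card_offdiag_filter(2)[of C adj] C'(3) finite_far[of hue] W by auto
      moreover have "far_mono hue = 0"
      proof -
        have "{(x, y). x \<in> far hue \<and> y \<in> far hue \<and> x \<noteq> y \<and> (adj x y \<and> hue x = hue y \<and> hue x \<noteq> 0)} = {}"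
          using sC W by auto
        then show ?thesis unfolding far_mono_def by (simp only: card.empty)
      qed
      ultimately show "hue \<in> ?A" using C'(2) W sn by simp
    qed
  qed
  have "inj_on ?c (cliques n adj w0)"
    by (rule inj_on_subset[OF inj_on_indicator]) (auto simp: cliques_def)
  then show ?thesis unfolding A by (simp add: card_image)
qed

end

section \<open>Clique numbers as coefficients of power sums\<close>

lemma R2_power_sum:
  assumes lam: "lam \<noteq> 0" and ps: "\<And>p. p \<in> set ps \<Longrightarrow> fst p < nv \<and> snd p < nv"
    and F: "finite F" "r0 \<notin> F"
    and node: "\<And>b hue. b \<le> nv \<Longrightarrow> (1 / lam - 1) gchoose b \<noteq> 0 \<Longrightarrow> hue \<in> onto nv b \<Longrightarrow>
      prod_list (map (pw mu hue) ps) \<noteq> r0 \<Longrightarrow> prod_list (map (pw mu hue) ps) \<in> F"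
    and N: "(\<Sum>b\<le>nv. ((1 / lam - 1) gchoose b)
      * of_nat (card {hue \<in> onto nv b. prod_list (map (pw mu hue) ps) = r0})) = N"
  shows "\<exists>c. \<forall>k. R2 lam mu (rgraph nv (map pset (concat (replicate k ps))))
    = (\<Sum>r\<in>F. c r * r ^ k) + lam ^ nv * N * r0 ^ k"
proof -
  have "\<exists>c. \<forall>k. (\<Sum>b\<le>nv. ((1 / lam - 1) gchoose b) * (\<Sum>hue\<in>onto nv b. prod_list (map (pw mu hue) ps) ^ k))
    = (\<Sum>r\<in>F. c r * r ^ k) + N * r0 ^ k"
    unfolding N[symmetric] by (rule power_sum_grouped[OF F]) (rule node)
  then obtain c where c: "\<And>k. (\<Sum>b\<le>nv. ((1 / lam - 1) gchoose b) * (\<Sum>hue\<in>onto nv b. prod_list (map (pw mu hue) ps) ^ k))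
    = (\<Sum>r\<in>F. c r * r ^ k) + N * r0 ^ k" by auto
  have "R2 lam mu (rgraph nv (map pset (concat (replicate k ps))))
      = (\<Sum>r\<in>F. lam ^ nv * c r * r ^ k) + lam ^ nv * N * r0 ^ k" for k
  proof -
    have "(1 / lam) ^ nv * R2 (1 / (1 / lam)) mu (rgraph nv (map pset (concat (replicate k ps))))
        = (\<Sum>r\<in>F. c r * r ^ k) + N * r0 ^ k"
      unfolding c[symmetric] prod_list_rows_replicate[symmetric]
      by (rule R2_colourings) (use lam ps in \<open>auto split: if_splits\<close>)
    then have "R2 lam mu (rgraph nv (map pset (concat (replicate k ps))))
        = lam ^ nv * ((\<Sum>r\<in>F. c r * r ^ k) + N * r0 ^ k)"
      using lam by (simp add: power_one_over field_simps)
    then show ?thesis by (simp add: sum_distrib_left distrib_left mult.assoc)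
  qed
  then show ?thesis by (intro exI allI)
qed

lemma gadget_bound: "p \<in> set (gadget hub L n adj) \<Longrightarrow> (\<And>x. x < n \<Longrightarrow> hub x < m) \<Longrightarrow> n \<le> m \<Longrightarrow> fst p < m \<and> snd p < m"
  by (fastforce simp: gadget_def split: if_splits)

text \<open>
  Powers of \<open>b\<close> up to the \<open>m\<close>-th are too small to compensate for a factor \<open>A ^ J\<close>.
\<close>

lemma power_separated:
  fixes A b :: rat
  assumes A: "A > 0" and b: "b > 1" and sep: "b ^ m < A ^ J \<or> b ^ m < (1 / A) ^ J"
    and eq: "A ^ (J * d) * b ^ e = A ^ (J * d') * b ^ e'" and e: "e \<le> m" "e' \<le> m"
  shows "d = d' \<and> e = e'"
proof -
  have main: "d = d'" if sep: "b ^ m < B ^ J" and eq: "B ^ (J * d) * b ^ e = B ^ (J * d') * b ^ e'"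
    and e: "e \<le> m" "e' \<le> m" and B: "B > 0" for B :: rat and d d' e e' :: nat
  proof -
    have le: "\<not> d < d'" if eq: "B ^ (J * d) * b ^ e = B ^ (J * d') * b ^ e'" and e: "e \<le> m" for d d' e e' :: nat
    proof
      assume d: "d < d'"
      have B1: "B ^ J > 1" using sep one_le_power[of b m] b by linarith
      have "B ^ (J * d) * b ^ e \<le> B ^ (J * d) * b ^ m"
        using B b e by (intro mult_left_mono power_increasing) auto
      also have "\<dots> < B ^ (J * d) * B ^ J" using sep B by simp
      also have "\<dots> = (B ^ J) ^ Suc d" by (simp add: power_mult mult.commute)
      also have "\<dots> \<le> (B ^ J) ^ d'" using d B1 by (intro power_increasing) auto
      also have "\<dots> \<le> B ^ (J * d') * b ^ e'"
        using B b by (simp add: power_mult one_le_power)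
      finally show False using eq by simp
    qed
    show ?thesis using le[OF eq e(1)] le[OF eq[symmetric] e(2)] by simp
  qed
  have "d = d'"
  proof (rule disjE[OF sep])
    assume "b ^ m < A ^ J"
    then show ?thesis using eq e A by (rule main)
  next
    assume s: "b ^ m < (1 / A) ^ J"
    have "(1 / A) ^ (J * d) * b ^ e' = (1 / A) ^ (J * d') * b ^ e"
      using eq A by (simp add: power_one_over field_simps)
    then show ?thesis using s e A by (intro main[of "1 / A" d e' d' e]) auto
  qed
  moreover from this eq A have "b ^ e = b ^ e'" by simp
  then have "e = e'" using b power_inject_exp by blast
  ultimately show ?thesis by simp
qed

context clique_graph begin

text \<open>
  The pair of the number of zeros and the number of monochromatic arcs can be recovered from the
  product, and only the colourings that give one colour to a clique of size \<open>w0\<close> and zero to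
  the rest attain the pair that is singled out.
\<close>

lemma power_sum_loops:
  assumes lam: "lam \<noteq> 0" and mu: "mu \<noteq> 0" "mu \<noteq> - 1" and w0: "1 \<le> w0" "w0 \<le> n"
    and J: "J = n - 1 + L"
    and sep: "(1 + mu\<^sup>2) ^ (n * n) < ((1 + mu)\<^sup>2) ^ J \<or> (1 + mu\<^sup>2) ^ (n * n) < (1 / (1 + mu)\<^sup>2) ^ J"
    and F: "F = (\<lambda>(d, e). ((1 + mu)\<^sup>2) ^ (J * d) * (1 + mu\<^sup>2) ^ e)
      ` ({..n} \<times> {..n * n} - {(n - w0, w0 * (w0 - 1))})"
    and r0: "r0 = ((1 + mu)\<^sup>2) ^ (J * (n - w0)) * (1 + mu\<^sup>2) ^ (w0 * (w0 - 1))"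
  shows "r0 \<notin> F"
    and "\<exists>c. \<forall>k. R2 lam mu (rgraph n (map pset (concat (replicate k (gadget (\<lambda>x. x) (2 * L) n adj)))))
    = (\<Sum>r\<in>F. c r * r ^ k) + lam ^ n * ((1 / lam - 1) * of_nat (card (cliques n adj w0))) * r0 ^ k"
proof -
  let ?A = "(1 + mu)\<^sup>2" and ?b = "1 + mu\<^sup>2"
  have A: "?A > 0" using mu by (simp add: zero_less_power2 add_eq_0_iff)
  have b: "?b > 1" using mu by simp
  have w2: "w0 * (w0 - 1) \<le> n * n" using w0 by (intro mult_le_mono) auto
  have uniq: "d = d' \<and> e = e'" if "?A ^ (J * d) * ?b ^ e = ?A ^ (J * d') * ?b ^ e'" "e \<le> n * n" "e' \<le> n * n" for d d' e e'
    by (rule power_separated[OF A b sep that])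
  show nF: "r0 \<notin> F"
    unfolding F r0 using uniq w2 by fastforce
  have node: "loop_node mu hue L
    = ?A ^ (J * zeros hue) * ?b ^ mono_arcs hue" for hue
    unfolding node_loops J ..
  have z: "zeros hue \<le> n" for hue :: "nat \<Rightarrow> nat"
    using card_mono[of "{..<n}" "{x. x < n \<and> hue x = 0}"] by auto
  have eq: "?A ^ (J * zeros hue) * ?b ^ mono_arcs hue = r0
    \<longleftrightarrow> zeros hue = n - w0 \<and> mono_arcs hue = w0 * (w0 - 1)" for hue
    unfolding r0 using uniq[OF _ mono_arcs_le w2] by (intro iffI) simp_all
  show "\<exists>c. \<forall>k. R2 lam mu (rgraph n (map pset (concat (replicate k (gadget (\<lambda>x. x) (2 * L) n adj)))))
    = (\<Sum>r\<in>F. c r * r ^ k) + lam ^ n * ((1 / lam - 1) * of_nat (card (cliques n adj w0))) * r0 ^ k"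
  proof (rule R2_power_sum[OF lam])
    show "finite F" unfolding F by simp
    fix b hue
    assume "loop_node mu hue L \<noteq> r0"
    then show "loop_node mu hue L \<in> F"
      unfolding node eq F using z[of hue] mono_arcs_le[of hue]
      by (intro image_eqI[of _ _ "(zeros hue, mono_arcs hue)"]) auto
  next
    have "(\<Sum>b\<le>n. ((1 / lam - 1) gchoose b) * of_nat (card {hue \<in> onto n b. loop_node mu hue L = r0}))
        = (\<Sum>b\<le>n. if b = 1 then (1 / lam - 1) * of_nat (card (cliques n adj w0)) else 0)"
      unfolding node eq card_clique_colouring_zero[OF w0]
      by (rule sum.cong) auto
    then show "(\<Sum>b\<le>n. ((1 / lam - 1) gchoose b) * of_nat (card {hue \<in> onto n b. loop_node mu hue L = r0}))
        = (1 / lam - 1) * of_nat (card (cliques n adj w0))"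
      using w0 by simp
  qed (use gadget_bound[of _ "\<lambda>x. x" _ n adj n] nF in auto)
qed

lemma far_exponent:
  assumes M: "2 * (n * n) < M" and w: "w0 \<le> n" and e: "e0 \<le> 2 * (n * n)"
    and eq: "M * (n - card (far hue)) + (far_arcs hue + far_mono hue) = M * (n - w0) + e0"
  shows "card (far hue) = w0 \<and> far_arcs hue + far_mono hue = e0"
proof -
  have "card (far hue) * (card (far hue) - 1) \<le> n * n" using card_far_le[of hue] by (intro mult_le_mono) auto
  then have "far_arcs hue + far_mono hue < M" using far_le[of hue] M by simp
  from mixed_radix_unique[OF eq this] have "n - card (far hue) = n - w0" "far_arcs hue + far_mono hue = e0"
    using e M by auto
  then show ?thesis using w card_far_le[of hue] by auto
qed

lemma far_bound: "M * (n - card (far hue)) + (far_arcs hue + far_mono hue) \<le> M * n + 2 * (n * n)"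
proof -
  have "card (far hue) * (card (far hue) - 1) \<le> n * n" using card_far_le[of hue] by (intro mult_le_mono) auto
  then have "far_arcs hue + far_mono hue \<le> 2 * (n * n)" using far_le[of hue] by simp
  then show ?thesis by (intro add_mono mult_le_mono) auto
qed

text \<open>
  The exponent of the ratio that is singled out cannot be attained with colour zero at the hub, since the
  clique leaves out a vertex.  In general it belongs to two nonzero colours.  For \<open>q = 2\<close> there is only
  one, and its coefficient is used.
\<close>

lemma power_sum_hub:
  assumes lam: "lam \<noteq> 0" and mu: "mu = - 1 \<or> mu = - 2" and w0: "2 \<le> w0" "w0 < n" and L: "n * n \<le> L"
    and M: "M = 2 * (n - 1 + L)" and D: "D = card (arcs n adj)"
    and F: "F = insert 0 ((\<lambda>i. (1 + mu\<^sup>2) ^ i / (1 + mu\<^sup>2) ^ D) ` ({..M * n + 2 * (n * n)} - {M * (n - w0) + e0}))"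
    and r0: "r0 = (1 + mu\<^sup>2) ^ (M * (n - w0) + e0) / (1 + mu\<^sup>2) ^ D"
    and cases: "lam \<noteq> 1 / 2 \<and> e0 = 2 * (w0 * (w0 - 1)) \<and> \<kappa> = (1 / lam - 1) * (1 / lam - 2)
      \<or> lam = 1 / 2 \<and> mu = - 2 \<and> e0 = w0 * (w0 - 1) \<and> \<kappa> = 1"
  shows "r0 \<notin> F"
    and "\<exists>c. \<forall>k. R2 lam mu (rgraph (Suc n) (map pset (concat (replicate k (gadget (\<lambda>_. n) (2 * L) n adj)))))
    = (\<Sum>r\<in>F. c r * r ^ k) + lam ^ Suc n * (\<kappa> * of_nat (card (cliques n adj w0))) * r0 ^ k"
proof -
  let ?b = "1 + mu\<^sup>2" and ?X = "M * (n - w0) + e0"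
  let ?node = "\<lambda>hue. hub_node mu hue L"
  let ?sum = "\<Sum>b\<le>Suc n. ((1 / lam - 1) gchoose b) * of_nat (card {hue \<in> onto (Suc n) b. ?node hue = r0})"
  have b: "?b > 1" using mu by auto
  have n1: "1 \<le> n" "1 \<le> L" using w0 L by (auto simp: Suc_le_eq intro: order.strict_trans2[of 0 "n * n"])
  have M2: "2 * (n * n) < M" using L w0 unfolding M by simp
  have w2: "w0 * (w0 - 1) \<le> n * n" using w0 by (intro mult_le_mono) auto
  have e0: "e0 \<le> 2 * (n * n)" using cases w2 by auto
  have MX: "M \<le> ?X"
  proof -
    have "M * 1 \<le> M * (n - w0)" using w0 by (intro mult_le_mono) auto
    then show ?thesis by (simp only: mult_1_right trans_le_add1)
  qed
  have "?b > 0" by (rule add_pos_nonneg) simp_all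
  then have b0: "?b \<noteq> 0" by simp
  show nF: "r0 \<notin> F"
    unfolding F r0 using b0 power_inject_exp[OF b] by auto
  have pow: "x = ?b ^ i / ?b ^ D" if "?b ^ D * x = ?b ^ i" for x i
    using that b0 by (simp add: eq_divide_eq mult.commute)
  have inj: "?b ^ i / ?b ^ D = r0 \<longleftrightarrow> i = ?X" for i
    unfolding r0 using power_inject_exp[OF b] b0 by auto
  have mem: "?b ^ i / ?b ^ D \<in> F" if "i \<le> M * n + 2 * (n * n)" "i \<noteq> ?X" for i
    unfolding F using that by auto
  have r0n: "r0 \<noteq> 0" using b0 unfolding r0 by simp
  have F0: "0 \<in> F" unfolding F by simp
  have zero: "?node hue \<noteq> r0 \<and> ?node hue \<in> F" if s: "hue n = 0" for hue
  proof (cases "mu = - 1")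
    case True
    have "?node hue = 0" by (rule node_hub_annihilated[of hue n]) (use True n1 s in auto)
    then show ?thesis using r0n F0 by metis
  next
    case False
    then have "(1 + mu)\<^sup>2 = 1" using mu by auto
    then have "?b ^ D * ?node hue = ?b ^ (D + mono_arcs hue)" using node_hub_zero[of hue mu L, OF s] by (simp add: power_add)
    then have e: "?node hue = ?b ^ (D + mono_arcs hue) / ?b ^ D" by (rule pow)
    have "D + mono_arcs hue \<le> 2 * (n * n)" using mono_arcs_le[of hue] card_arcs_le[of n adj] unfolding D by simp
    then have "D + mono_arcs hue \<le> M * n + 2 * (n * n)" "D + mono_arcs hue \<noteq> ?X" using M2 MX by auto
    then show ?thesis using inj mem unfolding e by blast
  qed
  have nonzero: "?node hue = ?b ^ (M * (n - card (far hue)) + (far_arcs hue + far_mono hue)) / ?b ^ D"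
    if "hue n \<noteq> 0" "mu = - 2 \<or> (\<forall>x<n. hue x \<noteq> 0)" for hue
  proof (rule pow)
    have "(1 + mu)\<^sup>2 = 1 \<or> (\<forall>x<n. hue x \<noteq> 0)" using that(2) by auto
    from node_hub[of hue mu L, OF that(1) this] show "?b ^ D * ?node hue = ?b ^ (M * (n - card (far hue)) + (far_arcs hue + far_mono hue))"
      unfolding D M .
  qed
  have somezero: "?node hue = 0" if "mu = - 1" "x < n" "hue x = 0" for hue x
    by (rule node_hub_annihilated[of hue x]) (use that n1 in auto)
  have inF: "?node hue \<in> F" if "?node hue \<noteq> r0" for hue
  proof (cases "hue n = 0")
    case False
    show ?thesis
    proof (cases "mu = - 2 \<or> (\<forall>x<n. hue x \<noteq> 0)")
      case True
      show ?thesis using that mem far_bound inj unfolding nonzero[OF False True] by blast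
    next
      case False
      then have "?node hue = 0" using mu somezero by blast
      then show ?thesis using F0 by (simp only:)
    qed
  qed (use zero in blast)
  have target: "?node hue = r0 \<longleftrightarrow> hue n \<noteq> 0 \<and> (mu = - 2 \<or> (\<forall>x<n. hue x \<noteq> 0))
      \<and> card (far hue) = w0 \<and> far_arcs hue + far_mono hue = e0" for hue
  proof (cases "hue n \<noteq> 0 \<and> (mu = - 2 \<or> (\<forall>x<n. hue x \<noteq> 0))")
    case True
    then show ?thesis using far_exponent[OF M2 _ e0, of w0 hue] w0 unfolding nonzero[OF conjunct1[OF True] conjunct2[OF True]] inj by auto
  next
    case False
    then have "?node hue \<noteq> r0" using zero somezero mu r0n by metis
    then show ?thesis using False by auto
  qed
  have count: "?sum
    = \<kappa> * of_nat (card (cliques n adj w0))"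
    using cases
  proof (elim disjE conjE)
    assume e: "e0 = 2 * (w0 * (w0 - 1))" and k: "\<kappa> = (1 / lam - 1) * (1 / lam - 2)"
    have "?node hue = r0 \<longleftrightarrow> (\<forall>x\<le>n. hue x \<noteq> 0) \<and> card (far hue) = w0
      \<and> far_arcs hue = w0 * (w0 - 1) \<and> far_mono hue = w0 * (w0 - 1)" for hue
    proof -
      have f: "far_arcs hue + far_mono hue = e0 \<longleftrightarrow> far_arcs hue = w0 * (w0 - 1) \<and> far_mono hue = w0 * (w0 - 1)"
        if "card (far hue) = w0"
        using far_le[of hue] unfolding that e by auto
      have nz: "\<forall>x<n. hue x \<noteq> 0" if "card (far hue) = w0" "far_mono hue = w0 * (w0 - 1)" "hue n \<noteq> 0"
      proof (intro allI impI)
        fix x assume x: "x < n"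
        have all: "\<forall>x\<in>far hue. \<forall>y\<in>far hue. x \<noteq> y \<longrightarrow> adj x y \<and> hue x = hue y \<and> hue x \<noteq> 0"
          using that(2) unfolding far_mono_def that(1)[symmetric] card_offdiag_filter(2)[OF finite_far] .
        show "hue x \<noteq> 0"
        proof (cases "x \<in> far hue")
          case True
          have "far hue \<noteq> {x}" using that(1) w0 by auto
          then obtain y where y: "y \<in> far hue" "x \<noteq> y" using True by blast
          show ?thesis using all[THEN bspec, OF True, THEN bspec, OF y(1)] y(2) by (rule impE) (elim conjE)
        next
          case False
          then show ?thesis using x that(3) by (simp add: far_def)
        qed
      qed
      have sp: "(\<forall>x\<le>n. hue x \<noteq> 0) \<longleftrightarrow> hue n \<noteq> 0 \<and> (\<forall>x<n. hue x \<noteq> 0)" using le_less by metis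
      show ?thesis unfolding target sp
      proof (intro iffI; elim conjE)
        assume "hue n \<noteq> 0" "card (far hue) = w0" "far_arcs hue + far_mono hue = e0"
        then show "(hue n \<noteq> 0 \<and> (\<forall>x<n. hue x \<noteq> 0)) \<and> card (far hue) = w0
            \<and> far_arcs hue = w0 * (w0 - 1) \<and> far_mono hue = w0 * (w0 - 1)"
          using f nz by metis
      next
        assume "hue n \<noteq> 0" "\<forall>x<n. hue x \<noteq> 0" "card (far hue) = w0"
          "far_arcs hue = w0 * (w0 - 1)" "far_mono hue = w0 * (w0 - 1)"
        then show "hue n \<noteq> 0 \<and> (mu = - 2 \<or> (\<forall>x<n. hue x \<noteq> 0))
            \<and> card (far hue) = w0 \<and> far_arcs hue + far_mono hue = e0"
          using f by metis
      qed
    qed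
    then have "?sum
        = (\<Sum>b\<le>Suc n. if b = 2 then ((1 / lam - 1) gchoose 2) * of_nat (2 * card (cliques n adj w0)) else 0)"
      using card_clique_colouring_hub[of w0, OF w0(1)] w0 by (intro sum.cong) auto
    also have "\<dots> = ((1 / lam - 1) gchoose 2) * of_nat (2 * card (cliques n adj w0))" using w0 by simp
    also have "(1 / lam - 1) gchoose 2 = (1 / lam - 1) * (1 / lam - 2) / 2"
      by (simp add: gbinomial_prod_rev numeral_2_eq_2 algebra_simps)
    finally show ?thesis unfolding k by simp
  next
    assume l: "lam = 1 / 2" and mu2: "mu = - 2" and e: "e0 = w0 * (w0 - 1)" and k: "\<kappa> = 1"
    have q: "1 / lam - 1 = of_nat 1" unfolding l by simp
    have g: "(1 / lam - 1) gchoose b = (if b \<le> 1 then 1 else 0)" for b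
      unfolding q binomial_gbinomial[symmetric] by (cases b; cases "b - 1") auto
    have c0: "card {hue \<in> onto (Suc n) 0. ?node hue = r0} = 0"
    proof -
      have "hue n = 0" if "hue \<in> onto (Suc n) 0" for hue using that by (auto simp: onto_def PiE_iff)
      then have "{hue \<in> onto (Suc n) 0. ?node hue = r0} = {}" unfolding target by auto
      then show ?thesis by (simp only: card.empty)
    qed
    have "?sum
        = (\<Sum>b\<le>Suc n. if b = 1 then of_nat (card {hue \<in> onto (Suc n) 1. ?node hue = r0}) else 0)"
    proof (rule sum.cong[OF refl])
      fix b :: nat
      have "b = 0 \<or> b = 1 \<or> \<not> b \<le> 1" by auto
      then show "((1 / lam - 1) gchoose b) * of_nat (card {hue \<in> onto (Suc n) b. ?node hue = r0})
          = (if b = 1 then of_nat (card {hue \<in> onto (Suc n) 1. ?node hue = r0}) else 0)"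
        unfolding g using c0 by (elim disjE) simp_all
    qed
    also have "\<dots> = of_nat (card {hue \<in> onto (Suc n) 1. ?node hue = r0})" by simp
    also have "{hue \<in> onto (Suc n) 1. ?node hue = r0}
        = {hue \<in> onto (Suc n) 1. hue n \<noteq> 0 \<and> card (far hue) = w0 \<and> far_arcs hue + far_mono hue = w0 * (w0 - 1)}"
      unfolding target using mu2 e by auto
    also have "card \<dots> = card (cliques n adj w0)" using card_clique_colouring_hub_one[of w0] w0 by simp
    finally show ?thesis unfolding k by simp
  qed
  show "\<exists>c. \<forall>k. R2 lam mu (rgraph (Suc n) (map pset (concat (replicate k (gadget (\<lambda>_. n) (2 * L) n adj)))))
    = (\<Sum>r\<in>F. c r * r ^ k) + lam ^ Suc n * (\<kappa> * of_nat (card (cliques n adj w0))) * r0 ^ k"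
    by (rule R2_power_sum[OF lam])
       (use gadget_bound[of _ "\<lambda>_. n" _ n adj "Suc n"] nF inF count F in auto)
qed

end

section \<open>Isolating one coefficient of a power sum\<close>

text \<open>
  For every fraction \<open>P / Q\<close> in the list, pass from the sequence \<open>y k\<close> to \<open>Q y (k + 1) - P y k\<close>, in which
  the powers of \<open>P / Q\<close> have disappeared.
\<close>

definition annihilate :: "(nat \<times> nat) list \<Rightarrow> rat list \<Rightarrow> rat list" where
  "annihilate rs ys = foldl (\<lambda>ys (P, Q). map2 (\<lambda>a b. of_nat Q * b - of_nat P * a) ys (tl ys)) ys rs"

lemma annihilate_power_sum:
  fixes c :: "rat \<Rightarrow> rat"
  assumes "length ys = length rs + Suc m" "finite F" "r0 \<notin> F"
    and "\<And>i. i < length ys \<Longrightarrow> ys ! i = (\<Sum>r\<in>F. c r * r ^ i) + c0 * r0 ^ i"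
    and "\<And>P Q. (P, Q) \<in> set rs \<Longrightarrow> Q \<noteq> 0"
    and "F \<subseteq> {of_nat P / of_nat Q | P Q. (P, Q) \<in> set rs}"
  shows "length (annihilate rs ys) = Suc m
    \<and> annihilate rs ys ! 0 = c0 * prod_list (map (\<lambda>(P, Q). of_nat Q * r0 - of_nat P) rs)"
  using assms
proof (induction rs arbitrary: ys F c c0)
  case Nil
  then have "F = {}" by auto
  then show ?case using Nil by (simp add: annihilate_def)
next
  case (Cons pq rs)
  obtain P Q where pq: "pq = (P, Q)" by (cases pq)
  have Q: "Q \<noteq> 0" using Cons.prems(5) pq by auto
  define s where "s = (of_nat P / of_nat Q :: rat)"
  let ?zs = "map2 (\<lambda>a b. of_nat Q * b - of_nat P * a) ys (tl ys)"
  have len: "length ?zs = length rs + Suc m" using Cons.prems(1) by simp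
  have z: "?zs ! i = (\<Sum>r\<in>F - {s}. (c r * (of_nat Q * r - of_nat P)) * r ^ i) + (c0 * (of_nat Q * r0 - of_nat P)) * r0 ^ i"
    if "i < length ?zs" for i
  proof -
    have i: "i < length ys" "Suc i < length ys" "i < length (tl ys)" using that Cons.prems(1) by auto
    have "?zs ! i = of_nat Q * ys ! Suc i - of_nat P * ys ! i" using i by (simp add: nth_tl)
    also have "\<dots> = (\<Sum>r\<in>F. (c r * (of_nat Q * r - of_nat P)) * r ^ i) + (c0 * (of_nat Q * r0 - of_nat P)) * r0 ^ i"
      unfolding Cons.prems(4)[OF i(1)] Cons.prems(4)[OF i(2)]
      by (simp add: distrib_left sum_distrib_left sum_subtractf[symmetric] algebra_simps sum.distrib[symmetric])
    also have "(\<Sum>r\<in>F. (c r * (of_nat Q * r - of_nat P)) * r ^ i) = (\<Sum>r\<in>F - {s}. (c r * (of_nat Q * r - of_nat P)) * r ^ i)"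
      by (rule sum.mono_neutral_right) (use Cons.prems(2) Q in \<open>auto simp: s_def\<close>)
    finally show ?thesis .
  qed
  have sub: "F - {s} \<subseteq> {of_nat P / of_nat Q | P Q. (P, Q) \<in> set rs}"
  proof
    fix x assume x: "x \<in> F - {s}"
    then obtain P' Q' where "x = of_nat P' / of_nat Q'" "(P', Q') \<in> set (pq # rs)" using Cons.prems(6) by blast
    moreover from this x have "(P', Q') \<noteq> pq" unfolding pq s_def by auto
    ultimately show "x \<in> {of_nat P / of_nat Q | P Q. (P, Q) \<in> set rs}" by auto
  qed
  have "length (annihilate rs ?zs) = Suc m \<and>
      annihilate rs ?zs ! 0 = c0 * (of_nat Q * r0 - of_nat P) * prod_list (map (\<lambda>(P, Q). of_nat Q * r0 - of_nat P) rs)"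
    by (rule Cons.IH[where F = "F - {s}" and c = "\<lambda>r. c r * (of_nat Q * r - of_nat P)"])
      (use Cons.prems len z sub in auto)
  moreover have "annihilate (pq # rs) ys = annihilate rs ?zs" by (simp add: annihilate_def pq)
  ultimately show ?case by (simp add: pq mult.assoc)
qed

section \<open>Cliques and constraint satisfaction\<close>

text \<open>
  Vertices are pairs of a variable and a value, and adjacent vertices have different variables.  A
  clique with as many vertices as there are variables is a solution of the constraints.
\<close>

lemma card_cliques_solutions:
  fixes vals :: "'p \<Rightarrow> 'a list"
  assumes P: "distinct P" "\<And>p. p \<in> set P \<Longrightarrow> distinct (vals p)"
    and vs: "vs = concat (map (\<lambda>p. map (Pair p) (vals p)) P)"
    and cmp: "\<And>v w. cmp v w \<Longrightarrow> fst v \<noteq> fst w"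
    and n: "length vs \<le> n" and w0: "w0 = length P" "2 \<le> w0"
  shows "card (cliques n (\<lambda>i j. i < length vs \<and> j < length vs \<and> cmp (vs ! i) (vs ! j)) w0)
    = card {g \<in> (\<Pi>\<^sub>E p\<in>set P. set (vals p)). \<forall>p\<in>set P. \<forall>p'\<in>set P. p \<noteq> p' \<longrightarrow> cmp (p, g p) (p', g p')}"
proof -
  let ?adj = "\<lambda>i j. i < length vs \<and> j < length vs \<and> cmp (vs ! i) (vs ! j)"
  let ?S = "{g \<in> (\<Pi>\<^sub>E p\<in>set P. set (vals p)). \<forall>p\<in>set P. \<forall>p'\<in>set P. p \<noteq> p' \<longrightarrow> cmp (p, g p) (p', g p')}"
  let ?G = "\<lambda>g. {i. i < length vs \<and> snd (vs ! i) = g (fst (vs ! i))}"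
  have set_vs: "v \<in> set vs \<longleftrightarrow> fst v \<in> set P \<and> snd v \<in> set (vals (fst v))" for v
    unfolding vs by (cases v) auto
  have dist: "distinct vs"
    unfolding vs using P
    by (induction P) (auto simp: distinct_map inj_on_def)
  have nth_inj: "i = j" if "i < length vs" "j < length vs" "vs ! i = vs ! j" for i j
    using nth_eq_iff_index_eq[OF dist that(1,2)] that(3) by simp
  have cardP: "card (set P) = w0" using distinct_card[OF P(1)] w0 by simp
  have ex: "\<exists>i<length vs. vs ! i = (p, g p)" if "g \<in> (\<Pi>\<^sub>E p\<in>set P. set (vals p))" "p \<in> set P" for g p
    using set_vs[of "(p, g p)"] that by (auto simp: in_set_conv_nth PiE_iff)
  have inP: "fst (vs ! i) \<in> set P" "snd (vs ! i) \<in> set (vals (fst (vs ! i)))" if "i < length vs" for i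
    using set_vs[of "vs ! i"] that by auto
  have "bij_betw ?G ?S (cliques n ?adj w0)"
    unfolding bij_betw_def
  proof (intro conjI inj_onI subset_antisym image_subsetI subsetI)
    fix g g' assume g: "g \<in> ?S" "g' \<in> ?S" and e: "?G g = ?G g'"
    show "g = g'"
    proof (rule PiE_ext)
      show "g \<in> (\<Pi>\<^sub>E p\<in>set P. set (vals p))" "g' \<in> (\<Pi>\<^sub>E p\<in>set P. set (vals p))" using g by auto
      fix p assume p: "p \<in> set P"
      obtain i where i: "i < length vs" "vs ! i = (p, g p)" using ex[of g p] g(1) p by auto
      then have "i \<in> ?G g'" unfolding e[symmetric] by simp
      then show "g p = g' p" using i by simp
    qed
  next
    fix g assume g: "g \<in> ?S"
    have "bij_betw (\<lambda>i. fst (vs ! i)) (?G g) (set P)"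
      unfolding bij_betw_def
    proof (intro conjI inj_onI subset_antisym image_subsetI subsetI)
      show "i = j" if "i \<in> ?G g" "j \<in> ?G g" "fst (vs ! i) = fst (vs ! j)" for i j
        by (rule nth_inj) (use that in \<open>auto simp: prod_eq_iff\<close>)
      show "fst (vs ! i) \<in> set P" if "i \<in> ?G g" for i using inP that by simp
      show "p \<in> (\<lambda>i. fst (vs ! i)) ` ?G g" if p: "p \<in> set P" for p
      proof -
        obtain i where i: "i < length vs" "vs ! i = (p, g p)" using ex[of g p] g p by auto
        show ?thesis by (rule image_eqI[of _ _ i]) (use i in auto)
      qed
    qed
    from bij_betw_same_card[OF this] have c: "card (?G g) = w0" unfolding cardP .
    have a: "?adj i j" if ij: "i \<in> ?G g" "j \<in> ?G g" "i \<noteq> j" for i j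
    proof -
      have l: "i < length vs" "j < length vs" using ij by simp_all
      have e: "(fst (vs ! i), g (fst (vs ! i))) = vs ! i" "(fst (vs ! j), g (fst (vs ! j))) = vs ! j"
        using ij by (simp_all add: prod_eq_iff)
      have "fst (vs ! i) \<noteq> fst (vs ! j)" using nth_inj[OF l] ij(3) e by metis
      moreover have "\<forall>p\<in>set P. \<forall>p'\<in>set P. p \<noteq> p' \<longrightarrow> cmp (p, g p) (p', g p')" using g by simp
      ultimately have "cmp (fst (vs ! i), g (fst (vs ! i))) (fst (vs ! j), g (fst (vs ! j)))"
        using inP(1)[OF l(1)] inP(1)[OF l(2)] by metis
      then show ?thesis unfolding e using l by simp
    qed
    have "?G g \<subseteq> {..<n}" using n by auto
    then show "?G g \<in> cliques n ?adj w0"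
      unfolding cliques_def mem_Collect_eq by (intro conjI ballI impI c a)
  next
    fix C assume C: "C \<in> cliques n ?adj w0"
    let ?f = "\<lambda>i. fst (vs ! i)"
    have card: "card C = w0" and adj: "\<And>i j. i \<in> C \<Longrightarrow> j \<in> C \<Longrightarrow> i \<noteq> j \<Longrightarrow> ?adj i j"
      using C unfolding cliques_def mem_Collect_eq by blast+
    have len: "i < length vs" if iC: "i \<in> C" for i
    proof -
      have "C \<noteq> {i}" using card w0 by auto
      then obtain j where "j \<in> C" "i \<noteq> j" using iC by blast
      then show ?thesis using adj[OF iC] by metis
    qed
    have inj: "inj_on ?f C" using adj cmp by (intro inj_onI) metis
    have "?f ` C \<subseteq> set P" using inP(1)[OF len] by (rule image_subsetI)
    moreover have "card (?f ` C) = card (set P)" using card_image[OF inj] card cardP by simp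
    ultimately have im: "?f ` C = set P" by (intro card_subset_eq) auto
    define g where "g = (\<lambda>p\<in>set P. snd (vs ! inv_into C ?f p))"
    have inv: "inv_into C ?f p \<in> C" "fst (vs ! inv_into C ?f p) = p" if "p \<in> set P" for p
      using that unfolding im[symmetric] by (rule inv_into_into, rule f_inv_into_f)
    have v: "vs ! inv_into C ?f p = (p, g p)" if "p \<in> set P" for p
      using inv(2)[OF that] that by (simp add: g_def prod_eq_iff)
    have "g \<in> (\<Pi>\<^sub>E p\<in>set P. set (vals p))"
    proof
      fix p assume p: "p \<in> set P"
      show "g p \<in> set (vals p)" using inP(2)[OF len[OF inv(1)[OF p]]] unfolding v[OF p] by simp
    qed (simp add: g_def)
    moreover have "cmp (p, g p) (p', g p')" if p: "p \<in> set P" "p' \<in> set P" "p \<noteq> p'" for p p'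
    proof -
      have "inv_into C ?f p \<noteq> inv_into C ?f p'" using inv(2) p by metis
      then have "cmp (vs ! inv_into C ?f p) (vs ! inv_into C ?f p')" using adj[OF inv(1)[OF p(1)] inv(1)[OF p(2)]] by metis
      then show ?thesis using v p by simp
    qed
    ultimately have gS: "g \<in> ?S" unfolding mem_Collect_eq by (intro conjI ballI impI)
    have "?G g = C"
    proof (intro subset_antisym subsetI)
      fix i assume i: "i \<in> ?G g"
      then have p: "?f i \<in> set P" using inP by simp
      have "vs ! i = vs ! inv_into C ?f (?f i)" unfolding v[OF p] using i by (simp add: prod_eq_iff)
      then have "i = inv_into C ?f (?f i)" using nth_inj i len[OF inv(1)[OF p]] by simp
      then show "i \<in> C" using inv(1)[OF p] by simp
    next
      fix i assume i: "i \<in> C"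
      have p: "?f i \<in> set P" using im i by blast
      have "inv_into C ?f (?f i) = i" by (rule inv_into_f_f[OF inj i])
      then have "vs ! i = (?f i, g (?f i))" using v[OF p] by simp
      then show "i \<in> ?G g" using len[OF i] by (simp add: prod_eq_iff)
    qed
    then have "C = ?G g" by (rule HOL.sym)
    from this gS show "C \<in> ?G ` ?S" by (rule image_eqI)
  qed
  from bij_betw_same_card[OF this, symmetric] show ?thesis .
qed

section \<open>Computations as solutions of constraints\<close>

text \<open>
  Directions are represented by the numbers 0, 1 and 2.
\<close>

definition move :: "nat \<Rightarrow> nat \<Rightarrow> nat" where
  "move d h = (if d = 0 then h - 1 else if d = 1 then h else h + 1)"

definition dirnum :: "direction \<Rightarrow> nat" where
  "dirnum d = (case d of Go_Left \<Rightarrow> 0 | Stay \<Rightarrow> 1 | Go_Right \<Rightarrow> 2)"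

lemma move_dirnum: "move (dirnum d) h = (case d of Go_Left \<Rightarrow> h - 1 | Stay \<Rightarrow> h | Go_Right \<Rightarrow> h + 1)"
  by (cases d) (auto simp: move_def dirnum_def)

text \<open>The action of a machine, which in the halting state is to repeat the scanned symbols.\<close>

definition action :: "machine \<Rightarrow> nat \<times> nat list \<Rightarrow> nat \<times> (nat \<times> nat) list" where
  "action M p = (if fst p = 1 then (1, map (\<lambda>s. (s, 1)) (snd p))
    else (fst (delta M (fst p) (snd p)), map (map_prod id dirnum) (snd (delta M (fst p) (snd p)))))"

locale oracle_free_machine =
  fixes M :: machine
  assumes wf: "machine_wf M" and free: "oracle_free M"
begin

abbreviation "ntapes \<equiv> num_tapes M"

text \<open>
  The configuration after \<open>t\<close> steps on input \<open>z\<close>, its state, head positions, scanned symbols and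
  tape cells, and the action taken in it.
\<close>

definition conf :: "bool list \<Rightarrow> nat \<Rightarrow> config" where
  "conf z t = (step M (\<lambda>_. []) ^^ t) (initial M z)"

definition st :: "bool list \<Rightarrow> nat \<Rightarrow> nat" where
  "st z t = fst (conf z t)"

definition heads :: "bool list \<Rightarrow> nat \<Rightarrow> nat list" where
  "heads z t = map snd (snd (conf z t))"

definition syms :: "bool list \<Rightarrow> nat \<Rightarrow> nat list" where
  "syms z t = map scanned (snd (conf z t))"

definition cell :: "bool list \<Rightarrow> nat \<Rightarrow> nat \<Rightarrow> nat \<Rightarrow> nat" where
  "cell z t i j = fst (snd (conf z t) ! i) j"

definition act :: "bool list \<Rightarrow> nat \<Rightarrow> nat \<times> (nat \<times> nat) list" where
  "act z t = action M (st z t, syms z t)"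

lemma tapes2: "2 \<le> ntapes"
  using wf by (simp add: machine_wf_def)

lemma conf_0: "conf z 0 = initial M z" and conf_Suc: "conf z (Suc t) = step M (\<lambda>_. []) (conf z t)"
  by (simp_all add: conf_def)

text \<open>
  Configurations within the bounds of the machine and outside of the query state.
\<close>

definition valid :: "config \<Rightarrow> bool" where
  "valid c \<longleftrightarrow> fst c < num_states M \<and> fst c \<noteq> 2 \<and> length (snd c) = ntapes
     \<and> (\<forall>tp\<in>set (snd c). \<forall>j. fst tp j < num_syms M)"

lemma scanned_syms: "valid c \<Longrightarrow> set (map scanned (snd c)) \<subseteq> {..<num_syms M}"
  by (auto simp: valid_def scanned_def)

lemma delta_valid:
  assumes "valid c"
  shows "fst (delta M (fst c) (map scanned (snd c))) < num_states M"
    "fst (delta M (fst c) (map scanned (snd c))) \<noteq> 2"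
    "length (snd (delta M (fst c) (map scanned (snd c)))) = ntapes"
    "fst ` set (snd (delta M (fst c) (map scanned (snd c)))) \<subseteq> {..<num_syms M}"
  using wf free scanned_syms[OF assms] assms unfolding machine_wf_def oracle_free_def valid_def
  by simp_all

lemma step_valid: "valid c \<Longrightarrow> fst c \<noteq> 1 \<Longrightarrow> step M orc c
  = (fst (delta M (fst c) (map scanned (snd c))), map2 update_tape (snd (delta M (fst c) (map scanned (snd c)))) (snd c))"
  by (simp add: step_def valid_def Let_def)

lemma valid_step: 
  assumes c: "valid c"
  shows "valid (step M orc c)"
proof (cases "fst c = 1")
  case True
  then show ?thesis using c by (simp add: step_def)
next
  case False
  have "fst tp j < num_syms M" if "tp \<in> set (map2 update_tape (snd (delta M (fst c) (map scanned (snd c)))) (snd c))" for tp j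
  proof -
    obtain a t where at: "(a, t) \<in> set (zip (snd (delta M (fst c) (map scanned (snd c)))) (snd c))" "tp = update_tape a t"
      using \<open>tp \<in> _\<close> by auto
    have "fst a < num_syms M" using set_zip_leftD[OF at(1)] delta_valid(4)[OF c] by auto
    moreover have "fst t j < num_syms M" using set_zip_rightD[OF at(1)] c by (auto simp: valid_def)
    ultimately show ?thesis by (simp add: at(2) update_tape_def)
  qed
  then show ?thesis using delta_valid[OF c] c by (simp add: step_valid[OF c False] valid_def)
qed

lemma valid_initial: "valid (initial M z)"
  using wf by (auto simp: valid_def initial_def machine_wf_def word_tape_def)

lemma valid_conf: "valid (conf z t)"
  by (induction t) (simp_all add: conf_0 conf_Suc valid_initial valid_step)

lemma lengths: "length (snd (conf z t)) = ntapes" "length (heads z t) = ntapes" "length (syms z t) = ntapes"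
  using valid_conf[of z t] by (simp_all add: valid_def heads_def syms_def)

lemma syms_nth: "i < ntapes \<Longrightarrow> syms z t ! i = cell z t i (heads z t ! i)"
  by (simp add: syms_def heads_def cell_def lengths scanned_def)

lemma syms_less: "set (syms z t) \<subseteq> {..<num_syms M}"
  unfolding syms_def by (rule scanned_syms[OF valid_conf])

lemma cell_less: "i < ntapes \<Longrightarrow> cell z t i j < num_syms M"
  using valid_conf[of z t] lengths(1)[of z t] by (auto simp: cell_def valid_def)

lemma st_less: "st z t < num_states M"
  using valid_conf[of z t] by (simp add: st_def valid_def)

lemma length_act: "length (snd (act z t)) = ntapes"
  using delta_valid(3)[OF valid_conf[of z t]] lengths(3)[of z t]
  by (simp add: act_def action_def st_def syms_def lengths)

lemma step_act:
  "st z (Suc t) = fst (act z t)"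
  "heads z (Suc t) = map (\<lambda>(h, a). move (snd a) h) (zip (heads z t) (snd (act z t)))"
  "i < ntapes \<Longrightarrow> cell z (Suc t) i j = (if heads z t ! i = j then fst (snd (act z t) ! i) else cell z t i j)"
proof -
  let ?c = "conf z t"
  have v: "valid ?c" by (rule valid_conf)
  have len: "length (snd ?c) = ntapes" by (rule lengths)
  let ?d = "snd (delta M (fst ?c) (map scanned (snd ?c)))"
  have ld: "length ?d = ntapes" by (rule delta_valid(3)[OF v])
  have halt: "conf z (Suc t) = ?c" if "fst ?c = 1" using that by (simp add: conf_Suc step_def)
  have go: "conf z (Suc t) = (fst (delta M (fst ?c) (map scanned (snd ?c))), map2 update_tape ?d (snd ?c))"
    if "fst ?c \<noteq> 1" unfolding conf_Suc by (rule step_valid[OF v that])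
  show "st z (Suc t) = fst (act z t)"
    by (cases "fst ?c = 1") (auto simp: st_def act_def action_def syms_def halt go)
  show "heads z (Suc t) = map (\<lambda>(h, a). move (snd a) h) (zip (heads z t) (snd (act z t)))"
  proof (cases "fst ?c = 1")
    case True
    then show ?thesis
      by (auto simp: heads_def act_def action_def st_def syms_def halt len move_def intro!: nth_equalityI)
  next
    case False
    show ?thesis
      by (rule nth_equalityI)
        (use False len ld in \<open>auto simp: heads_def act_def action_def st_def syms_def go move_dirnum update_tape_def\<close>)
  qed
  show "cell z (Suc t) i j = (if heads z t ! i = j then fst (snd (act z t) ! i) else cell z t i j)" if i: "i < ntapes"
  proof (cases "fst ?c = 1")
    case True
    then show ?thesis using i by (auto simp: cell_def heads_def act_def action_def st_def syms_def halt len scanned_def)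
  next
    case False
    then show ?thesis using i ld len
      by (auto simp: heads_def act_def action_def st_def syms_def go update_tape_def cell_def)
  qed
qed

lemma start:
  "st z 0 = 0" "heads z 0 = replicate ntapes 0"
  "i < ntapes \<Longrightarrow> cell z 0 i j = (if i = 0 \<and> j < length z then if z ! j then 2 else 1 else 0)"
proof -
  have "ntapes = Suc (ntapes - 1)" using tapes2 by simp
  then show "heads z 0 = replicate ntapes 0"
    unfolding heads_def conf_0 initial_def by (metis (no_types, lifting) list.simps(9) map_replicate replicate_Suc snd_conv word_tape_def)
  show "i < ntapes \<Longrightarrow> cell z 0 i j = (if i = 0 \<and> j < length z then if z ! j then 2 else 1 else 0)"
    by (cases i) (auto simp: cell_def conf_0 initial_def word_tape_def)
qed (simp add: st_def conf_0 initial_def)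

lemma heads_le: "i < ntapes \<Longrightarrow> heads z t ! i \<le> t"
proof (induction t)
  case 0
  then show ?case by (simp add: start)
next
  case (Suc t)
  have "heads z (Suc t) ! i = move (snd (snd (act z t) ! i)) (heads z t ! i)"
    using Suc.prems lengths(2)[of z t] length_act[of z t] by (simp add: step_act(2))
  then show ?case using Suc by (auto simp: move_def)
qed

lemma cell_blank: "i < ntapes \<Longrightarrow> length z + t \<le> j \<Longrightarrow> cell z t i j = 0"
proof (induction t)
  case 0
  then show ?case by (simp add: start)
next
  case (Suc t)
  then show ?case using heads_le[of i z t] by (auto simp: step_act(3))
qed

lemma accepted:
  assumes "computes_within M (\<lambda>_. []) z T [b]"
  shows "st z T = 1" "b \<longleftrightarrow> cell z T 0 0 = 2 \<and> cell z T 0 1 \<notin> {1, 2}"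
proof -
  let ?n = "LEAST n. cell z T 0 n \<notin> {1, 2}"
  have t0: "0 < ntapes" using tapes2 by simp
  have c: "st z T = 1 \<and> tape_word (hd (snd (conf z T))) = [b]"
    using assms by (simp add: computes_within_def conf_def st_def Let_def)
  then show "st z T = 1" by simp
  have "snd (conf z T) \<noteq> []" using lengths(1)[of z T] t0 by auto
  then have "tape_word (hd (snd (conf z T))) = map (\<lambda>i. cell z T 0 i = 2) [0..<?n]"
    by (simp add: tape_word_def cell_def hd_conv_nth)
  then have e: "map (\<lambda>i. cell z T 0 i = 2) [0..<?n] = [b]" using c by simp
  then have "length (map (\<lambda>i. cell z T 0 i = 2) [0..<?n]) = 1" by (simp only:) simp
  then have n1: "?n = 1" by simp
  then have "b \<longleftrightarrow> cell z T 0 0 = 2" using e by simp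
  moreover have "cell z T 0 ?n \<notin> {1, 2}"
    by (rule LeastI_ex) (use cell_blank[OF t0, of z T "length z + T"] in \<open>auto intro: exI[of _ "length z + T"]\<close>)
  ultimately show "b \<longleftrightarrow> cell z T 0 0 = 2 \<and> cell z T 0 1 \<notin> {1, 2}" unfolding n1 by simp
qed

end

declare upt_Suc [simp del]

text \<open>
  The variables of the constraints are the global state at each time, that is, the state, the head
  positions and the scanned symbols, and each tape cell at each time, with a flag for the presence
  of the head.  The flags make all constraints binary.
\<close>

type_synonym tvar = "nat \<times> (unit + nat \<times> nat)"
type_synonym tval = "(nat \<times> nat list \<times> nat list) + (nat \<times> bool)"

text \<open>
  The variables for the times \<open>ts\<close>, the tapes below \<open>k\<close> and the cells \<open>js\<close>.
\<close>

definition tvars :: "nat \<Rightarrow> nat list \<Rightarrow> nat list \<Rightarrow> tvar list" where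
  "tvars k ts js = concat (map (\<lambda>t. (t, Inl ()) # concat (map (\<lambda>i. map (\<lambda>j. (t, Inr (i, j))) js) [0..<k])) ts)"

primrec tuples :: "nat \<Rightarrow> 'a list \<Rightarrow> 'a list list" where
  "tuples 0 xs = [[]]"
| "tuples (Suc k) xs = concat (map (\<lambda>x. map (Cons x) (tuples k xs)) xs)"

text \<open>
  The values that a variable may take.
\<close>

definition tvals :: "machine \<Rightarrow> nat list \<Rightarrow> tvar \<Rightarrow> tval list" where
  "tvals M js v = (case snd v of
     Inl _ \<Rightarrow> concat (map (\<lambda>hs. map (\<lambda>p. Inl (fst p, hs, snd p))
       (List.product [0..<num_states M] (tuples (num_tapes M) [0..<num_syms M]))) (tuples (num_tapes M) js))
   | Inr _ \<Rightarrow> map Inr (List.product [0..<num_syms M] [False, True]))"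

text \<open>
  The conditions on single variables: the start, where every cell \<open>j\<close> of tape 0 holds one of the
  symbols in \<open>ini ! j\<close>, and acceptance at time \<open>T\<close>, where the output is the word with the single letter \<open>True\<close>.
\<close>

definition unary :: "nat \<Rightarrow> nat list list \<Rightarrow> nat \<Rightarrow> tvar \<times> tval \<Rightarrow> bool" where
  "unary k ini T v = (case snd v of
     Inl a \<Rightarrow> (fst (fst v) = 0 \<longrightarrow> fst a = 0 \<and> fst (snd a) = replicate k 0) \<and> (fst (fst v) = T \<longrightarrow> fst a = 1)
   | Inr c \<Rightarrow> (case snd (fst v) of Inl _ \<Rightarrow> True
     | Inr p \<Rightarrow> (fst (fst v) = 0 \<longrightarrow> fst c \<in> set (if fst p = 0 then nthd [0] ini (snd p) else [0]))
        \<and> (fst (fst v) = T \<and> fst p = 0 \<and> snd p = 0 \<longrightarrow> fst c = 2)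
        \<and> (fst (fst v) = T \<and> fst p = 0 \<and> snd p = 1 \<longrightarrow> fst c \<noteq> 1 \<and> fst c \<noteq> 2)))"

text \<open>
  The conditions on two variables: the scanned symbols and the flags fit, the states and the head
  positions at consecutive times fit, scanned cells are overwritten and the others persist.  The
  action of the machine is a parameter \<open>tr\<close>, for which a finite table may be substituted.
\<close>

definition agree :: "(nat \<times> nat list \<Rightarrow> nat \<times> (nat \<times> nat) list) \<Rightarrow> tvar \<times> tval \<Rightarrow> tvar \<times> tval \<Rightarrow> bool" where
  "agree tr v w = (case snd v of
     Inl a \<Rightarrow> (case snd w of
        Inl b \<Rightarrow> fst (fst w) = Suc (fst (fst v)) \<longrightarrow> fst b = fst (tr (fst a, snd (snd a)))
          \<and> fst (snd b) = map (\<lambda>p. move (snd (snd p)) (fst p)) (zip (fst (snd a)) (snd (tr (fst a, snd (snd a)))))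
      | Inr c \<Rightarrow> (case snd (fst w) of Inl _ \<Rightarrow> True
        | Inr p \<Rightarrow> (fst (fst w) = fst (fst v) \<longrightarrow> (snd c \<longleftrightarrow> nthd 0 (fst (snd a)) (fst p) = snd p)
              \<and> (snd c \<longrightarrow> nthd 0 (snd (snd a)) (fst p) = fst c))
          \<and> (fst (fst w) = Suc (fst (fst v)) \<and> nthd 0 (fst (snd a)) (fst p) = snd p
              \<longrightarrow> fst c = fst (nthd (0, 0) (snd (tr (fst a, snd (snd a)))) (fst p)))))
   | Inr c \<Rightarrow> (case snd w of Inl _ \<Rightarrow> True
      | Inr d \<Rightarrow> fst (fst w) = Suc (fst (fst v)) \<and> snd (fst v) = snd (fst w) \<and> \<not> snd c \<longrightarrow> fst c = fst d))"

definition compatible ::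
  "(nat \<times> nat list \<Rightarrow> nat \<times> (nat \<times> nat) list) \<Rightarrow> nat \<Rightarrow> nat list list \<Rightarrow> nat \<Rightarrow> tvar \<times> tval \<Rightarrow> tvar \<times> tval \<Rightarrow> bool" where
  "compatible tr k ini T v w \<longleftrightarrow>
     fst v \<noteq> fst w \<and> unary k ini T v \<and> unary k ini T w \<and> agree tr v w \<and> agree tr w v"

lemma set_tuples: "set (tuples k xs) = {ys. length ys = k \<and> set ys \<subseteq> set xs}"
proof (induction k)
  case (Suc k)
  show ?case
  proof (intro subset_antisym subsetI)
    show "ys \<in> {ys. length ys = Suc k \<and> set ys \<subseteq> set xs}" if "ys \<in> set (tuples (Suc k) xs)" for ys
      using that Suc by auto
    show "ys \<in> set (tuples (Suc k) xs)" if "ys \<in> {ys. length ys = Suc k \<and> set ys \<subseteq> set xs}" for ys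
      using that Suc by (cases ys) auto
  qed
qed auto

lemma distinct_tuples: "distinct xs \<Longrightarrow> distinct (tuples k xs)"
proof (induction k)
  case (Suc k)
  have "distinct (concat (map (\<lambda>x. map (Cons x) (tuples k xs)) ys))" if "distinct ys" for ys
    using that by (induction ys) (use Suc in \<open>auto simp: distinct_map\<close>)
  then show ?case using Suc by simp
qed simp

lemma set_tvars: "v \<in> set (tvars k ts js)
  \<longleftrightarrow> fst v \<in> set ts \<and> (case snd v of Inl _ \<Rightarrow> True | Inr p \<Rightarrow> fst p < k \<and> snd p \<in> set js)"
  by (cases v; cases "snd v") (auto simp: tvars_def image_iff)

lemma distinct_tvars: "distinct ts \<Longrightarrow> distinct js \<Longrightarrow> distinct (tvars k ts js)"
proof (induction ts)
  case (Cons t ts)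
  have "distinct (concat (map (\<lambda>i. map (\<lambda>j. (t, Inr (i, j))) js) is))" if "distinct is" for "is" :: "nat list"
    using that by (induction "is") (use Cons.prems in \<open>auto simp: distinct_map inj_on_def\<close>)
  from this[of "[0..<k]"] show ?case
    using Cons by (auto simp: tvars_def)
qed (simp add: tvars_def)

lemma distinct_tvals: "distinct js \<Longrightarrow> distinct (tvals M js v)"
proof -
  assume js: "distinct js"
  let ?l = "List.product [0..<num_states M] (tuples (num_tapes M) [0..<num_syms M])"
  have d: "distinct ?l" by (rule distinct_product) (simp_all add: distinct_tuples)
  have "distinct (concat (map (\<lambda>hs. map (\<lambda>p. Inl (fst p, hs, snd p)) ?l) hss) :: tval list)" if "distinct hss" for hss
    using that by (induction hss) (use d in \<open>auto simp: distinct_map inj_on_def prod_eq_iff\<close>)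
  moreover have "distinct (map Inr (List.product [0..<num_syms M] [False, True]) :: tval list)"
    unfolding distinct_map by (intro conjI distinct_product) auto
  ultimately show ?thesis
    using distinct_tuples[OF js] unfolding tvals_def by (simp split: sum.split)
qed

lemma set_tvals:
  "Inl (q, hs, ss) \<in> set (tvals M js (t, Inl u)) \<longleftrightarrow> q < num_states M \<and> length hs = num_tapes M \<and> set hs \<subseteq> set js
     \<and> length ss = num_tapes M \<and> set ss \<subseteq> {..<num_syms M}"
  "Inr (s, h) \<in> set (tvals M js (t, Inr p)) \<longleftrightarrow> s < num_syms M"
  "x \<in> set (tvals M js (t, Inl u)) \<Longrightarrow> \<exists>q hs ss. x = Inl (q, hs, ss)"
  "x \<in> set (tvals M js (t, Inr p)) \<Longrightarrow> \<exists>s h. x = Inr (s, h)"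
  by (auto simp: tvals_def set_tuples image_iff)

context oracle_free_machine begin

text \<open>The solution given by a computation.\<close>

definition trace :: "bool list \<Rightarrow> nat \<Rightarrow> nat \<Rightarrow> tvar \<Rightarrow> tval" where
  "trace z T B = (\<lambda>v\<in>set (tvars ntapes [0..<Suc T] [0..<B]). case snd v of
     Inl _ \<Rightarrow> Inl (st z (fst v), heads z (fst v), syms z (fst v))
   | Inr p \<Rightarrow> Inr (cell z (fst v) (fst p) (snd p), heads z (fst v) ! fst p = snd p))"

lemma trace_simps:
  "t \<le> T \<Longrightarrow> trace z T B (t, Inl ()) = Inl (st z t, heads z t, syms z t)"
  "t \<le> T \<Longrightarrow> i < ntapes \<Longrightarrow> j < B \<Longrightarrow> trace z T B (t, Inr (i, j)) = Inr (cell z t i j, heads z t ! i = j)"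
  by (simp_all add: trace_def set_tvars less_Suc_eq_le)

text \<open>
  The word \<open>x\<close>, followed by \<open>m\<close> bits that are left open.
\<close>

definition initial_symbols :: "bool list \<Rightarrow> nat \<Rightarrow> nat list list" where
  "initial_symbols x m = map (\<lambda>b. [if b then 2 else 1]) x @ replicate m [1, 2]"

lemma agree_trace:
  assumes "fst v \<in> set (tvars ntapes [0..<Suc T] [0..<B])" "fst w \<in> set (tvars ntapes [0..<Suc T] [0..<B])"
    "snd v = trace z T B (fst v)" "snd w = trace z T B (fst w)" "fst v \<noteq> fst w"
  shows "agree (action M) v w"
proof -
  obtain t p a where v: "v = ((t, p), a)" by (metis prod.collapse)
  obtain t' p' a' where w: "w = ((t', p'), a')" by (metis prod.collapse)
  have t: "t \<le> T" "t' \<le> T" using assms(1,2) by (auto simp: v w set_tvars less_Suc_eq_le)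
  show ?thesis
  proof (cases p)
    case (Inl u)
    then have a: "a = Inl (st z t, heads z t, syms z t)" using assms(3) t by (simp add: v trace_simps)
    show ?thesis
    proof (cases p')
      case (Inl u')
      then have a': "a' = Inl (st z t', heads z t', syms z t')" using assms(4) t by (simp add: w trace_simps)
      show ?thesis
        unfolding v w a a' agree_def by (auto simp: step_act act_def case_prod_beta)
    next
      case (Inr ij)
      obtain i j where ij: "ij = (i, j)" by (cases ij)
      have k: "i < ntapes" "j < B" using assms(2) by (auto simp: w Inr ij set_tvars)
      have a': "a' = Inr (cell z t' i j, heads z t' ! i = j)" using assms(4) t k by (simp add: w Inr ij trace_simps)
      show ?thesis
        unfolding v w a a' agree_def Inr ij
        using k by (auto simp: step_act lengths length_act syms_nth act_def[symmetric])
    qed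
  next
    case (Inr ij)
    obtain i j where ij: "ij = (i, j)" by (cases ij)
    have k: "i < ntapes" "j < B" using assms(1) by (auto simp: v Inr ij set_tvars)
    have a: "a = Inr (cell z t i j, heads z t ! i = j)" using assms(3) t k by (simp add: v Inr ij trace_simps)
    show ?thesis
    proof (cases p')
      case (Inl u')
      then have a': "a' = Inl (st z t', heads z t', syms z t')" using assms(4) t by (simp add: w trace_simps)
      show ?thesis unfolding v w a a' agree_def Inr by simp
    next
      case Inr': (Inr ij')
      obtain i' j' where ij': "ij' = (i', j')" by (cases ij')
      have k': "i' < ntapes" "j' < B" using assms(2) by (auto simp: w Inr' ij' set_tvars)
      have a': "a' = Inr (cell z t' i' j', heads z t' ! i' = j')" using assms(4) t k' by (simp add: w Inr' ij' trace_simps)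
      show ?thesis unfolding v w a a' agree_def Inr Inr' ij ij' using k by (auto simp: step_act)
    qed
  qed
qed

text \<open>
  Solutions correspond to the words \<open>y\<close> for which the computation on \<open>x @ y\<close> accepts.
\<close>

lemma card_solutions:
  assumes acc: "\<And>y. length y = m \<Longrightarrow> computes_within M (\<lambda>_. []) (x @ y) T [V (x @ y)]"
    and B: "T < B" "length x + m \<le> B" "2 \<le> B"
  shows "card {g \<in> (\<Pi>\<^sub>E p\<in>set (tvars ntapes [0..<Suc T] [0..<B]). set (tvals M [0..<B] p)).
      \<forall>p\<in>set (tvars ntapes [0..<Suc T] [0..<B]). \<forall>p'\<in>set (tvars ntapes [0..<Suc T] [0..<B]). p \<noteq> p' \<longrightarrow>
        compatible (action M) ntapes (initial_symbols x m) T (p, g p) (p', g p')}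
    = card {y. length y = m \<and> V (x @ y)}"
proof -
  let ?P = "set (tvars ntapes [0..<Suc T] [0..<B])"
  let ?vals = "\<lambda>p. set (tvals M [0..<B] p)" and ?ini = "initial_symbols x m"
  let ?ok = "compatible (action M) ntapes ?ini T"
  let ?S = "{g \<in> (\<Pi>\<^sub>E p\<in>?P. ?vals p). \<forall>p\<in>?P. \<forall>p'\<in>?P. p \<noteq> p' \<longrightarrow> ?ok (p, g p) (p', g p')}"
  let ?Y = "{y. length y = m \<and> V (x @ y)}"
  have k0: "0 < ntapes" using tapes2 by simp
  have PA: "(t, Inl ()) \<in> ?P \<longleftrightarrow> t \<le> T" for t by (auto simp: set_tvars)
  have PC: "(t, Inr (i, j)) \<in> ?P \<longleftrightarrow> t \<le> T \<and> i < ntapes \<and> j < B" for t i j by (auto simp: set_tvars)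
  have ini: "nthd [0] ?ini j = (if j < length x then [if x ! j then 2 else 1] else if j < length x + m then [1, 2] else [0])" for j
    by (auto simp: nthd_def initial_symbols_def nth_append)
  have headsB: "i < ntapes \<Longrightarrow> t \<le> T \<Longrightarrow> heads z t ! i < B" for i t z
    using heads_le[of i z t] B by simp
  have "bij_betw (\<lambda>y. trace (x @ y) T B) ?Y ?S"
    unfolding bij_betw_def
  proof (intro conjI inj_onI subset_antisym image_subsetI subsetI)
    fix y y' assume y: "y \<in> ?Y" "y' \<in> ?Y" and e: "trace (x @ y) T B = trace (x @ y') T B"
    show "y = y'"
    proof (rule nth_equalityI)
      show "length y = length y'" using y by simp
      fix j assume j: "j < length y"
      have "length x + j < B" using j y B by simp
      then have "cell (x @ y) 0 0 (length x + j) = cell (x @ y') 0 0 (length x + j)"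
        using fun_cong[OF e, of "(0, Inr (0, length x + j))"] k0 by (simp add: trace_simps)
      then show "y ! j = y' ! j" using j y k0 by (simp add: start split: if_splits)
    qed
  next
    fix y assume y: "y \<in> ?Y"
    let ?z = "x @ y" and ?g = "trace (x @ y) T B"
    have len: "length y = m" using y by simp
    have fin: "st ?z T = 1" "cell ?z T 0 0 = 2 \<and> cell ?z T 0 1 \<notin> {1, 2}"
      using accepted[OF acc[OF len]] y by simp_all
    have "?g \<in> (\<Pi>\<^sub>E p\<in>?P. ?vals p)"
    proof
      fix p assume p: "p \<in> ?P"
      obtain t q where tq: "p = (t, q)" by (cases p)
      show "?g p \<in> ?vals p"
      proof (cases q)
        case (Inl u)
        then have t: "t \<le> T" using p by (simp add: tq PA)
        have "set (heads ?z t) \<subseteq> {..<B}" using headsB[OF _ t] lengths(2)[of ?z t] by (auto simp: in_set_conv_nth)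
        then show ?thesis unfolding tq Inl using t syms_less[of ?z t] by (auto simp: trace_simps set_tvals st_less lengths)
      next
        case (Inr ij)
        obtain i j where ij: "ij = (i, j)" by (cases ij)
        show ?thesis unfolding tq Inr ij
          using p by (simp add: tq Inr ij PC trace_simps set_tvals cell_less)
      qed
    qed (simp add: trace_def)
    moreover have "unary ntapes ?ini T (p, ?g p)" if p: "p \<in> ?P" for p
    proof -
      obtain t q where tq: "p = (t, q)" by (cases p)
      show ?thesis
      proof (cases q)
        case (Inl u)
        then have t: "t \<le> T" using p by (simp add: tq PA)
        show ?thesis unfolding unary_def tq Inl using t fin(1) by (auto simp: trace_simps start)
      next
        case (Inr ij)
        obtain i j where ij: "ij = (i, j)" by (cases ij)
        have k: "t \<le> T" "i < ntapes" "j < B" using p by (simp_all add: tq Inr ij PC)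
        have "cell ?z 0 i j \<in> set (if i = 0 then nthd [0] ?ini j else [0])"
          using k(2) len unfolding ini by (auto simp: start nth_append)
        then show ?thesis unfolding unary_def tq Inr ij using k fin(2) by (auto simp: trace_simps)
      qed
    qed
    moreover have "agree (action M) (p, ?g p) (p', ?g p')" if "p \<in> ?P" "p' \<in> ?P" "p \<noteq> p'" for p p'
      by (rule agree_trace[where z = ?z and T = T and B = B]) (use that in simp_all)
    ultimately show "?g \<in> ?S"
      unfolding mem_Collect_eq compatible_def fst_conv by (intro conjI ballI impI) (assumption | rule not_sym | blast)+
  next
    fix g assume g: "g \<in> ?S"
    have gv: "g p \<in> ?vals p" if "p \<in> ?P" for p using g that by auto
    have ok: "?ok (p, g p) (p', g p')" if "p \<in> ?P" "p' \<in> ?P" "p \<noteq> p'" for p p' using g that by blast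
    have un: "unary ntapes ?ini T (p, g p)" if p: "p \<in> ?P" for p
    proof -
      define p' :: tvar where "p' = (if p = (0, Inl ()) then (0, Inr (0, 0)) else (0, Inl ()))"
      have "p' \<in> ?P" "p \<noteq> p'" using B k0 by (auto simp: p'_def PA PC)
      then show ?thesis using ok[OF p] by (simp add: compatible_def)
    qed
    have ag: "agree (action M) (p, g p) (p', g p')" if "p \<in> ?P" "p' \<in> ?P" "p \<noteq> p'" for p p'
      using ok[OF that] by (simp add: compatible_def)
    have exA: "\<exists>q hs ss. g (t, Inl ()) = Inl (q, hs, ss) \<and> length hs = ntapes \<and> length ss = ntapes \<and> set hs \<subseteq> {..<B}"
      if t: "t \<le> T" for t
    proof -
      have v: "g (t, Inl ()) \<in> ?vals (t, Inl ())" using gv t by (simp add: PA)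
      from set_tvals(3)[OF v] obtain q hs ss where e: "g (t, Inl ()) = Inl (q, hs, ss)" by blast
      show ?thesis using v unfolding e set_tvals by auto
    qed
    have exC: "\<exists>s h. g (t, Inr (i, j)) = Inr (s, h)" if "t \<le> T" "i < ntapes" "j < B" for t i j
      by (rule set_tvals(4)[OF gv]) (use that in \<open>simp add: PC\<close>)
    define y where "y = map (\<lambda>j. fst (projr (g (0, Inr (0, length x + j)))) = 2) [0..<m]"
    let ?z = "x @ y"
    have len: "length y = m" by (simp add: y_def)
    text \<open>The scanned symbols and the flags are determined by the rest.\<close>
    have complete: "g (t, Inl ()) = Inl (st ?z t, heads ?z t, syms ?z t)
        \<and> (\<forall>i<ntapes. \<forall>j<B. g (t, Inr (i, j)) = Inr (cell ?z t i j, heads ?z t ! i = j))"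
      if t: "t \<le> T" and A: "\<exists>ss. g (t, Inl ()) = Inl (st ?z t, heads ?z t, ss)"
        and C: "\<And>i j. i < ntapes \<Longrightarrow> j < B \<Longrightarrow> \<exists>h. g (t, Inr (i, j)) = Inr (cell ?z t i j, h)" for t
    proof -
      obtain ss where ss: "g (t, Inl ()) = Inl (st ?z t, heads ?z t, ss)" using A by blast
      have ls: "length ss = ntapes" using exA[OF t] ss by auto
      have flag: "h = (heads ?z t ! i = j) \<and> (h \<longrightarrow> ss ! i = s)"
        if "i < ntapes" "j < B" "g (t, Inr (i, j)) = Inr (s, h)" for i j s h
      proof -
        have "agree (action M) ((t, Inl ()), g (t, Inl ())) ((t, Inr (i, j)), g (t, Inr (i, j)))"
          by (rule ag) (use t that in \<open>simp_all add: PA PC\<close>)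
        then show ?thesis unfolding agree_def ss that(3) using that(1) by (simp add: ls lengths)
      qed
      have "ss = syms ?z t"
      proof (rule nth_equalityI)
        show "length ss = length (syms ?z t)" using ls by (simp add: lengths)
        fix i assume "i < length ss"
        then have i: "i < ntapes" using ls by simp
        have j: "heads ?z t ! i < B" by (rule headsB[OF i t])
        obtain h where h: "g (t, Inr (i, heads ?z t ! i)) = Inr (cell ?z t i (heads ?z t ! i), h)" using C[OF i j] by blast
        show "ss ! i = syms ?z t ! i" using flag[OF i j h] syms_nth[OF i] by simp
      qed
      then show ?thesis using ss flag C by fastforce
    qed
    have all: "g (t, Inl ()) = Inl (st ?z t, heads ?z t, syms ?z t)
        \<and> (\<forall>i<ntapes. \<forall>j<B. g (t, Inr (i, j)) = Inr (cell ?z t i j, heads ?z t ! i = j))" if "t \<le> T" for t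
      using that
    proof (induction t)
      case 0
      show ?case
      proof (rule complete)
        obtain q hs ss where a: "g (0, Inl ()) = Inl (q, hs, ss)" using exA[of 0] by auto
        then show "\<exists>ss. g (0, Inl ()) = Inl (st ?z 0, heads ?z 0, ss)"
          using un[of "(0, Inl ())"] by (simp add: PA unary_def start)
        fix i j assume ij: "i < ntapes" "j < B"
        obtain s h where c: "g (0, Inr (i, j)) = Inr (s, h)" using exC[of 0 i j] ij by auto
        have "s \<in> set (if i = 0 then nthd [0] ?ini j else [0])"
          using un[of "(0, Inr (i, j))"] ij unfolding unary_def c by (auto simp: PC)
        moreover have "y ! (j - length x) \<longleftrightarrow> s = 2" if "i = 0" "length x \<le> j" "j < length x + m"
        proof -
          have "j - length x < m" using that by arith
          then show ?thesis using that c by (simp add: y_def)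
        qed
        ultimately have "s = cell ?z 0 i j"
          using ij len unfolding ini by (auto simp: start nth_append split: if_splits)
        then show "\<exists>h. g (0, Inr (i, j)) = Inr (cell ?z 0 i j, h)" using c by blast
      qed simp
    next
      case (Suc t)
      have IH: "g (t, Inl ()) = Inl (st ?z t, heads ?z t, syms ?z t)"
        "\<And>i j. i < ntapes \<Longrightarrow> j < B \<Longrightarrow> g (t, Inr (i, j)) = Inr (cell ?z t i j, heads ?z t ! i = j)"
        using Suc by auto
      show ?case
      proof (rule complete[OF Suc.prems])
        obtain q hs ss where a: "g (Suc t, Inl ()) = Inl (q, hs, ss)" using exA[OF Suc.prems] by auto
        have "agree (action M) ((t, Inl ()), g (t, Inl ())) ((Suc t, Inl ()), g (Suc t, Inl ()))"
          by (rule ag) (use Suc.prems in \<open>simp_all add: PA\<close>)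
        then show "\<exists>ss. g (Suc t, Inl ()) = Inl (st ?z (Suc t), heads ?z (Suc t), ss)"
          unfolding agree_def IH a by (simp add: step_act act_def[symmetric] case_prod_beta)
        fix i j assume ij: "i < ntapes" "j < B"
        obtain s h where c: "g (Suc t, Inr (i, j)) = Inr (s, h)" using exC[OF Suc.prems] ij by blast
        have "agree (action M) ((t, Inl ()), g (t, Inl ())) ((Suc t, Inr (i, j)), g (Suc t, Inr (i, j)))"
          "agree (action M) ((t, Inr (i, j)), g (t, Inr (i, j))) ((Suc t, Inr (i, j)), g (Suc t, Inr (i, j)))"
          by (rule ag; use Suc.prems ij in \<open>simp add: PA PC\<close>)+
        then have "s = cell ?z (Suc t) i j"
          unfolding agree_def IH(1) IH(2)[OF ij] c
          using ij by (simp add: step_act act_def[symmetric] lengths length_act split: if_splits)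
        then show "\<exists>h. g (Suc t, Inr (i, j)) = Inr (cell ?z (Suc t) i j, h)" using c by blast
      qed
    qed
    have "g = trace ?z T B"
    proof (rule PiE_ext)
      show "g \<in> (\<Pi>\<^sub>E p\<in>?P. UNIV)" using g by (auto simp: PiE_iff)
      show "trace ?z T B \<in> (\<Pi>\<^sub>E p\<in>?P. UNIV)" by (simp add: trace_def PiE_iff extensional_def)
      fix p assume p: "p \<in> ?P"
      obtain t q where tq: "p = (t, q)" by (cases p)
      show "g p = trace ?z T B p"
      proof (cases q)
        case (Inl u)
        then show ?thesis using p all[of t] by (simp add: tq PA trace_simps)
      next
        case (Inr ij)
        then show ?thesis using p all[of t] by (cases ij) (simp add: tq PC trace_simps)
      qed
    qed
    moreover have "V ?z"
    proof -
      have "cell ?z T 0 0 = 2" "cell ?z T 0 1 \<noteq> 1 \<and> cell ?z T 0 1 \<noteq> 2"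
        using un[of "(T, Inr (0, 0))"] un[of "(T, Inr (0, 1))"] all[of T] B k0
        by (simp_all add: PC unary_def)
      then show ?thesis using accepted(2)[OF acc[OF len]] by simp
    qed
    ultimately show "g \<in> (\<lambda>y. trace (x @ y) T B) ` ?Y" using len by (intro image_eqI[of _ _ y]) auto
  qed
  from bij_betw_same_card[OF this, symmetric] show ?thesis .
qed

end

section \<open>Counting problems as clique problems\<close>

lemma fpt_tuples [fpt_intros]: "fpt l \<Longrightarrow> fpt (\<lambda>x. tuples k (l x))"
proof (induction k)
  case (Suc k)
  have "fpt (\<lambda>x. concat (map (\<lambda>y. map (\<lambda>ys. y # ys) (tuples k (l x))) (l x)))"
    by (rule fpt_concat_map) (intro fpt_intros Suc.prems fpt_comp[OF Suc.IH[OF Suc.prems]])+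
  then show ?case by simp
qed (simp add: fpt_const)

lemma fpt_product [fpt_intros]: "fpt l \<Longrightarrow> fpt m \<Longrightarrow> fpt (\<lambda>x. List.product (l x) (m x))"
proof -
  assume l: "fpt l" and m: "fpt m"
  have "fpt (\<lambda>x. concat (map (\<lambda>y. map (\<lambda>z. (y, z)) (m x)) (l x)))"
    by (rule fpt_concat_map) (intro fpt_intros l fpt_comp[OF m])+
  then show ?thesis by (simp add: product_concat_map)
qed

lemma fpt_tvars: "fpt ts \<Longrightarrow> fpt js \<Longrightarrow> fpt (\<lambda>x. tvars k (ts x) (js x))"
proof -
  assume ts: "fpt ts" and js: "fpt js"
  have 1: "fpt (\<lambda>p. concat (map (\<lambda>i. map (\<lambda>j. (snd p, Inr (i, j)) :: tvar) (js (fst p))) [0..<k]))"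
    by (rule fpt_concat_map) (intro fpt_intros fpt_comp[OF js])+
  show ?thesis
    unfolding tvars_def by (rule fpt_concat_map[OF _ ts]) (intro fpt_intros 1)
qed

lemma fpt_tvals:
  assumes js: "fpt js" and v: "fpt v"
  shows "fpt (\<lambda>x. tvals M (js x) (v x))"
proof -
  have "fpt (\<lambda>x. concat (map (\<lambda>hs. map (\<lambda>p. Inl (fst p, hs, snd p) :: tval)
       (List.product [0..<num_states M] (tuples (num_tapes M) [0..<num_syms M]))) (tuples (num_tapes M) (js x))))"
    by (rule fpt_concat_map) (intro fpt_intros js)+
  note 1 = fpt_comp[OF this]
  show ?thesis unfolding tvals_def
    by (rule fpt_case_sum) (intro fpt_intros v 1)+
qed

lemma fpt_move [fpt_intros]: "fpt d \<Longrightarrow> fpt h \<Longrightarrow> fpt (\<lambda>x. move (d x) (h x))"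
  unfolding move_def by (intro fpt_intros)

lemma fpt_unary:
  assumes "fpt ini" "fpt T" "fpt v"
  shows "fpt (\<lambda>x. unary k (ini x) (T x) (v x))"
  unfolding unary_def
  by (intro fpt_intros assms fpt_case_sum fpt_comp[OF assms(1)] fpt_comp[OF assms(2)] fpt_comp[OF assms(3)])

lemma fpt_agree:
  assumes "fpt tr" "fpt v" "fpt w"
  shows "fpt (\<lambda>x. agree tr (v x) (w x))"
  unfolding agree_def
  by (intro fpt_intros assms fpt_case_sum fpt_iff fpt_comp[OF assms(1)] fpt_comp[OF assms(2)] fpt_comp[OF assms(3)])

lemma agree_cong:
  assumes "\<And>q hs ss. snd v = Inl (q, hs, ss) \<Longrightarrow> tr (q, ss) = tr' (q, ss)"
  shows "agree tr v w = agree tr' v w"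
  using assms unfolding agree_def by (auto split: sum.split)

lemma length_tvals:
  assumes M: "machine_wf M" and js: "js \<noteq> []"
  shows "2 \<le> length (tvals M js v)"
proof (cases "snd v")
  case (Inr p)
  then show ?thesis using M by (simp add: tvals_def machine_wf_def)
next
  case (Inl u)
  obtain t where v: "v = (t, Inl u)" using Inl by (metis prod.collapse)
  let ?e = "\<lambda>q. Inl (q, replicate (num_tapes M) (hd js), replicate (num_tapes M) 0) :: tval"
  have "?e q \<in> set (tvals M js v)" if "q < 2" for q
    unfolding v set_tvals using that js M by (auto simp: machine_wf_def)
  from this[of 0] this[of 1] have sub: "{?e 0, ?e 1} \<subseteq> set (tvals M js v)" by simp
  have "2 = card {?e 0, ?e 1}" by simp
  also have "\<dots> \<le> card (set (tvals M js v))" by (rule card_mono[OF _ sub]) simp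
  also have "\<dots> \<le> length (tvals M js v)" by (rule card_length)
  finally show ?thesis .
qed

text \<open>
  The two unary numbers are the number of vertices and the size of the cliques.
\<close>

theorem sharpP_cliques:
  assumes "f \<in> sharpP"
  shows "\<exists>(nu :: bool list \<Rightarrow> unit list) (wu :: bool list \<Rightarrow> unit list) A.
    fpt nu \<and> fpt wu \<and> fpt (\<lambda>p. A (fst p) (fst (snd p)) (snd (snd p)))
    \<and> (\<forall>x i j. A x i j \<longrightarrow> A x j i) \<and> (\<forall>x. 2 \<le> length (wu x) \<and> length (wu x) < length (nu x)
      \<and> f x = card (cliques (length (nu x)) (A x) (length (wu x))))"
proof -
  obtain V p where V: "polytime_computable (\<lambda>z. [V z])"
    and f: "\<And>x. f x = card {y. length y = poly p (length x) \<and> V (pair_code x y)}"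
    using assms unfolding sharpP_def by blast
  obtain M pt where M: "machine_wf M" "oracle_free M"
    and run: "\<And>z. computes_within M (\<lambda>_. []) z (poly pt (length z)) [V z]"
    using V unfolding polytime_computable_def by blast
  interpret oracle_free_machine M by unfold_locales (rule M)+
  \<comment> \<open>the action is only needed for finitely many arguments\<close>
  define D where "D = {..<num_states M} \<times> {ss. length ss = ntapes \<and> set ss \<subseteq> {..<num_syms M}}"
  have "{ss. length ss = ntapes \<and> set ss \<subseteq> {..<num_syms M}} = set (tuples ntapes [0..<num_syms M])"
    by (auto simp: set_tuples)
  then have "finite D" unfolding D_def by simp
  then obtain tr where tr: "fpt tr" "\<And>d. d \<in> D \<Longrightarrow> tr d = action M d" using fpt_table[of D "action M"] by blast
  define pre where "pre x = concat (map (\<lambda>b. [b, b]) x) @ [False, True]" for x :: "bool list"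
  define yu where "yu x = replicate (poly p (length x)) ()" for x :: "bool list"
  define zu where "zu x = map (\<lambda>_. ()) (pre x) @ yu x" for x
  define tu where "tu x = replicate (poly pt (length (zu x))) ()" for x
  define ts where "ts x = [0..<length (() # tu x)]" for x
  define js where "js x = [0..<length (() # tu x @ zu x)]" for x
  define tv where "tv x = tvars ntapes (ts x) (js x)" for x
  define vs where "vs x = concat (map (\<lambda>v. map (\<lambda>a. (v, a)) (tvals M (js x) v)) (tv x))" for x
  define ini where "ini x = map (\<lambda>b. [if b then 2 else 1 :: nat]) (pre x) @ map (\<lambda>_. [1, 2]) (yu x)" for x
  define R where "R tr x v w = compatible tr ntapes (ini x) (length (tu x)) v w" for tr x v w
  define d :: "tvar \<times> tval" where "d = ((0, Inl ()), Inr (0, False))"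
  define A where "A x i j \<longleftrightarrow> i < length (vs x) \<and> j < length (vs x) \<and> R tr x (nthd d (vs x) i) (nthd d (vs x) j)" for x i j
  have pre: "fpt pre"
    unfolding pre_def by (intro fpt_intros fpt_concat_map[where f = "\<lambda>x b. [b, b]"])
  have yu: "fpt yu" unfolding yu_def by (rule fpt_poly) (rule fpt_id)
  have zu: "fpt zu" unfolding zu_def by (intro fpt_intros pre yu)
  have tu: "fpt tu" unfolding tu_def by (rule fpt_poly) (rule zu)
  have ts: "fpt ts" unfolding ts_def by (intro fpt_intros tu)
  have js: "fpt js" unfolding js_def by (intro fpt_intros tu zu)
  have tv: "fpt tv" unfolding tv_def by (rule fpt_tvars[OF ts js])
  have vs: "fpt vs" unfolding vs_def
  proof (rule fpt_concat_map[OF _ tv])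
    have "fpt (\<lambda>p. tvals M (js (fst p)) (snd p))" by (rule fpt_tvals[OF fpt_comp[OF js]]) (intro fpt_intros)+
    then show "fpt (\<lambda>p. map (\<lambda>a. (snd p, a)) (tvals M (js (fst p)) (snd p)))" by (intro fpt_intros)
  qed
  have ini: "fpt ini" unfolding ini_def by (intro fpt_intros pre yu)
  have R: "fpt (\<lambda>x. R tr (g x) (v x) (w x))" if "fpt g" "fpt v" "fpt w"
    for g :: "bool list \<times> nat \<times> nat \<Rightarrow> bool list" and v w
    unfolding R_def compatible_def
    by (intro fpt_intros that fpt_unary fpt_agree tr(1) fpt_comp[OF ini that(1)] fpt_comp[OF tu that(1)])
  have A: "fpt (\<lambda>p. A (fst p) (fst (snd p)) (snd (snd p)))"
    unfolding A_def by (intro fpt_intros R fpt_comp[OF vs])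
  have sym: "A x j i" if "A x i j" for x i j
    using that unfolding A_def R_def compatible_def by auto
  have jsne: "js x \<noteq> []" for x by (simp add: js_def)
  have size: "2 \<le> length (tv x) \<and> length (tv x) < length (vs x)" for x
  proof -
    have d: "distinct (tv x)" unfolding tv_def by (rule distinct_tvars) (simp_all add: ts_def js_def)
    have "{(0, Inl ()), (0, Inr (0, 0))} \<subseteq> set (tv x)"
      using tapes2 by (auto simp: tv_def set_tvars ts_def js_def)
    then have "card {(0, Inl ()), (0, Inr (0, 0)) :: tvar} \<le> card (set (tv x))" by (rule card_mono[rotated]) simp
    then have 2: "2 \<le> length (tv x)" using distinct_card[OF d] by simp
    have "length ys * 2 \<le> length (concat (map (\<lambda>v. map (\<lambda>a. (v, a)) (tvals M (js x) v)) ys))" for ys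
    proof (induction ys)
      case (Cons y ys)
      then show ?case using length_tvals[OF M(1) jsne[of x], of y] by simp
    qed simp
    from this[of "tv x"] 2 show ?thesis by (simp add: vs_def)
  qed
  have count: "f x = card (cliques (length (vs x)) (A x) (length (tv x)))" for x
  proof -
    have inD: "R tr x v w = R (action M) x v w" if "v \<in> set (vs x)" "w \<in> set (vs x)" for v w
    proof -
      have "agree tr v w = agree (action M) v w" if vin: "v \<in> set (vs x)" for v w
      proof (rule agree_cong)
        fix q hs ss assume v: "snd v = Inl (q, hs, ss)"
        have vb: "fst v \<in> set (tv x)" "snd v \<in> set (tvals M (js x) (fst v))"
          using vin unfolding vs_def by auto
        obtain t u where tu: "fst v = (t, u)" by (cases "fst v")
        have "u = Inl ()" using vb(2) v unfolding tu by (cases u) (auto simp: tvals_def)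
        then have "(q, ss) \<in> D" using vb(2) unfolding tu v by (auto simp: set_tvals D_def)
        then show "tr (q, ss) = action M (q, ss)" by (rule tr)
      qed
      then show ?thesis using that unfolding R_def compatible_def by simp
    qed
    have "A x = (\<lambda>i j. i < length (vs x) \<and> j < length (vs x) \<and> R (action M) x (vs x ! i) (vs x ! j))"
    proof (intro ext)
      fix i j
      show "A x i j = (i < length (vs x) \<and> j < length (vs x) \<and> R (action M) x (vs x ! i) (vs x ! j))"
        unfolding A_def using inD[OF nth_mem[of i] nth_mem[of j]]
        by (cases "i < length (vs x)"; cases "j < length (vs x)") simp_all
    qed
    note Ax = this
    have "card (cliques (length (vs x)) (A x) (length (tv x)))
      = card {g \<in> (\<Pi>\<^sub>E p\<in>set (tv x). set (tvals M (js x) p)).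
          \<forall>p\<in>set (tv x). \<forall>p'\<in>set (tv x). p \<noteq> p' \<longrightarrow> R (action M) x (p, g p) (p', g p')}"
      unfolding Ax
    proof (rule card_cliques_solutions)
      show "distinct (tv x)" unfolding tv_def by (rule distinct_tvars) (simp_all add: ts_def js_def)
      show "distinct (tvals M (js x) v)" for v by (rule distinct_tvals) (simp add: js_def)
      show "vs x = concat (map (\<lambda>v. map (Pair v) (tvals M (js x) v)) (tv x))" unfolding vs_def ..
      show "fst v \<noteq> fst w" if "R (action M) x v w" for v w using that by (simp add: R_def compatible_def)
    qed (use size in simp_all)
    also have "\<dots> = card {y. length y = poly p (length x) \<and> V (pre x @ y)}"
    proof -
      have i: "ini x = initial_symbols (pre x) (poly p (length x))"
        by (simp add: ini_def initial_symbols_def yu_def map_replicate_const)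
      have z: "length (zu x) = length (pre x) + poly p (length x)" by (simp add: zu_def yu_def)
      have t: "ts x = [0..<Suc (length (tu x))]" by (simp add: ts_def)
      have j: "js x = [0..<Suc (length (tu x) + length (zu x))]" by (simp add: js_def)
      show ?thesis unfolding R_def tv_def i t j
      proof (rule card_solutions)
        show "computes_within M (\<lambda>_. []) (pre x @ y) (length (tu x)) [V (pre x @ y)]"
          if "length y = poly p (length x)" for y
          using run[of "pre x @ y"] that z by (simp add: tu_def)
      qed (simp_all add: z pre_def)
    qed
    also have "\<dots> = f x" by (simp add: f pre_def pair_code_def)
    finally show ?thesis by simp
  qed
  have wu: "fpt (\<lambda>x. map (\<lambda>_. ()) (tv x))" "fpt (\<lambda>x. map (\<lambda>_. ()) (vs x))" by (intro fpt_intros tv vs)+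
  show ?thesis
    by (rule exI[of _ "\<lambda>x. map (\<lambda>_. ()) (vs x)"], rule exI[of _ "\<lambda>x. map (\<lambda>_. ()) (tv x)"], rule exI[of _ A])
      (use wu A sym size count in auto)
qed

section \<open>Reductions by polynomial-time functions\<close>

lemma fpt_polytime_turing_reducible:
  fixes qs :: "bool list \<Rightarrow> bool list list" and rs :: "bool list \<Rightarrow> 'r::enc"
  assumes "fpt qs" "fpt rs" "fpt post" and post: "\<And>x. post (rev (map g (qs x)), rs x) = f x"
    and b: "pb b" "\<And>w. length (g w) \<le> b (length w)"
  shows "polytime_turing_reducible f g"
proof -
  obtain Pre where Pre: "fp (range (enc :: bool list \<Rightarrow> tree)) Pre" "\<And>x. Pre (enc x) = enc (qs x, rs x)"
    using fpt_Pair[OF assms(1,2)] by (auto elim: fptE)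
  obtain Post where Post: "fp (range (enc :: bool list list \<times> 'r \<Rightarrow> tree)) Post" "\<And>x. Post (enc x) = enc (post x)"
    using assms(3) by (auto elim: fptE)
  have e: "Nd (tlist (rev (map (\<lambda>w. blist (g w)) (qs x)))) (enc (rs x)) = enc (rev (map g (qs x)), rs x)" for x
    by (simp add: enc_simps enc_list_def[where 'a = "bool list"] blist_enc rev_map[symmetric] comp_def)
  show ?thesis
  proof (rule fp_polytime_turing_reducible[where rest = "\<lambda>x. enc (rs x)" and qs = qs])
    show "fp (range blist) Pre" using Pre(1) unfolding blist_enc .
    show "Pre (blist x) = Nd (tlist (map blist (qs x))) (enc (rs x))" for x
      by (simp add: blist_enc Pre(2) enc_simps enc_list_def[where 'a = "bool list"])
    show "fp (range (\<lambda>x. Nd (tlist (rev (map (\<lambda>w. blist (g w)) (qs x)))) (enc (rs x)))) Post"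
      unfolding e by (rule fp_subset[OF Post(1)]) auto
    show "Post (Nd (tlist (rev (map (\<lambda>w. blist (g w)) (qs x)))) (enc (rs x))) = blist (f x)" for x
      unfolding e unfolding Post(2) post unfolding blist_enc ..
  qed (fact b)+
qed

section \<open>Graphs as words\<close>

text \<open>
  The code of the graph with the given rows; the length of \<open>nv\<close> is the number of columns.
\<close>

definition rows_word :: "'a list \<Rightarrow> (nat \<times> nat) list \<Rightarrow> bool list" where
  "rows_word nv rws = map (\<lambda>_. True) rws @ False # map (\<lambda>_. True) nv @ False #
     concat (map (\<lambda>p. map (\<lambda>i. i = fst p \<or> i = snd p) [0..<length nv]) rws)"

lemma rows_word: "bipgraph_code (rgraph (length nv) (map pset rws)) = rows_word nv rws"
proof -
  have "map (\<lambda>u. map (\<lambda>w. (u, w) \<in> rowset (length rws) (\<lambda>u. map pset rws ! u)) [0..<length nv]) [0..<length rws]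
      = map (\<lambda>u. map (\<lambda>i. i = fst (rws ! u) \<or> i = snd (rws ! u)) [0..<length nv]) [0..<length rws]"
    by (intro map_cong refl) (auto simp: rowset_def pset_def)
  also have "\<dots> = map (\<lambda>p. map (\<lambda>i. i = fst p \<or> i = snd p) [0..<length nv]) (map ((!) rws) [0..<length rws])"
    by simp
  finally show ?thesis
    unfolding map_nth by (simp add: bipgraph_code_def rgraph_def rows_word_def map_replicate_const)
qed

lemma fpt_rows_word [fpt_intros]: 
  assumes nv: "fpt nv" and rws: "fpt rws"
  shows "fpt (\<lambda>x. rows_word (nv x) (rws x))"
proof -
  have "fpt (\<lambda>x. concat (map (\<lambda>p. map (\<lambda>i. i = fst p \<or> i = snd p) [0..<length (nv x)]) (rws x)))"
    by (rule fpt_concat_map[OF _ rws]) (intro fpt_intros fpt_comp[OF nv])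
  then show ?thesis unfolding rows_word_def by (intro fpt_intros assms fpt_comp[OF nv])
qed

lemma fpt_gadget:
  fixes nu lu :: "'x::enc \<Rightarrow> unit list"
  assumes nu: "fpt nu" and lu: "fpt lu" and A: "fpt (\<lambda>p. A (fst p) (fst (snd p)) (snd (snd p)))"
    and hub: "fpt (\<lambda>p. hub (fst p) (snd p))"
  shows "fpt (\<lambda>x. gadget (hub x) (length (lu x)) (length (nu x)) (A x))"
proof -
  have 2: "replicate 2 p = [p, p]" for p :: "nat \<times> nat" by (simp add: numeral_2_eq_2)
  have A': "fpt (\<lambda>q :: ('x \<times> nat) \<times> nat. A (fst (fst q)) (snd (fst q)) (snd q))"
  proof -
    have "fpt (\<lambda>q :: ('x \<times> nat) \<times> nat. (fst (fst q), (snd (fst q), snd q)))" by (intro fpt_intros)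
    from fpt_comp[OF A this] show ?thesis by simp
  qed
  have h: "fpt (\<lambda>q :: ('x \<times> nat) \<times> nat. hub (fst (fst q)) (snd (fst q)))"
  proof -
    have "fpt (\<lambda>q :: ('x \<times> nat) \<times> nat. fst q)" by (intro fpt_intros)
    from fpt_comp[OF hub this] show ?thesis by simp
  qed
  have 1: "fpt (\<lambda>p. concat (map (\<lambda>y. if snd p = y then replicate (length (lu (fst p))) (snd p, hub (fst p) (snd p))
      else if A (fst p) (snd p) y then [(snd p, y)] else replicate 2 (snd p, hub (fst p) (snd p))) [0..<length (nu (fst p))]))"
    unfolding 2 by (rule fpt_concat_map) (intro fpt_intros A' h fpt_comp[OF nu] fpt_comp[OF lu])+
  show ?thesis unfolding gadget_def by (rule fpt_concat_map) (intro fpt_intros 1 nu)+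
qed

section \<open>Fractions as words\<close>

text \<open>The state of the decoder: phase, pending bit, and the two words in reverse.\<close>

definition unpair_step :: "bool \<times> bool list \<times> bool list \<times> bool list \<Rightarrow> bool \<Rightarrow> bool \<times> bool list \<times> bool list \<times> bool list" where
  "unpair_step s b = (if fst s then (True, [], fst (snd (snd s)), b # snd (snd (snd s)))
     else if fst (snd s) = [] then (False, [b], snd (snd s))
     else if hd (fst (snd s)) = b then (False, [], b # fst (snd (snd s)), snd (snd (snd s)))
     else (True, [], snd (snd s)))"

definition unpair :: "bool list \<Rightarrow> bool list \<times> bool list" where
  "unpair w = (let s = snd (snd (foldl unpair_step (False, [], [], []) w)) in (rev (fst s), rev (snd s)))"

lemma unpair: "unpair (pair_code u v) = (u, v)"
proof -
  have 1: "foldl unpair_step (False, [], a, c) (concat (map (\<lambda>b. [b, b]) u)) = (False, [], rev u @ a, c)" for a c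
    by (induction u arbitrary: a) (auto simp: unpair_step_def)
  have 2: "foldl unpair_step (True, [], a, c) v = (True, [], a, rev v @ c)" for a c
    by (induction v arbitrary: c) (auto simp: unpair_step_def)
  have 3: "unpair_step (unpair_step (False, [], a, c) False) True = (True, [], a, c)" for a c
    by (simp add: unpair_step_def)
  show ?thesis by (simp add: unpair_def pair_code_def 1 2 3)
qed

lemma fpt_unpair': "fpt unpair"
proof -
  have inv: "length (fst (snd s)) \<le> 1 \<and> length (fst (snd (snd s))) + length (snd (snd (snd s))) \<le> length w"
    if "s = foldl unpair_step (False, [], [], []) w" for s w
    unfolding that by (induction w rule: rev_induct) (auto simp: unpair_step_def)
  have "fpt (\<lambda>w. foldl unpair_step (False, [], [], []) w)"
  proof (rule fpt_foldl[where h = "\<lambda>w. 8 * length w + 20"])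
    show "fpt (\<lambda>p. unpair_step (snd (fst p)) (snd p))"
      unfolding unpair_step_def by (intro fpt_intros fpt_iff)
    fix w :: "bool list" and k
    obtain ph pe a c where s: "foldl unpair_step (False, [], [], []) (take k w) = (ph, pe, a, c)" by (metis prod_cases4)
    have "length pe \<le> 1 \<and> length a + length c \<le> length w"
      using inv[OF refl, of "take k w"] unfolding s by auto
    then show "esz (foldl unpair_step (False, [], [], []) (take k w)) \<le> 8 * length w + 20"
      unfolding s using esz_word[of pe] esz_word[of a] esz_word[of c]
      by (cases ph) (simp_all add: esz_Pair enc_bool_def btree_def)
  qed (intro fpt_intros pbt_intros)+
  note 1 = this
  show ?thesis unfolding unpair_def Let_def by (intro fpt_intros 1)
qed

lemmas fpt_unpair [fpt_intros] = fpt_comp[OF fpt_unpair']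

text \<open>Sign, numerator and denominator.\<close>

definition parse :: "bool list \<Rightarrow> bool \<times> nat \<times> nat" where
  "parse w = (hd w, val (fst (unpair (tl w))), val (snd (unpair (tl w))))"

definition fraction :: "bool \<times> nat \<times> nat \<Rightarrow> rat" where
  "fraction p = (if fst p then - 1 else 1) * of_nat (fst (snd p)) / of_nat (snd (snd p))"

lemma parse: "fraction (parse (rat_code r)) = r" "snd (snd (parse (rat_code r))) \<noteq> 0"
proof -
  obtain a b where ab: "quotient_of r = (a, b)" by (cases "quotient_of r")
  have b: "b > 0" by (rule quotient_of_denom_pos[OF ab])
  have p: "parse (rat_code r) = (a < 0, nat \<bar>a\<bar>, nat b)"
    by (simp add: parse_def rat_code_def ab unpair val_nat_code)
  have r: "r = of_int a / of_int b" by (rule quotient_of_div[OF ab])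
  have "fraction (a < 0, nat \<bar>a\<bar>, nat b) = of_int a / of_int b"
    unfolding fraction_def using b by (cases "a < 0") simp_all
  then show "fraction (parse (rat_code r)) = r" unfolding p using r by simp
  show "snd (snd (parse (rat_code r))) \<noteq> 0" unfolding p using b by simp
qed

lemma fpt_parse [fpt_intros]: "fpt f \<Longrightarrow> fpt (\<lambda>x. parse (f x))"
  unfolding parse_def by (intro fpt_intros)

section \<open>Exact interpolation with natural numbers\<close>

text \<open>Integers are represented as differences.\<close>

definition dval :: "nat \<times> nat \<Rightarrow> rat" where
  "dval p = of_nat (fst p) - of_nat (snd p)"

text \<open>
  One step of the annihilation, on integers.
\<close>

definition dstep :: "(nat \<times> nat) list \<Rightarrow> nat \<times> nat \<Rightarrow> (nat \<times> nat) list" where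
  "dstep ys r = map (\<lambda>q. (snd r * fst (snd q) + fst r * snd (fst q), snd r * snd (snd q) + fst r * fst (fst q)))
     (zip ys (tl ys))"

lemma dval_dstep: "map dval (dstep ys r) = map2 (\<lambda>a b. of_nat (snd r) * b - of_nat (fst r) * a) (map dval ys) (tl (map dval ys))"
  by (simp add: dstep_def map_tl[symmetric] zip_map_map case_prod_beta dval_def algebra_simps)

lemma annihilate_Cons:
  "annihilate (r # rs) ys = annihilate rs (map2 (\<lambda>a b. of_nat (snd r) * b - of_nat (fst r) * a) ys (tl ys))"
  by (cases r) (simp add: annihilate_def)

lemma dval_annihilate: "map dval (foldl dstep ys rs) = annihilate rs (map dval ys)"
proof (induction rs arbitrary: ys)
  case (Cons r rs)
  show ?case by (simp only: foldl.simps Cons annihilate_Cons dval_dstep)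
qed (simp add: annihilate_def)

lemma dstep_bound:
  assumes "\<And>q. q \<in> set ys \<Longrightarrow> fst q < 2 ^ w \<and> snd q < 2 ^ w" "q \<in> set (dstep ys r)"
  shows "fst q < 2 ^ (w + esz r) \<and> snd q < 2 ^ (w + esz r)"
proof -
  obtain u v where uv: "(u, v) \<in> set (zip ys (tl ys))"
    and q: "q = (snd r * fst v + fst r * snd u, snd r * snd v + fst r * fst u)"
    using assms(2) unfolding dstep_def by force
  have "u \<in> set ys" "v \<in> set ys" using set_zip_leftD[OF uv] set_zip_rightD[OF uv] by (auto dest: list.set_sel(2)[rotated])
  then have *: "fst u < 2 ^ w" "snd u < 2 ^ w" "fst v < 2 ^ w" "snd v < 2 ^ w" using assms(1) by auto
  have main: "snd r * a + fst r * c < 2 ^ (w + esz r)" if "a < 2 ^ w" "c < 2 ^ w" for a c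
  proof -
    have e: "blen (fst r) + blen (snd r) + 1 \<le> esz r"
      using esz_nat(1)[of "fst r"] esz_nat(1)[of "snd r"] by (cases r) (simp add: esz_Pair)
    have "snd r * a + fst r * c \<le> (snd r + fst r) * (2 ^ w - 1)"
      unfolding distrib_right using that by (intro add_mono mult_le_mono) auto
    also have "\<dots> < 2 ^ esz r * 2 ^ w"
    proof -
      have "snd r + fst r < 2 ^ blen (snd r) + 2 ^ blen (fst r)" using less_blen by (intro add_strict_mono)
      also have "\<dots> \<le> 2 ^ (esz r - 1) + 2 ^ (esz r - 1)" using e by (intro add_mono power_increasing) auto
      also have "\<dots> = 2 ^ esz r" using e by (cases "esz r") auto
      finally show ?thesis by (intro mult_strict_mono) auto
    qed
    finally show ?thesis by (simp add: power_add mult.commute)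
  qed
  show ?thesis unfolding q fst_conv snd_conv using main * by blast
qed

lemma foldl_dstep_bound:
  assumes "\<And>q. q \<in> set ys \<Longrightarrow> fst q < 2 ^ w \<and> snd q < 2 ^ w"
  shows "length (foldl dstep ys rs) \<le> length ys \<and> (\<forall>q\<in>set (foldl dstep ys rs). fst q < 2 ^ (w + esz rs) \<and> snd q < 2 ^ (w + esz rs))"
  using assms
proof (induction rs arbitrary: ys w)
  case Nil
  have e: "2 ^ w \<le> (2 :: nat) ^ (w + esz ([] :: (nat \<times> nat) list))" by (rule power_increasing) auto
  have "a < 2 ^ (w + esz ([] :: (nat \<times> nat) list))" if "a < 2 ^ w" for a :: nat
    using that e by (rule order.strict_trans2)
  then show ?case using Nil by simp
next
  case (Cons r rs)
  have l: "length (dstep ys r) \<le> length ys" by (simp add: dstep_def)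
  have e: "2 ^ (w + esz r + esz rs) \<le> (2 :: nat) ^ (w + esz (r # rs))" by (rule power_increasing) (auto simp: esz_Cons)
  have le: "a < 2 ^ (w + esz (r # rs))" if "a < 2 ^ (w + esz r + esz rs)" for a :: nat
    using that e by (rule order.strict_trans2)
  have "length (foldl dstep (dstep ys r) rs) \<le> length (dstep ys r) \<and>
    (\<forall>q\<in>set (foldl dstep (dstep ys r) rs). fst q < 2 ^ (w + esz r + esz rs) \<and> snd q < 2 ^ (w + esz r + esz rs))"
    by (rule Cons.IH) (rule dstep_bound[OF Cons.prems])
  then show ?case using l le by simp
qed

lemma fpt_foldl_dstep [fpt_intros]:
  assumes ys: "fpt ys" and rs: "fpt rs"
  shows "fpt (\<lambda>x. foldl dstep (ys x) (rs x))"
proof (rule fpt_foldl[OF _ ys rs, where h = "\<lambda>x. length (ys x) * (8 * (esz (ys x) + esz (rs x)) + 4) + 1"])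
  show "fpt (\<lambda>p. dstep (snd (fst p)) (snd p))" unfolding dstep_def by (intro fpt_intros)
  show "pbt (\<lambda>x. length (ys x) * (8 * (esz (ys x) + esz (rs x)) + 4) + 1)" by (intro pbt_intros ys rs)
  fix x n
  let ?rs = "take n (rs x)" and ?w = "esz (ys x)"
  let ?z = "foldl dstep (ys x) ?rs"
  have w: "fst q < 2 ^ ?w \<and> snd q < 2 ^ ?w" if "q \<in> set (ys x)" for q
  proof -
    have e: "esz q < ?w" by (rule esz_mem[OF that])
    have b: "blen (fst q) < esz q" "blen (snd q) < esz q"
      using esz_nat(1)[of "fst q"] esz_nat(1)[of "snd q"] by (cases q; simp add: esz_Pair)+
    show ?thesis unfolding blen_le_iff[symmetric] using b e by simp
  qed
  have len: "length ?z \<le> length (ys x)"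
    and val: "\<And>q. q \<in> set ?z \<Longrightarrow> fst q < 2 ^ (?w + esz ?rs) \<and> snd q < 2 ^ (?w + esz ?rs)"
    using foldl_dstep_bound[of "ys x" ?w ?rs, OF w] by auto
  have r: "esz ?rs \<le> esz (rs x)"
    using esz_append[of ?rs "drop n (rs x)"] sz_pos[of "enc (drop n (rs x))"]
    unfolding append_take_drop_id by linarith
  have "esz q \<le> 8 * (?w + esz (rs x)) + 3" if "q \<in> set ?z" for q
  proof -
    have "blen (fst q) \<le> ?w + esz ?rs" "blen (snd q) \<le> ?w + esz ?rs" using val[OF that] by (simp_all add: blen_le_iff)
    then show ?thesis using esz_nat(2)[of "fst q"] esz_nat(2)[of "snd q"] r by (cases q) (simp add: esz_Pair)
  qed
  then have "esz ?z \<le> length ?z * (8 * (?w + esz (rs x)) + 3 + 1) + 1" by (rule esz_list_le)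
  also have "\<dots> \<le> length (ys x) * (8 * (?w + esz (rs x)) + 4) + 1"
  proof -
    have "8 * (?w + esz (rs x)) + 3 + 1 = 8 * (?w + esz (rs x)) + 4" by simp
    then show ?thesis using mult_le_mono1[OF len] by (simp only: add_le_cancel_right)
  qed
  finally show "esz ?z \<le> length (ys x) * (8 * (esz (ys x) + esz (rs x)) + 4) + 1" .
qed

text \<open>The given fractions with a common denominator, as differences.\<close>

definition scaled :: "(bool \<times> nat \<times> nat) list \<Rightarrow> (nat \<times> nat) list" where
  "scaled ps = map (\<lambda>p. if fst p then (0, fst (snd p) * (prod_list (map (\<lambda>p. snd (snd p)) ps) div snd (snd p)))
     else (fst (snd p) * (prod_list (map (\<lambda>p. snd (snd p)) ps) div snd (snd p)), 0)) ps"

lemma fpt_scaled [fpt_intros]: "fpt f \<Longrightarrow> fpt (\<lambda>x. scaled (f x))"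
proof -
  assume f: "fpt f"
  have "fpt (\<lambda>x. prod_list (map (\<lambda>p. snd (snd p)) (f x)))" by (intro fpt_intros f)
  note 1 = fpt_comp[OF this]
  show ?thesis unfolding scaled_def by (intro fpt_intros f 1)
qed

lemma dval_scaled:
  assumes "\<And>p. p \<in> set ps \<Longrightarrow> snd (snd p) \<noteq> 0"
  shows "map dval (scaled ps) = map (\<lambda>p. of_nat (prod_list (map (\<lambda>p. snd (snd p)) ps)) * fraction p) ps"
proof -
  let ?B = "prod_list (map (\<lambda>p. snd (snd p)) ps)"
  have "of_nat (?B div snd (snd p)) = (of_nat ?B / of_nat (snd (snd p)) :: rat)" if p: "p \<in> set ps" for p
  proof -
    have "snd (snd p) dvd ?B" using p by (induction ps) auto
    then obtain k where k: "?B = snd (snd p) * k" by (rule dvdE)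
    show ?thesis unfolding k using assms[OF p] by simp
  qed
  then show ?thesis
    unfolding scaled_def map_map comp_def by (intro map_cong refl) (auto simp: dval_def fraction_def)
qed

lemma annihilate_scale: "annihilate rs (map (\<lambda>y. c * y) ys) = map (\<lambda>y. c * y) (annihilate rs ys)"
proof (induction rs arbitrary: ys)
  case (Cons r rs)
  have 1: "map2 (\<lambda>a b. of_nat (snd r) * b - of_nat (fst r) * a) (map (\<lambda>y. c * y) ys) (tl (map (\<lambda>y. c * y) ys))
    = map (\<lambda>y. c * y) (map2 (\<lambda>a b. of_nat (snd r) * b - of_nat (fst r) * a) ys (tl ys))"
    by (simp add: map_tl[symmetric] zip_map_map case_prod_beta algebra_simps)
  show ?case unfolding annihilate_Cons 1 by (rule Cons)
qed (simp add: annihilate_def)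

section \<open>The size of the values\<close>

lemma rat_code_length:
  assumes D: "D > 0" and r: "r * of_nat D = of_int z"
  shows "length (rat_code r) \<le> 2 * blen (nat \<bar>z\<bar>) + blen D + 3"
proof -
  obtain a b where ab: "quotient_of r = (a, b)" by (cases "quotient_of r")
  have b: "b > 0" by (rule quotient_of_denom_pos[OF ab])
  have r': "r = of_int a / of_int b" by (rule quotient_of_div[OF ab])
  have "of_int (a * int D) = (of_int (z * b) :: rat)" using r b unfolding r' by (simp add: field_simps)
  then have e: "a * int D = z * b" by (simp only: of_int_eq_iff)
  have "coprime b a" using quotient_of_coprime[OF ab] by (simp add: coprime_commute)
  moreover have "b dvd a * int D" unfolding e by simp
  ultimately have "b dvd int D" by (simp add: coprime_dvd_mult_right_iff)
  then obtain k where k: "int D = b * k" by (rule dvdE)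
  have kp: "k > 0" using k D b by (metis of_nat_0_less_iff zero_less_mult_pos)
  have "b * (a * k) = b * z" using e unfolding k by (simp add: mult_ac)
  then have z: "z = a * k" using b by simp
  have "\<bar>a\<bar> * 1 \<le> \<bar>a\<bar> * k" using kp by (intro mult_left_mono) auto
  then have "nat \<bar>a\<bar> \<le> nat \<bar>z\<bar>" unfolding z abs_mult using kp by simp
  moreover have "b * 1 \<le> b * k" using b kp by (intro mult_left_mono) auto
  then have "nat b \<le> D" using k by simp
  ultimately have "blen (nat \<bar>a\<bar>) \<le> blen (nat \<bar>z\<bar>)" "blen (nat b) \<le> blen D" by (simp_all add: blen_mono)
  moreover have "length (concat (map (\<lambda>b. [b, b]) u)) = 2 * length u" for u :: "bool list" by (induction u) auto
  ultimately show ?thesis by (simp add: rat_code_def ab pair_code_def)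
qed

text \<open>
  All summands have a common denominator of polynomial length.
\<close>

lemma R2_integer:
  fixes l c :: int and l' d :: nat
  assumes G: "G \<in> bipgraphs" and l': "l' > 0" and d: "d > 0"
  shows "\<exists>z. R2 (of_int l / of_nat l') (of_int c / of_nat d) G * of_nat (l' ^ right_size G * d ^ card (edges G)) = of_int z
    \<and> \<bar>z\<bar> \<le> int ((2 * (nat \<bar>l\<bar> + l' + nat \<bar>c\<bar> + d)) ^ (right_size G + card (edges G)))"
proof -
  let ?n = "right_size G" and ?E = "card (edges G)" and ?K = "nat \<bar>l\<bar> + l' + nat \<bar>c\<bar> + d"
  let ?rk = "\<lambda>S. rk2 (left_size G) (right_size G) S"
  have fin: "finite (edges G)" using G by (auto simp: bipgraphs_def dest: finite_subset)
  let ?t = "\<lambda>S. l ^ ?rk S * int l' ^ (?n - ?rk S) * (c ^ card S * int d ^ (?E - card S))"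
  have cS: "card S \<le> ?E" if "S \<in> Pow (edges G)" for S using that fin by (auto intro: card_mono)
  have "(of_int l / of_nat l') ^ ?rk S * (of_int c / of_nat d) ^ card S * of_nat (l' ^ ?n * d ^ ?E) = (of_int (?t S) :: rat)"
    if S: "S \<in> Pow (edges G)" for S
  proof -
    have 1: "(of_int l / of_nat l') ^ k * of_nat l' ^ ?n = (of_int (l ^ k * int l' ^ (?n - k)) :: rat)" if "k \<le> ?n" for k
    proof -
      have "of_nat l' ^ ?n = (of_nat l' ^ k * of_nat l' ^ (?n - k) :: rat)" using that by (simp flip: power_add)
      then show ?thesis using l' by (simp add: power_divide)
    qed
    have 2: "(of_int c / of_nat d) ^ k * of_nat d ^ ?E = (of_int (c ^ k * int d ^ (?E - k)) :: rat)" if "k \<le> ?E" for k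
    proof -
      have "of_nat d ^ ?E = (of_nat d ^ k * of_nat d ^ (?E - k) :: rat)" using that by (simp flip: power_add)
      then show ?thesis using d by (simp add: power_divide)
    qed
    show ?thesis
      unfolding of_int_mult[of "_ * _" "_ * _"] 1[OF rk2_le, symmetric] 2[OF cS[OF S], symmetric] by simp
  qed
  then have e: "R2 (of_int l / of_nat l') (of_int c / of_nat d) G * of_nat (l' ^ ?n * d ^ ?E) = of_int (\<Sum>S\<in>Pow (edges G). ?t S)"
    unfolding R2_def of_int_sum sum_distrib_right by (intro sum.cong refl)
  have b: "\<bar>?t S\<bar> \<le> int (?K ^ (?n + ?E))" if S: "S \<in> Pow (edges G)" for S
  proof -
    have p: "\<bar>x\<bar> ^ k * int y ^ (N - k) \<le> int ?K ^ N" if "k \<le> N" "\<bar>x\<bar> \<le> int ?K" "y \<le> ?K" for x :: int and y k N :: nat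
    proof -
      have "\<bar>x\<bar> ^ k * int y ^ (N - k) \<le> int ?K ^ k * int ?K ^ (N - k)"
        using that by (intro mult_mono power_mono) auto
      also have "\<dots> = int ?K ^ N" using that(1) by (simp only: power_add[symmetric] le_add_diff_inverse)
      finally show ?thesis .
    qed
    have "\<bar>?t S\<bar> = (\<bar>l\<bar> ^ ?rk S * int l' ^ (?n - ?rk S)) * (\<bar>c\<bar> ^ card S * int d ^ (?E - card S))"
      by (simp add: abs_mult power_abs)
    also have "\<dots> \<le> int ?K ^ ?n * int ?K ^ ?E"
      using rk2_le cS[OF S] by (intro mult_mono p) auto
    finally show ?thesis by (simp add: power_add)
  qed
  have "\<bar>\<Sum>S\<in>Pow (edges G). ?t S\<bar> \<le> (\<Sum>S\<in>Pow (edges G). \<bar>?t S\<bar>)" by (rule sum_abs)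
  also have "\<dots> \<le> (\<Sum>S\<in>Pow (edges G). int (?K ^ (?n + ?E)))" by (rule sum_mono) (rule b)
  also have "\<dots> = int (2 ^ ?E * ?K ^ (?n + ?E))" using fin by (simp add: card_Pow)
  also have "\<dots> \<le> int (2 ^ (?n + ?E) * ?K ^ (?n + ?E))" using l' by (intro of_nat_mono mult_le_mono power_increasing) auto
  finally show ?thesis using e by (intro exI conjI) (simp_all only: power_mult_distrib)
qed

lemma length_bipgraph_code:
  "length (bipgraph_code G) = left_size G + right_size G + 2 + left_size G * right_size G"
  by (simp add: bipgraph_code_def length_concat comp_def sum_list_triv)

lemma R2_size: "\<exists>b. pb b \<and> (\<forall>w. length (eval_problem (R2 lam mu) w) \<le> b (length w))"
proof -
  have nat_fraction: "\<exists>(l :: int) (l' :: nat). l' > 0 \<and> r = of_int l / of_nat l'" for r :: rat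
  proof -
    obtain a b where ab: "quotient_of r = (a, b)" by (cases "quotient_of r")
    then show ?thesis using quotient_of_denom_pos[OF ab] quotient_of_div[OF ab]
      by (intro exI[of _ a] exI[of _ "nat b"]) auto
  qed
  obtain l l' where l: "l' > 0" "lam = of_int l / of_nat l'" using nat_fraction by blast
  obtain c d where c: "d > 0" "mu = of_int c / of_nat d" using nat_fraction by blast
  define K where "K = 2 * (nat \<bar>l\<bar> + l' + nat \<bar>c\<bar> + d)"
  have pw: "blen x \<le> blen K * N + 1" if "x \<le> K ^ N" for x N
  proof -
    have "x \<le> (2 ^ blen K) ^ N" using that power_mono[of K "2 ^ blen K" N] less_blen[of K] by simp
    also have "\<dots> < 2 ^ (blen K * N + 1)" by (simp add: power_mult)
    finally show ?thesis unfolding blen_le_iff .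
  qed
  have "length (eval_problem (R2 lam mu) w) \<le> 3 * (blen K * length w + 1) + 3" for w
  proof (cases "w \<in> bipgraph_code ` bipgraphs")
    case True
    then obtain G where G: "G \<in> bipgraphs" and w: "w = bipgraph_code G" by blast
    let ?N = "right_size G + card (edges G)"
    have "card (edges G) \<le> card ({..<left_size G} \<times> {..<right_size G})"
      using G by (intro card_mono) (auto simp: bipgraphs_def)
    then have N: "?N \<le> length w" unfolding w length_bipgraph_code by (simp add: card_cartesian_product)
    let ?D = "l' ^ right_size G * d ^ card (edges G)"
    obtain z where z: "R2 lam mu G * of_nat ?D = of_int z" "\<bar>z\<bar> \<le> int (K ^ ?N)"
      using R2_integer[OF G l(1) c(1), of l c] unfolding l(2) c(2) K_def by blast
    have D: "?D > 0" using l(1) c(1) by simp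
    have "?D \<le> K ^ right_size G * K ^ card (edges G)" unfolding K_def by (intro mult_le_mono power_mono) auto
    then have 1: "blen ?D \<le> blen K * ?N + 1" by (intro pw) (simp add: power_add)
    have 2: "blen (nat \<bar>z\<bar>) \<le> blen K * ?N + 1" by (rule pw) (simp only: nat_le_iff z(2))
    have 3: "blen K * ?N \<le> blen K * length w" using N by (rule mult_le_mono2)
    have "a \<le> 2 * a1 + a2 + 3 \<Longrightarrow> a2 \<le> b + 1 \<Longrightarrow> a1 \<le> b + 1 \<Longrightarrow> b \<le> c \<Longrightarrow> a \<le> 3 * (c + 1) + 3"
      for a a1 a2 b c :: nat by arith
    from this[OF rat_code_length[OF D z(1)] 1 2 3] show ?thesis unfolding w eval_problem_code[OF G] .
  next
    case False
    then show ?thesis by (simp add: eval_problem_def)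
  qed
  moreover have "pb (\<lambda>n. 3 * (blen K * n + 1) + 3)" by (intro pb_add pb_mult pb_const pb_id)
  ultimately show ?thesis by blast
qed

section \<open>Reductions by interpolation\<close>

text \<open>
  The values of fractions that are given by numerator and denominator.
\<close>

definition node_values :: "(nat \<times> nat) list \<Rightarrow> rat set" where
  "node_values ns = (\<lambda>p. of_nat (fst p) / of_nat (snd p)) ` set ns"

definition absdiff :: "nat \<Rightarrow> nat \<Rightarrow> nat" where
  "absdiff a b = (a - b) + (b - a)"

lemma absdiff: "of_nat (absdiff a b) = \<bar>of_nat a - of_nat b :: rat\<bar>"
  by (cases "a \<le> b") (simp_all add: absdiff_def)

lemma fpt_absdiff [fpt_intros]: "fpt f \<Longrightarrow> fpt g \<Longrightarrow> fpt (\<lambda>x. absdiff (f x) (g x))"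
  unfolding absdiff_def by (intro fpt_intros)

text \<open>
  The coefficient, from the values \<open>as\<close>, the fractions \<open>ns\<close> to be annihilated, the fraction \<open>t\<close> that is
  kept, and the number \<open>nv\<close> of columns, where \<open>k1 / k2\<close> and \<open>l1 / l2\<close> are the absolute values of the constant
  in the coefficient and of \<open>\<lambda>\<close>.  The division is exact.
\<close>

definition interpolate ::
  "nat \<Rightarrow> nat \<Rightarrow> nat \<Rightarrow> nat \<Rightarrow> (bool \<times> nat \<times> nat) list \<Rightarrow> (nat \<times> nat) list \<Rightarrow> nat \<times> nat \<Rightarrow> unit list \<Rightarrow> nat" where
  "interpolate k1 k2 l1 l2 as ns t nv =
     absdiff (fst (hd (foldl dstep (scaled as) ns))) (snd (hd (foldl dstep (scaled as) ns)))
       * snd t ^ length ((0, 0) # ns) * (k2 * l2 ^ length nv)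
     div (prod_list (map (\<lambda>p. snd (snd p)) as) * (k1 * l1 ^ length nv) * fst t
       * prod_list (map (\<lambda>r. absdiff (snd r * fst t) (fst r * snd t)) ns))"

lemma interpolate:
  fixes c :: "rat \<Rightarrow> rat"
  assumes k: "k1 \<noteq> 0" "k2 \<noteq> 0" "\<bar>kap\<bar> = of_nat k1 / of_nat k2"
    and l: "l1 \<noteq> 0" "l2 \<noteq> 0" "\<bar>lam\<bar> = of_nat l1 / of_nat l2"
    and den: "\<And>p. p \<in> set as \<Longrightarrow> snd (snd p) \<noteq> 0"
    and len: "length as = Suc (length ns)"
    and t: "fst t \<noteq> 0" "snd t \<noteq> 0" "of_nat (fst t) / of_nat (snd t) \<notin> node_values ns"
    and ns: "\<And>r. r \<in> set ns \<Longrightarrow> snd r \<noteq> 0"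
    and val: "\<And>i. i < length as \<Longrightarrow> fraction (as ! i) = (\<Sum>r\<in>node_values ns. c r * r ^ Suc i)
      + lam ^ length nv * (kap * of_nat N) * (of_nat (fst t) / of_nat (snd t)) ^ Suc i"
  shows "interpolate k1 k2 l1 l2 as ns t nv = N"
proof -
  let ?B = "prod_list (map (\<lambda>p. snd (snd p)) as)" and ?r0 = "of_nat (fst t) / of_nat (snd t) :: rat"
  let ?y = "hd (foldl dstep (scaled as) ns)" and ?C = "lam ^ length nv * (kap * of_nat N)"
  let ?d = "\<lambda>r. absdiff (snd r * fst t) (fst r * snd t)"
  have F: "finite (node_values ns)" "node_values ns \<subseteq> {of_nat P / of_nat Q | P Q. (P, Q) \<in> set ns}"
    by (simp add: node_values_def) (unfold node_values_def, force)
  have an: "length (annihilate ns (map fraction as)) = Suc 0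
    \<and> annihilate ns (map fraction as) ! 0 = ?C * ?r0 * prod_list (map (\<lambda>(P, Q). of_nat Q * ?r0 - of_nat P) ns)"
  proof (rule annihilate_power_sum[OF _ F(1) t(3) _ _ F(2)])
    show "length (map fraction as) = length ns + Suc 0" using len by simp
    show "map fraction as ! i = (\<Sum>r\<in>node_values ns. c r * r * r ^ i) + ?C * ?r0 * ?r0 ^ i"
      if "i < length (map fraction as)" for i
      using val[of i] that by (simp add: mult.assoc)
  qed (use ns in force)
  have "map dval (foldl dstep (scaled as) ns) = map (\<lambda>y. of_nat ?B * y) (annihilate ns (map fraction as))"
  proof -
    have "map dval (scaled as) = map (\<lambda>p. of_nat ?B * fraction p) as" by (rule dval_scaled) (rule den)
    then show ?thesis unfolding dval_annihilate annihilate_scale[symmetric] map_map comp_def by (rule arg_cong)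
  qed
  moreover obtain a where a: "annihilate ns (map fraction as) = [a]"
    using an by (metis length_0_conv length_Suc_conv)
  ultimately have "map dval (foldl dstep (scaled as) ns) = [of_nat ?B * a]" by simp
  then have y: "dval ?y = of_nat ?B * a" by auto
  have fac: "\<bar>prod_list (map (\<lambda>(P, Q). of_nat Q * ?r0 - of_nat P) rs)\<bar>
      * of_nat (snd t) ^ length rs = of_nat (prod_list (map ?d rs))" for rs
  proof (induction rs)
    case (Cons r rs)
    have "\<bar>of_nat (snd r) * ?r0 - of_nat (fst r)\<bar> * of_nat (snd t)
        = \<bar>(of_nat (snd r) * ?r0 - of_nat (fst r)) * of_nat (snd t)\<bar>" by (simp add: abs_mult)
    also have "\<dots> = of_nat (?d r)" using t(2) by (simp add: absdiff left_diff_distrib)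
    finally have 1: "\<bar>of_nat (snd r) * ?r0 - of_nat (fst r)\<bar> * of_nat (snd t) = of_nat (?d r)" .
    have "a * b * (t * u) = (a * t) * (b * u)" for a b t u :: rat by simp
    then show ?case
      unfolding list.map prod_list.Cons abs_mult length_Cons power_Suc of_nat_mult 1[symmetric] Cons[symmetric]
      by (simp only: case_prod_beta)
  qed simp
  have dnz: "?d r \<noteq> 0" if r: "r \<in> set ns" for r
  proof
    assume "?d r = 0"
    then have "snd r * fst t = fst r * snd t" by (simp add: absdiff_def)
    then have "of_nat (snd r) * of_nat (fst t) = (of_nat (fst r) * of_nat (snd t) :: rat)" by (metis of_nat_mult)
    then have "?r0 = of_nat (fst r) / of_nat (snd r)" using ns[OF r] t(2) by (simp add: field_simps)
    then show False using t(3) r by (auto simp: node_values_def)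
  qed
  have Bnz: "?B \<noteq> 0" unfolding prod_list_zero_iff set_map by (rule notI, erule imageE) (metis den)
  have Pnz: "prod_list (map ?d ns) \<noteq> 0" unfolding prod_list_zero_iff set_map by (rule notI, erule imageE) (metis dnz)
  let ?num = "absdiff (fst ?y) (snd ?y) * snd t ^ length ((0, 0) # ns) * (k2 * l2 ^ length nv)"
  let ?den = "?B * (k1 * l1 ^ length nv) * fst t * prod_list (map ?d ns)"
  have "of_nat ?num = (of_nat (N * ?den) :: rat)"
  proof -
    have "of_nat (absdiff (fst ?y) (snd ?y)) = \<bar>of_nat ?B * a\<bar>"
      unfolding absdiff y[symmetric] dval_def ..
    also have "\<dots> = of_nat ?B * (\<bar>?C\<bar> * ?r0 * \<bar>prod_list (map (\<lambda>(P, Q). of_nat Q * ?r0 - of_nat P) ns)\<bar>)"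
      using an unfolding a by (simp add: abs_mult)
    also have "\<bar>?C\<bar> = (of_nat l1 / of_nat l2) ^ length nv * ((of_nat k1 / of_nat k2) * of_nat N)"
      by (simp add: abs_mult power_abs k l)
    finally have "of_nat (absdiff (fst ?y) (snd ?y)) * of_nat (snd t) ^ length ns
      = of_nat ?B * ((of_nat l1 / of_nat l2) ^ length nv * ((of_nat k1 / of_nat k2) * of_nat N) * ?r0) * of_nat (prod_list (map ?d ns))"
      unfolding fac[of ns, symmetric] by (simp only: mult_ac)
    then show ?thesis using k(2) l(2) t(2) by (simp add: power_divide field_simps)
  qed
  then have e: "?num = N * ?den" by (simp only: of_nat_eq_iff)
  have "?den \<noteq> 0" using Bnz Pnz k(1) l(1) t(1) by simp
  then show ?thesis unfolding interpolate_def e by (rule nonzero_mult_div_cancel_right)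
qed

lemma nat_fraction: "r \<noteq> 0 \<Longrightarrow> \<exists>a b :: nat. a \<noteq> 0 \<and> b \<noteq> 0 \<and> \<bar>r :: rat\<bar> = of_nat a / of_nat b"
proof -
  assume r: "r \<noteq> 0"
  obtain a b where ab: "quotient_of r = (a, b)" by (cases "quotient_of r")
  have b: "b > 0" by (rule quotient_of_denom_pos[OF ab])
  have r': "r = of_int a / of_int b" by (rule quotient_of_div[OF ab])
  have "\<bar>r\<bar> = of_nat (nat \<bar>a\<bar>) / of_nat (nat b)" unfolding r' using b by simp
  then show ?thesis using r b unfolding r' by (intro exI[of _ "nat \<bar>a\<bar>"] exI[of _ "nat b"]) auto
qed

text \<open>
  The queries are the graphs with \<open>1, 2, ...\<close> copies of the rows, one more than there are fractions to
  be annihilated.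
\<close>

theorem interpolation_reduction:
  fixes nv :: "bool list \<Rightarrow> unit list" and ps nodes :: "bool list \<Rightarrow> (nat \<times> nat) list" and t :: "bool list \<Rightarrow> nat \<times> nat"
  assumes fpt: "fpt nv" "fpt ps" "fpt nodes" "fpt t"
    and lam: "lam \<noteq> 0" and kap: "kap \<noteq> 0"
    and ps: "\<And>x p. p \<in> set (ps x) \<Longrightarrow> fst p < length (nv x) \<and> snd p < length (nv x)"
    and ns: "\<And>x r. r \<in> set (nodes x) \<Longrightarrow> snd r \<noteq> 0"
    and t: "\<And>x. fst (t x) \<noteq> 0" "\<And>x. snd (t x) \<noteq> 0"
      "\<And>x. of_nat (fst (t x)) / of_nat (snd (t x)) \<notin> node_values (nodes x)"
    and sum: "\<And>x. \<exists>c. \<forall>k. R2 lam mu (rgraph (length (nv x)) (map pset (concat (replicate k (ps x)))))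
      = (\<Sum>r\<in>node_values (nodes x). c r * r ^ k)
        + lam ^ length (nv x) * (kap * of_nat (f x)) * (of_nat (fst (t x)) / of_nat (snd (t x))) ^ k"
  shows "polytime_turing_reducible (\<lambda>x. nat_code (f x)) (eval_problem (R2 lam mu))"
proof -
  obtain k1 k2 where k: "k1 \<noteq> 0" "k2 \<noteq> 0" "\<bar>kap\<bar> = of_nat k1 / of_nat k2" using nat_fraction[OF kap] by blast
  obtain l1 l2 where l: "l1 \<noteq> 0" "l2 \<noteq> 0" "\<bar>lam\<bar> = of_nat l1 / of_nat l2" using nat_fraction[OF lam] by blast
  obtain b where b: "pb b" "\<And>w. length (eval_problem (R2 lam mu) w) \<le> b (length w)" using R2_size by blast
  define idx where "idx x = [0..<length ((0, 0) # nodes x)]" for x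
  define rws where "rws x k = concat (map (\<lambda>i. if i \<le> k then ps x else []) (idx x))" for x k
  define qs where "qs x = map (\<lambda>k. rows_word (nv x) (rws x k)) (idx x)" for x
  define post where "post p = nat_code (interpolate k1 k2 l1 l2 (map parse (rev (fst p))) (fst (snd p)) (fst (snd (snd p))) (snd (snd (snd p))))"
    for p :: "bool list list \<times> (nat \<times> nat) list \<times> (nat \<times> nat) \<times> unit list"
  have idx: "fpt idx" unfolding idx_def by (intro fpt_intros fpt)
  have rws: "fpt (\<lambda>p. rws (fst p) (snd p))" unfolding rws_def
    by (rule fpt_concat_map) (intro fpt_intros fpt_comp[OF fpt(2)] fpt_comp[OF idx])+
  have rows_eq: "rws x k = concat (replicate (Suc k) (ps x))" if "k < Suc (length (nodes x))" for x k
  proof -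
    have "concat (map (\<lambda>i. if i \<le> k then ps x else []) [0..<m]) = concat (replicate (min m (Suc k)) (ps x))" for m
    proof (induction m)
      case (Suc m)
      show ?case
      proof (cases "m \<le> k")
        case True
        then have "min (Suc m) (Suc k) = Suc m" "min m (Suc k) = m" by auto
        then show ?thesis using Suc True by (simp add: upt_Suc replicate_append_same[symmetric])
      next
        case False
        then have "min (Suc m) (Suc k) = Suc k" "min m (Suc k) = Suc k" by auto
        then show ?thesis using Suc False by (simp add: upt_Suc)
      qed
    qed simp
    moreover have "min (Suc (length (nodes x))) (Suc k) = Suc k" using that by simp
    ultimately show ?thesis unfolding rws_def idx_def by (metis length_Cons)
  qed
  show ?thesis
  proof (rule fpt_polytime_turing_reducible[OF _ _ _ _ b])
    show "fpt qs" unfolding qs_def by (intro fpt_intros fpt_comp[OF fpt(1)] rws idx)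
    show "fpt (\<lambda>x. (nodes x, t x, nv x))" by (intro fpt_intros fpt)
    show "fpt post" unfolding post_def interpolate_def by (intro fpt_intros)
    fix x
    define G where "G k = rgraph (length (nv x)) (map pset (concat (replicate k (ps x))))" for k
    have G: "G k \<in> bipgraphs" for k
      unfolding G_def by (rule rgraph_bipgraphs) (use ps in \<open>auto simp: pset_def\<close>)
    have q: "map (eval_problem (R2 lam mu)) (qs x) = map (\<lambda>k. rat_code (R2 lam mu (G (Suc k)))) (idx x)"
      unfolding qs_def map_map comp_def
    proof (intro map_cong refl)
      fix k assume "k \<in> set (idx x)"
      then have k: "k < Suc (length (nodes x))" by (simp add: idx_def)
      show "eval_problem (R2 lam mu) (rows_word (nv x) (rws x k)) = rat_code (R2 lam mu (G (Suc k)))"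
        unfolding rows_eq[OF k] rows_word[symmetric] G_def[symmetric] by (rule eval_problem_code[OF G])
    qed
    obtain c where c: "\<And>k. R2 lam mu (G k) = (\<Sum>r\<in>node_values (nodes x). c r * r ^ k)
        + lam ^ length (nv x) * (kap * of_nat (f x)) * (of_nat (fst (t x)) / of_nat (snd (t x))) ^ k"
      using sum[of x] unfolding G_def by blast
    let ?as = "map (\<lambda>k. parse (rat_code (R2 lam mu (G (Suc k))))) (idx x)"
    have "interpolate k1 k2 l1 l2 ?as (nodes x) (t x) (nv x) = f x"
    proof (rule interpolate[OF k l])
      show "snd (snd p) \<noteq> 0" if "p \<in> set ?as" for p using that parse(2) by auto
      show "length ?as = Suc (length (nodes x))" by (simp add: idx_def)
      show "fraction (?as ! i) = (\<Sum>r\<in>node_values (nodes x). c r * r ^ Suc i)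
          + lam ^ length (nv x) * (kap * of_nat (f x)) * (of_nat (fst (t x)) / of_nat (snd (t x))) ^ Suc i"
        if "i < length ?as" for i
      proof -
        have "?as ! i = parse (rat_code (R2 lam mu (G (Suc i))))" using that by (simp add: idx_def)
        then show ?thesis unfolding c[symmetric] by (simp only: parse(1))
      qed
    qed (use t ns in auto)
    then show "post (rev (map (eval_problem (R2 lam mu)) (qs x)), (nodes x, t x, nv x)) = nat_code (f x)"
      unfolding post_def q by (simp add: comp_def)
  qed
qed

section \<open>Hardness\<close>

lemma fpt_bounded_power [fpt_intros]:
  fixes f g :: "'a::enc \<Rightarrow> nat"
  assumes f: "fpt f" and g: "fpt g" and l: "fpt l"
  shows "fpt (\<lambda>x. f x ^ min (g x) (length (l x)))"
proof -
  have "length (filter (\<lambda>i. i < k) [0..<n]) = min k n" for k n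
    by (induction n) (auto simp: upt_Suc)
  moreover have "fpt (\<lambda>x. f x ^ length (filter (\<lambda>i. i < g x) [0..<length (l x)]))"
    by (intro fpt_intros f l fpt_comp[OF g])
  ultimately show ?thesis by simp
qed

lemma large_power:
  fixes g :: rat
  assumes "g > 1"
  shows "\<exists>c. b \<le> g ^ c"
proof -
  obtain d where d: "g = 1 + d" "d > 0" using assms by (metis add.commute diff_add_cancel diff_gt_0_iff_gt)
  have bern: "1 + of_nat c * d \<le> g ^ c" for c
  proof (induction c)
    case (Suc c)
    have "1 + of_nat (Suc c) * d \<le> (1 + of_nat c * d) * (1 + d)" using d(2) by (simp add: algebra_simps)
    also have "\<dots> \<le> g ^ c * g" using Suc d by (intro mult_mono) auto
    finally show ?case by (simp add: mult.commute)
  qed simp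
  obtain c :: nat where "b < of_nat c * d" using ex_less_of_nat_mult[OF d(2)] by blast
  then show ?thesis using bern[of c] by (intro exI[of _ c]) linarith
qed

lemma sharpP_hardI:
  assumes "\<And>f (nu :: bool list \<Rightarrow> unit list) (wu :: bool list \<Rightarrow> unit list) A. fpt nu \<Longrightarrow> fpt wu \<Longrightarrow>
    fpt (\<lambda>p. A (fst p) (fst (snd p)) (snd (snd p))) \<Longrightarrow> (\<And>x i j. A x i j \<Longrightarrow> A x j i) \<Longrightarrow>
    (\<And>x. 2 \<le> length (wu x)) \<Longrightarrow> (\<And>x. length (wu x) < length (nu x)) \<Longrightarrow>
    (\<And>x. f x = card (cliques (length (nu x)) (A x) (length (wu x)))) \<Longrightarrow>
    polytime_turing_reducible (\<lambda>x. nat_code (f x)) g"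
  shows "sharpP_hard g"
  unfolding sharpP_hard_def
proof
  fix f assume "f \<in> sharpP"
  from sharpP_cliques[OF this] show "polytime_turing_reducible (\<lambda>x. nat_code (f x)) g"
    by (elim exE conjE) (rule assms, simp_all)
qed

theorem hardness_loops:
  assumes lam: "lam \<noteq> 0" "lam \<noteq> 1" and mu: "mu \<noteq> 0" "mu \<noteq> - 1" "mu \<noteq> - 2"
  shows "sharpP_hard (eval_problem (R2 lam mu))"
proof (rule sharpP_hardI)
  fix f and nu wu :: "bool list \<Rightarrow> unit list" and A
  assume fpt: "fpt nu" "fpt wu" "fpt (\<lambda>p. A (fst p) (fst (snd p)) (snd (snd p)))"
    and sym: "\<And>x i j. A x i j \<Longrightarrow> A x j i"
    and w: "\<And>x. 2 \<le> length (wu x)" "\<And>x. length (wu x) < length (nu x)"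
    and f: "\<And>x. f x = card (cliques (length (nu x)) (A x) (length (wu x)))"
  let ?A = "(1 + mu)\<^sup>2" and ?b = "1 + mu\<^sup>2"
  have Apos: "?A > 0" using mu by (simp add: zero_less_power2 add_eq_0_iff)
  have A1: "?A \<noteq> 1" using mu by (auto simp: power2_eq_1_iff)
  have bpos: "?b > 0" by (rule add_pos_nonneg) simp_all
  obtain a a' :: nat where a: "a \<noteq> 0" "a' \<noteq> 0" "?A = of_nat a / of_nat a'"
    using nat_fraction[of ?A] Apos by (metis abs_of_pos less_irrefl)
  obtain b b' :: nat where b: "b \<noteq> 0" "b' \<noteq> 0" "?b = of_nat b / of_nat b'"
    using nat_fraction[of ?b] bpos by (metis abs_of_pos less_irrefl)
  \<comment> \<open>so many pendant rows that the powers of \<open>(1 + \<mu>)\<^sup>2\<close> dominate those of \<open>1 + \<mu>\<^sup>2\<close>\<close>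
  obtain B c where B: "B = ?A \<or> B = 1 / ?A" "B > 1" and c: "?b \<le> B ^ c"
  proof -
    have "?A > 1 \<or> 1 / ?A > 1" using Apos A1 by (auto simp: less_divide_eq)
    then show thesis using that large_power by metis
  qed
  define lu where "lu x = replicate (poly [:0, 0, 2 * c:] (length (nu x))) ()" for x
  define hu where "hu x = replicate (poly [:0, 0, c:] (length (nu x))) ()" for x
  define ju where "ju x = tl (nu x) @ hu x" for x
  define nn where "nn x = concat (map (\<lambda>_. nu x) (nu x))" for x
  define dt where "dt x = (length (nu x) - length (wu x), length (wu x) * (length (wu x) - 1))" for x
  define node where "node x de = ((a ^ length (ju x)) ^ min (fst de) (length (nu x)) * b ^ min (snd de) (length (nn x)),
    (a' ^ length (ju x)) ^ min (fst de) (length (nu x)) * b' ^ min (snd de) (length (nn x)))" for x de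
  define ns where "ns x = map (node x) (filter (\<lambda>de. de \<noteq> dt x)
    (List.product [0..<length (() # nu x)] [0..<length (() # nn x)]))" for x
  have lu: "fpt lu" unfolding lu_def by (rule fpt_poly) (rule fpt)
  have hu: "fpt hu" unfolding hu_def by (rule fpt_poly) (rule fpt)
  have ju: "fpt ju" unfolding ju_def by (intro fpt_intros fpt hu)
  have nn: "fpt nn" unfolding nn_def by (rule fpt_concat_map) (intro fpt_intros fpt fpt_comp[OF fpt(1)])+
  have dt: "fpt dt" unfolding dt_def by (intro fpt_intros fpt)
  have node: "fpt (\<lambda>x. node (g x) (h x))" if "fpt g" "fpt h" for g :: "'z::enc \<Rightarrow> bool list" and h
    unfolding node_def by (intro fpt_intros that fpt_comp[OF ju that(1)] fpt_comp[OF fpt(1) that(1)] fpt_comp[OF nn that(1)])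
  have ns: "fpt ns" unfolding ns_def by (intro fpt_intros node fpt nn fpt_comp[OF dt])
  have node_simp: "node x (d, e) = (a ^ (length (ju x) * d) * b ^ e, a' ^ (length (ju x) * d) * b' ^ e)"
    if "d \<le> length (nu x)" "e \<le> length (nn x)" for x d e
    using that by (simp add: node_def power_mult)
  have val: "of_nat (fst (node x (d, e))) / of_nat (snd (node x (d, e))) = ?A ^ (length (ju x) * d) * ?b ^ e"
    if "d \<le> length (nu x)" "e \<le> length (nn x)" for x d e
    unfolding node_simp[OF that] a(3) b(3) by (simp add: power_divide)
  have node_pos: "fst (node x de) \<noteq> 0" "snd (node x de) \<noteq> 0" for x de
    using a b by (simp_all add: node_def)
  have lnn: "length (nn x) = length (nu x) * length (nu x)" for x
    by (simp add: nn_def length_concat comp_def sum_list_triv)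
  have dt_le: "fst (dt x) \<le> length (nu x)" "snd (dt x) \<le> length (nn x)" for x
    using w(2)[of x] unfolding dt_def lnn by (auto intro!: mult_le_mono)
  show "polytime_turing_reducible (\<lambda>x. nat_code (f x)) (eval_problem (R2 lam mu))"
  proof (rule interpolation_reduction[where nv = nu and nodes = ns and t = "\<lambda>x. node x (dt x)" and kap = "1 / lam - 1"
        and ps = "\<lambda>x. gadget (\<lambda>i. i) (length (lu x)) (length (nu x)) (A x)"])
    show "fpt nu" "fpt ns" by (fact fpt ns)+
    show "fpt (\<lambda>x. gadget (\<lambda>i. i) (length (lu x)) (length (nu x)) (A x))"
      by (rule fpt_gadget[where hub = "\<lambda>_ i. i"]) (intro fpt_intros lu fpt)+
    show "fpt (\<lambda>x. node x (dt x))" by (intro node fpt_intros dt)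
    show "lam \<noteq> 0" "1 / lam - 1 \<noteq> 0" using lam by simp_all
    show "fst p < length (nu x) \<and> snd p < length (nu x)"
      if "p \<in> set (gadget (\<lambda>i. i) (length (lu x)) (length (nu x)) (A x))" for x p
      by (rule gadget_bound[OF that]) auto
    show "snd r \<noteq> 0" if "r \<in> set (ns x)" for x r using that node_pos by (auto simp: ns_def)
    show "fst (node x (dt x)) \<noteq> 0" "snd (node x (dt x)) \<noteq> 0" for x by (rule node_pos)+
    fix x
    let ?n = "length (nu x)" and ?w = "length (wu x)" and ?J = "length (ju x)"
    let ?L = "c * (?n * ?n)"
    interpret clique_graph ?n "A x" by unfold_locales (rule sym)
    define F where "F = (\<lambda>(d, e). ?A ^ (?J * d) * ?b ^ e) ` ({..?n} \<times> {..?n * ?n} - {(?n - ?w, ?w * (?w - 1))})"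
    define r0 where "r0 = ?A ^ (?J * (?n - ?w)) * ?b ^ (?w * (?w - 1))"
    have J: "?J = ?n - 1 + ?L" by (simp add: ju_def hu_def mult_ac)
    have L: "length (lu x) = 2 * ?L" by (simp add: lu_def mult_ac)
    have "?b ^ (?n * ?n) \<le> (B ^ c) ^ (?n * ?n)" using c bpos by (intro power_mono) auto
    also have "\<dots> < B ^ (?n - 1) * (B ^ c) ^ (?n * ?n)"
    proof -
      have "1 < B ^ (?n - 1)" using B(2) w(1)[of x] w(2)[of x] by (intro one_less_power) auto
      moreover have "0 < (B ^ c) ^ (?n * ?n)" using B(2) by simp
      ultimately show ?thesis by simp
    qed
    also have "\<dots> = B ^ ?J" unfolding J by (simp only: power_add power_mult)
    finally have "?b ^ (?n * ?n) < ?A ^ ?J \<or> ?b ^ (?n * ?n) < (1 / ?A) ^ ?J" using B(1) by metis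
    from power_sum_loops[OF lam(1) mu(1,2) _ _ J this F_def r0_def]
    have main: "r0 \<notin> F"
      "\<exists>c. \<forall>k. R2 lam mu (rgraph ?n (map pset (concat (replicate k (gadget (\<lambda>i. i) (2 * ?L) ?n (A x))))))
        = (\<Sum>r\<in>F. c r * r ^ k) + lam ^ ?n * ((1 / lam - 1) * of_nat (card (cliques ?n (A x) ?w))) * r0 ^ k"
      using w(1)[of x] w(2)[of x] by auto
    have t: "of_nat (fst (node x (dt x))) / of_nat (snd (node x (dt x))) = r0"
      using val[OF dt_le(1) dt_le(2), of x] unfolding prod.collapse r0_def by (simp add: dt_def)
    have nv: "node_values (ns x) = F"
    proof -
      have "node_values (ns x) = (\<lambda>de. of_nat (fst (node x de)) / of_nat (snd (node x de)))
          ` {de \<in> {..?n} \<times> {..?n * ?n}. de \<noteq> dt x}"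
        unfolding node_values_def ns_def set_map image_image set_filter by (simp add: lnn atMost_atLeast0 atLeastLessThanSuc_atLeastAtMost)
      also have "\<dots> = F"
        unfolding F_def dt_def[symmetric, of x] by (rule image_cong) (auto simp: val lnn)
      finally show ?thesis .
    qed
    show "of_nat (fst (node x (dt x))) / of_nat (snd (node x (dt x))) \<notin> node_values (ns x)"
      unfolding t nv by (rule main)
    show "\<exists>c. \<forall>k. R2 lam mu (rgraph ?n (map pset (concat (replicate k (gadget (\<lambda>i. i) (length (lu x)) ?n (A x))))))
      = (\<Sum>r\<in>node_values (ns x). c r * r ^ k)
        + lam ^ ?n * ((1 / lam - 1) * of_nat (f x)) * (of_nat (fst (node x (dt x))) / of_nat (snd (node x (dt x)))) ^ k"
      unfolding t nv L f by (rule main)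
  qed
qed

theorem hardness_hub:
  assumes lam: "lam \<noteq> 0" "lam \<noteq> 1" and mu: "mu = - 1 \<or> mu = - 2" and not: "lam \<noteq> 1 / 2 \<or> mu = - 2"
  shows "sharpP_hard (eval_problem (R2 lam mu))"
proof (rule sharpP_hardI)
  fix f and nu wu :: "bool list \<Rightarrow> unit list" and A
  assume fpt: "fpt nu" "fpt wu" "fpt (\<lambda>p. A (fst p) (fst (snd p)) (snd (snd p)))"
    and sym: "\<And>x i j. A x i j \<Longrightarrow> A x j i"
    and w: "\<And>x. 2 \<le> length (wu x)" "\<And>x. length (wu x) < length (nu x)"
    and f: "\<And>x. f x = card (cliques (length (nu x)) (A x) (length (wu x)))"
  define b :: nat where "b = (if mu = - 1 then 2 else 5)"
  have b: "1 + mu\<^sup>2 = of_nat b" "b \<noteq> 0" using mu by (auto simp: b_def)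
  define m :: nat where "m = (if lam = 1 / 2 then 1 else 2)"
  define kap where "kap = (if lam = 1 / 2 then 1 else (1 / lam - 1) * (1 / lam - 2))"
  define hu where "hu x = concat (map (\<lambda>_. nu x) (nu x))" for x
  define lu where "lu x = hu x @ hu x" for x
  define mu' where "mu' x = (tl (nu x) @ hu x) @ (tl (nu x) @ hu x)" for x
  define bu where "bu x = concat (map (\<lambda>_. nu x) (mu' x)) @ lu x" for x
  define ar where "ar x = filter (\<lambda>p. fst p \<noteq> snd p \<and> A x (fst p) (snd p)) (List.product [0..<length (nu x)] [0..<length (nu x)])" for x
  define e where "e x = length (mu' x) * (length (nu x) - length (wu x)) + m * (length (wu x) * (length (wu x) - 1))" for x
  define node where "node x i = (b ^ min i (length (bu x)), b ^ length (ar x))" for x i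
  define ns where "ns x = (0, 1) # map (node x) (filter (\<lambda>i. i \<noteq> e x) [0..<length (() # bu x)])" for x
  have hu: "fpt hu" unfolding hu_def by (rule fpt_concat_map) (intro fpt_intros fpt fpt_comp[OF fpt(1)])+
  have lu: "fpt lu" unfolding lu_def by (intro fpt_intros hu)
  have mu': "fpt mu'" unfolding mu'_def by (intro fpt_intros hu fpt)
  have bu: "fpt bu" unfolding bu_def by (intro fpt_intros lu mu' fpt_comp[OF fpt(1)])
  have A': "fpt (\<lambda>p :: bool list \<times> nat \<times> nat. A (fst p) (fst (snd p)) (snd (snd p)))" by (rule fpt)
  have ar: "fpt ar" unfolding ar_def by (intro fpt_intros fpt A')
  have e: "fpt e" unfolding e_def by (intro fpt_intros fpt mu')
  have node: "fpt (\<lambda>x. node (g x) (h x))" if "fpt g" "fpt h" for g :: "'z::enc \<Rightarrow> bool list" and h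
    unfolding node_def by (intro fpt_intros that fpt_comp[OF ar that(1)] fpt_comp[OF bu that(1)])
  have ns: "fpt ns" unfolding ns_def by (intro fpt_intros node bu fpt_comp[OF e])
  have node_pos: "fst (node x i) \<noteq> 0" "snd (node x i) \<noteq> 0" for x i
    using b by (simp_all add: node_def)
  have lhu: "length (hu x) = length (nu x) * length (nu x)" for x
    by (simp add: hu_def length_concat comp_def sum_list_triv)
  have lbu: "length (bu x) = length (mu' x) * length (nu x) + 2 * (length (nu x) * length (nu x))" for x
    by (simp add: bu_def lu_def lhu length_concat comp_def sum_list_triv)
  have e_le: "e x \<le> length (bu x)" for x
  proof -
    have 1: "length (wu x) * (length (wu x) - 1) \<le> length (nu x) * length (nu x)"
      using w(2)[of x] by (intro mult_le_mono) auto
    have "m \<le> 2" by (simp add: m_def)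
    from mult_le_mono[OF this 1] show ?thesis unfolding e_def lbu
      by (rule add_mono[rotated]) (intro mult_le_mono order_refl diff_le_self)
  qed
  show "polytime_turing_reducible (\<lambda>x. nat_code (f x)) (eval_problem (R2 lam mu))"
  proof (rule interpolation_reduction[where nv = "\<lambda>x. () # nu x" and nodes = ns and t = "\<lambda>x. node x (e x)" and kap = kap
        and ps = "\<lambda>x. gadget (\<lambda>_. length (nu x)) (length (lu x)) (length (nu x)) (A x)"])
    show "fpt (\<lambda>x. () # nu x)" by (intro fpt_intros fpt)
    show "fpt ns" by (fact ns)
    show "fpt (\<lambda>x. gadget (\<lambda>_. length (nu x)) (length (lu x)) (length (nu x)) (A x))"
      by (rule fpt_gadget[where hub = "\<lambda>x _. length (nu x)"]) (intro fpt_intros lu fpt fpt_comp[OF fpt(1)])+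
    show "fpt (\<lambda>x. node x (e x))" by (intro node fpt_intros e)
    show "lam \<noteq> 0" by (fact lam)
    have "1 / lam \<noteq> 1" "lam \<noteq> 1 / 2 \<Longrightarrow> 1 / lam \<noteq> 2" using lam by (auto simp: field_simps)
    then show "kap \<noteq> 0" by (simp add: kap_def)
    show "fst p < length (() # nu x) \<and> snd p < length (() # nu x)"
      if "p \<in> set (gadget (\<lambda>_. length (nu x)) (length (lu x)) (length (nu x)) (A x))" for x p
      by (rule gadget_bound[OF that]) auto
    show "snd r \<noteq> 0" if "r \<in> set (ns x)" for x r using that node_pos by (auto simp: ns_def)
    show "fst (node x (e x)) \<noteq> 0" "snd (node x (e x)) \<noteq> 0" for x by (rule node_pos)+
    fix x
    let ?n = "length (nu x)" and ?w = "length (wu x)" and ?M = "length (mu' x)" and ?D = "card (arcs (length (nu x)) (A x))"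
    interpret clique_graph ?n "A x" by unfold_locales (rule sym)
    have M: "?M = 2 * (?n - 1 + ?n * ?n)" by (simp add: mu'_def lhu)
    have L: "length (lu x) = 2 * (?n * ?n)" by (simp add: lu_def lhu)
    have D: "length (ar x) = ?D"
    proof -
      have "distinct (ar x)" unfolding ar_def by (intro distinct_filter distinct_product) auto
      moreover have "set (ar x) = arcs ?n (A x)" by (auto simp: ar_def arcs_def)
      ultimately show ?thesis using distinct_card by metis
    qed
    let ?e0 = "m * (?w * (?w - 1))"
    define F where "F = insert 0 ((\<lambda>i. (1 + mu\<^sup>2) ^ i / (1 + mu\<^sup>2) ^ ?D) ` ({..?M * ?n + 2 * (?n * ?n)} - {?M * (?n - ?w) + ?e0}))"
    define r0 where "r0 = (1 + mu\<^sup>2) ^ (?M * (?n - ?w) + ?e0) / (1 + mu\<^sup>2) ^ ?D"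
    have cases: "lam \<noteq> 1 / 2 \<and> ?e0 = 2 * (?w * (?w - 1)) \<and> kap = (1 / lam - 1) * (1 / lam - 2)
      \<or> lam = 1 / 2 \<and> mu = - 2 \<and> ?e0 = ?w * (?w - 1) \<and> kap = 1"
      using not by (simp add: m_def kap_def)
    note main = power_sum_hub[OF lam(1) mu w(1) w(2) order_refl M refl F_def r0_def cases]
    have val: "of_nat (fst (node x i)) / of_nat (snd (node x i)) = (1 + mu\<^sup>2) ^ i / (1 + mu\<^sup>2) ^ ?D" if "i \<le> length (bu x)" for i
      using that by (simp add: node_def b D)
    have t: "of_nat (fst (node x (e x))) / of_nat (snd (node x (e x))) = r0"
      unfolding val[OF e_le] unfolding r0_def e_def ..
    have nv: "node_values (ns x) = F"
    proof -
      have "node_values (ns x) = insert 0 ((\<lambda>i. of_nat (fst (node x i)) / of_nat (snd (node x i)))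
          ` {i \<in> {..length (bu x)}. i \<noteq> e x})"
        unfolding node_values_def ns_def list.set set_map image_insert image_image set_filter
        by (simp add: atMost_atLeast0 atLeastLessThanSuc_atLeastAtMost)
      also have "(\<lambda>i. of_nat (fst (node x i)) / of_nat (snd (node x i))) ` {i \<in> {..length (bu x)}. i \<noteq> e x}
        = (\<lambda>i. (1 + mu\<^sup>2) ^ i / (1 + mu\<^sup>2) ^ ?D) ` ({..?M * ?n + 2 * (?n * ?n)} - {?M * (?n - ?w) + ?e0})"
        by (rule image_cong) (auto simp: val lbu e_def)
      finally show ?thesis unfolding F_def .
    qed
    show "of_nat (fst (node x (e x))) / of_nat (snd (node x (e x))) \<notin> node_values (ns x)"
      unfolding t nv by (rule main)
    show "\<exists>c. \<forall>k. R2 lam mu (rgraph (length (() # nu x)) (map pset (concat (replicate k (gadget (\<lambda>_. ?n) (length (lu x)) ?n (A x))))))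
      = (\<Sum>r\<in>node_values (ns x). c r * r ^ k)
        + lam ^ length (() # nu x) * (kap * of_nat (f x)) * (of_nat (fst (node x (e x))) / of_nat (snd (node x (e x)))) ^ k"
      unfolding t nv L f length_Cons by (rule main)
  qed
qed

section \<open>Reading a graph\<close>

type_synonym dstate = "bool \<times> bool \<times> unit list \<times> unit list \<times> bool list"

text \<open>The flags tell whether the first and the second separator have been seen.\<close>

definition decode_step :: "dstate \<Rightarrow> bool \<Rightarrow> dstate" where
  "decode_step s b = (if \<not> fst s
     then if b then (False, False, () # fst (snd (snd s)), snd (snd (snd s)))
       else (True, False, snd (snd s))
     else if \<not> fst (snd s)
     then if b then (True, False, fst (snd (snd s)), () # fst (snd (snd (snd s))), snd (snd (snd (snd s))))
       else (True, True, snd (snd s))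
     else (True, True, fst (snd (snd s)), fst (snd (snd (snd s))), b # snd (snd (snd (snd s)))))"

definition decode :: "bool list \<Rightarrow> dstate" where
  "decode w = foldl decode_step (False, False, [], [], []) w"

lemma decode_code:
  "decode (replicate m True @ False # replicate n True @ False # bs) = (True, True, replicate m (), replicate n (), rev bs)"
proof -
  have 1: "foldl decode_step (False, False, us, vs, cs) (replicate m True) = (False, False, replicate m () @ us, vs, cs)" for us vs cs m
    by (induction m arbitrary: us) (auto simp: decode_step_def replicate_app_Cons_same)
  have 2: "foldl decode_step (True, False, us, vs, cs) (replicate m True) = (True, False, us, replicate m () @ vs, cs)" for us vs cs m
    by (induction m arbitrary: vs) (auto simp: decode_step_def replicate_app_Cons_same)
  have 3: "foldl decode_step (True, True, us, vs, cs) bs = (True, True, us, vs, rev bs @ cs)" for us vs cs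
    by (induction bs arbitrary: cs) (auto simp: decode_step_def)
  have 4: "decode_step (False, False, us, vs, cs) False = (True, False, us, vs, cs)"
    "decode_step (True, False, us, vs, cs) False = (True, True, us, vs, cs)" for us vs cs
    by (simp_all add: decode_step_def)
  show ?thesis by (simp add: decode_def 1 2 3 4)
qed

lemma decode_inv:
  "case decode w of (d, e, us, vs, bs) \<Rightarrow>
    length us + length vs + length bs \<le> length w \<and> (e \<longrightarrow> d) \<and> (\<not> e \<longrightarrow> bs = []) \<and> (\<not> d \<longrightarrow> vs = []) \<and>
    w = replicate (length us) True @ (if d then False # replicate (length vs) True else []) @ (if e then False # rev bs else [])"
proof (induction w rule: rev_induct)
  case (snoc b w)
  obtain d e us vs bs where s: "decode w = (d, e, us, vs, bs)" by (metis prod_cases5)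
  have d: "decode (w @ [b]) = decode_step (d, e, us, vs, bs) b" using s by (simp add: decode_def)
  show ?case
    using snoc unfolding s d
    by (auto simp: decode_step_def replicate_append_same)
qed (simp add: decode_def)

lemma fpt_decode: "fpt decode"
  unfolding decode_def
proof (rule fpt_foldl[where h = "\<lambda>w. 20 * length w + 40"])
  show "fpt (\<lambda>p. decode_step (snd (fst p)) (snd p))" unfolding decode_step_def by (intro fpt_intros)
  fix w :: "bool list" and k
  obtain d e us vs bs where s: "decode (take k w) = (d, e, us, vs, bs)" by (metis prod_cases5)
  have l: "length us + length vs + length bs \<le> length w" using decode_inv[of "take k w"] unfolding s by auto
  have u: "esz xs = 2 * length xs + 1" for xs :: "unit list" by (induction xs) (auto simp: enc_simps)
  show "esz (foldl decode_step (False, False, [], [], []) (take k w)) \<le> 20 * length w + 40"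
    unfolding decode_def[symmetric] s using l esz_word[of bs]
    by (cases d; cases e) (simp_all add: esz_Pair u enc_simps)
qed (intro fpt_intros pbt_intros)+

text \<open>
  The graph with the given numbers of vertices and the given entries of the adjacency matrix.
\<close>

definition bgraph :: "nat \<Rightarrow> nat \<Rightarrow> bool list \<Rightarrow> bipgraph" where
  "bgraph m n bs = \<lparr>left_size = m, right_size = n, edges = {(u, w). u < m \<and> w < n \<and> bs ! (u * n + w)}\<rparr>"

lemma bgraph: "bgraph m n bs \<in> bipgraphs"
  by (auto simp: bgraph_def bipgraphs_def)

lemma bgraph_code:
  assumes "length bs = m * n"
  shows "bipgraph_code (bgraph m n bs) = replicate m True @ False # replicate n True @ False # bs"
proof -
  have "concat (map (\<lambda>u. map (\<lambda>w. bs ! (u * n + w)) [0..<n]) [0..<k]) = take (k * n) bs" if "k \<le> m" for k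
    using that
  proof (induction k)
    case (Suc k)
    have "Suc k * n \<le> length bs" using Suc.prems unfolding assms by (rule mult_le_mono1)
    then have "map (\<lambda>w. bs ! (k * n + w)) [0..<n] = take n (drop (k * n) bs)"
      by (intro nth_equalityI) auto
    then show ?case using Suc by (simp add: upt_Suc take_add[symmetric] add.commute)
  qed simp
  from this[of m] have "concat (map (\<lambda>u. map (\<lambda>w. bs ! (u * n + w)) [0..<n]) [0..<m]) = bs"
    using assms by simp
  moreover have "concat (map (\<lambda>u. map (\<lambda>w. (u, w) \<in> edges (bgraph m n bs)) [0..<n]) [0..<m])
      = concat (map (\<lambda>u. map (\<lambda>w. bs ! (u * n + w)) [0..<n]) [0..<m])"
    by (intro arg_cong[where f = concat] map_cong refl) (simp add: bgraph_def)
  ultimately show ?thesis by (simp add: bipgraph_code_def bgraph_def)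
qed

lemma polytime_computable_eval:
  assumes h: "fpt h" and val: "\<And>m n bs. length bs = m * n \<Longrightarrow>
    h (replicate m (), replicate n (), bs) = rat_code (F (bgraph m n bs))"
  shows "polytime_computable (eval_problem F)"
proof -
  let ?g = "\<lambda>s :: dstate. if fst s \<and> fst (snd s) \<and> length (snd (snd (snd (snd s)))) = length (fst (snd (snd s))) * length (fst (snd (snd (snd s))))
    then h (fst (snd (snd s)), fst (snd (snd (snd s))), rev (snd (snd (snd (snd s))))) else []"
  have "fpt ?g" by (intro fpt_intros fpt_comp[OF h])
  from fpt_comp[OF this fpt_decode] have "fpt (\<lambda>w. ?g (decode w))" .
  moreover have "?g (decode w) = eval_problem F w" for w
  proof (cases "w \<in> bipgraph_code ` bipgraphs")
    case True
    then obtain G where G: "G \<in> bipgraphs" and w: "w = bipgraph_code G" by blast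
    define bs where "bs = concat (map (\<lambda>u. map (\<lambda>w. (u, w) \<in> edges G) [0..<right_size G]) [0..<left_size G])"
    have c: "w = replicate (left_size G) True @ False # replicate (right_size G) True @ False # bs"
      unfolding w bipgraph_code_def bs_def ..
    have l: "length bs = left_size G * right_size G"
      by (simp add: bs_def length_concat comp_def sum_list_triv)
    have "w = bipgraph_code (bgraph (left_size G) (right_size G) bs)" unfolding bgraph_code[OF l] c ..
    then have "eval_problem F w = rat_code (F (bgraph (left_size G) (right_size G) bs))"
      using eval_problem_code[OF bgraph] by metis
    then show ?thesis unfolding c decode_code using val[OF l] l by simp
  next
    case False
    have "?g (decode w) = []"
    proof (rule ccontr)
      obtain d e us vs bs where s: "decode w = (d, e, us, vs, bs)" by (metis prod_cases5)
      assume "?g (decode w) \<noteq> []"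
      then have l: "length (rev bs) = length us * length vs" and "d" "e" unfolding s by (auto split: if_splits)
      then have "w = replicate (length us) True @ False # replicate (length vs) True @ False # rev bs"
        using decode_inv[of w] unfolding s by simp
      then have "w = bipgraph_code (bgraph (length us) (length vs) (rev bs))" unfolding bgraph_code[OF l] .
      then show False using False bgraph by blast
    qed
    then show ?thesis using False by (simp add: eval_problem_def)
  qed
  ultimately have "fpt (eval_problem F)" by (simp only:)
  then obtain P where "fp (range (enc :: bool list \<Rightarrow> tree)) P" "\<And>x. P (enc x) = enc (eval_problem F x)"
    by (auto elim: fptE)
  then show ?thesis by (intro fp_polytime_computable[of P]) (simp_all add: blist_enc)
qed

section \<open>The tractable cases\<close>

lemma sum_Pow_prod:
  fixes c :: "'a \<Rightarrow> rat"
  assumes "finite A"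
  shows "(\<Sum>B\<in>Pow A. \<Prod>i\<in>B. c i) = (\<Prod>i\<in>A. 1 + c i)"
  using prod_add[OF assms, of c "\<lambda>_. 1"] by (simp add: add.commute)

lemma finite_edges: "G \<in> bipgraphs \<Longrightarrow> finite (edges G)"
  by (auto simp: bipgraphs_def dest: finite_subset)

lemma R2_1: "G \<in> bipgraphs \<Longrightarrow> R2 1 mu G = (1 + mu) ^ card (edges G)"
  using sum_Pow_prod[OF finite_edges, of G "\<lambda>_. mu"] by (simp add: R2_def)

lemma rk2_eq_0:
  assumes S: "S \<subseteq> {..<m} \<times> {..<n}"
  shows "rk2 m n S = 0 \<longleftrightarrow> S = {}"
proof -
  let ?B = "\<lambda>u. {w. (u, w) \<in> S}"
  have e: "rowset m ?B = S" using S by (auto simp: rowset_def)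
  have c: "card (ker2 m n ?B) * 2 ^ rk2 m n S = 2 ^ n" using card_ker2[of m ?B n] S unfolding e by auto
  let ?U = "{..<n} \<rightarrow>\<^sub>E (UNIV :: bool set)"
  have U: "finite ?U" "card ?U = 2 ^ n" by (simp_all add: finite_PiE card_PiE)
  have sub: "ker2 m n ?B \<subseteq> ?U" by (auto simp: ker2_def)
  show ?thesis
  proof
    assume "rk2 m n S = 0"
    then have "ker2 m n ?B = ?U" using card_subset_eq[OF U(1) sub] c U(2) by simp
    then have ev: "even (card {w' \<in> ?B u. (\<lambda>v\<in>{..<n}. v = w) w'})" if "u < m" for u w
    proof -
      have "(\<lambda>v\<in>{..<n}. v = w) \<in> ker2 m n ?B" unfolding \<open>ker2 m n ?B = ?U\<close> by simp
      then show ?thesis using that unfolding ker2_def by blast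
    qed
    show "S = {}"
    proof (rule ccontr)
      assume "S \<noteq> {}"
      then obtain u w where uw: "(u, w) \<in> S" by auto
      then have "u < m" "w < n" using S by auto
      moreover from this uw have "{w' \<in> ?B u. (\<lambda>v\<in>{..<n}. v = w) w'} = {w}" using S by auto
      ultimately show False using ev[of u w] by simp
    qed
  next
    assume "S = {}"
    then have "ker2 m n ?B = ?U" by (auto simp: ker2_def)
    then show "rk2 m n S = 0" using c U(2) by simp
  qed
qed

lemma R2_eq_1:
  assumes G: "G \<in> bipgraphs" and "lam = 0 \<or> mu = 0"
  shows "R2 lam mu G = 1"
proof -
  have "lam ^ rk2 (left_size G) (right_size G) S * mu ^ card S = of_bool (S = {})" if S: "S \<in> Pow (edges G)" for S
  proof -
    have "S \<subseteq> {..<left_size G} \<times> {..<right_size G}" using S G by (auto simp: bipgraphs_def)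
    from rk2_eq_0[OF this] have "rk2 (left_size G) (right_size G) S = 0 \<longleftrightarrow> S = {}" .
    moreover have "card S = 0 \<longleftrightarrow> S = {}" using S finite_edges[OF G] by (auto dest: finite_subset)
    ultimately show ?thesis using assms(2) by (auto simp: power_0_left)
  qed
  then have "R2 lam mu G = (\<Sum>S\<in>Pow (edges G). of_bool (S = {}))" unfolding R2_def by (intro sum.cong refl)
  also have "\<dots> = 1" using finite_edges[OF G] by (simp add: of_bool_def sum.delta)
  finally show ?thesis .
qed

text \<open>With two colours and \<open>\<mu> = -1\<close>, a row that is not empty forces colour one on its entries.\<close>

lemma rweight_minus_one:
  assumes A: "finite A"
  shows "rweight 1 (- 1) hue A = (if A = {} then 1 else if \<forall>w\<in>A. odd (hue w) then 2 ^ card A / 2 else 0)"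
proof -
  have b: "balanced 1 hue B \<longleftrightarrow> even (card {w \<in> B. odd (hue w)})" for B
    by (simp add: balanced_def bit_0)
  have t: "(- 1) ^ card B * of_bool (balanced 1 hue B)
      = ((\<Prod>i\<in>B. - 1) + (\<Prod>i\<in>B. if odd (hue i) then 1 else - 1)) / (2 :: rat)" if B: "B \<in> Pow A" for B
  proof -
    have fB: "finite B" using B A finite_subset by blast
    have "(\<Prod>i\<in>B. if odd (hue i) then 1 else - 1 :: rat) = (\<Prod>i\<in>B. (- 1) * (if odd (hue i) then - 1 else 1))"
      by (rule prod.cong) auto
    also have "\<dots> = (- 1) ^ card B * (- 1) ^ card {w \<in> B. odd (hue w)}"
      unfolding prod.distrib by (simp add: prod.If_cases[OF fB] Int_def)
    finally show ?thesis unfolding b by (cases "even (card {w \<in> B. odd (hue w)})") simp_all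
  qed
  have "rweight 1 (- 1) hue A = (\<Sum>B\<in>Pow A. ((\<Prod>i\<in>B. - 1) + (\<Prod>i\<in>B. if odd (hue i) then 1 else - 1)) / 2)"
    unfolding rweight_def by (rule sum.cong[OF refl t])
  also have "\<dots> = ((\<Prod>i\<in>A. 1 + - 1) + (\<Prod>i\<in>A. 1 + (if odd (hue i) then 1 else - 1))) / 2"
    unfolding sum_divide_distrib[symmetric] sum.distrib sum_Pow_prod[OF A] ..
  also have "(\<Prod>i\<in>A. 1 + (if odd (hue i) then 1 else - 1 :: rat)) = (if \<forall>w\<in>A. odd (hue w) then 2 ^ card A else 0)"
  proof (cases "\<forall>w\<in>A. odd (hue w)")
    case False
    then have "(\<Prod>i\<in>A. 1 + (if odd (hue i) then 1 else - 1 :: rat)) = 0" using A by (auto simp: prod_zero_iff)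
    then show ?thesis using False by simp
  qed simp
  finally show ?thesis using A by (cases "A = {}"; cases "\<forall>w\<in>A. odd (hue w)") (simp_all add: power_0_left)
qed

text \<open>
  The left and the right vertices that are not isolated.
\<close>

definition left_touched :: "bipgraph \<Rightarrow> nat set" where
  "left_touched G = {u. u < left_size G \<and> (\<exists>w<right_size G. (u, w) \<in> edges G)}"

definition right_touched :: "bipgraph \<Rightarrow> nat set" where
  "right_touched G = {w. w < right_size G \<and> (\<exists>u<left_size G. (u, w) \<in> edges G)}"

lemma R2_half_minus_one:
  assumes G: "G \<in> bipgraphs"
  shows "R2 (1 / 2) (- 1) G = 2 ^ card (edges G) / 2 ^ (card (left_touched G) + card (right_touched G))"
proof -
  let ?m = "left_size G" and ?n = "right_size G"
  define A where "A u = {w. (u, w) \<in> edges G}" for u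
  let ?rs = "map A [0..<?m]"
  have sub: "A u \<subseteq> {..<?n}" for u using G by (auto simp: A_def bipgraphs_def)
  have finA: "finite (A u)" for u using finite_subset[OF sub] by simp
  have edges: "edges G = rowset ?m A" using G by (auto simp: A_def rowset_def bipgraphs_def)
  have GR: "G = rgraph ?n ?rs"
    unfolding rgraph_def by (simp add: edges rowset_def cong: conj_cong)
  have lt: "left_touched G = {u \<in> {..<?m}. A u \<noteq> {}}" using sub by (auto simp: left_touched_def A_def)
  have rt: "right_touched G = (\<Union>u<?m. A u)" using sub by (auto simp: right_touched_def A_def)
  have "2 ^ ?n * R2 (1 / 2) (- 1) G = (\<Sum>hue \<in> {..<?n} \<rightarrow>\<^sub>E {..<2 :: nat}. \<Prod>u<?m. rweight 1 (- 1) hue (A u))"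
  proof -
    have "X \<subseteq> {..<?n}" if "X \<in> set ?rs" for X using that sub by auto
    from R2_partition_function[of ?rs ?n 1 "- 1", OF this] show ?thesis unfolding GR[symmetric] by simp
  qed
  also have "\<dots> = (\<Sum>hue \<in> {..<?n} \<rightarrow>\<^sub>E {..<2 :: nat}. if \<forall>w\<in>right_touched G. odd (hue w)
      then 2 ^ card (edges G) / 2 ^ card (left_touched G) else 0)"
  proof (rule sum.cong[OF refl])
    fix hue :: "nat \<Rightarrow> nat"
    show "(\<Prod>u<?m. rweight 1 (- 1) hue (A u)) = (if \<forall>w\<in>right_touched G. odd (hue w)
      then 2 ^ card (edges G) / 2 ^ card (left_touched G) else 0)"
    proof (cases "\<forall>w\<in>right_touched G. odd (hue w)")
      case True
      have "(\<Prod>u<?m. rweight 1 (- 1) hue (A u)) = (\<Prod>u<?m. 2 ^ card (A u) / (if A u \<noteq> {} then 2 else 1))"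
        unfolding rweight_minus_one[OF finA] using True unfolding rt by (intro prod.cong refl) auto
      also have "\<dots> = 2 ^ (\<Sum>u<?m. card (A u)) / 2 ^ card (left_touched G)"
        unfolding prod_dividef power_sum lt by (simp add: prod.If_cases Int_def)
      finally show ?thesis using True card_rowset[of ?m A, OF finA] unfolding edges by simp
    next
      case False
      then obtain u w where "u < ?m" "w \<in> A u" "even (hue w)" unfolding rt by auto
      then have "rweight 1 (- 1) hue (A u) = 0" unfolding rweight_minus_one[OF finA] by auto
      then have "(\<Prod>u<?m. rweight 1 (- 1) hue (A u)) = 0" using \<open>u < ?m\<close> by (intro prod_zero) auto
      then show ?thesis unfolding if_not_P[OF False] .
    qed
  qed
  also have "\<dots> = of_nat (card {hue \<in> {..<?n} \<rightarrow>\<^sub>E {..<2 :: nat}. \<forall>w\<in>right_touched G. odd (hue w)})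
      * (2 ^ card (edges G) / 2 ^ card (left_touched G))"
    by (simp add: sum.If_cases finite_PiE Int_def)
  also have "{hue \<in> {..<?n} \<rightarrow>\<^sub>E {..<2 :: nat}. \<forall>w\<in>right_touched G. odd (hue w)}
      = (\<Pi>\<^sub>E w\<in>{..<?n}. if w \<in> right_touched G then {1} else {..<2})"
  proof -
    have T: "right_touched G \<subseteq> {..<?n}" by (auto simp: right_touched_def)
    have o: "x \<in> {1} \<longleftrightarrow> x < 2 \<and> odd x" for x :: nat by (auto simp: less_2_cases_iff)
    have "(\<forall>i\<in>{..<?n}. hue i \<in> (if i \<in> right_touched G then {1} else {..<2 :: nat}))
        \<longleftrightarrow> (\<forall>i\<in>{..<?n}. hue i \<in> {..<2}) \<and> (\<forall>w\<in>right_touched G. odd (hue w))" for hue :: "nat \<Rightarrow> nat"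
    proof (intro iffI conjI ballI; (elim conjE)?)
      fix i assume *: "\<forall>i\<in>{..<?n}. hue i \<in> (if i \<in> right_touched G then {1} else {..<2})"
      show "hue i \<in> {..<2}" if "i \<in> {..<?n}"
        using bspec[OF * that] o[of "hue i"] by (simp split: if_splits)
      show "odd (hue i)" if "i \<in> right_touched G"
        using bspec[OF * subsetD[OF T that]] that by simp
    next
      fix i assume "\<forall>i\<in>{..<?n}. hue i \<in> {..<2}" "\<forall>w\<in>right_touched G. odd (hue w)" "i \<in> {..<?n}"
      then show "hue i \<in> (if i \<in> right_touched G then {1} else {..<2})"
        using o[of "hue i"] by simp
    qed
    note 1 = this
    show ?thesis by (simp only: set_eq_iff mem_Collect_eq PiE_iff 1 conj_ac) (intro allI refl)
  qed
  also have "card \<dots> = 2 ^ card ({..<?n} - right_touched G)"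
    by (simp add: card_PiE if_distrib[of card] prod.If_cases Int_def set_diff_eq cong: if_cong)
  also have "card ({..<?n} - right_touched G) = ?n - card (right_touched G)"
    by (subst card_Diff_subset) (auto simp: right_touched_def)
  finally have 1: "2 ^ ?n * R2 (1 / 2) (- 1) G
    = 2 ^ (?n - card (right_touched G)) * (2 ^ card (edges G) / 2 ^ card (left_touched G))" by simp
  have "card (right_touched G) \<le> ?n"
    using card_mono[of "{..<?n}" "right_touched G"] by (auto simp: right_touched_def)
  then have "(2 :: rat) ^ ?n = 2 ^ (?n - card (right_touched G)) * 2 ^ card (right_touched G)"
    by (simp flip: power_add)
  then show ?thesis using 1 by (simp add: power_add field_simps)
qed

text \<open>
  The edges of the graph that has been read.
\<close>

definition edge_list :: "unit list \<times> unit list \<times> bool list \<Rightarrow> (nat \<times> nat) list" where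
  "edge_list x = filter (\<lambda>p. nthd False (snd (snd x)) (fst p * length (fst (snd x)) + snd p))
     (List.product [0..<length (fst x)] [0..<length (fst (snd x))])"

lemma fpt_edge_list: "fpt edge_list"
  unfolding edge_list_def by (intro fpt_intros)

lemma edge_list:
  assumes "length bs = m * n"
  shows "distinct (edge_list (replicate m (), replicate n (), bs))"
    "set (edge_list (replicate m (), replicate n (), bs)) = edges (bgraph m n bs)"
proof -
  show "distinct (edge_list (replicate m (), replicate n (), bs))"
    unfolding edge_list_def by (intro distinct_filter distinct_product) auto
  have "u * n + w < length bs" if "u < m" "w < n" for u w
  proof -
    have "u * n + w < Suc u * n" using that by simp
    also have "\<dots> \<le> m * n" using that by (intro mult_le_mono1) simp
    finally show ?thesis using assms by simp
  qed
  then show "set (edge_list (replicate m (), replicate n (), bs)) = edges (bgraph m n bs)"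
    by (auto simp: edge_list_def bgraph_def)
qed

definition fraction_code :: "bool \<Rightarrow> nat \<Rightarrow> nat \<Rightarrow> bool list" where
  "fraction_code s a b = s # pair_code (nat_code a) (nat_code b)"

lemma fpt_fraction_code [fpt_intros]: "fpt s \<Longrightarrow> fpt a \<Longrightarrow> fpt b \<Longrightarrow> fpt (\<lambda>x. fraction_code (s x) (a x) (b x))"
proof -
  assume s: "fpt s" and a: "fpt a" and b: "fpt b"
  have "fpt (\<lambda>x. concat (map (\<lambda>b. [b, b]) (nat_code (a x))))"
    by (rule fpt_concat_map[where f = "\<lambda>x b. [b, b]"]) (intro fpt_intros a)+
  note 1 = this
  show ?thesis unfolding fraction_code_def pair_code_def
    by (intro fpt_Cons fpt_append s fpt_const fpt_nat_code b 1)
qed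

lemma rat_code_coprime:
  assumes "b > 0" "coprime a b"
  shows "rat_code (of_int a / of_int b) = fraction_code (a < 0) (nat \<bar>a\<bar>) (nat b)"
proof -
  have "quotient_of (of_int a / of_int b) = (a, b)"
    using assms by (simp add: Fract_of_int_quotient[symmetric] quotient_of_Fract normalize_stable)
  then show ?thesis by (simp add: rat_code_def fraction_code_def)
qed

lemma polytime_one: "lam = 0 \<or> mu = 0 \<Longrightarrow> polytime_computable (eval_problem (R2 lam mu))"
  by (rule polytime_computable_eval[OF fpt_const]) (simp add: R2_eq_1[OF bgraph])

lemma polytime_lam_1: "polytime_computable (eval_problem (R2 1 mu))"
proof -
  obtain a b where ab: "quotient_of (1 + mu) = (a, b)" by (cases "quotient_of (1 + mu)")
  have b: "b > 0" by (rule quotient_of_denom_pos[OF ab])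
  have q: "1 + mu = of_int a / of_int b" by (rule quotient_of_div[OF ab])
  have c: "coprime a b" by (rule quotient_of_coprime[OF ab])
  have sgn: "a ^ k < 0 \<longleftrightarrow> a < 0 \<and> 2 * (k div 2) \<noteq> k" for k
  proof -
    have "2 * (k div 2) \<noteq> k \<longleftrightarrow> odd k" by presburger
    then show ?thesis by (cases "even k") (auto simp: power_less_zero_eq)
  qed
  show ?thesis
  proof (rule polytime_computable_eval)
    show "fpt (\<lambda>x. fraction_code (a < 0 \<and> 2 * (length (edge_list x) div 2) \<noteq> length (edge_list x))
        (nat \<bar>a\<bar> ^ length (edge_list x)) (nat b ^ length (edge_list x)))"
      by (intro fpt_intros fpt_edge_list)
    fix m n :: nat and bs :: "bool list" assume l: "length bs = m * n"
    let ?k = "card (edges (bgraph m n bs))"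
    have k: "length (edge_list (replicate m (), replicate n (), bs)) = ?k"
      using distinct_card[OF edge_list(1)[OF l]] edge_list(2)[OF l] by simp
    have "rat_code (R2 1 mu (bgraph m n bs)) = rat_code (of_int (a ^ ?k) / of_int (b ^ ?k))"
      by (simp add: R2_1[OF bgraph] q power_divide)
    also have "\<dots> = fraction_code (a ^ ?k < 0) (nat \<bar>a ^ ?k\<bar>) (nat (b ^ ?k))"
      using b c by (intro rat_code_coprime) auto
    finally show "fraction_code (a < 0 \<and> 2 * (length (edge_list (replicate m (), replicate n (), bs)) div 2)
          \<noteq> length (edge_list (replicate m (), replicate n (), bs)))
        (nat \<bar>a\<bar> ^ length (edge_list (replicate m (), replicate n (), bs)))
        (nat b ^ length (edge_list (replicate m (), replicate n (), bs))) = rat_code (R2 1 mu (bgraph m n bs))"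
      unfolding k sgn power_abs using b by (simp add: nat_power_eq)
  qed
qed

lemma polytime_half_minus_one: "polytime_computable (eval_problem (R2 (1 / 2) (- 1)))"
proof (rule polytime_computable_eval)
  let ?L = "\<lambda>x. filter (\<lambda>u. \<exists>p\<in>set (edge_list x). fst p = u) [0..<length (fst x)]"
  let ?R = "\<lambda>x. filter (\<lambda>w. \<exists>p\<in>set (edge_list x). snd p = w) [0..<length (fst (snd x))]"
  let ?h = "\<lambda>x. fraction_code False
      (2 ^ min (length (edge_list x) - length (?L x @ ?R x)) (length (edge_list x)))
      (2 ^ min (length (?L x @ ?R x) - length (edge_list x)) (length (?L x @ ?R x)))"
  show "fpt ?h" by (intro fpt_intros fpt_edge_list fpt_comp[OF fpt_edge_list])
  fix m n :: nat and bs :: "bool list" assume l: "length bs = m * n"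
  let ?x = "(replicate m (), replicate n (), bs)" and ?G = "bgraph m n bs"
  let ?E = "card (edges ?G)" and ?k = "card (left_touched ?G) + card (right_touched ?G)"
  have E: "length (edge_list ?x) = ?E"
    using distinct_card[OF edge_list(1)[OF l]] edge_list(2)[OF l] by simp
  have "set (?L ?x) = left_touched ?G" "set (?R ?x) = right_touched ?G"
    unfolding edge_list(2)[OF l, symmetric]
    by (auto simp: left_touched_def right_touched_def edge_list(2)[OF l] bgraph_def)
  then have k: "length (?L ?x @ ?R ?x) = ?k"
    using distinct_card[of "?L ?x"] distinct_card[of "?R ?x"] by simp
  have "R2 (1 / 2) (- 1) ?G = of_int (2 ^ (?E - ?k)) / of_int (2 ^ (?k - ?E))"
  proof -
    have "(2 :: rat) ^ i / 2 ^ j = of_int (2 ^ (i - j)) / of_int (2 ^ (j - i))" for i j :: nat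
    proof (cases "j \<le> i")
      case True
      then obtain d where "i = j + d" by (auto simp: le_iff_add)
      then show ?thesis by (simp add: power_add)
    next
      case False
      then obtain d where "j = i + d" using le_iff_add[of i j] by auto
      then show ?thesis by (simp add: power_add)
    qed
    then show ?thesis unfolding R2_half_minus_one[OF bgraph] .
  qed
  also have "rat_code \<dots> = fraction_code (2 ^ (?E - ?k) < (0 :: int)) (nat \<bar>2 ^ (?E - ?k)\<bar>) (nat (2 ^ (?k - ?E)))"
    by (rule rat_code_coprime) (cases "?k \<le> ?E"; simp)+
  also have "\<dots> = ?h ?x" unfolding E k by (simp add: nat_power_eq)
  finally show "?h ?x = rat_code (R2 (1 / 2) (- 1) ?G)" by simp
qed

theorem theorem2:
  fixes lam mu :: rat
  shows
    "(lam \<in> {0, 1} \<or> mu = 0 \<or> (lam, mu) = (1 / 2, - 1) \<longrightarrow>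
        polytime_computable (eval_problem (R2 lam mu))) \<and>
     (generalized_Riemann_hypothesis \<longrightarrow> lam \<notin> {0, 1, 1 / 2} \<and> mu \<noteq> 0 \<longrightarrow>
        sharpP_hard (eval_problem (R2 lam mu))) \<and>
     (lam = 1 / 2 \<and> mu \<notin> {0, - 1} \<longrightarrow>
        sharpP_hard (eval_problem (R2 lam mu)))"
proof (intro conjI impI)
  assume "lam \<in> {0, 1} \<or> mu = 0 \<or> (lam, mu) = (1 / 2, - 1)"
  then consider "lam = 0 \<or> mu = 0" | "lam = 1" | "lam = 1 / 2" "mu = - 1" by blast
  then show "polytime_computable (eval_problem (R2 lam mu))"
    by cases (simp_all only: polytime_one polytime_lam_1 polytime_half_minus_one)
next
  assume "lam \<notin> {0, 1, 1 / 2} \<and> mu \<noteq> 0"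
  then show "sharpP_hard (eval_problem (R2 lam mu))"
    using hardness_loops[of lam mu] hardness_hub[of lam mu] by auto
next
  assume "lam = 1 / 2 \<and> mu \<notin> {0, - 1}"
  then have "lam \<noteq> 0" "lam \<noteq> 1" "mu \<noteq> 0" "mu \<noteq> - 1" by auto
  then show "sharpP_hard (eval_problem (R2 lam mu))"
    using hardness_loops[of lam mu] hardness_hub[of lam mu] by blast
qed

end
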